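(* Let $\lambda_1,\lambda_2\in\mathbb{R}$, let $V\in W^{3,\infty}(\mathbb{R})$ be real-valued, let $\Phi_0:\mathbb{R}\to\mathbb{C}^2$, and let $0<T<T^*$. For each $\varepsilon\in(0,1]$ let $\Phi=\Phi^{(\varepsilon)}(t,x)$ be the solution of the one-dimensional nonlinear Dirac equation (NLDE) with initial data $\Phi_0$ (see context), and assume that $\Phi\in L^\infty([0,T];(H^3(\mathbb{R}))^2)$, uniformly in $\varepsilon$, i.e. $\sup_{0<\varepsilon\le1}\|\Phi^{(\varepsilon)}\|_{L^\infty([0,T];(H^3(\mathbb{R}))^2)}<\infty$. Let $\Phi^n$ be the Lie–Trotter splitting approximation with time step $\tau>0$ and ${\bf e}^n(x)=\Phi(t_n,x)-\Phi^n(x)$, $t_n=n\tau$. Then there exist $0<\tau_0\le 1$ and a constant $C>0$, both independent of $\varepsilon$ (and $C$ independent of $\tau$ and $n$), such that for all $\varepsilon\in(0,1]$, all $0<\tau<\tau_0$ and all integers $0\le n\le T/\tau$, both estimates $$\|{\bf e}^n\|_{H^1}\le C(\tau+\varepsilon),\qquad \|{\bf e}^n\|_{H^1}\le C\left(\tau+\frac{\tau}{\varepsilon}\right)$$ hold. Consequently, there is a uniform error bound: for a constant $C>0$ independent of $\varepsilon$, $\tau$ and $n$, for all $\varepsilon\in(0,1]$, $0<\tau<\tau_0$ and $0\le n\le T/\tau$, $$\|{\bf e}^n\|_{H^1}\le C\left(\tau+\max_{0<\epsilon'\le1}\min\{\epsilon',\tau/\epsilon'\}\right)\quad\text{and}\quad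 \|{\bf e}^n\|_{H^1}\le C\sqrt{\tau}.$$
   Context: Pauli matrices: $\sigma_1=\begin{pmatrix}0&1\\1&0\end{pmatrix}$, $\sigma_3=\begin{pmatrix}1&0\\0&-1\end{pmatrix}$; $I_2$ is the $2\times2$ identity matrix; $\Phi^*=\overline{\Phi}^T$ and $|\Phi|^2=\Phi^*\Phi$. NLDE: for $\varepsilon\in(0,1]$, $\Phi=\Phi(t,x)\in\mathbb{C}^2$ solves $$i\partial_t\Phi=\frac{1}{\varepsilon^2}Q^\varepsilon\Phi+V(x)\Phi+\mathbf{F}(\Phi)\Phi,\quad x\in\mathbb{R},\ t>0,\qquad \Phi(0,x)=\Phi_0(x),$$ where $Q^\varepsilon=-i\varepsilon\sigma_1\partial_x+\sigma_3$ and $\mathbf{F}(\Phi)=\lambda_1(\Phi^*\sigma_3\Phi)\sigma_3+\lambda_2|\Phi|^2I_2$. $T^*$ denotes the common maximal existence time of the solutions for all $0<\varepsilon\le1$. Lie–Trotter splitting ($S_1$), discrete in time only: $\Phi^0=\Phi_0$ and, for $n\ge0$, $$\Phi^{n+1}(x)=e^{-\frac{i\tau}{\varepsilon^2}Q^\varepsilon}\,e^{-i\tau[V(x)+\mathbf{F}(\Phi^n(x))]}\,\Phi^n(x),$$ where $V(x)$ is understood as $V(x)I_2$, the second factor is a pointwise matrix exponential, and $e^{-\frac{i\tau}{\varepsilon^2}Q^\varepsilon}$ is the unitary group generated by the self-adjoint operator $Q^\varepsilon$ (a Fourier multiplier). Norms: $\|\Phi\|_{L^2}^2=\int_{\mathbb{R}}|\Phi(x)|^2dx$,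 $\|\Phi\|_{H^1}^2=\|\Phi\|_{L^2}^2+\|\partial_x\Phi\|_{L^2}^2$. *)

theory Defs
  imports "HOL-Analysis.Analysis"
begin

section \<open>Weak derivatives and Sobolev spaces on the real line\<close>

text \<open>
  Elements of function spaces are represented by functions, not by classes modulo null sets;
  equality in such a space is therefore equality almost everywhere.
\<close>

definition test_function :: "(real \<Rightarrow> real) \<Rightarrow> bool" where
  "test_function \<phi> \<longleftrightarrow>
     (\<forall>k x. (deriv ^^ k) \<phi> field_differentiable (at x)) \<and> compact (closure {x. \<phi> x \<noteq> 0})"

definition locally_integrable :: "(real \<Rightarrow> 'a::euclidean_space) \<Rightarrow> bool" where
  "locally_integrable f \<longleftrightarrow> (\<forall>a b. set_integrable lebesgue {a..b} f)"

definition has_weak_deriv ::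
    "nat \<Rightarrow> (real \<Rightarrow> 'a::euclidean_space) \<Rightarrow> (real \<Rightarrow> 'a) \<Rightarrow> bool" where
  "has_weak_deriv k f g \<longleftrightarrow>
     locally_integrable f \<and> locally_integrable g \<and>
     (\<forall>\<phi>. test_function \<phi> \<longrightarrow>
        (LINT x|lebesgue. (deriv ^^ k) \<phi> x *\<^sub>R f x)
          = (-1) ^ k *\<^sub>R (LINT x|lebesgue. \<phi> x *\<^sub>R g x))"

text \<open>The weak derivative is unique almost everywhere; a representative is chosen.\<close>

definition weak_deriv ::
    "nat \<Rightarrow> (real \<Rightarrow> 'a::euclidean_space) \<Rightarrow> real \<Rightarrow> 'a" where
  "weak_deriv k f = (SOME g. has_weak_deriv k f g)"

definition L2_space :: "(real \<Rightarrow> 'a::euclidean_space) set" where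
  "L2_space = {f. f \<in> borel_measurable lebesgue \<and> integrable lebesgue (\<lambda>x. (norm (f x))\<^sup>2)}"

definition L2_norm :: "(real \<Rightarrow> 'a::euclidean_space) \<Rightarrow> real" where
  "L2_norm f = sqrt (LINT x|lebesgue. (norm (f x))\<^sup>2)"

definition sobolev_H :: "nat \<Rightarrow> (real \<Rightarrow> 'a::euclidean_space) set" where
  "sobolev_H k = {f. \<forall>j\<le>k. \<exists>g\<in>L2_space. has_weak_deriv j f g}"

text \<open>This and the previous norm are meaningful only for members of the respective space:
  the Bochner integral of a non-integrable function is \<open>0\<close>.\<close>

definition sobolev_norm :: "nat \<Rightarrow> (real \<Rightarrow> 'a::euclidean_space) \<Rightarrow> real" where
  "sobolev_norm k f = sqrt (\<Sum>j\<le>k. (L2_norm (weak_deriv j f))\<^sup>2)"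

definition sobolev_W_inf :: "nat \<Rightarrow> (real \<Rightarrow> 'a::euclidean_space) set" where
  "sobolev_W_inf k =
     {f. \<forall>j\<le>k. \<exists>g. has_weak_deriv j f g \<and> (\<exists>M. AE x in lebesgue. norm (g x) \<le> M)}"

text \<open>Derivative of a curve in \<open>L\<^sup>2\<close> at time \<open>t\<close>, one-sided at an endpoint of \<open>I\<close>.\<close>

definition has_L2_deriv ::
    "(real \<Rightarrow> real \<Rightarrow> 'a::euclidean_space) \<Rightarrow> (real \<Rightarrow> 'a) \<Rightarrow> real \<Rightarrow> real set \<Rightarrow> bool" where
  "has_L2_deriv u p t I \<longleftrightarrow>
     p \<in> L2_space \<and>
     ((\<lambda>s. L2_norm (\<lambda>x. (1 / (s - t)) *\<^sub>R (u s x - u t x) - p x)) \<longlongrightarrow> 0) (at t within I)"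


section \<open>The Dirac operator and its unitary group\<close>

type_synonym spinor = "complex^2"

definition sigma1 :: "complex^2^2" where
  "sigma1 = vector [vector [0, 1], vector [1, 0]]"

definition sigma3 :: "complex^2^2" where
  "sigma3 = vector [vector [1, 0], vector [0, -1]]"

text \<open>\<open>Q\<^sup>\<epsilon> = - i \<epsilon> \<sigma>\<^sub>1 \<partial>\<^sub>x + \<sigma>\<^sub>3\<close>, with domain \<open>sobolev_H 1\<close>.\<close>

definition dirac_op :: "real \<Rightarrow> (real \<Rightarrow> spinor) \<Rightarrow> real \<Rightarrow> spinor" where
  "dirac_op \<epsilon> f =
     (\<lambda>x. (- \<i> * of_real \<epsilon>) *s (sigma1 *v weak_deriv 1 f x) + sigma3 *v f x)"

text \<open>
  \<open>U\<close> is the strongly continuous unitary group \<open>U t = exp (- i t A)\<close> on \<open>L\<^sup>2\<close> generated by the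
  self-adjoint operator \<open>A\<close> with domain \<open>D\<close>: its infinitesimal generator is \<open>- i A\<close>, domains
  included. Each \<open>U t\<close> is surjective, hence unitary, by the group law.
\<close>

definition generated_unitary_group ::
    "(real \<Rightarrow> spinor) set \<Rightarrow> ((real \<Rightarrow> spinor) \<Rightarrow> real \<Rightarrow> spinor) \<Rightarrow>
     (real \<Rightarrow> (real \<Rightarrow> spinor) \<Rightarrow> real \<Rightarrow> spinor) \<Rightarrow> bool" where
  "generated_unitary_group D A U \<longleftrightarrow>
     (\<forall>t. \<forall>f\<in>L2_space. U t f \<in> L2_space \<and> L2_norm (U t f) = L2_norm f) \<and>
     (\<forall>t a b. \<forall>f\<in>L2_space. \<forall>g\<in>L2_space.
        AE x in lebesgue. U t (\<lambda>x. a *s f x + b *s g x) x = a *s U t f x + b *s U t g x) \<and>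
     (\<forall>f\<in>L2_space. AE x in lebesgue. U 0 f x = f x) \<and>
     (\<forall>s t. \<forall>f\<in>L2_space. AE x in lebesgue. U (s + t) f x = U s (U t f) x) \<and>
     (\<forall>f\<in>L2_space. ((\<lambda>t. L2_norm (\<lambda>x. U t f x - f x)) \<longlongrightarrow> 0) (at 0)) \<and>
     (\<forall>f\<in>L2_space. \<forall>g\<in>L2_space.
        has_L2_deriv (\<lambda>t. U t f) g 0 UNIV \<longleftrightarrow>
        f \<in> D \<and> (AE x in lebesgue. g x = (- \<i>) *s A f x))"

text \<open>\<open>dirac_group \<epsilon> t = exp (- i t Q\<^sup>\<epsilon>)\<close>. By Stone's theorem the group exists and is unique up to
  equality almost everywhere.\<close>

definition dirac_group :: "real \<Rightarrow> real \<Rightarrow> (real \<Rightarrow> spinor) \<Rightarrow> real \<Rightarrow> spinor" where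
  "dirac_group \<epsilon> = (SOME U. generated_unitary_group (sobolev_H 1) (dirac_op \<epsilon>) U)"


section \<open>The nonlinear Dirac equation\<close>

text \<open>\<open>\<Phi>\<^sup>* \<Psi>\<close>\<close>

definition herm_prod :: "spinor \<Rightarrow> spinor \<Rightarrow> complex" where
  "herm_prod u v = (\<Sum>i\<in>UNIV. cnj (u $ i) * v $ i)"

text \<open>Here and below \<open>mat c\<close> is the scalar matrix \<open>c I\<^sub>2\<close>, and multiplication of a matrix by a
  complex scalar \<open>c\<close> is written as the product with \<open>mat c\<close>.\<close>

definition nl_matrix :: "real \<Rightarrow> real \<Rightarrow> spinor \<Rightarrow> complex^2^2" where
  "nl_matrix l1 l2 v =
     mat (of_real l1 * herm_prod v (sigma3 *v v)) ** sigma3 + mat (of_real l2 * herm_prod v v)"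

text \<open>
  Strong solution on the time interval \<open>I\<close>: \<open>\<Phi> \<in> C(I; H\<^sup>1)\<close>, differentiable in time as an
  \<open>L\<^sup>2\<close>-valued curve, with the equation holding in \<open>L\<^sup>2\<close> for every \<open>t \<in> I\<close>. For bounded \<open>V\<close> the
  equation makes the time derivative continuous, so \<open>\<Phi> \<in> C(I; H\<^sup>1) \<inter> C\<^sup>1(I; L\<^sup>2)\<close>.
\<close>

definition nlde_solution ::
    "real \<Rightarrow> real \<Rightarrow> real \<Rightarrow> (real \<Rightarrow> real) \<Rightarrow> (real \<Rightarrow> spinor) \<Rightarrow> real set \<Rightarrow>
     (real \<Rightarrow> real \<Rightarrow> spinor) \<Rightarrow> bool" where
  "nlde_solution \<epsilon> l1 l2 V \<Phi>0 I \<Phi> \<longleftrightarrow>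
     (AE x in lebesgue. \<Phi> 0 x = \<Phi>0 x) \<and>
     (\<forall>t\<in>I. \<Phi> t \<in> sobolev_H 1) \<and>
     (\<forall>t\<in>I. ((\<lambda>s. sobolev_norm 1 (\<lambda>x. \<Phi> s x - \<Phi> t x)) \<longlongrightarrow> 0) (at t within I)) \<and>
     (\<forall>t\<in>I. \<exists>\<Phi>t. has_L2_deriv \<Phi> \<Phi>t t I \<and>
        (AE x in lebesgue.
           \<i> *s \<Phi>t x = of_real (1 / \<epsilon>\<^sup>2) *s dirac_op \<epsilon> (\<Phi> t) x
                      + of_real (V x) *s \<Phi> t x
                      + nl_matrix l1 l2 (\<Phi> t x) *v \<Phi> t x))"

definition time_interval :: "ereal \<Rightarrow> real set" where
  "time_interval S = {t. 0 \<le> t \<and> ereal t < S}"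

text \<open>Maximal existence time for one \<open>\<epsilon>\<close>, and the common one for all \<open>0 < \<epsilon> \<le> 1\<close>.\<close>

definition nlde_max_time ::
    "real \<Rightarrow> real \<Rightarrow> real \<Rightarrow> (real \<Rightarrow> real) \<Rightarrow> (real \<Rightarrow> spinor) \<Rightarrow> ereal" where
  "nlde_max_time \<epsilon> l1 l2 V \<Phi>0 =
     Sup {S. \<exists>\<Phi>. nlde_solution \<epsilon> l1 l2 V \<Phi>0 (time_interval S) \<Phi>}"

definition nlde_common_max_time ::
    "real \<Rightarrow> real \<Rightarrow> (real \<Rightarrow> real) \<Rightarrow> (real \<Rightarrow> spinor) \<Rightarrow> ereal" where
  "nlde_common_max_time l1 l2 V \<Phi>0 = (INF \<epsilon>\<in>{0<..1}. nlde_max_time \<epsilon> l1 l2 V \<Phi>0)"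


section \<open>Lie--Trotter splitting\<close>

definition mat_exp :: "complex^2^2 \<Rightarrow> complex^2^2" where
  "mat_exp A = (\<Sum>n. (1 / fact n) *\<^sub>R (((**) A) ^^ n) (mat 1))"

primrec lie_trotter ::
    "real \<Rightarrow> real \<Rightarrow> real \<Rightarrow> (real \<Rightarrow> real) \<Rightarrow> (real \<Rightarrow> spinor) \<Rightarrow> real \<Rightarrow> nat \<Rightarrow> real \<Rightarrow> spinor"
where
  "lie_trotter \<epsilon> l1 l2 V \<Phi>0 \<tau> 0 = \<Phi>0"
| "lie_trotter \<epsilon> l1 l2 V \<Phi>0 \<tau> (Suc n) =
     dirac_group \<epsilon> (\<tau> / \<epsilon>\<^sup>2)
       (\<lambda>x. mat_exp (mat (- \<i> * of_real \<tau>) **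
                (mat (of_real (V x)) + nl_matrix l1 l2 (lie_trotter \<epsilon> l1 l2 V \<Phi>0 \<tau> n x)))
            *v lie_trotter \<epsilon> l1 l2 V \<Phi>0 \<tau> n x)"

definition splitting_error ::
    "real \<Rightarrow> real \<Rightarrow> real \<Rightarrow> (real \<Rightarrow> real) \<Rightarrow> (real \<Rightarrow> spinor) \<Rightarrow> (real \<Rightarrow> real \<Rightarrow> spinor) \<Rightarrow>
     real \<Rightarrow> nat \<Rightarrow> real \<Rightarrow> spinor" where
  "splitting_error \<epsilon> l1 l2 V \<Phi>0 \<Phi> \<tau> n =
     (\<lambda>x. \<Phi> (real n * \<tau>) x - lie_trotter \<epsilon> l1 l2 V \<Phi>0 \<tau> n x)"

end

theory Submission
  imports Defs
begin

text \<open>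
  Let \<open>S t = exp (- i t Q\<^sup>\<epsilon> / \<epsilon>\<^sup>2)\<close> and \<open>N v = - i (V + F v) v\<close>. In the frame moving with \<open>S\<close> the exact
  solution has velocity \<open>S (-s) (N (u (t + s)))\<close> after time \<open>t\<close>, whereas one splitting step uses the frozen velocity
  \<open>N (u t)\<close> up to \<open>O(\<tau>)\<close>. The matrices \<open>V + F v\<close> are diagonal and depend only on the moduli of the
  components, so \<open>N\<close> commutes with the mass rotation \<open>exp (- i s \<sigma>\<^sub>3 / \<epsilon>\<^sup>2)\<close> (\<open>genM_hrot\<close>), although this
  rotation is as fast as \<open>S\<close>. If \<open>S s\<close> could be replaced by the rotation, the two velocities
  would agree up to \<open>O(s)\<close>. The error is therefore governed by the distance between \<open>S s\<close> and the mass
  rotation on smooth data.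

  The two generators differ by \<open>\<sigma>\<^sub>1 \<partial>\<^sub>x / \<epsilon>\<close>, which gives the distance \<open>O(s / \<epsilon>)\<close> at the price of one derivative.
  But \<open>\<sigma>\<^sub>1\<close> anticommutes with \<open>\<sigma>\<^sub>3\<close>, so this difference oscillates with frequency \<open>2 / \<epsilon>\<^sup>2\<close>, and integrating
  by parts in time gives \<open>O(\<epsilon> + s)\<close> at the price of two derivatives (\<open>mass_comparison_h1\<close>). The error committed
  in one step is thus \<open>O(\<tau> (\<tau> + min \<epsilon> (\<tau> / \<epsilon>)))\<close> in \<open>H\<^sup>1\<close> for \<open>H\<^sup>3\<close> solutions (\<open>flow_local_error\<close>). A step is
  Lipschitz in \<open>H\<^sup>1\<close> with constant \<open>1 + O(\<tau>)\<close> on bounded sets (\<open>flow_lipschitz\<close>), and a discrete Gronwall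
  argument sums the local errors; since \<open>min \<epsilon> (\<tau> / \<epsilon>) \<le> sqrt \<tau>\<close>, the error stays small uniformly in \<open>\<epsilon>\<close> and the
  numerical solution never leaves a fixed ball (\<open>discrete_gronwall_bootstrap\<close>).

  The functional analysis rests on one notion, strongly continuous groups of isometries of a Hilbert
  space and their generators. The weak derivative is the generator of the translations of \<open>L\<^sup>2\<close>
  (\<open>weak_deriv_iff_has_D\<close>), and \<open>H\<^sup>1\<close> is its graph. The Dirac group is the transport group of \<open>- \<epsilon> \<sigma>\<^sub>1 \<partial>\<^sub>x\<close>,
  perturbed by the bounded skew mass term (\<open>skew_perturbation\<close>); a group is determined by its generator
  (\<open>isometry_group_eqI\<close>), so it commutes with translations and acts on \<open>H\<^sup>1\<close>. Elements of \<open>H\<^sup>1\<close> are bounded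
  (\<open>h1_ess_bounded\<close>), hence \<open>H\<^sup>1\<close> is closed under products and the cubic nonlinearity is smooth on it.
\<close>

section \<open>The Hilbert space of square-integrable functions modulo null sets\<close>

lemma L2_spaceD:
  assumes "f \<in> L2_space"
  shows "f \<in> borel_measurable lebesgue" "integrable lebesgue (\<lambda>x. (norm (f x))\<^sup>2)"
  using assms by (auto simp: L2_space_def)

lemma L2_space_bound:
  fixes f :: "real \<Rightarrow> 'a::euclidean_space"
  assumes "f \<in> borel_measurable lebesgue" "integrable lebesgue g"
    "AE x in lebesgue. (norm (f x))\<^sup>2 \<le> g x"
  shows "f \<in> L2_space"
proof -
  have "integrable lebesgue (\<lambda>x. (norm (f x))\<^sup>2)"
    by (rule Bochner_Integration.integrable_bound[OF assms(2)])
       (use assms in \<open>auto elim!: eventually_mono\<close>)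
  then show ?thesis using assms by (simp add: L2_space_def)
qed

lemma L2_space_dominated:
  fixes f :: "real \<Rightarrow> 'a::euclidean_space" and g :: "real \<Rightarrow> 'b::euclidean_space"
  assumes "f \<in> borel_measurable lebesgue" "g \<in> L2_space"
    "AE x in lebesgue. norm (f x) \<le> c * norm (g x)"
  shows "f \<in> L2_space"
proof (rule L2_space_bound[OF assms(1)])
  show "integrable lebesgue (\<lambda>x. c\<^sup>2 * (norm (g x))\<^sup>2)"
    using L2_spaceD(2)[OF assms(2)] by simp
  show "AE x in lebesgue. (norm (f x))\<^sup>2 \<le> c\<^sup>2 * (norm (g x))\<^sup>2"
    using assms(3)
  proof eventually_elim
    case (elim x)
    show ?case using power_mono[OF elim norm_ge_zero, of 2] by (simp add: power_mult_distrib)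
  qed
qed

lemma L2_space_add:
  fixes f g :: "real \<Rightarrow> 'a::euclidean_space"
  assumes "f \<in> L2_space" "g \<in> L2_space"
  shows "(\<lambda>x. f x + g x) \<in> L2_space"
proof (rule L2_space_bound)
  note m = L2_spaceD[OF assms(1)] L2_spaceD[OF assms(2)]
  show "(\<lambda>x. f x + g x) \<in> borel_measurable lebesgue" using m by simp
  show "integrable lebesgue (\<lambda>x. 2 * (norm (f x))\<^sup>2 + 2 * (norm (g x))\<^sup>2)" using m by simp
  have "(norm (f x + g x))\<^sup>2 \<le> 2 * (norm (f x))\<^sup>2 + 2 * (norm (g x))\<^sup>2" for x
  proof -
    have "(norm (f x + g x))\<^sup>2 \<le> (norm (f x) + norm (g x))\<^sup>2"
      by (intro power_mono norm_triangle_ineq) auto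
    also have "\<dots> \<le> 2 * (norm (f x))\<^sup>2 + 2 * (norm (g x))\<^sup>2"
      using sum_squares_bound[of "norm (f x)" "norm (g x)"] by (simp add: power2_sum)
    finally show ?thesis .
  qed
  then show "AE x in lebesgue. (norm (f x + g x))\<^sup>2 \<le> 2 * (norm (f x))\<^sup>2 + 2 * (norm (g x))\<^sup>2"
    by simp
qed

lemma L2_space_linear:
  fixes f :: "real \<Rightarrow> 'a::euclidean_space" and A :: "'a \<Rightarrow> 'b::euclidean_space"
  assumes "f \<in> L2_space" "bounded_linear A"
  shows "(\<lambda>x. A (f x)) \<in> L2_space"
proof (rule L2_space_dominated[OF _ assms(1)])
  have "A \<in> borel_measurable borel"
    by (intro borel_measurable_continuous_onI linear_continuous_on assms)
  then show "(\<lambda>x. A (f x)) \<in> borel_measurable lebesgue"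
    using L2_spaceD(1)[OF assms(1)] by (rule measurable_compose_rev)
  show "AE x in lebesgue. norm (A (f x)) \<le> onorm A * norm (f x)"
    using onorm[OF assms(2)] by simp
qed

lemma L2_space_scaleR: "f \<in> L2_space \<Longrightarrow> (\<lambda>x. c *\<^sub>R f x) \<in> L2_space"
  by (rule L2_space_linear) (simp_all add: bounded_linear_scaleR_right)

lemma L2_space_zero: "(\<lambda>x. 0) \<in> L2_space"
  by (simp add: L2_space_def)

lemma L2_space_diff:
  fixes f g :: "real \<Rightarrow> 'a::euclidean_space"
  assumes "f \<in> L2_space" "g \<in> L2_space"
  shows "(\<lambda>x. f x - g x) \<in> L2_space"
  using L2_space_add[OF assms(1) L2_space_scaleR[OF assms(2), of "-1"]] by simp

lemma L2_space_cong_AE: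
  assumes "f \<in> L2_space" "AE x in lebesgue. f x = g x"
  shows "g \<in> L2_space"
proof -
  have m: "g \<in> borel_measurable lebesgue"
    using borel_measurable_AE[OF L2_spaceD(1)] assms by blast
  show ?thesis
    by (rule L2_space_dominated[OF m assms(1), of 1]) (use assms(2) in \<open>auto elim!: eventually_mono\<close>)
qed

lemma integrable_inner_L2:
  fixes f g :: "real \<Rightarrow> 'a::euclidean_space"
  assumes "f \<in> L2_space" "g \<in> L2_space"
  shows "integrable lebesgue (\<lambda>x. f x \<bullet> g x)"
proof (rule Bochner_Integration.integrable_bound)
  note m = L2_spaceD[OF assms(1)] L2_spaceD[OF assms(2)]
  show "integrable lebesgue (\<lambda>x. (norm (f x))\<^sup>2 + (norm (g x))\<^sup>2)" using m by simp
  show "(\<lambda>x. f x \<bullet> g x) \<in> borel_measurable lebesgue" using m by simp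
  have "norm (f x \<bullet> g x) \<le> norm ((norm (f x))\<^sup>2 + (norm (g x))\<^sup>2)" for x
  proof -
    have "norm (f x \<bullet> g x) \<le> norm (f x) * norm (g x)" by (simp add: Cauchy_Schwarz_ineq2)
    also have "\<dots> \<le> (norm (f x))\<^sup>2 + (norm (g x))\<^sup>2"
      using sum_squares_bound[of "norm (f x)" "norm (g x)"]
        mult_nonneg_nonneg[OF norm_ge_zero[of "f x"] norm_ge_zero[of "g x"]] by linarith
    finally show ?thesis by simp
  qed
  then show "AE x in lebesgue. norm (f x \<bullet> g x) \<le> norm ((norm (f x))\<^sup>2 + (norm (g x))\<^sup>2)"
    by simp
qed

quotient_type (overloaded) 'a l2 = "real \<Rightarrow> 'a::euclidean_space" / partial:
  "\<lambda>f g. f \<in> L2_space \<and> g \<in> L2_space \<and> (AE x in lebesgue. f x = g x)"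
proof (rule part_equivpI)
  show "\<exists>f::real \<Rightarrow> 'a. f \<in> L2_space \<and> f \<in> L2_space \<and> (AE x in lebesgue. f x = f x)"
    using L2_space_zero by auto
qed (auto intro!: sympI transpI elim: eventually_elim2)

text \<open>
  Values of a class are only defined almost everywhere. \<open>ev\<close> evaluates an
  arbitrary representative, so that identities between values are stated under an
  almost-everywhere quantifier.
\<close>

definition cls :: "(real \<Rightarrow> 'a::euclidean_space) \<Rightarrow> 'a l2" where "cls = abs_l2"
definition ev :: "'a::euclidean_space l2 \<Rightarrow> real \<Rightarrow> 'a" where "ev = rep_l2"

lemma ev_L2 [simp]: "ev F \<in> L2_space"
  using Quotient3_rep_reflp[OF Quotient3_l2, of F] by (simp add: ev_def)

lemma cls_ev [simp]: "cls (ev F) = F"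
  by (simp add: ev_def cls_def Quotient3_abs_rep[OF Quotient3_l2])

lemma cls_eq_iff:
  assumes "f \<in> L2_space" "g \<in> L2_space"
  shows "cls f = cls g \<longleftrightarrow> (AE x in lebesgue. f x = g x)"
  using Quotient3_rel[OF Quotient3_l2, of f g] assms by (auto simp: cls_def)

lemma cls_cong: "f \<in> L2_space \<Longrightarrow> AE x in lebesgue. f x = g x \<Longrightarrow> cls f = cls g"
  using cls_eq_iff L2_space_cong_AE by blast

lemma ev_cls: "f \<in> L2_space \<Longrightarrow> AE x in lebesgue. ev (cls f) x = f x"
  using cls_eq_iff[of "ev (cls f)" f] by simp

lemma l2_eqI: "AE x in lebesgue. ev F x = ev G x \<Longrightarrow> F = G"
  using cls_eq_iff[of "ev F" "ev G"] by simp

lemma ev_measurable [simp, measurable]: "ev F \<in> borel_measurable lebesgue"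
  using L2_spaceD(1) ev_L2 by blast

lemma ev_integrable [simp]: "integrable lebesgue (\<lambda>x. (norm (ev F x))\<^sup>2)"
  using L2_spaceD(2) ev_L2 by blast

instantiation l2 :: (euclidean_space) real_vector
begin
definition "0 = cls (\<lambda>x. 0)"
definition "F + G = cls (\<lambda>x. ev F x + ev G x)"
definition "F - G = cls (\<lambda>x. ev F x - ev G x)"
definition "- F = cls (\<lambda>x. - ev F x)"
definition "c *\<^sub>R F = cls (\<lambda>x. c *\<^sub>R ev F x)"

lemma ev_zero: "AE x in lebesgue. ev (0::'a l2) x = 0"
  unfolding zero_l2_def by (intro ev_cls L2_space_zero)
lemma ev_add: "AE x in lebesgue. ev (F + G :: 'a l2) x = ev F x + ev G x"
  unfolding plus_l2_def by (intro ev_cls L2_space_add ev_L2)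
lemma ev_diff: "AE x in lebesgue. ev (F - G :: 'a l2) x = ev F x - ev G x"
  unfolding minus_l2_def by (intro ev_cls L2_space_diff ev_L2)
lemma ev_scaleR: "AE x in lebesgue. ev (c *\<^sub>R F :: 'a l2) x = c *\<^sub>R ev F x"
  unfolding scaleR_l2_def by (intro ev_cls L2_space_scaleR ev_L2)
lemma ev_minus: "AE x in lebesgue. ev (- F :: 'a l2) x = - ev F x"
  unfolding uminus_l2_def using L2_space_scaleR[of "ev F" "-1"] by (intro ev_cls) simp

instance
proof
  fix a b c :: "'a l2" and r s :: real
  show "a + b + c = a + (b + c)"
    using ev_add[of "a+b" c] ev_add[of a b] ev_add[of a "b+c"] ev_add[of b c]
    by (intro l2_eqI, eventually_elim) simp
  show "a + b = b + a"
    using ev_add[of a b] ev_add[of b a] by (intro l2_eqI, eventually_elim) simp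
  show "0 + a = a"
    using ev_add[of 0 a] ev_zero by (intro l2_eqI, eventually_elim) simp
  show "- a + a = 0"
    using ev_add[of "-a" a] ev_minus[of a] ev_zero by (intro l2_eqI, eventually_elim) simp
  show "a - b = a + - b"
    using ev_add[of a "-b"] ev_minus[of b] ev_diff[of a b] by (intro l2_eqI, eventually_elim) simp
  show "r *\<^sub>R (a + b) = r *\<^sub>R a + r *\<^sub>R b"
    using ev_scaleR[of r "a+b"] ev_add[of a b] ev_add[of "r *\<^sub>R a" "r *\<^sub>R b"]
      ev_scaleR[of r a] ev_scaleR[of r b]
    by (intro l2_eqI, eventually_elim) (simp add: scaleR_add_right)
  show "(r + s) *\<^sub>R a = r *\<^sub>R a + s *\<^sub>R a"
    using ev_scaleR[of "r+s" a] ev_add[of "r *\<^sub>R a" "s *\<^sub>R a"]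
      ev_scaleR[of r a] ev_scaleR[of s a]
    by (intro l2_eqI, eventually_elim) (simp add: scaleR_add_left)
  show "r *\<^sub>R s *\<^sub>R a = (r * s) *\<^sub>R a"
    using ev_scaleR[of r "s *\<^sub>R a"] ev_scaleR[of s a] ev_scaleR[of "r * s" a]
    by (intro l2_eqI, eventually_elim) simp
  show "1 *\<^sub>R a = a"
    using ev_scaleR[of 1 a] by (intro l2_eqI, eventually_elim) simp
qed
end

instantiation l2 :: (euclidean_space) real_inner
begin
definition "inner F G = (LINT x|lebesgue. ev F x \<bullet> ev G x)"
definition "norm (F::'a l2) = sqrt (inner F F)"
definition "sgn (F::'a l2) = F /\<^sub>R norm F"
definition "dist (F::'a l2) G = norm (F - G)"
definition [code del]: "uniformity = (INF e\<in>{0 <..}. principal {(x::'a l2, y). dist x y < e})"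
definition [code del]: "open (U::'a l2 set) = (\<forall>x\<in>U. eventually (\<lambda>(x', y). x' = x \<longrightarrow> y \<in> U) uniformity)"
instance
proof
  fix F G H :: "'a l2" and r :: real
  show "inner F G = inner G F" by (simp add: inner_l2_def inner_commute)
  have "inner (F + G) H = (LINT x|lebesgue. ev F x \<bullet> ev H x + ev G x \<bullet> ev H x)"
    unfolding inner_l2_def
    by (rule integral_cong_AE) (use ev_add[of F G] in \<open>auto elim!: eventually_mono simp: inner_add_left\<close>)
  then show "inner (F + G) H = inner F H + inner G H"
    by (simp add: inner_l2_def integrable_inner_L2)
  have "inner (r *\<^sub>R F) G = (LINT x|lebesgue. r * (ev F x \<bullet> ev G x))"
    unfolding inner_l2_def
    by (rule integral_cong_AE) (use ev_scaleR[of r F] in \<open>auto elim!: eventually_mono\<close>)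
  then show "inner (r *\<^sub>R F) G = r * inner F G" by (simp add: inner_l2_def)
  show "0 \<le> inner F F" by (simp add: inner_l2_def)
  have "inner F F = 0 \<longleftrightarrow> (AE x in lebesgue. ev F x \<bullet> ev F x = 0)"
    unfolding inner_l2_def by (rule integral_nonneg_eq_0_iff_AE) (auto simp: integrable_inner_L2)
  also have "\<dots> \<longleftrightarrow> F = 0"
    using ev_zero[where 'a='a] by (auto intro!: l2_eqI elim: eventually_elim2)
  finally show "inner F F = 0 \<longleftrightarrow> F = 0" .
qed (simp_all add: norm_l2_def sgn_l2_def dist_l2_def uniformity_l2_def open_l2_def)
end

lemma norm_cls:
  assumes "f \<in> L2_space"
  shows "norm (cls f) = L2_norm f"
proof -
  have "(LINT x|lebesgue. ev (cls f) x \<bullet> ev (cls f) x) = (LINT x|lebesgue. (norm (f x))\<^sup>2)"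
    by (rule integral_cong_AE)
       (use ev_cls[OF assms] L2_spaceD[OF assms] in \<open>auto elim!: eventually_mono simp: power2_norm_eq_inner\<close>)
  then show ?thesis by (simp add: norm_l2_def inner_l2_def L2_norm_def)
qed

lemma norm_l2_L2: "norm F = L2_norm (ev F)"
  using norm_cls[of "ev F"] by simp

lemma inner_cls:
  assumes "f \<in> L2_space" "g \<in> L2_space"
  shows "inner (cls f) (cls g) = (LINT x|lebesgue. f x \<bullet> g x)"
  unfolding inner_l2_def
proof (rule integral_cong_AE)
  show "AE x in lebesgue. ev (cls f) x \<bullet> ev (cls g) x = f x \<bullet> g x"
    using ev_cls[OF assms(1)] ev_cls[OF assms(2)] by eventually_elim simp
qed (use assms[THEN L2_spaceD(1)] in auto)

lemma cls_add: "f \<in> L2_space \<Longrightarrow> g \<in> L2_space \<Longrightarrow> cls (\<lambda>x. f x + g x) = cls f + cls g"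
  using ev_add[of "cls f" "cls g"] ev_cls[of f] ev_cls[of g] ev_cls[OF L2_space_add[of f g]]
  by (intro l2_eqI) (auto elim: eventually_elim2)

lemma cls_diff: "f \<in> L2_space \<Longrightarrow> g \<in> L2_space \<Longrightarrow> cls (\<lambda>x. f x - g x) = cls f - cls g"
  using ev_diff[of "cls f" "cls g"] ev_cls[of f] ev_cls[of g] ev_cls[OF L2_space_diff[of f g]]
  by (intro l2_eqI) (auto elim: eventually_elim2)

lemma cls_scaleR: "f \<in> L2_space \<Longrightarrow> cls (\<lambda>x. c *\<^sub>R f x) = c *\<^sub>R cls f"
  using ev_scaleR[of c "cls f"] ev_cls[of f] ev_cls[OF L2_space_scaleR[of f c]]
  by (intro l2_eqI) (auto elim: eventually_elim2)

text \<open>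
  Fatou's lemma is all that completeness needs: an almost everywhere limit stays in
  \<open>L\<^sup>2\<close> and inherits uniform norm bounds.
\<close>

lemma L2_norm_limit:
  fixes s :: "nat \<Rightarrow> real \<Rightarrow> 'a::euclidean_space"
  assumes s: "\<And>n. s n \<in> L2_space" "\<And>n. L2_norm (s n) \<le> B"
    and f: "f \<in> borel_measurable lebesgue" "AE x in lebesgue. (\<lambda>n. s n x) \<longlonglongrightarrow> f x"
  shows "f \<in> L2_space" "L2_norm f \<le> B"
proof -
  have B: "0 \<le> B" using s(2)[of 0] by (rule order_trans[rotated]) (simp add: L2_norm_def)
  have m [measurable]: "s n \<in> borel_measurable lebesgue" for n using L2_spaceD s by blast
  note f(1) [measurable]
  have "(\<integral>\<^sup>+x. ennreal ((norm (f x))\<^sup>2) \<partial>lebesgue)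
      = (\<integral>\<^sup>+x. liminf (\<lambda>n. ennreal ((norm (s n x))\<^sup>2)) \<partial>lebesgue)"
  proof (rule nn_integral_cong_AE)
    show "AE x in lebesgue. ennreal ((norm (f x))\<^sup>2) = liminf (\<lambda>n. ennreal ((norm (s n x))\<^sup>2))"
      using f(2)
    proof eventually_elim
      case (elim x)
      have "(\<lambda>n. ennreal ((norm (s n x))\<^sup>2)) \<longlonglongrightarrow> ennreal ((norm (f x))\<^sup>2)"
        by (intro tendsto_ennrealI tendsto_intros elim)
      from lim_imp_Liminf[OF trivial_limit_sequentially this] show ?case by simp
    qed
  qed
  also have "\<dots> \<le> liminf (\<lambda>n. \<integral>\<^sup>+x. ennreal ((norm (s n x))\<^sup>2) \<partial>lebesgue)"
    by (rule nn_integral_liminf) simp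
  also have "\<dots> \<le> ennreal (B\<^sup>2)"
  proof -
    have "(\<integral>\<^sup>+x. ennreal ((norm (s n x))\<^sup>2) \<partial>lebesgue) \<le> ennreal (B\<^sup>2)" for n
    proof -
      have "(\<integral>\<^sup>+x. ennreal ((norm (s n x))\<^sup>2) \<partial>lebesgue) = ennreal (LINT x|lebesgue. (norm (s n x))\<^sup>2)"
        by (rule nn_integral_eq_integral) (use L2_spaceD s in auto)
      also have "(LINT x|lebesgue. (norm (s n x))\<^sup>2) \<le> B\<^sup>2"
        using s(2)[of n] B by (simp add: L2_norm_def real_le_lsqrt real_sqrt_le_iff real_le_lsqrt sqrt_le_D)
      finally show ?thesis by (simp add: ennreal_leI)
    qed
    then have "liminf (\<lambda>n. \<integral>\<^sup>+x. ennreal ((norm (s n x))\<^sup>2) \<partial>lebesgue) \<le> liminf (\<lambda>n. ennreal (B\<^sup>2))"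
      by (intro Liminf_mono) simp
    then show ?thesis by (simp only: Liminf_const[OF trivial_limit_sequentially])
  qed
  finally have le: "(\<integral>\<^sup>+x. ennreal ((norm (f x))\<^sup>2) \<partial>lebesgue) \<le> ennreal (B\<^sup>2)" .
  then have i: "integrable lebesgue (\<lambda>x. (norm (f x))\<^sup>2)"
    by (intro integrableI_bounded) (auto simp: le_less_trans)
  then show "f \<in> L2_space" using f by (simp add: L2_space_def)
  have "ennreal (LINT x|lebesgue. (norm (f x))\<^sup>2) \<le> ennreal (B\<^sup>2)"
    using le nn_integral_eq_integral[OF i] by simp
  then have "(LINT x|lebesgue. (norm (f x))\<^sup>2) \<le> B\<^sup>2" by (simp add: ennreal_le_iff)
  then show "L2_norm f \<le> B" unfolding L2_norm_def using B real_le_lsqrt real_sqrt_le_iff by (metis real_sqrt_abs abs_of_nonneg)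
qed

text \<open>
  Riesz--Fischer. Multiplication by a strictly positive \<open>w \<in> L\<^sup>2\<close> turns
  a Cauchy sequence of \<open>L\<^sup>2\<close> into one of \<open>L\<^sup>1\<close>, which
  has an almost everywhere convergent subsequence; the pointwise limit is the limit in
  \<open>L\<^sup>2\<close> by Fatou's lemma.
\<close>

instance l2 :: (euclidean_space) banach
proof
  fix X :: "nat \<Rightarrow> 'a l2"
  assume X: "Cauchy X"
  obtain p :: "real \<Rightarrow> real" where p': "p \<in> borel_measurable lborel" "\<And>x. p x > 0" "integrable lborel p"
    by (rule sigma_finite_measure.obtain_positive_integrable_function[OF sigma_finite_lborel]) blast
  then have p: "p \<in> borel_measurable lebesgue" "\<And>x. p x > 0" "integrable lebesgue p"
    by (auto simp: integrable_completion intro: measurable_completion)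
  \<comment> \<open>\<open>w\<^sup>2 = p\<close> is integrable, so \<open>w\<close> is in \<open>L\<^sup>2\<close>\<close>
  define w where "w x = sqrt (p x)" for x
  have w: "w \<in> L2_space" "w x > 0" for x
    using p by (auto simp: w_def[abs_def] L2_space_def abs_of_nonneg less_imp_le)
  have nL: "(\<lambda>x. norm (ev F x)) \<in> L2_space" for F :: "'a l2"
    by (rule L2_space_dominated[of _ "ev F" 1]) auto
  have i: "integrable lebesgue (\<lambda>x. w x *\<^sub>R ev (X n) x)" for n
    by (rule Bochner_Integration.integrable_bound[OF integrable_inner_L2[OF w(1) nL[of "X n"]]])
       (use w L2_spaceD(1)[OF w(1)] in auto)
  have "\<exists>N. \<forall>i\<ge>N. \<forall>j\<ge>N. LINT x|lebesgue. norm (w x *\<^sub>R ev (X i) x - w x *\<^sub>R ev (X j) x) < e"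
    if "e > 0" for e
  proof -
    have "e / (norm (cls w) + 1) > 0" using that by (intro divide_pos_pos) (auto intro: add_nonneg_pos)
    then obtain N where N: "\<And>i j. i \<ge> N \<Longrightarrow> j \<ge> N \<Longrightarrow> norm (X i - X j) < e / (norm (cls w) + 1)"
      using X unfolding Cauchy_def dist_norm by meson
    show ?thesis
    proof (intro exI allI impI)
      fix i j assume ij: "N \<le> i" "N \<le> j"
      have "(LINT x|lebesgue. norm (w x *\<^sub>R ev (X i) x - w x *\<^sub>R ev (X j) x))
          = (LINT x|lebesgue. w x \<bullet> norm (ev (X i - X j) x))"
      proof (rule integral_cong_AE)
        show "AE x in lebesgue. norm (w x *\<^sub>R ev (X i) x - w x *\<^sub>R ev (X j) x) = w x \<bullet> norm (ev (X i - X j) x)"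
          using ev_diff[of "X i" "X j"]
        proof eventually_elim
          case (elim x)
          then show ?case using w(2)[of x]
            by (simp add: abs_of_pos flip: scaleR_diff_right)
        qed
      qed (use L2_spaceD(1)[OF w(1)] in auto)
      also have "\<dots> = inner (cls w) (cls (\<lambda>x. norm (ev (X i - X j) x)))"
        by (rule inner_cls[symmetric]) (use w nL in auto)
      also have "\<dots> \<le> norm (cls w) * norm (cls (\<lambda>x. norm (ev (X i - X j) x)))"
        by (rule norm_cauchy_schwarz)
      also have "norm (cls (\<lambda>x. norm (ev (X i - X j) x))) = norm (X i - X j)"
        using norm_cls[OF nL, of "X i - X j"] norm_l2_L2[of "X i - X j"] by (simp add: L2_norm_def)
      also have "norm (cls w) * norm (X i - X j) \<le> norm (cls w) * (e / (norm (cls w) + 1))"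
        using N[OF ij] by (intro mult_left_mono) auto
      also have "\<dots> < e"
        using that add_nonneg_pos[OF norm_ge_zero[of "cls w"] zero_less_one] by (simp add: field_simps)
      finally show "(LINT x|lebesgue. norm (w x *\<^sub>R ev (X i) x - w x *\<^sub>R ev (X j) x)) < e" .
    qed
  qed
  from cauchy_L1_AE_cauchy_subseq[OF i this] obtain r where r: "strict_mono r"
    "AE x in lebesgue. Cauchy (\<lambda>i. w x *\<^sub>R ev (X (r i)) x)" by blast
  define f where "f x = lim (\<lambda>i. ev (X (r i)) x)" for x
  have fm [measurable]: "f \<in> borel_measurable lebesgue"
    unfolding f_def by (rule borel_measurable_lim_metric) simp
  have lim: "AE x in lebesgue. (\<lambda>i. ev (X (r i)) x) \<longlonglongrightarrow> f x"
    using r(2)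
  proof eventually_elim
    case (elim x)
    then obtain L where "(\<lambda>i. w x *\<^sub>R ev (X (r i)) x) \<longlonglongrightarrow> L"
      using Cauchy_convergent convergent_def by blast
    then have "(\<lambda>i. (1 / w x) *\<^sub>R (w x *\<^sub>R ev (X (r i)) x)) \<longlonglongrightarrow> (1 / w x) *\<^sub>R L"
      by (intro tendsto_intros)
    then have *: "(\<lambda>i. ev (X (r i)) x) \<longlonglongrightarrow> (1 / w x) *\<^sub>R L"
      using w(2)[of x] by simp
    then show ?case unfolding f_def using limI[OF *] by simp
  qed
  have key: "f \<in> L2_space \<and> norm (cls f - X m) \<le> e"
    if "\<And>i. i \<ge> m \<Longrightarrow> norm (X i - X m) \<le> e" for m e
  proof -
    have a: "AE x in lebesgue. (\<lambda>n. ev (X (r (n + m))) x - ev (X m) x) \<longlonglongrightarrow> f x - ev (X m) x"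
      using lim by eventually_elim (auto intro!: tendsto_intros LIMSEQ_ignore_initial_segment)
    have b: "L2_norm (\<lambda>x. ev (X (r (n + m))) x - ev (X m) x) \<le> e" for n
    proof -
      have "m \<le> r (n + m)" using seq_suble[OF r(1), of "n + m"] by simp
      from that[OF this] show ?thesis
        by (simp add: L2_space_diff cls_diff flip: norm_cls)
    qed
    have c: "(\<lambda>x. f x - ev (X m) x) \<in> L2_space" "L2_norm (\<lambda>x. f x - ev (X m) x) \<le> e"
      using L2_norm_limit[OF L2_space_diff[OF ev_L2 ev_L2] b _ a] by simp_all
    have "(\<lambda>x. (f x - ev (X m) x) + ev (X m) x) \<in> L2_space" by (rule L2_space_add[OF c(1) ev_L2])
    then have "f \<in> L2_space" by simp
    then show ?thesis using c cls_diff[of f "ev (X m)"] norm_cls[OF c(1)] by simp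
  qed
  have "X \<longlonglongrightarrow> cls f"
  proof (rule LIMSEQ_I)
    fix e :: real assume e: "0 < e"
    then obtain N where N: "\<And>i j. i \<ge> N \<Longrightarrow> j \<ge> N \<Longrightarrow> norm (X i - X j) < e/2"
      using X half_gt_zero[OF e] by (metis CauchyD)
    have "norm (X n - cls f) < e" if "n \<ge> N" for n
      using key[of n "e/2"] N that e by (force simp: norm_minus_commute less_imp_le)
    then show "\<exists>N. \<forall>n\<ge>N. norm (X n - cls f) < e" by blast
  qed
  then show "convergent X" by (auto simp: convergent_def)
qed

section \<open>Pointwise linear maps and translations in \<open>L\<^sup>2\<close>\<close>

lemma L2_dominated_convergence:
  fixes s :: "nat \<Rightarrow> real \<Rightarrow> 'a::euclidean_space" and w :: "real \<Rightarrow> real"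
  assumes s: "\<And>n. s n \<in> borel_measurable lebesgue" and f: "f \<in> borel_measurable lebesgue"
    and w: "w \<in> L2_space" "\<And>n. AE x in lebesgue. norm (s n x) \<le> w x"
    and lim: "AE x in lebesgue. (\<lambda>n. s n x) \<longlonglongrightarrow> f x"
  shows "\<And>n. s n \<in> L2_space" "f \<in> L2_space" "(\<lambda>n. cls (s n)) \<longlonglongrightarrow> cls f"
proof -
  show sL: "s n \<in> L2_space" for n
    by (rule L2_space_dominated[OF s w(1), of _ 1]) (use w(2)[of n] in \<open>auto elim!: eventually_mono\<close>)
  have ae: "AE x in lebesgue. \<forall>n. norm (s n x) \<le> w x" using w(2) by (simp add: AE_all_countable)
  have fw: "AE x in lebesgue. norm (f x) \<le> w x" using ae lim
  proof eventually_elim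
    case (elim x)
    then show ?case by (intro LIMSEQ_le_const2[OF tendsto_norm]) auto
  qed
  show fL: "f \<in> L2_space"
    by (rule L2_space_dominated[OF f w(1), of 1]) (use fw in \<open>auto elim!: eventually_mono\<close>)
  have dL: "(\<lambda>x. s n x - f x) \<in> L2_space" for n by (intro L2_space_diff sL fL)
  have "(\<lambda>n. LINT x|lebesgue. (norm (s n x - f x))\<^sup>2) \<longlonglongrightarrow> (LINT x::real|lebesgue. (0::real))"
  proof (rule integral_dominated_convergence[where w="\<lambda>x. 4 * (norm (w x))\<^sup>2"])
    show "integrable lebesgue (\<lambda>x. 4 * (norm (w x))\<^sup>2)" using L2_spaceD(2)[OF w(1)] by simp
    show "AE x in lebesgue. (\<lambda>n. (norm (s n x - f x))\<^sup>2) \<longlonglongrightarrow> 0" using lim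
    proof eventually_elim
      case (elim x)
      have "(\<lambda>n. (norm (s n x - f x))\<^sup>2) \<longlonglongrightarrow> (norm (f x - f x))\<^sup>2"
        by (intro tendsto_intros elim)
      then show ?case by simp
    qed
    show "AE x in lebesgue. norm ((norm (s n x - f x))\<^sup>2) \<le> 4 * (norm (w x))\<^sup>2" for n
      using ae fw
    proof eventually_elim
      case (elim x)
      have "norm (s n x - f x) \<le> 2 * norm (w x)"
        using norm_triangle_ineq4[of "s n x" "f x"] elim(2) elim(1)[rule_format, of n] by simp
      then have "(norm (s n x - f x))\<^sup>2 \<le> (2 * norm (w x))\<^sup>2" by (intro power_mono) auto
      then show ?case by (simp add: power_mult_distrib)
    qed
    show "(\<lambda>x. (norm (s n x - f x))\<^sup>2) \<in> borel_measurable lebesgue" for n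
      using L2_spaceD(1)[OF dL[of n]] by simp
  qed simp
  then have "(\<lambda>n. sqrt (LINT x|lebesgue. (norm (s n x - f x))\<^sup>2)) \<longlonglongrightarrow> sqrt 0"
    by (intro tendsto_real_sqrt) simp
  moreover have "norm (cls (s n) - cls f) = sqrt (LINT x|lebesgue. (norm (s n x - f x))\<^sup>2)" for n
    unfolding cls_diff[OF sL fL, symmetric] norm_cls[OF dL] L2_norm_def ..
  ultimately have "(\<lambda>n. norm (cls (s n) - cls f)) \<longlonglongrightarrow> 0" by simp
  then show "(\<lambda>n. cls (s n)) \<longlonglongrightarrow> cls f"
    by (rule LIM_zero_cancel[OF tendsto_norm_zero_cancel])
qed

definition lin :: "('a::euclidean_space \<Rightarrow> 'b::euclidean_space) \<Rightarrow> 'a l2 \<Rightarrow> 'b l2"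
  where "lin A F = cls (\<lambda>x. A (ev F x))"

lemma ev_lin: "bounded_linear A \<Longrightarrow> AE x in lebesgue. ev (lin A F) x = A (ev F x)"
  unfolding lin_def by (rule ev_cls[OF L2_space_linear[OF ev_L2]])

lemma lin_cls: "bounded_linear A \<Longrightarrow> f \<in> L2_space \<Longrightarrow> lin A (cls f) = cls (\<lambda>x. A (f x))"
  unfolding lin_def using ev_cls[of f]
  by (intro cls_cong L2_space_linear[OF ev_L2]) (auto elim!: eventually_mono)

lemma norm_l2_le:
  assumes "AE x in lebesgue. norm (ev F x) \<le> c * norm (ev G x)" "0 \<le> c"
  shows "norm F \<le> c * norm G"
proof -
  have "(LINT x|lebesgue. (norm (ev F x))\<^sup>2) \<le> (LINT x|lebesgue. c\<^sup>2 * (norm (ev G x))\<^sup>2)"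
  proof (rule integral_mono_AE)
    show "AE x in lebesgue. (norm (ev F x))\<^sup>2 \<le> c\<^sup>2 * (norm (ev G x))\<^sup>2" using assms(1)
    proof eventually_elim
      case (elim x)
      show ?case using power_mono[OF elim norm_ge_zero, of 2] by (simp add: power_mult_distrib)
    qed
  qed (intro ev_integrable integrable_mult_right)+
  then have "sqrt (LINT x|lebesgue. (norm (ev F x))\<^sup>2) \<le> sqrt (c\<^sup>2 * (LINT x|lebesgue. (norm (ev G x))\<^sup>2))"
    by (intro real_sqrt_le_mono) simp
  also have "\<dots> = c * sqrt (LINT x|lebesgue. (norm (ev G x))\<^sup>2)"
    using assms(2) by (simp only: real_sqrt_mult real_sqrt_abs abs_of_nonneg)
  finally show ?thesis by (simp only: norm_l2_L2 L2_norm_def)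
qed

lemma bounded_linear_lin [simp]:
  assumes A: "bounded_linear A"
  shows "bounded_linear (lin A)"
proof (rule bounded_linear_intro)
  interpret bounded_linear A by fact
  show "lin A (F + G) = lin A F + lin A G" for F G
    using ev_lin[OF A, of "F + G"] ev_lin[OF A, of F] ev_lin[OF A, of G] ev_add[of F G]
      ev_add[of "lin A F" "lin A G"]
    by (intro l2_eqI, eventually_elim) (simp add: add)
  show "lin A (c *\<^sub>R F) = c *\<^sub>R lin A F" for c F
    using ev_lin[OF A, of "c *\<^sub>R F"] ev_lin[OF A, of F] ev_scaleR[of c F] ev_scaleR[of c "lin A F"]
    by (intro l2_eqI, eventually_elim) (simp add: scaleR)
  show "norm (lin A F) \<le> norm F * onorm A" for F
  proof -
    have "norm (lin A F) \<le> onorm A * norm F"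
      by (rule norm_l2_le) (use ev_lin[OF A, of F] onorm[OF A] onorm_pos_le[OF A] in \<open>auto elim!: eventually_mono\<close>)
    then show ?thesis by (simp add: mult.commute)
  qed
qed

lemma lin_compose:
  assumes "bounded_linear A" "bounded_linear B"
  shows "lin A (lin B F) = lin (\<lambda>v. A (B v)) F"
  using ev_lin[OF assms(1), of "lin B F"] ev_lin[OF assms(2), of F]
    ev_lin[OF bounded_linear_compose[OF assms], of F]
  by (intro l2_eqI, eventually_elim) (simp add: o_def)

lemma inner_lin:
  assumes "bounded_linear A" "bounded_linear B" "\<And>u v. A u \<bullet> v = u \<bullet> B v"
  shows "inner (lin A F) G = inner F (lin B G)"
  unfolding inner_l2_def
proof (rule integral_cong_AE)
  show "AE x in lebesgue. ev (lin A F) x \<bullet> ev G x = ev F x \<bullet> ev (lin B G) x"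
    using ev_lin[OF assms(1), of F] ev_lin[OF assms(2), of G] by eventually_elim (simp add: assms)
qed auto

lemma norm_lin_isometry:
  assumes "bounded_linear A" "\<And>v. norm (A v) = norm v"
  shows "norm (lin A F) = norm F"
proof -
  have "norm (lin A F) \<le> 1 * norm F"
    by (rule norm_l2_le) (use ev_lin[OF assms(1), of F] in \<open>auto simp: assms(2) elim!: eventually_mono\<close>)
  moreover have "norm F \<le> 1 * norm (lin A F)"
    by (rule norm_l2_le) (use ev_lin[OF assms(1), of F] in \<open>auto simp: assms(2) elim!: eventually_mono\<close>)
  ultimately show ?thesis by simp
qed

lemma AE_lebesgue_shift:
  assumes "AE x in lebesgue. P (x::real)"
  shows "AE x in lebesgue. P (x + h)"
proof -
  obtain N where N: "negligible N" "{x. \<not> P x} \<subseteq> N"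
    using assms eventually_ae_filter_negligible[of P] by auto
  have "negligible ((+) (-h) ` N)" using N(1) by (rule negligible_translation)
  moreover have "{x. \<not> P (x + h)} \<subseteq> (+) (-h) ` N"
  proof
    fix x assume "x \<in> {x. \<not> P (x + h)}"
    then have "x + h \<in> N" using N(2) by auto
    then show "x \<in> (+) (-h) ` N" by (auto intro!: image_eqI[of _ _ "x + h"])
  qed
  ultimately show ?thesis using eventually_ae_filter_negligible[of "\<lambda>x. P (x + h)"] by auto
qed

lemma lebesgue_measurable_shift:
  assumes "f \<in> borel_measurable lebesgue"
  shows "(\<lambda>x::real. f (x + h)) \<in> borel_measurable lebesgue"
proof -
  have "(\<lambda>x::real. h + x) \<in> lebesgue \<rightarrow>\<^sub>M lebesgue"
    using lebesgue_affine_measurable[where c="\<lambda>x::real. 1" and t=h] by simp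
  from measurable_compose[OF this assms] show ?thesis by (simp add: add.commute)
qed

lemma lebesgue_integral_shift:
  fixes f :: "real \<Rightarrow> 'a::euclidean_space"
  shows "(LINT x|lebesgue. f (x + h)) = (LINT x|lebesgue. f x)"
  using lebesgue_integral_real_affine[of 1 f h] by (simp add: add.commute)

lemma lebesgue_integrable_shift:
  fixes f :: "real \<Rightarrow> 'a::euclidean_space"
  shows "integrable lebesgue (\<lambda>x. f (x + h)) \<longleftrightarrow> integrable lebesgue f"
  using lebesgue_integrable_real_affine_iff[of 1 f h] by (simp add: add.commute)

lemma L2_space_shift:
  "f \<in> L2_space \<Longrightarrow> (\<lambda>x. f (x + h)) \<in> L2_space"
  using lebesgue_integrable_shift[of "\<lambda>x. (norm (f x))\<^sup>2" h]
  by (simp add: L2_space_def lebesgue_measurable_shift)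

definition shift :: "real \<Rightarrow> 'a::euclidean_space l2 \<Rightarrow> 'a l2"
  where "shift h F = cls (\<lambda>x. ev F (x + h))"

lemma ev_shift: "AE x in lebesgue. ev (shift h F) x = ev F (x + h)"
  unfolding shift_def by (intro ev_cls L2_space_shift ev_L2)

lemma shift_cls: "f \<in> L2_space \<Longrightarrow> shift h (cls f) = cls (\<lambda>x. f (x + h))"
  unfolding shift_def by (intro cls_cong L2_space_shift ev_L2 AE_lebesgue_shift ev_cls)

lemma inner_shift: "inner (shift h F) G = inner F (shift (-h) G)"
proof -
  have "inner (shift h F) G = (LINT x|lebesgue. ev F (x + h) \<bullet> ev G x)"
    unfolding inner_l2_def
    by (rule integral_cong_AE)
       (use ev_shift[of h F] lebesgue_measurable_shift[OF ev_measurable, of F h] in \<open>auto elim!: eventually_mono\<close>)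
  also have "\<dots> = (LINT x|lebesgue. ev F x \<bullet> ev G (x - h))"
    using lebesgue_integral_shift[of "\<lambda>x. ev F (x + h) \<bullet> ev G x" "-h"] by simp
  also have "\<dots> = inner F (shift (-h) G)"
    unfolding inner_l2_def
    by (rule integral_cong_AE)
       (use ev_shift[of "-h" G] lebesgue_measurable_shift[of "ev G" "-h"] in \<open>auto elim!: eventually_mono\<close>)
  finally show ?thesis .
qed

lemma shift_0 [simp]: "shift 0 F = F"
  by (simp add: shift_def)

lemma shift_shift: "shift s (shift t F) = shift (s + t) F"
  using ev_shift[of s "shift t F"] AE_lebesgue_shift[OF ev_shift[of t F], of s] ev_shift[of "s + t" F]
  by (intro l2_eqI, eventually_elim) (simp add: add_ac)

lemma norm_shift [simp]: "norm (shift h F) = norm F"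
  by (simp add: norm_eq_sqrt_inner inner_shift shift_shift)

lemma bounded_linear_shift: "bounded_linear (shift h)"
proof (rule bounded_linear_intro)
  show "shift h (F + G) = shift h F + shift h G" for F G
    using ev_shift[of h "F + G"] ev_shift[of h F] ev_shift[of h G] AE_lebesgue_shift[OF ev_add[of F G], of h]
      ev_add[of "shift h F" "shift h G"]
    by (intro l2_eqI, eventually_elim) simp
  show "shift h (c *\<^sub>R F) = c *\<^sub>R shift h F" for c F
    using ev_shift[of h "c *\<^sub>R F"] ev_shift[of h F] AE_lebesgue_shift[OF ev_scaleR[of c F], of h]
      ev_scaleR[of c "shift h F"]
    by (intro l2_eqI, eventually_elim) simp
  show "norm (shift h F) \<le> norm F * 1" for F by simp
qed

lemma shift_lin:
  assumes "bounded_linear A"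
  shows "shift h (lin A F) = lin A (shift h F)"
  using ev_shift[of h "lin A F"] AE_lebesgue_shift[OF ev_lin[OF assms, of F], of h]
    ev_lin[OF assms, of "shift h F"] ev_shift[of h F]
  by (intro l2_eqI, eventually_elim) simp

section \<open>Strong continuity of translations\<close>

lemma L2_space_indicator:
  fixes c :: real
  shows "(\<lambda>x. c * indicator {a..b} x) \<in> L2_space"
proof -
  have "(norm (c * indicator {a..b} x))\<^sup>2 = c\<^sup>2 * indicator {a..b} x" for x :: real
    by (simp add: indicator_def)
  moreover have "integrable lebesgue (\<lambda>x. c\<^sup>2 * indicator {a..b} x)"
    by (intro integrable_mult_right integrable_real_indicator) (auto simp: emeasure_lborel_Icc_eq)
  moreover have "(\<lambda>x. c * indicator {a..b} x) \<in> borel_measurable lebesgue"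
    by (intro borel_measurable_times borel_measurable_const borel_measurable_indicator) auto
  ultimately show ?thesis by (simp add: L2_space_def del: norm_mult)
qed

lemma continuous_lebesgue_measurable:
  fixes f :: "real \<Rightarrow> 'a::euclidean_space"
  assumes "continuous_on UNIV f"
  shows "f \<in> borel_measurable lebesgue"
proof -
  have "f \<in> borel_measurable lborel"
    using borel_measurable_continuous_onI[OF assms] by simp
  then show ?thesis by (rule measurable_completion)
qed

text \<open>
  A measurable function is an almost everywhere limit of continuous functions. Truncating
  their values (\<open>tr\<close>) and their supports (\<open>c\<close>) keeps continuity and
  provides an \<open>L\<^sup>2\<close> majorant, so the convergence takes place in
  \<open>L\<^sup>2\<close>.
\<close>

lemma dense_compact_support:
  fixes F :: "'a::euclidean_space l2"
  assumes "0 < e"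
  obtains f R where "continuous_on UNIV f" "\<And>x. R < \<bar>x\<bar> \<Longrightarrow> f x = 0" "f \<in> L2_space" "norm (F - cls f) < e"
proof -
  have "ev F measurable_on UNIV"
    by (rule lebesgue_measurable_imp_measurable_on) auto
  then obtain N g where N: "negligible N" and g: "\<And>n. continuous_on UNIV (g n)"
    and lim: "\<And>x. x \<notin> N \<Longrightarrow> (\<lambda>n. g n x) \<longlonglongrightarrow> ev F x"
    unfolding measurable_on_def by auto
  have aelim: "AE x in lebesgue. (\<lambda>n. g n x) \<longlonglongrightarrow> ev F x"
    using N lim eventually_ae_filter_negligible[of "\<lambda>x. (\<lambda>n. g n x) \<longlonglongrightarrow> ev F x"] by blast
  define c :: "nat \<Rightarrow> real \<Rightarrow> real" where "c n x = max 0 (min 1 (real n + 1 - \<bar>x\<bar>))" for n x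
  define tr :: "nat \<Rightarrow> 'a \<Rightarrow> 'a" where "tr n v = (real n / max (real n) (norm v)) *\<^sub>R v" for n v
  have tr_le: "norm (tr n v) \<le> real n" "norm (tr n v) \<le> norm v" for n v
    by (cases "n = 0"; auto simp: tr_def max_def divide_simps)+
  have tr_eq: "tr n v = v" if "norm v \<le> real n" for n v
    using that by (cases "n = 0") (auto simp: tr_def max_def)
  have tr_cont: "continuous_on UNIV (tr n)" for n
    by (cases "n = 0") (auto simp: tr_def[abs_def] intro!: continuous_intros continuous_on_max)
  have c01: "0 \<le> c n x" "c n x \<le> 1" for n x by (auto simp: c_def)
  have c_cont: "continuous_on UNIV (c n)" for n
    unfolding c_def[abs_def] by (intro continuous_intros)
  have c_supp: "c n x = 0" if "real n + 1 < \<bar>x\<bar>" for n x using that by (auto simp: c_def)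
  define f where "f n k x = c n x *\<^sub>R tr n (g k x)" for n k x
  define G where "G n x = c n x *\<^sub>R tr n (ev F x)" for n x
  have f_cont: "continuous_on UNIV (f n k)" for n k
    unfolding f_def[abs_def]
    by (intro continuous_on_scaleR c_cont continuous_on_compose2[OF tr_cont g]) auto
  have mc: "c n \<in> borel_measurable lebesgue" for n
    by (rule continuous_lebesgue_measurable[OF c_cont])
  have mt: "tr n \<in> borel_measurable borel" for n
    by (intro borel_measurable_continuous_onI tr_cont)
  have mG: "G n \<in> borel_measurable lebesgue" for n
    unfolding G_def[abs_def]
    by (intro borel_measurable_scaleR mc measurable_compose[OF ev_measurable mt])
  have mf: "f n k \<in> borel_measurable lebesgue" for n k
    by (rule continuous_lebesgue_measurable[OF f_cont])
  have dom1: "norm (f n k x) \<le> (real n * indicator {-(real n + 1)..real n + 1} x)" for n k x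
  proof (cases "real n + 1 < \<bar>x\<bar>")
    case True
    then show ?thesis using c_supp[of n x] by (simp add: f_def)
  next
    case False
    have "\<bar>c n x\<bar> * norm (tr n (g k x)) \<le> 1 * real n"
      using c01[of n x] tr_le(1)[of n "g k x"] by (intro mult_mono) auto
    then show ?thesis using False by (auto simp: f_def indicator_def)
  qed
  have lim1: "(\<lambda>k. cls (f n k)) \<longlonglongrightarrow> cls (G n)" and fL: "f n k \<in> L2_space" for n k
  proof -
    have "AE x in lebesgue. (\<lambda>k. f n k x) \<longlonglongrightarrow> G n x" using aelim
    proof eventually_elim
      case (elim x)
      have "(\<lambda>k. tr n (g k x)) \<longlonglongrightarrow> tr n (ev F x)"
        using tr_cont[of n] elim by (auto intro: continuous_on_tendsto_compose)
      then show ?case unfolding f_def G_def by (intro tendsto_intros)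
    qed
    note * = L2_dominated_convergence[OF mf mG L2_space_indicator AE_I2 this, OF dom1]
    show "(\<lambda>k. cls (f n k)) \<longlonglongrightarrow> cls (G n)" "f n k \<in> L2_space"
      by (rule *)+
  qed
  have lim2: "(\<lambda>n. cls (G n)) \<longlonglongrightarrow> cls (ev F)"
  proof (rule L2_dominated_convergence(3)[OF mG ev_measurable])
    show "(\<lambda>x. norm (ev F x)) \<in> L2_space"
      by (rule L2_space_dominated[of _ "ev F" 1]) auto
    have "norm (G n x) \<le> norm (ev F x)" for n x
    proof -
      have "\<bar>c n x\<bar> * norm (tr n (ev F x)) \<le> 1 * norm (ev F x)"
        using c01[of n x] tr_le(2)[of n "ev F x"] by (intro mult_mono) auto
      then show ?thesis by (simp add: G_def)
    qed
    then show "AE x in lebesgue. norm (G n x) \<le> norm (ev F x)" for n by simp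
    have "(\<lambda>n. G n x) \<longlonglongrightarrow> ev F x" for x
    proof (rule tendsto_eventually)
      have "G n x = ev F x" if "n \<ge> nat \<lceil>\<bar>x\<bar> + norm (ev F x)\<rceil>" for n
      proof -
        have "real n \<ge> \<bar>x\<bar> + norm (ev F x)" using that by linarith
        then have "\<bar>x\<bar> \<le> real n" "norm (ev F x) \<le> real n" using norm_ge_zero[of "ev F x"] by linarith+
        then show ?thesis by (simp add: G_def tr_eq c_def)
      qed
      then show "\<forall>\<^sub>F n in sequentially. G n x = ev F x" using eventually_sequentially by blast
    qed
    then show "AE x in lebesgue. (\<lambda>n. G n x) \<longlonglongrightarrow> ev F x" by simp
  qed
  obtain n where n: "norm (cls (G n) - F) < e / 2"
    using LIMSEQ_D[OF lim2, of "e/2"] assms by auto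
  obtain k where k: "norm (cls (f n k) - cls (G n)) < e / 2"
    using LIMSEQ_D[OF lim1[of n], of "e/2"] assms by auto
  have "norm (F - cls (f n k)) < e"
    using norm_triangle_lt[of "F - cls (G n)" "cls (G n) - cls (f n k)" e] n k
    by (simp add: norm_minus_commute)
  moreover have "f n k x = 0" if "real n + 1 < \<bar>x\<bar>" for x using c_supp[OF that] by (simp add: f_def)
  ultimately show thesis using that f_cont fL by blast
qed

text \<open>
  Translations are isometries, so it suffices to prove the convergence on a dense class; for a
  continuous function with compact support it is dominated convergence.
\<close>

lemma shift_tendsto_0: "((\<lambda>h. shift h F) \<longlongrightarrow> F) (at 0)"
proof -
  have "\<exists>d>0. \<forall>h. h \<noteq> 0 \<and> norm (h - 0) < d \<longrightarrow> norm (shift h F - F) < e" if "0 < e" for e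
  proof -
    have e3: "0 < e / 3" using that by simp
    obtain f R where f: "continuous_on UNIV f" "\<And>x. R < \<bar>x\<bar> \<Longrightarrow> f x = 0" "f \<in> L2_space" "norm (F - cls f) < e / 3"
      by (rule dense_compact_support[OF e3, where F=F]) (rule that)
    have bdd: "\<exists>B. \<forall>x. norm (f x) \<le> B"
    proof -
      have "bounded (f ` {-R..R})"
        by (intro compact_imp_bounded compact_continuous_image continuous_on_subset[OF f(1)]) auto
      then obtain B where B: "\<forall>x\<in>{-R..R}. norm (f x) \<le> B" unfolding bounded_iff by auto
      have "norm (f x) \<le> max B 0" for x
      proof (cases "R < \<bar>x\<bar>")
        case False
        then have "x \<in> {-R..R}" by auto
        with B have "norm (f x) \<le> B" by blast
        then show ?thesis by simp
      qed (simp add: f(2))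
      then show ?thesis by blast
    qed
    then obtain B where B: "\<And>x. norm (f x) \<le> B" by blast
    have "((\<lambda>h. shift h (cls f)) \<longlongrightarrow> cls f) (at 0 within {-1<..<1})"
      unfolding tendsto_at_iff_sequentially
    proof (intro allI impI)
      fix X :: "nat \<Rightarrow> real" assume X: "\<forall>i. X i \<in> {-1<..<1} - {0}" "X \<longlonglongrightarrow> 0"
      have "(\<lambda>n. cls (\<lambda>x. f (x + X n))) \<longlonglongrightarrow> cls f"
      proof (rule L2_dominated_convergence(3)[OF _ _ L2_space_indicator])
        show "(\<lambda>x. f (x + X n)) \<in> borel_measurable lebesgue" for n
          using L2_spaceD(1)[OF L2_space_shift[OF f(3)]] .
        show "f \<in> borel_measurable lebesgue" using L2_spaceD f by blast
        have "norm (f (x + X n)) \<le> B * indicator {-(\<bar>R\<bar> + 1)..\<bar>R\<bar> + 1} x" for n x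
        proof (cases "R < \<bar>x + X n\<bar>")
          case True
          then show ?thesis using f(2)[OF True] order_trans[OF norm_ge_zero B] by auto
        next
          case False
          have "-1 < X n" "X n < 1" using X(1) by auto
          then have "x \<in> {-(\<bar>R\<bar> + 1)..\<bar>R\<bar> + 1}" using False by auto
          then show ?thesis using B by simp
        qed
        then show "AE x in lebesgue. norm (f (x + X n)) \<le> B * indicator {-(\<bar>R\<bar> + 1)..\<bar>R\<bar> + 1} x" for n
          by simp
        have "(\<lambda>n. f (x + X n)) \<longlonglongrightarrow> f (x + 0)" for x
          by (rule continuous_on_tendsto_compose[OF f(1) tendsto_add[OF tendsto_const X(2)]]) auto
        then show "AE x in lebesgue. (\<lambda>n. f (x + X n)) \<longlonglongrightarrow> f x" by simp
      qed
      then show "((\<lambda>h. shift h (cls f)) \<circ> X) \<longlonglongrightarrow> cls f" by (simp add: o_def shift_cls[OF f(3)])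
    qed
    then have "((\<lambda>h. shift h (cls f)) \<longlongrightarrow> cls f) (at 0)"
      by (subst (asm) tendsto_within_open) auto
    from LIM_D[OF this, of "e/3"] that obtain d where d: "d > 0"
      "\<And>h. h \<noteq> 0 \<Longrightarrow> norm (h - 0) < d \<Longrightarrow> norm (shift h (cls f) - cls f) < e / 3" by auto
    have "norm (shift h F - F) < e" if "h \<noteq> 0" "norm (h - 0) < d" for h
    proof -
      interpret bounded_linear "shift h" by (rule bounded_linear_shift)
      have eq: "shift h F - F = shift h (F - cls f) + (shift h (cls f) - cls f) + (cls f - F)"
        by (simp add: diff)
      have "norm (shift h F - F) \<le> norm (shift h (F - cls f)) + norm (shift h (cls f) - cls f) + norm (cls f - F)"
        unfolding eq by (intro norm_triangle_le add_mono order_refl norm_triangle_ineq)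
      also have "\<dots> < e / 3 + e / 3 + e / 3"
        using f(4) d(2)[OF that] by (intro add_strict_mono) (simp_all add: norm_minus_commute)
      finally show ?thesis by simp
    qed
    then show ?thesis using d(1) by blast
  qed
  then show ?thesis by (intro LIM_I) blast
qed

section \<open>Lebesgue differentiation\<close>

lemma locally_integrableD:
  assumes "locally_integrable f"
  shows "set_integrable lebesgue {a..b} f" "f integrable_on {a..b}"
    "integral {a..b} f = (LINT x:{a..b}|lebesgue. f x)"
proof -
  show 1: "set_integrable lebesgue {a..b} f" using assms by (simp add: locally_integrable_def)
  show "f integrable_on {a..b}" "integral {a..b} f = (LINT x:{a..b}|lebesgue. f x)"
    using set_lebesgue_integral_eq_integral[OF 1] by simp_all
qed

text \<open>
  Lebesgue differentiation, in the form that turns information on integrals over intervals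
  into almost everywhere information on the integrand.
\<close>

lemma AE_interval_averages:
  fixes f :: "real \<Rightarrow> 'a::euclidean_space"
  assumes "locally_integrable f"
  shows "AE x in lebesgue. \<forall>e>0. \<exists>h>0. norm ((1 / h) *\<^sub>R (LINT y:{x..x+h}|lebesgue. f y) - f x) < e"
proof -
  obtain N where N: "negligible N" "\<And>x e. x \<notin> N \<Longrightarrow> 0 < e \<Longrightarrow>
      \<exists>d>0. \<forall>h. 0 < h \<and> h < d \<longrightarrow> norm (integral (cbox x (x + h *\<^sub>R One)) f /\<^sub>R h ^ DIM(real) - f x) < e"
    using integrable_ccontinuous_explicit[of f] locally_integrableD(2)[OF assms] by (auto simp: cbox_interval)
  have "\<exists>h>0. norm ((1 / h) *\<^sub>R (LINT y:{x..x+h}|lebesgue. f y) - f x) < e" if x: "x \<notin> N" "0 < e" for x e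
  proof -
    obtain d where d: "d > 0"
      "\<forall>h. 0 < h \<and> h < d \<longrightarrow> norm (integral (cbox x (x + h *\<^sub>R One)) f /\<^sub>R h ^ DIM(real) - f x) < e"
      using N(2)[OF x] by blast
    have "norm (integral (cbox x (x + (d/2) *\<^sub>R One)) f /\<^sub>R (d/2) ^ DIM(real) - f x) < e"
      using d by (auto dest: spec[of _ "d/2"])
    then show ?thesis using d(1) locally_integrableD(3)[OF assms]
      by (intro exI[of _ "d/2"]) (simp add: cbox_interval inverse_eq_divide)
  qed
  then show ?thesis using N(1) unfolding eventually_ae_filter_negligible by blast
qed

lemma AE_zero_of_interval_integrals:
  fixes f :: "real \<Rightarrow> 'a::euclidean_space"
  assumes "locally_integrable f" "\<And>a b. a < b \<Longrightarrow> (LINT x:{a..b}|lebesgue. f x) = 0"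
  shows "AE x in lebesgue. f x = 0"
  using AE_interval_averages[OF assms(1)]
proof eventually_elim
  case (elim x)
  show ?case
  proof (rule ccontr)
    assume "f x \<noteq> 0"
    then obtain h where "h > 0" "norm ((1 / h) *\<^sub>R (LINT y:{x..x+h}|lebesgue. f y) - f x) < norm (f x)"
      using elim by (metis zero_less_norm_iff)
    then show False using assms(2)[of x "x + h"] by simp
  qed
qed

lemma AE_le_of_interval_integrals:
  fixes f :: "real \<Rightarrow> real"
  assumes "locally_integrable f" "\<And>a b. a < b \<Longrightarrow> (LINT x:{a..b}|lebesgue. f x) \<le> c * (b - a)"
  shows "AE x in lebesgue. f x \<le> c"
  using AE_interval_averages[OF assms(1)]
proof eventually_elim
  case (elim x)
  show ?case
  proof (rule ccontr)
    assume "\<not> f x \<le> c"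
    then obtain h where h: "h > 0" "norm ((1 / h) *\<^sub>R (LINT y:{x..x+h}|lebesgue. f y) - f x) < f x - c"
      using elim by (metis diff_gt_0_iff_gt not_le)
    have "(1 / h) * (LINT y:{x..x+h}|lebesgue. f y) \<le> (1 / h) * (c * h)"
      using assms(2)[of x "x + h"] h(1) by (intro mult_left_mono) auto
    then show False using h by (simp add: abs_less_iff)
  qed
qed

lemma L2_locally_integrable:
  fixes f :: "real \<Rightarrow> 'a::euclidean_space"
  assumes "f \<in> L2_space"
  shows "locally_integrable f"
  unfolding locally_integrable_def set_integrable_def
proof (intro allI)
  fix a b :: real
  show "integrable lebesgue (\<lambda>x. indicator {a..b} x *\<^sub>R f x)"
  proof (rule Bochner_Integration.integrable_bound)
    show "integrable lebesgue (\<lambda>x. indicator {a..b} x + (norm (f x))\<^sup>2)"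
      using L2_spaceD[OF assms] by (auto simp: emeasure_lborel_Icc_eq intro!: Bochner_Integration.integrable_add integrable_real_indicator)
    show "(\<lambda>x. indicator {a..b} x *\<^sub>R f x) \<in> borel_measurable lebesgue"
      using L2_spaceD[OF assms] by (intro borel_measurable_scaleR borel_measurable_indicator) auto
    have "norm (f x) \<le> 1 + (norm (f x))\<^sup>2" for x
    proof (cases "norm (f x) \<le> 1")
      case False
      then have "norm (f x) * 1 \<le> norm (f x) * norm (f x)" by (intro mult_left_mono) auto
      then show ?thesis by (simp add: power2_eq_square)
    qed (simp add: add_increasing2)
    then show "AE x in lebesgue. norm (indicator {a..b} x *\<^sub>R f x) \<le> norm (indicator {a..b} x + (norm (f x))\<^sup>2)"
      by (intro AE_I2) (auto simp: indicator_def)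
  qed
qed

section \<open>Antiderivatives of curves in Banach spaces\<close>

lemma has_vector_derivative_iff_tendsto:
  fixes f :: "real \<Rightarrow> 'x::real_normed_vector"
  shows "(f has_vector_derivative f') (at t within S) \<longleftrightarrow>
    ((\<lambda>s. (1 / (s - t)) *\<^sub>R (f s - f t)) \<longlongrightarrow> f') (at t within S)"
proof -
  have "(f has_vector_derivative f') (at t within S) \<longleftrightarrow>
      ((\<lambda>s. (1 / norm (s - t)) *\<^sub>R (f s - (f t + (s - t) *\<^sub>R f'))) \<longlongrightarrow> 0) (at t within S)"
    by (simp add: has_vector_derivative_def has_derivative_within bounded_linear_scaleR_left)
  also have "\<dots> \<longleftrightarrow> ((\<lambda>s. norm ((1 / norm (s - t)) *\<^sub>R (f s - (f t + (s - t) *\<^sub>R f')))) \<longlongrightarrow> 0) (at t within S)"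
    by (rule tendsto_norm_zero_iff[symmetric])
  also have "\<dots> \<longleftrightarrow> ((\<lambda>s. norm ((1 / (s - t)) *\<^sub>R (f s - f t) - f')) \<longlongrightarrow> 0) (at t within S)"
  proof (rule tendsto_cong, unfold eventually_at_filter, intro always_eventually allI impI)
    fix s assume "s \<noteq> t" "s \<in> S"
    then have "f' = (1 / (s - t)) *\<^sub>R ((s - t) *\<^sub>R f')" by simp
    then have "(1 / (s - t)) *\<^sub>R (f s - f t) - f' = (1 / (s - t)) *\<^sub>R (f s - (f t + (s - t) *\<^sub>R f'))"
      by (metis diff_diff_eq scaleR_right_diff_distrib)
    then show "norm ((1 / norm (s - t)) *\<^sub>R (f s - (f t + (s - t) *\<^sub>R f'))) = norm ((1 / (s - t)) *\<^sub>R (f s - f t) - f')"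
      by simp
  qed
  also have "\<dots> \<longleftrightarrow> ((\<lambda>s. (1 / (s - t)) *\<^sub>R (f s - f t) - f') \<longlongrightarrow> 0) (at t within S)"
    by (rule tendsto_norm_zero_iff)
  also have "\<dots> \<longleftrightarrow> ((\<lambda>s. (1 / (s - t)) *\<^sub>R (f s - f t)) \<longlongrightarrow> f') (at t within S)"
    by (rule LIM_zero_iff)
  finally show ?thesis .
qed

lemma has_vector_derivative_affine:
  fixes f :: "real \<Rightarrow> 'x::real_normed_vector"
  assumes "(f has_vector_derivative g) (at (t + c * s))"
  shows "((\<lambda>s. f (t + c * s)) has_vector_derivative c *\<^sub>R g) (at s)"
proof -
  have "((\<lambda>s. t + c * s) has_vector_derivative c) (at s)"
    by (auto intro!: derivative_eq_intros)
  from vector_diff_chain_at[OF this, of f g] assms show ?thesis by (simp add: o_def)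
qed

text \<open>
  The antiderivative is needed on both sides of 0, since group parameters have both signs; it
  is patched together from integrals over the intervals \<open>[-n, n]\<close>.
\<close>

lemma antiderivative_exists:
  fixes g :: "real \<Rightarrow> 'x::banach"
  assumes "continuous_on UNIV g"
  shows "\<exists>G. G 0 = 0 \<and> (\<forall>t. (G has_vector_derivative g t) (at t))"
proof -
  have *: "\<exists>G. G 0 = 0 \<and> (\<forall>t\<in>{-real n<..<real n}. (G has_vector_derivative g t) (at t))" for n
  proof -
    let ?G = "\<lambda>t. integral {- real n..t} g"
    have "(?G has_vector_derivative g t) (at t)" if "t \<in> {- real n<..<real n}" for t
    proof -
      have "(?G has_vector_derivative g t) (at t within {-real n..real n})"
        by (rule integral_has_vector_derivative) (use that in \<open>auto intro: continuous_on_subset[OF assms]\<close>)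
      then show ?thesis using that by (metis at_within_Icc_at greaterThanLessThan_iff)
    qed
    then show ?thesis
      by (intro exI[of _ "\<lambda>t. ?G t - ?G 0"])
         (auto intro!: derivative_eq_intros)
  qed
  then obtain G where G: "\<And>n. G n 0 = 0" "\<And>n t. t \<in> {-real n<..<real n} \<Longrightarrow> (G n has_vector_derivative g t) (at t)"
    by metis
  have eq: "G m t = G n t" if "\<bar>t\<bar> < real m" "\<bar>t\<bar> < real n" for m n t
  proof -
    let ?r = "min (real m) (real n)"
    have "((\<lambda>s. G m s - G n s) has_vector_derivative 0) (at s within {-?r<..<?r})" if "s \<in> {-?r<..<?r}" for s
    proof -
      have "s \<in> {-real m<..<real m}" "s \<in> {-real n<..<real n}" using that by auto
      from has_vector_derivative_diff[OF G(2)[OF this(1)] G(2)[OF this(2)]]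
      show ?thesis by (simp add: has_vector_derivative_at_within)
    qed
    then obtain c where c: "\<And>s. s \<in> {-?r<..<?r} \<Longrightarrow> G m s - G n s = c"
      using has_vector_derivative_zero_constant[of "{-?r<..<?r}" "\<lambda>s. G m s - G n s"]
      by (metis (mono_tags, lifting) convex_real_interval(8))
    have "t \<in> {-?r<..<?r}" "0 \<in> {-?r<..<?r}" using that by auto
    from c[OF this(1)] c[OF this(2)] show ?thesis by (simp add: G(1))
  qed
  define H where "H t = G (nat \<lceil>\<bar>t\<bar>\<rceil> + 1) t" for t
  have "(H has_vector_derivative g t) (at t)" for t
  proof -
    let ?n = "nat \<lceil>\<bar>t\<bar>\<rceil> + 1"
    have t: "t \<in> {-real ?n<..<real ?n}" by (auto, linarith+)
    show ?thesis
    proof (rule has_vector_derivative_transform_within_open[OF G(2)[OF t] _ t])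
      fix s assume s: "s \<in> {-real ?n<..<real ?n}"
      show "G ?n s = H s" unfolding H_def
      proof (rule eq)
        show "\<bar>s\<bar> < real ?n" using s by auto
        show "\<bar>s\<bar> < real (nat \<lceil>\<bar>s\<bar>\<rceil> + 1)" by (simp, linarith)
      qed
    qed simp
  qed
  moreover have "H 0 = 0" by (simp add: H_def G)
  ultimately show ?thesis by blast
qed

text \<open>
  The mean value inequality against \<open>c t\<^sup>n\<^sup>+\<^sup>1 / (n + 1)\<close>. For
  \<open>n = 0\<close> it measures the distance travelled by a curve with bounded velocity;
  iterated, it produces the factorials of the Dyson series.
\<close>

lemma antiderivative_power_bound:
  fixes G :: "real \<Rightarrow> 'x::real_normed_vector"
  assumes G: "G 0 = 0" "\<And>s. (G has_vector_derivative g s) (at s)"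
    and g: "\<And>s. \<bar>s\<bar> \<le> \<bar>t\<bar> \<Longrightarrow> norm (g s) \<le> c * \<bar>s\<bar> ^ n"
  shows "norm (G t) \<le> c * \<bar>t\<bar> ^ Suc n / real (Suc n)"
proof -
  have main: "norm (G t) \<le> c * t ^ Suc n / real (Suc n)"
    if G: "G 0 = 0" "\<And>s. (G has_vector_derivative g s) (at s)"
      and g: "\<And>s. \<bar>s\<bar> \<le> \<bar>t\<bar> \<Longrightarrow> norm (g s) \<le> c * \<bar>s\<bar> ^ n" and t: "0 < t" for G t and g :: "real \<Rightarrow> 'x"
  proof -
    have "norm (G t - G 0) \<le> (\<lambda>s. c * s ^ Suc n / real (Suc n)) t - (\<lambda>s. c * s ^ Suc n / real (Suc n)) 0"
    proof (rule differentiable_bound_general[OF t])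
      show "continuous_on {0..t} G"
        by (intro continuous_at_imp_continuous_on ballI) (rule has_vector_derivative_continuous[OF G(2)])
      show "continuous_on {0..t} (\<lambda>s. c * s ^ Suc n / real (Suc n))" by (intro continuous_intros) simp
      show "((\<lambda>s. c * s ^ Suc n / real (Suc n)) has_vector_derivative c * s ^ n) (at s)" for s
      proof -
        have "((\<lambda>s. c * s ^ Suc n / real (Suc n)) has_real_derivative (c * (real (Suc n) * s ^ n)) / real (Suc n)) (at s)"
          by (intro DERIV_cdivide DERIV_cmult) (use DERIV_pow[of "Suc n" s] in simp)
        then show ?thesis by (simp add: has_real_derivative_iff_has_vector_derivative)
      qed
      show "norm (g s) \<le> c * s ^ n" if "0 < s" "s < t" for s using g[of s] that by auto
    qed (rule G)
    then show ?thesis using G(1) by simp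
  qed
  consider "t = 0" | "0 < t" | "t < 0" by linarith
  then show ?thesis
  proof cases
    case 1 then show ?thesis using G(1) by simp
  next
    case 2 then show ?thesis using main[OF G g] by simp
  next
    case 3
    have "norm (G (- (- t))) \<le> c * (- t) ^ Suc n / real (Suc n)"
    proof (rule main[where g="\<lambda>s. - g (- s)"])
      show "((\<lambda>s. G (- s)) has_vector_derivative - g (- s)) (at s)" for s
        using has_vector_derivative_affine[of G "g (- s)" 0 "-1" s] G(2)[of "-s"] by simp
      show "norm (- g (- s)) \<le> c * \<bar>s\<bar> ^ n" if "\<bar>s\<bar> \<le> \<bar>- t\<bar>" for s
        using g[of "- s"] that by simp
    qed (use 3 G(1) in auto)
    then show ?thesis using 3 by simp
  qed
qed

section \<open>One-parameter groups of isometries\<close>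

locale isometry_group =
  fixes U :: "real \<Rightarrow> 'x::real_normed_vector \<Rightarrow> 'x"
  assumes linear_U: "linear (U t)"
    and norm_U [simp]: "norm (U t x) = norm x"
    and U_0 [simp]: "U 0 x = x"
    and U_add: "U s (U t x) = U (s + t) x"
    and U_tendsto_0: "((\<lambda>t. U t x) \<longlongrightarrow> x) (at 0)"

text \<open>
  The graph of the infinitesimal generator. A relation encodes the domain and the value at
  once.
\<close>

definition gen :: "(real \<Rightarrow> 'x::real_normed_vector \<Rightarrow> 'x) \<Rightarrow> 'x \<Rightarrow> 'x \<Rightarrow> bool"
  where "gen U x g \<longleftrightarrow> ((\<lambda>t. U t x) has_vector_derivative g) (at 0)"

context isometry_group
begin

lemma bounded_linear_U: "bounded_linear (U t)"
  using linear_U[of t] by (intro bounded_linear_intro[where K=1]) (auto simp: linear_add linear_scale)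

lemma U_diff: "U t (x - y) = U t x - U t y" by (rule linear_diff[OF linear_U])
lemma U_plus: "U t (x + y) = U t x + U t y" by (rule linear_add[OF linear_U])
lemma U_scale: "U t (c *\<^sub>R x) = c *\<^sub>R U t x" by (rule linear_scale[OF linear_U])
lemma U_minus [simp]: "U (-t) (U t x) = x" "U t (U (-t) x) = x" by (simp_all add: U_add)

lemma U_tendsto_at: "((\<lambda>s. U s x) \<longlongrightarrow> U t x) (at t)"
proof -
  have "((\<lambda>h. U t (U h x)) \<longlongrightarrow> U t x) (at 0)"
    by (rule bounded_linear.tendsto[OF bounded_linear_U U_tendsto_0])
  then show ?thesis using LIM_offset_zero_iff[of t "\<lambda>s. U s x"] by (simp add: U_add)
qed

text \<open>
  Joint continuity follows from strong continuity because the maps are isometries.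
\<close>

lemma U_tendsto:
  assumes "(f \<longlongrightarrow> a) net" "(y \<longlongrightarrow> x) net"
  shows "((\<lambda>s. U (f s) (y s)) \<longlongrightarrow> U a x) net"
proof -
  have 1: "((\<lambda>s. U (f s) x) \<longlongrightarrow> U a x) net"
  proof (rule tendsto_compose[OF _ assms(1)])
    show "((\<lambda>s. U s x) \<longlongrightarrow> U a x) (at a)" by (rule U_tendsto_at)
  qed
  have "((\<lambda>s. norm (y s - x)) \<longlongrightarrow> 0) net"
    using assms(2) by (intro tendsto_norm_zero) (rule LIM_zero)
  then have "((\<lambda>s. norm (U (f s) (y s - x))) \<longlongrightarrow> 0) net" by simp
  then have "((\<lambda>s. U (f s) (y s - x)) \<longlongrightarrow> 0) net" by (rule tendsto_norm_zero_cancel)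
  from tendsto_add[OF this 1] show ?thesis by (simp add: U_diff)
qed

lemma U_continuous_on:
  assumes "continuous_on S f" "continuous_on S y"
  shows "continuous_on S (\<lambda>s. U (f s) (y s))"
  using assms unfolding continuous_on_def by (auto intro: U_tendsto)

lemma gen_at:
  assumes "gen U x g"
  shows "((\<lambda>t. U t x) has_vector_derivative U t g) (at t)"
proof -
  have "((\<lambda>s. U (s - t) x) has_vector_derivative g) (at t)"
    using has_vector_derivative_affine[of "\<lambda>h. U h x" g "-t" 1 t] assms by (simp add: gen_def)
  from bounded_linear.has_vector_derivative[OF bounded_linear_U this, of t]
  show ?thesis by (simp add: U_add)
qed

lemma gen_U:
  assumes "gen U x g"
  shows "gen U (U t x) (U t g)"
proof -
  have "((\<lambda>h. U t (U h x)) has_vector_derivative U t g) (at 0)"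
    using assms unfolding gen_def by (rule bounded_linear.has_vector_derivative[OF bounded_linear_U])
  then show ?thesis by (simp add: gen_def U_add add.commute)
qed

text \<open>
  Product rule for a curve seen in the moving frame \<open>U (c s)\<close>. Only the point
  \<open>y s\<close> has to lie in the domain of the generator; the velocity \<open>y'\<close>
  need not. Duhamel's formula, uniqueness of groups and the comparison of two groups are
  instances.
\<close>

lemma curve_derivative:
  assumes y: "(y has_vector_derivative y') (at s within I)" and g: "gen U (y s) g"
  shows "((\<lambda>s. U (c * s) (y s)) has_vector_derivative U (c * s) (y' + c *\<^sub>R g)) (at s within I)"
proof -
  have 1: "((\<lambda>r. U (c * r) ((1 / (r - s)) *\<^sub>R (y r - y s))) \<longlongrightarrow> U (c * s) y') (at s within I)"
    using y unfolding has_vector_derivative_iff_tendsto by (intro U_tendsto tendsto_intros)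
  have "((\<lambda>r. U (c * r) (y s)) has_vector_derivative c *\<^sub>R U (c * s) g) (at s)"
    using has_vector_derivative_affine[of "\<lambda>t. U t (y s)" "U (c * s) g" 0 c s] gen_at[OF g] by simp
  then have "((\<lambda>r. U (c * r) (y s)) has_vector_derivative c *\<^sub>R U (c * s) g) (at s within I)"
    by (rule has_vector_derivative_at_within)
  then have 2: "((\<lambda>r. (1 / (r - s)) *\<^sub>R (U (c * r) (y s) - U (c * s) (y s))) \<longlongrightarrow> c *\<^sub>R U (c * s) g) (at s within I)"
    unfolding has_vector_derivative_iff_tendsto .
  show ?thesis
    unfolding has_vector_derivative_iff_tendsto
    using tendsto_add[OF 1 2] by (simp add: U_plus U_scale U_diff algebra_simps)
qed

lemma gen_unique: "gen U x g \<Longrightarrow> gen U x g' \<Longrightarrow> g = g'"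
  unfolding gen_def by (rule vector_derivative_unique_at)

lemma gen_add: "gen U x g \<Longrightarrow> gen U y k \<Longrightarrow> gen U (x + y) (g + k)"
  unfolding gen_def by (auto simp: U_plus intro: has_vector_derivative_add)

lemma gen_scale: "gen U x g \<Longrightarrow> gen U (c *\<^sub>R x) (c *\<^sub>R g)"
  unfolding gen_def U_scale
  by (rule bounded_linear.has_vector_derivative[OF bounded_linear_scaleR_right])

end

text \<open>
  The averages of \<open>U r x\<close> over \<open>0 \<le> r \<le> h\<close> lie in the
  domain, because \<open>U t\<close> maps the integral \<open>A h\<close> to \<open>A (t + h)
  - A t\<close>; they tend to \<open>x\<close> as \<open>h\<close> tends to 0.
\<close>

lemma gen_dense:
  fixes U :: "real \<Rightarrow> 'x::banach \<Rightarrow> 'x"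
  assumes U: "isometry_group U" and e: "0 < e"
  shows "\<exists>z g. gen U z g \<and> norm (z - x) < e"
proof -
  interpret isometry_group U by fact
  have "continuous_on UNIV (\<lambda>r. U r x)" by (intro U_continuous_on continuous_intros)
  then obtain A where A: "A 0 = 0" "\<And>t. (A has_vector_derivative U t x) (at t)"
    using antiderivative_exists by blast
  have eq: "U t (A h) = A (t + h) - A t" for t h
  proof -
    have "((\<lambda>h. U t (A h) - A (t + h)) has_vector_derivative 0) (at h within UNIV)" for h
    proof -
      have "((\<lambda>h. A (t + h)) has_vector_derivative U (t + h) x) (at h)"
        using has_vector_derivative_affine[of A "U (t + h) x" t 1 h] A(2) by simp
      with bounded_linear.has_vector_derivative[OF bounded_linear_U A(2), of t h]
      show ?thesis by (auto simp: U_add intro!: derivative_eq_intros)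
    qed
    then obtain c where c: "\<And>h. U t (A h) - A (t + h) = c"
      using has_vector_derivative_zero_constant[of UNIV "\<lambda>h. U t (A h) - A (t + h)"] by auto
    from c[of h] c[of 0] have "U t (A h) - A (t + h) = - A t" by (simp add: A linear_0[OF linear_U])
    then show ?thesis by (simp add: algebra_simps)
  qed
  have g: "gen U (A h) (U h x - x)" for h
  proof -
    have "((\<lambda>t. A (t + h)) has_vector_derivative U h x) (at 0)"
      using has_vector_derivative_affine[of A "U h x" h 1 0] A(2)[of h] by (simp add: add.commute)
    with A(2)[of 0] show ?thesis by (auto simp: gen_def eq intro!: derivative_eq_intros)
  qed
  have "((\<lambda>h. (1 / (h - 0)) *\<^sub>R (A h - A 0)) \<longlongrightarrow> U 0 x) (at 0)"
    using A(2)[of 0] unfolding has_vector_derivative_iff_tendsto .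
  from LIM_D[OF this e] obtain d where d: "d > 0"
    "\<And>h. h \<noteq> 0 \<Longrightarrow> norm (h - 0) < d \<Longrightarrow> norm ((1 / h) *\<^sub>R A h - x) < e" by (auto simp: A)
  show ?thesis using d(2)[of "d/2"] d(1) gen_scale[OF g[of "d/2"], of "1 / (d/2)"] by (intro exI conjI) auto
qed

text \<open>
  A group is determined by its generator: for \<open>x\<close> in the domain, \<open>V (-s) (U
  s x)\<close> has derivative zero, and the domain is dense.
\<close>

lemma isometry_group_eqI:
  fixes U V :: "real \<Rightarrow> 'x::banach \<Rightarrow> 'x"
  assumes U: "isometry_group U" and V: "isometry_group V" and g: "\<And>x g. gen U x g \<Longrightarrow> gen V x g"
  shows "U t x = V t x"
proof -
  interpret U: isometry_group U by fact
  interpret V: isometry_group V by fact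
  have eq: "U t x = V t x" if x: "gen U x k" for x k t
  proof -
    have "((\<lambda>s. V ((-1) * s) (U s x)) has_vector_derivative 0) (at s within UNIV)" for s
      using V.curve_derivative[OF U.gen_at[OF x, of s] g[OF U.gen_U[OF x]], of "-1"]
      by (simp add: linear_0[OF V.linear_U])
    then obtain c where "\<And>s. V ((-1) * s) (U s x) = c"
      using has_vector_derivative_zero_constant[of UNIV "\<lambda>s. V ((-1) * s) (U s x)"] by auto
    from this[of t] this[of 0] have "V (- t) (U t x) = x" by simp
    then show ?thesis by (metis V.U_minus(2))
  qed
  have "norm (U t x - V t x) \<le> e" if e: "e > 0" for e
  proof -
    obtain z k where z: "gen U z k" "norm (z - x) < e / 2"
      using gen_dense[OF U half_gt_zero[OF e]] by blast
    have "U t x - V t x = U t (x - z) + V t (z - x)"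
      using eq[OF z(1)] by (simp add: U.U_diff V.U_diff)
    then have "norm (U t x - V t x) \<le> norm (x - z) + norm (z - x)"
      by (metis U.norm_U V.norm_U norm_triangle_ineq)
    then show ?thesis using z(2) by (simp add: norm_minus_commute)
  qed
  then have "norm (U t x - V t x) \<le> 0" using field_le_epsilon[of "norm (U t x - V t x)" 0] by simp
  then show ?thesis by simp
qed

section \<open>Skew perturbations of isometry groups\<close>

lemma isometry_inner:
  fixes A :: "'x::real_inner \<Rightarrow> 'x"
  assumes "linear A" "\<And>x. norm (A x) = norm x"
  shows "inner (A x) (A y) = inner x y"
  unfolding dot_norm using assms by (simp flip: linear_add[OF assms(1)])

text \<open>
  The linear equation \<open>y' = b t y\<close> with bounded skew coefficients. Skewness makes
  the norm of a solution constant, which gives uniqueness and, later, isometry of the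
  perturbed group. The coefficients are only strongly continuous, as conjugates by a strongly
  continuous group are.
\<close>

locale skew_family =
  fixes b :: "real \<Rightarrow> 'x::{real_inner,banach} \<Rightarrow> 'x" and K :: real
  assumes linear_b: "linear (b t)"
    and norm_b: "norm (b t x) \<le> K * norm x"
    and skew_b: "inner (b t x) x = 0"
    and b_cont: "continuous_on S y \<Longrightarrow> continuous_on S (\<lambda>t. b t (y t))"
begin

definition sol :: "'x \<Rightarrow> (real \<Rightarrow> 'x) \<Rightarrow> bool" where
  "sol x y \<longleftrightarrow> y 0 = x \<and> (\<forall>t. (y has_vector_derivative b t (y t)) (at t))"

lemma sol_norm:
  assumes "sol x y"
  shows "norm (y t) = norm x"
proof -
  have "((\<lambda>t. inner (y t) (y t)) has_vector_derivative 0) (at t within UNIV)" for t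
  proof -
    have "((\<lambda>t. inner (y t) (y t)) has_vector_derivative inner (y t) (b t (y t)) + inner (b t (y t)) (y t)) (at t)"
      using assms by (intro bounded_bilinear.has_vector_derivative[OF bounded_bilinear_inner]) (simp_all add: sol_def)
    moreover have "inner (y t) (b t (y t)) = 0" by (subst inner_commute) (rule skew_b)
    ultimately show ?thesis by (simp add: skew_b)
  qed
  then obtain c where "\<And>t. inner (y t) (y t) = c"
    using has_vector_derivative_zero_constant[of UNIV "\<lambda>t. inner (y t) (y t)"] by auto
  then have "inner (y t) (y t) = inner (y 0) (y 0)" by simp
  then show ?thesis using assms by (simp add: sol_def norm_eq_sqrt_inner)
qed

lemma sol_lincomb:
  assumes "sol x y" "sol z w"
  shows "sol (a *\<^sub>R x + c *\<^sub>R z) (\<lambda>t. a *\<^sub>R y t + c *\<^sub>R w t)"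
  unfolding sol_def linear_add[OF linear_b] linear_scale[OF linear_b]
  using assms unfolding sol_def
  by (auto intro!: has_vector_derivative_add bounded_linear.has_vector_derivative[OF bounded_linear_scaleR_right])

lemma sol_unique:
  assumes "sol x y" "sol x w"
  shows "y t = w t"
  using sol_norm[OF sol_lincomb[OF assms, of 1 "-1"], of t] by simp

text \<open>
  Dyson series. The iterated antiderivatives \<open>d n\<close> are bounded by \<open>norm x
  (K \<bar>t\<bar>)\<^sup>n / n!\<close>, so their sum \<open>y\<close> converges uniformly on
  bounded intervals. The antiderivative \<open>z\<close> of \<open>b t (y t)\<close> starting
  at \<open>x\<close> is the limit of the same partial sums and hence equals \<open>y\<close>.
\<close>

lemma sol_exists: "\<exists>y. sol x y"
proof -
  define J where "J g = (SOME G. G 0 = (0::'x) \<and> (\<forall>t. (G has_vector_derivative g t) (at t)))" for g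
  have J: "J g 0 = 0" "(J g has_vector_derivative g t) (at t)" if "continuous_on UNIV g" for g t
    using someI_ex[OF antiderivative_exists[OF that]] by (auto simp: J_def)
  have Jc: "continuous_on UNIV (J g)" if "continuous_on UNIV g" for g
    by (intro continuous_at_imp_continuous_on ballI) (rule has_vector_derivative_continuous[OF J(2)[OF that]])
  define d where "d = rec_nat (\<lambda>t. x) (\<lambda>n e. J (\<lambda>t. b t (e t)))"
  have d_Suc: "d (Suc n) = J (\<lambda>t. b t (d n t))" and d_0: "d 0 t = x" for n t by (simp_all add: d_def)
  have dc: "continuous_on UNIV (d n)" for n
  proof (induction n)
    case 0 then show ?case by (simp add: d_def)
  next
    case (Suc n) then show ?case unfolding d_Suc by (intro Jc b_cont)
  qed
  have d0: "d (Suc n) 0 = 0" and d': "(d (Suc n) has_vector_derivative b t (d n t)) (at t)" for n t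
    unfolding d_Suc by (intro J b_cont dc)+
  have bound: "norm (d n t) \<le> norm x * (max K 0 ^ n / fact n) * \<bar>t\<bar> ^ n" for n t
  proof (induction n arbitrary: t)
    case 0 then show ?case by (simp add: d_0)
  next
    case (Suc n)
    have "norm (d (Suc n) t) \<le> (norm x * (max K 0 ^ Suc n / fact n)) * \<bar>t\<bar> ^ Suc n / real (Suc n)"
    proof (rule antiderivative_power_bound[OF d0 d'])
      fix s
      have "norm (b s (d n s)) \<le> K * norm (d n s)" by (rule norm_b)
      also have "\<dots> \<le> max K 0 * norm (d n s)" by (intro mult_right_mono) auto
      also have "\<dots> \<le> max K 0 * (norm x * (max K 0 ^ n / fact n) * \<bar>s\<bar> ^ n)"
        by (intro mult_left_mono Suc.IH) auto
      finally show "norm (b s (d n s)) \<le> (norm x * (max K 0 ^ Suc n / fact n)) * \<bar>s\<bar> ^ n" by (simp add: mult_ac)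
    qed
    then show ?case by (simp add: field_simps)
  qed
  define y where "y t = (\<Sum>n. d n t)" for t
  have unif: "uniform_limit {-R..R} (\<lambda>n t. \<Sum>i<n. d i t) y sequentially" for R
    unfolding y_def
  proof (rule Weierstrass_m_test)
    show "norm (d n t) \<le> norm x * ((max K 0 * \<bar>R\<bar>) ^ n / fact n)" if "t \<in> {-R..R}" for n t
    proof -
      have "norm x * (max K 0 ^ n / fact n) * \<bar>t\<bar> ^ n \<le> norm x * (max K 0 ^ n / fact n) * \<bar>R\<bar> ^ n"
        using that by (intro mult_left_mono power_mono) auto
      with bound[of n t] show ?thesis by (simp add: power_mult_distrib field_simps)
    qed
    have "summable (\<lambda>n. (max K 0 * \<bar>R\<bar>) ^ n /\<^sub>R fact n)" by (rule summable_exp_generic)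
    then show "summable (\<lambda>n. norm x * ((max K 0 * \<bar>R\<bar>) ^ n / fact n))"
      by (intro summable_mult) (simp add: field_simps)
  qed
  have yc: "continuous_on UNIV y"
  proof -
    have "isCont y t" for t
    proof -
      have "continuous_on {-(\<bar>t\<bar> + 1)..\<bar>t\<bar> + 1} y"
        by (rule uniform_limit_theorem[OF _ unif])
           (auto intro!: always_eventually continuous_on_sum continuous_on_subset[OF dc])
      then show ?thesis by (rule continuous_on_interior) (auto simp: abs_le_iff; linarith)
    qed
    then show ?thesis by (intro continuous_at_imp_continuous_on) auto
  qed
  define z where "z t = x + J (\<lambda>s. b s (y s)) t" for t
  have z': "(z has_vector_derivative b t (y t)) (at t)" "z 0 = x" for t
    unfolding z_def[abs_def] using J[OF b_cont[OF yc]] by (auto intro!: derivative_eq_intros)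
  have "z t = y t" for t
  proof -
    have *: "norm (z t - (\<Sum>i<Suc n. d i t)) \<le> max K 0 * e * \<bar>t\<bar>"
      if e: "\<And>s. s \<in> {-\<bar>t\<bar>..\<bar>t\<bar>} \<Longrightarrow> norm ((\<Sum>i<n. d i s) - y s) \<le> e" for n e
    proof -
      have eq: "(\<Sum>i<Suc n. d i s) = x + (\<Sum>i<n. d (Suc i) s)" for s
        by (simp only: sum.lessThan_Suc_shift d_0)
      have "norm (z t - (\<Sum>i<Suc n. d i t)) \<le> (max K 0 * e) * \<bar>t\<bar> ^ Suc 0 / real (Suc 0)"
      proof (rule antiderivative_power_bound[where g="\<lambda>s. b s (y s) - (\<Sum>i<n. b s (d i s))"])
        show "((\<lambda>s. z s - (\<Sum>i<Suc n. d i s)) has_vector_derivative b s (y s) - (\<Sum>i<n. b s (d i s))) (at s)" for s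
          unfolding eq using z'(1)[of s] d'[of _ s]
          by (auto intro!: derivative_eq_intros has_vector_derivative_sum)
        show "z 0 - (\<Sum>i<Suc n. d i 0) = 0" unfolding eq by (simp add: z' d0)
        fix s assume s: "\<bar>s\<bar> \<le> \<bar>t\<bar>"
        have "b s (y s) - (\<Sum>i<n. b s (d i s)) = b s (y s - (\<Sum>i<n. d i s))"
          by (simp add: linear_diff[OF linear_b] linear_sum[OF linear_b])
        then have "norm (b s (y s) - (\<Sum>i<n. b s (d i s))) \<le> max K 0 * norm (y s - (\<Sum>i<n. d i s))"
          using norm_b[of s "y s - (\<Sum>i<n. d i s)"]
          by (simp add: order_trans[OF _ mult_right_mono[of K "max K 0"]])
        also have "\<dots> \<le> max K 0 * e"
        proof (intro mult_left_mono)
          have "s \<in> {-\<bar>t\<bar>..\<bar>t\<bar>}" using abs_le_D1[OF s] abs_le_D2[OF s] by simp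
          then show "norm (y s - (\<Sum>i<n. d i s)) \<le> e" using e by (simp add: norm_minus_commute)
        qed simp
        finally show "norm (b s (y s) - (\<Sum>i<n. b s (d i s))) \<le> max K 0 * e * \<bar>s\<bar> ^ 0" by simp
      qed
      then show ?thesis by simp
    qed
    have "(\<lambda>n. \<Sum>i<Suc n. d i t) \<longlonglongrightarrow> z t"
    proof (rule LIMSEQ_I)
      fix r :: real assume r: "0 < r"
      define e where "e = r / (max K 0 * \<bar>t\<bar> + 1)"
      have pos: "0 < max K 0 * \<bar>t\<bar> + 1" by (intro add_nonneg_pos) auto
      have e: "e > 0" using r pos by (simp add: e_def)
      obtain N where N: "\<And>n s. n \<ge> N \<Longrightarrow> s \<in> {-\<bar>t\<bar>..\<bar>t\<bar>} \<Longrightarrow> norm ((\<Sum>i<n. d i s) - y s) < e"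
        using uniform_limitD[OF unif e] unfolding eventually_sequentially dist_norm by blast
      have "norm ((\<Sum>i<Suc n. d i t) - z t) < r" if "n \<ge> N" for n
      proof -
        have "norm (z t - (\<Sum>i<Suc n. d i t)) \<le> max K 0 * e * \<bar>t\<bar>"
          by (rule *) (use N[OF that] in \<open>auto intro: less_imp_le\<close>)
        also have "\<dots> < r" using r pos by (simp add: e_def field_simps)
        finally show ?thesis by (simp add: norm_minus_commute)
      qed
      then show "\<exists>N. \<forall>n\<ge>N. norm ((\<Sum>i<Suc n. d i t) - z t) < r" by blast
    qed
    moreover have "(\<lambda>n. \<Sum>i<Suc n. d i t) \<longlonglongrightarrow> y t"
    proof (rule LIMSEQ_Suc, rule tendsto_uniform_limitI[OF unif[of "\<bar>t\<bar>"]])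
      show "t \<in> {-\<bar>t\<bar>..\<bar>t\<bar>}" by (simp; linarith)
    qed
    ultimately show ?thesis by (rule LIMSEQ_unique)
  qed
  then have "z = y" by auto
  then show ?thesis using z' by (auto simp: sol_def)
qed

end

text \<open>
  Interaction picture: \<open>V\<close> solves \<open>V' = (A + B) V\<close>, where
  \<open>A\<close> generates \<open>U\<close>, exactly when \<open>y t = U (-t) (V t
  x)\<close> solves \<open>y' = U (-t) B U t y\<close>, an equation with bounded skew
  coefficients. The domain of the generator does not change because \<open>V t x - U t
  x\<close> is differentiable at 0 for every \<open>x\<close>.
\<close>

theorem skew_perturbation:
  fixes U :: "real \<Rightarrow> 'x::{real_inner,banach} \<Rightarrow> 'x"
  assumes U: "isometry_group U" and B: "bounded_linear B" and skew: "\<And>x. inner (B x) x = 0"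
  shows "\<exists>V. isometry_group V \<and> (\<forall>x g. gen V x g \<longleftrightarrow> gen U x (g - B x))"
proof -
  interpret U: isometry_group U by fact
  interpret B: bounded_linear B by fact
  define b where "b t x = U (- t) (B (U t x))" for t x
  interpret skew_family b "onorm B"
  proof (rule skew_family.intro)
    show "linear (b t)" for t
      unfolding b_def[abs_def]
      by (rule linearI) (simp_all add: U.U_plus U.U_scale B.add B.scaleR)
    show "norm (b t x) \<le> onorm B * norm x" for t x
      using onorm[OF B, of "U t x"] by (simp add: b_def)
    show "inner (b t x) x = 0" for t x
    proof -
      have "inner (b t x) x = inner (U t (b t x)) (U t x)"
        by (simp add: isometry_inner[OF U.linear_U U.norm_U])
      then show ?thesis by (simp add: b_def skew)
    qed
    show "continuous_on S (\<lambda>t. b t (y t))" if "continuous_on S y" for S y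
      unfolding b_def by (intro U.U_continuous_on B.continuous_on continuous_intros that)
  qed
  define Y where "Y x = (SOME y. sol x y)" for x
  have Y: "sol x (Y x)" for x unfolding Y_def by (rule someI_ex[OF sol_exists])
  have Y0: "Y x 0 = x" and Y': "(Y x has_vector_derivative b t (Y x t)) (at t)" for x t
    using Y by (auto simp: sol_def)
  have Y_eq: "Y x t = y t" if "sol x y" for x y t by (rule sol_unique[OF Y that])
  define V where "V t x = U t (Y x t)" for t x
  have V: "isometry_group V"
  proof (rule isometry_group.intro)
    fix s t x
    show "linear (V t)"
    proof (rule linearI)
      show "V t (x + y) = V t x + V t y" for x y
        using Y_eq[OF sol_lincomb[OF Y Y, of 1 x 1 y], of t] by (simp add: V_def U.U_plus)
      show "V t (r *\<^sub>R x) = r *\<^sub>R V t x" for r x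
        using Y_eq[OF sol_lincomb[OF Y Y, of r x 0 x], of t] by (simp add: V_def U.U_scale)
    qed
    show "norm (V t x) = norm x" by (simp add: V_def sol_norm[OF Y])
    show "V 0 x = x" by (simp add: V_def Y0)
    show "V s (V t x) = V (s + t) x"
    proof -
      have "sol (V t x) (\<lambda>s. U t (Y x (s + t)))"
        unfolding sol_def
      proof (intro conjI allI)
        fix s
        have "((\<lambda>s. Y x (s + t)) has_vector_derivative b (s + t) (Y x (s + t))) (at s)"
          using has_vector_derivative_affine[of "Y x" _ t 1 s, simplified] Y'[of x "s + t"]
          by (simp add: add.commute)
        from bounded_linear.has_vector_derivative[OF U.bounded_linear_U this, of t]
        show "((\<lambda>s. U t (Y x (s + t))) has_vector_derivative b s (U t (Y x (s + t)))) (at s)"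
          by (simp add: b_def U.U_add)
      qed (simp add: V_def)
      from Y_eq[OF this, of s] show ?thesis by (simp add: V_def U.U_add)
    qed
    have "(Y x \<longlongrightarrow> Y x 0) (at 0)"
      using has_vector_derivative_continuous[OF Y'[of x 0]] by (simp add: isCont_def)
    then have "((\<lambda>t. U t (Y x t)) \<longlongrightarrow> U 0 (Y x 0)) (at 0)"
      by (intro U.U_tendsto tendsto_ident_at)
    then show "((\<lambda>t. V t x) \<longlongrightarrow> x) (at 0)" by (simp add: V_def Y0)
  qed
  \<comment> \<open>the two groups differ to first order by \<open>t B x\<close> for every \<open>x\<close>, in the domain or not\<close>
  have D: "((\<lambda>t. V t x - U t x) has_vector_derivative B x) (at 0)" for x
  proof -
    have "((\<lambda>t. U t ((1 / (t - 0)) *\<^sub>R (Y x t - Y x 0))) \<longlongrightarrow> U 0 (b 0 (Y x 0))) (at 0)"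
      using Y'[of x 0] unfolding has_vector_derivative_iff_tendsto by (intro U.U_tendsto tendsto_ident_at)
    then show ?thesis
      unfolding has_vector_derivative_iff_tendsto by (simp add: V_def Y0 b_def U.U_scale U.U_diff)
  qed
  have "gen V x g \<longleftrightarrow> gen U x (g - B x)" for x g
  proof
    assume "gen V x g"
    from has_vector_derivative_diff[OF this[unfolded gen_def] D[of x]] show "gen U x (g - B x)" by (simp add: gen_def)
  next
    assume "gen U x (g - B x)"
    from has_vector_derivative_add[OF this[unfolded gen_def] D[of x]] show "gen V x g" by (simp add: gen_def)
  qed
  with V show ?thesis by blast
qed

section \<open>Test functions\<close>

definition smooth :: "(real \<Rightarrow> real) \<Rightarrow> bool" where
  "smooth \<phi> \<longleftrightarrow> (\<forall>k x. (deriv ^^ k) \<phi> field_differentiable (at x))"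

lemma test_function_iff: "test_function \<phi> \<longleftrightarrow> smooth \<phi> \<and> compact (closure {x. \<phi> x \<noteq> 0})"
  by (simp add: test_function_def smooth_def)

text \<open>
  Coinduction for smoothness: iterated derivatives never have to be computed, a class of
  differentiable functions closed under differentiation is enough.
\<close>

lemma smooth_coinduct:
  assumes "f \<in> C" "\<And>f x. f \<in> C \<Longrightarrow> f field_differentiable (at x)" "\<And>f. f \<in> C \<Longrightarrow> deriv f \<in> C"
  shows "smooth f"
proof -
  have "(deriv ^^ k) f \<in> C" for k
    by (induction k) (use assms in auto)
  then show ?thesis using assms(2) by (auto simp: smooth_def)
qed

lemma smooth_deriv: "smooth f \<Longrightarrow> smooth (deriv f)"
  unfolding smooth_def by (metis funpow_Suc_right o_apply)

lemma smooth_DERIV: "smooth f \<Longrightarrow> (f has_real_derivative deriv f x) (at x)"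
  unfolding smooth_def by (metis DERIV_deriv_iff_field_differentiable funpow_0)

lemma smooth_isCont: "smooth f \<Longrightarrow> isCont f x"
  using smooth_DERIV DERIV_isCont by blast

lemma smooth_continuous: "smooth f \<Longrightarrow> continuous_on S f"
  by (intro continuous_at_imp_continuous_on ballI smooth_isCont)

lemma smooth_shift:
  assumes "smooth f"
  shows "smooth (\<lambda>x. f (x + h))" "deriv (\<lambda>x. f (x + h)) = (\<lambda>x. deriv f (x + h))"
proof -
  have D: "((\<lambda>x. f (x + h)) has_real_derivative deriv f (x + h)) (at x)" if "smooth f" for f x
    using DERIV_shift[of f "deriv f (x + h)" x h] smooth_DERIV[OF that] by blast
  then have E: "deriv (\<lambda>x. f (x + h)) = (\<lambda>x. deriv f (x + h))" if "smooth f" for f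
    using that by (auto intro!: DERIV_imp_deriv)
  show "deriv (\<lambda>x. f (x + h)) = (\<lambda>x. deriv f (x + h))" by (rule E[OF assms])
  show "smooth (\<lambda>x. f (x + h))"
  proof (rule smooth_coinduct[where C="{\<lambda>x. g (x + h) | g. smooth g}"])
    show "(\<lambda>x. f (x + h)) \<in> {\<lambda>x. g (x + h) |g. smooth g}" using assms by blast
    show "f field_differentiable (at x)" if "f \<in> {\<lambda>x. g (x + h) |g. smooth g}" for f x
      using that D by (auto simp: field_differentiable_def)
    show "deriv f \<in> {\<lambda>x. g (x + h) |g. smooth g}" if "f \<in> {\<lambda>x. g (x + h) |g. smooth g}" for f
      using that E smooth_deriv by auto
  qed
qed

text \<open>
  The smallest class that contains the products of smooth functions and is closed under
  differentiation by Leibniz' rule.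
\<close>

inductive_set product_sums :: "(real \<Rightarrow> real) set" where
  prod: "smooth f \<Longrightarrow> smooth g \<Longrightarrow> (\<lambda>x. f x * g x) \<in> product_sums"
| sum: "u \<in> product_sums \<Longrightarrow> v \<in> product_sums \<Longrightarrow> (\<lambda>x. u x + v x) \<in> product_sums"

lemma smooth_mult_deriv:
  assumes "smooth f" "smooth g"
  shows "((\<lambda>x. f x * g x) has_real_derivative deriv f x * g x + f x * deriv g x) (at x)"
  using DERIV_mult[OF smooth_DERIV[OF assms(1)] smooth_DERIV[OF assms(2)], of x] by (simp add: mult.commute)

lemma smooth_mult:
  assumes "smooth f" "smooth g"
  shows "smooth (\<lambda>x. f x * g x)"
proof (rule smooth_coinduct[where C=product_sums])
  have *: "\<exists>w\<in>product_sums. \<forall>x. (u has_real_derivative w x) (at x)" if "u \<in> product_sums" for u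
    using that
  proof induction
    case (prod f g)
    have "(\<lambda>x. deriv f x * g x + f x * deriv g x) \<in> product_sums"
      by (intro product_sums.intros smooth_deriv prod)
    with smooth_mult_deriv[OF prod] show ?case
      by (intro bexI[of _ "\<lambda>x. deriv f x * g x + f x * deriv g x"] allI)
  next
    case (sum u v)
    then obtain a b where "a \<in> product_sums" "b \<in> product_sums"
      "\<And>x. (u has_real_derivative a x) (at x)" "\<And>x. (v has_real_derivative b x) (at x)" by blast
    then show ?case by (intro bexI[of _ "\<lambda>x. a x + b x"]) (auto intro: DERIV_add product_sums.sum)
  qed
  show "f field_differentiable (at x)" if "f \<in> product_sums" for f x
    using *[OF that] by (auto simp: field_differentiable_def)
  show "deriv f \<in> product_sums" if f: "f \<in> product_sums" for f
  proof -
    obtain w where "w \<in> product_sums" "\<And>x. (f has_real_derivative w x) (at x)" using *[OF f] by blast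
    moreover from this(2) have "deriv f = w" using DERIV_imp_deriv by blast
    ultimately show ?thesis by simp
  qed
qed (intro product_sums.prod assms)

text \<open>
  The function \<open>exp (-1 / q)\<close> on the set where the polynomial \<open>q\<close> is
  positive, extended by 0. The factors \<open>R / q\<^sup>m\<close> make the family closed
  under differentiation. Different choices of \<open>q\<close> give approximations of
  indicator functions and cutoff functions that tend to 1.
\<close>

definition bump :: "nat \<Rightarrow> real poly \<Rightarrow> real poly \<Rightarrow> real \<Rightarrow> real" where
  "bump m R q x = (if poly q x > 0 then poly R x / poly q x ^ m * exp (- (1 / poly q x)) else 0)"

lemma exp_recip_bound:
  fixes u :: real
  assumes "0 < u"
  shows "exp (- (1 / u)) / u ^ k \<le> fact k"
proof -
  have "(1 / u) ^ k / fact k \<le> exp (1 / u)"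
  proof -
    have "(\<Sum>n\<in>{k}. (1 / u) ^ n /\<^sub>R fact n) \<le> (\<Sum>n. (1 / u) ^ n /\<^sub>R fact n)"
      by (rule sum_le_suminf[OF summable_exp_generic]) (use assms in auto)
    then show ?thesis by (simp add: exp_def field_simps)
  qed
  then show ?thesis using assms by (simp add: exp_minus field_simps)
qed

text \<open>
  At a zero of \<open>q\<close> the function is bounded by a multiple of
  \<open>q\<^sup>2\<close>, since \<open>exp (-1 / u) / u\<^sup>k\<close> is bounded; so its
  derivative vanishes there.
\<close>

lemma bump_DERIV:
  "(bump m R q has_real_derivative
     bump (m + 2) (pderiv R * q ^ 2 - of_nat m * R * pderiv q * q + R * pderiv q) q x) (at x)"
proof -
  consider "poly q x > 0" | "poly q x < 0" | "poly q x = 0" by linarith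
  then show ?thesis
  proof cases
    case 1
    have op: "open {y. 0 < poly q y}" by (intro open_Collect_less continuous_intros)
    have "((\<lambda>y. poly R y / poly q y ^ m * exp (- (1 / poly q y))) has_real_derivative
        bump (m + 2) (pderiv R * q ^ 2 - of_nat m * R * pderiv q * q + R * pderiv q) q x) (at x)"
    proof -
      have q: "(poly q has_real_derivative poly (pderiv q) x) (at x)"
        "(poly R has_real_derivative poly (pderiv R) x) (at x)" by (rule poly_DERIV)+
      have "((\<lambda>y. poly R y / poly q y ^ m * exp (- (1 / poly q y))) has_real_derivative
         (poly (pderiv R) x * poly q x ^ m - poly R x * (real m * poly q x ^ (m - 1) * poly (pderiv q) x)) / (poly q x ^ m * poly q x ^ m) * exp (- (1 / poly q x))
         + poly R x / poly q x ^ m * (exp (- (1 / poly q x)) * (poly (pderiv q) x / (poly q x * poly q x)))) (at x)"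
        using 1 by (auto intro!: derivative_eq_intros q simp: field_simps)
      also have "(poly (pderiv R) x * poly q x ^ m - poly R x * (real m * poly q x ^ (m - 1) * poly (pderiv q) x)) / (poly q x ^ m * poly q x ^ m) * exp (- (1 / poly q x))
         + poly R x / poly q x ^ m * (exp (- (1 / poly q x)) * (poly (pderiv q) x / (poly q x * poly q x)))
         = bump (m + 2) (pderiv R * q ^ 2 - of_nat m * R * pderiv q * q + R * pderiv q) q x"
      proof -
        have eq: "real m * poly q x ^ (m - 1) = real m * poly q x ^ m / poly q x"
          using 1 by (cases m) auto
        show ?thesis
          unfolding eq using 1 by (simp add: bump_def field_simps power2_eq_square power_add)
      qed
      finally show ?thesis .
    qed
    then show ?thesis
      by (rule has_field_derivative_transform_within_open[OF _ op]) (use 1 in \<open>auto simp: bump_def\<close>)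
  next
    case 2
    have op: "open {y. poly q y < 0}" by (intro open_Collect_less continuous_intros)
    have "((\<lambda>y. 0) has_real_derivative 0) (at x)" by simp
    then have "(bump m R q has_real_derivative 0) (at x)"
      by (rule has_field_derivative_transform_within_open[OF _ op]) (use 2 in \<open>auto simp: bump_def\<close>)
    then show ?thesis using 2 by (simp add: bump_def)
  next
    case 3
    have "((\<lambda>y. \<bar>poly R y\<bar> * fact (m + 2) * \<bar>poly q y\<bar> * \<bar>(poly q y - poly q x) / (y - x)\<bar>)
        \<longlongrightarrow> \<bar>poly R x\<bar> * fact (m + 2) * \<bar>poly q x\<bar> * \<bar>poly (pderiv q) x\<bar>) (at x)"
      using poly_DERIV[of q x] unfolding has_field_derivative_iff
      by (intro tendsto_intros poly_isCont[unfolded isCont_def]) auto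
    then have lim: "((\<lambda>y. \<bar>poly R y\<bar> * fact (m + 2) * \<bar>poly q y\<bar> * \<bar>(poly q y - poly q x) / (y - x)\<bar>) \<longlongrightarrow> 0) (at x)"
      by (simp add: 3)
    have "((\<lambda>y. (bump m R q y - bump m R q x) / (y - x)) \<longlongrightarrow> 0) (at x)"
    proof (rule Lim_null_comparison[OF _ lim], rule always_eventually, intro allI)
      fix y
      show "norm ((bump m R q y - bump m R q x) / (y - x))
        \<le> \<bar>poly R y\<bar> * fact (m + 2) * \<bar>poly q y\<bar> * \<bar>(poly q y - poly q x) / (y - x)\<bar>"
      proof (cases "poly q y > 0")
        case True
        have "\<bar>bump m R q y\<bar> = \<bar>poly R y\<bar> * (exp (- (1 / poly q y)) / poly q y ^ (m + 2)) * (poly q y)\<^sup>2"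
          using True by (simp add: bump_def abs_mult power_add field_simps power2_eq_square)
        also have "\<dots> \<le> \<bar>poly R y\<bar> * fact (m + 2) * (poly q y)\<^sup>2"
          by (intro mult_right_mono mult_left_mono exp_recip_bound True) auto
        finally have "\<bar>bump m R q y\<bar> / \<bar>y - x\<bar> \<le> \<bar>poly R y\<bar> * fact (m + 2) * (poly q y)\<^sup>2 / \<bar>y - x\<bar>"
          by (intro divide_right_mono) auto
        then show ?thesis using 3 by (simp add: bump_def abs_mult power2_eq_square mult.assoc)
      next
        case False
        then have 0: "bump m R q y = 0" "bump m R q x = 0" by (simp_all add: bump_def 3)
        show ?thesis unfolding 0
          by (simp only: diff_self div_0 norm_zero) (intro mult_nonneg_nonneg abs_ge_zero fact_ge_zero)
      qed
    qed
    then show ?thesis by (simp add: has_field_derivative_iff 3 bump_def)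
  qed
qed

lemma bump_smooth: "smooth (bump m R q)"
proof (rule smooth_coinduct[where C="{bump m R q | m R. True}"])
  show "bump m R q \<in> {bump m R q | m R. True}" by blast
  show "f field_differentiable (at x)" if "f \<in> {bump m R q | m R. True}" for f x
    using that bump_DERIV unfolding field_differentiable_def by blast
  show "deriv f \<in> {bump m R q | m R. True}" if f: "f \<in> {bump m R q | m R. True}" for f
  proof -
    obtain m R where f: "f = bump m R q" using f by blast
    have "deriv f = bump (m + 2) (pderiv R * q ^ 2 - of_nat m * R * pderiv q * q + R * pderiv q) q"
      unfolding f using bump_DERIV DERIV_imp_deriv by blast
    then show ?thesis by blast
  qed
qed

lemma compact_support_iff: "compact (closure {x::real. \<phi> x \<noteq> 0}) \<longleftrightarrow> (\<exists>r. \<forall>x. \<phi> x \<noteq> 0 \<longrightarrow> \<bar>x\<bar> \<le> r)"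
proof -
  have "compact (closure {x. \<phi> x \<noteq> 0}) \<longleftrightarrow> bounded {x. \<phi> x \<noteq> 0}"
    by (meson bounded_closure bounded_subset closure_subset compact_closure)
  then show ?thesis by (auto simp: bounded_iff)
qed

lemma test_bump:
  assumes "\<And>x. poly q x > 0 \<Longrightarrow> \<bar>x\<bar> \<le> r"
  shows "test_function (bump 0 1 q)"
  unfolding test_function_iff compact_support_iff using assms
  by (auto simp: bump_smooth bump_def split: if_splits)

lemma test_functionE:
  assumes "test_function \<phi>"
  obtains r where "r > 0" "smooth \<phi>" "\<And>x. r < \<bar>x\<bar> \<Longrightarrow> \<phi> x = 0"
proof -
  obtain r where r: "\<forall>x. \<phi> x \<noteq> 0 \<longrightarrow> \<bar>x\<bar> \<le> r" using assms unfolding test_function_iff compact_support_iff by blast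
  show thesis
    by (rule that[of "max r 1"]) (use r assms in \<open>auto simp: test_function_iff\<close>)
qed

lemma test_functionI:
  assumes "smooth \<phi>" "\<And>x. r < \<bar>x\<bar> \<Longrightarrow> \<phi> x = 0"
  shows "test_function \<phi>"
  unfolding test_function_iff compact_support_iff using assms by (meson not_le)

lemma test_deriv:
  assumes "test_function \<phi>"
  shows "test_function (deriv \<phi>)"
proof -
  obtain r where r: "r > 0" "smooth \<phi>" "\<And>x. r < \<bar>x\<bar> \<Longrightarrow> \<phi> x = 0" by (rule test_functionE[OF assms]) (rule that)
  show ?thesis
  proof (rule test_functionI[of _ r])
    show "deriv \<phi> x = 0" if "r < \<bar>x\<bar>" for x
    proof -
      have op: "open {x::real. r < \<bar>x\<bar>}" by (intro open_Collect_less continuous_intros)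
      have "((\<lambda>y. 0) has_real_derivative 0) (at x)" by simp
      then have "(\<phi> has_real_derivative 0) (at x)"
        by (rule has_field_derivative_transform_within_open[OF _ op]) (use r(3) that in auto)
      then show ?thesis by (rule DERIV_imp_deriv)
    qed
  qed (rule smooth_deriv[OF r(2)])
qed

lemma test_shift:
  assumes "test_function \<phi>"
  shows "test_function (\<lambda>x. \<phi> (x + h))"
proof -
  obtain r where r: "r > 0" "smooth \<phi>" "\<And>x. r < \<bar>x\<bar> \<Longrightarrow> \<phi> x = 0" by (rule test_functionE[OF assms]) (rule that)
  show ?thesis
    by (rule test_functionI[of _ "r + \<bar>h\<bar>"]) (use r in \<open>auto intro: smooth_shift\<close>)
qed

lemma test_mult:
  assumes "test_function \<phi>" "smooth \<eta>"
  shows "test_function (\<lambda>x. \<phi> x * \<eta> x)"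
proof -
  obtain r where r: "r > 0" "smooth \<phi>" "\<And>x. r < \<bar>x\<bar> \<Longrightarrow> \<phi> x = 0" by (rule test_functionE[OF assms(1)]) (rule that)
  show ?thesis
    by (rule test_functionI[of _ r]) (use r assms in \<open>auto intro: smooth_mult\<close>)
qed

lemma test_bounded:
  assumes "test_function \<phi>"
  obtains B r where "0 < r" "0 \<le> B" "\<And>x. \<bar>\<phi> x\<bar> \<le> B * indicator {-r..r} x"
proof -
  obtain r where r: "r > 0" "smooth \<phi>" "\<And>x. r < \<bar>x\<bar> \<Longrightarrow> \<phi> x = 0" by (rule test_functionE[OF assms]) (rule that)
  have "bounded (\<phi> ` {-r..r})"
    by (intro compact_imp_bounded compact_continuous_image smooth_continuous r) auto
  then obtain B where B: "\<forall>x\<in>{-r..r}. \<bar>\<phi> x\<bar> \<le> B" unfolding bounded_iff by auto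
  have "0 \<le> B" using B[rule_format, of 0] r(1) by (intro order_trans[OF abs_ge_zero]) auto
  moreover have "\<bar>\<phi> x\<bar> \<le> B * indicator {-r..r} x" for x
    using B r(3)[of x] by (cases "r < \<bar>x\<bar>") (auto simp: indicator_def)
  ultimately show thesis using that r(1) by blast
qed

lemma test_measurable: "test_function \<phi> \<Longrightarrow> \<phi> \<in> borel_measurable lebesgue"
  by (intro continuous_lebesgue_measurable smooth_continuous) (simp add: test_function_iff)

lemma test_L2:
  assumes "test_function \<phi>"
  shows "(\<lambda>x. \<phi> x *\<^sub>R (e::'a::euclidean_space)) \<in> L2_space"
proof -
  obtain B r where B: "\<And>x. \<bar>\<phi> x\<bar> \<le> B * indicator {-r..r} x" using test_bounded[OF assms] by metis
  show ?thesis
  proof (rule L2_space_dominated[OF _ L2_space_indicator[of B "-r" r], of _ "norm e"])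
    show "(\<lambda>x. \<phi> x *\<^sub>R e) \<in> borel_measurable lebesgue" using test_measurable[OF assms] by simp
    show "AE x in lebesgue. norm (\<phi> x *\<^sub>R e) \<le> norm e * norm (B * indicator {-r..r} x)"
    proof (rule AE_I2)
      fix x
      have "\<bar>\<phi> x\<bar> \<le> norm (B * indicator {-r..r} x)" using B[of x] by simp
      from mult_right_mono[OF this norm_ge_zero[of e]]
      show "norm (\<phi> x *\<^sub>R e) \<le> norm e * norm (B * indicator {-r..r} x)" by (simp add: mult.commute)
    qed
  qed
qed

lemma test_integrable:
  fixes f :: "real \<Rightarrow> 'a::euclidean_space"
  assumes "test_function \<phi>" "locally_integrable f" "f \<in> borel_measurable lebesgue"
  shows "integrable lebesgue (\<lambda>x. \<phi> x *\<^sub>R f x)"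
proof -
  obtain B r where B: "\<And>x. \<bar>\<phi> x\<bar> \<le> B * indicator {-r..r} x" using test_bounded[OF assms(1)] by metis
  show ?thesis
  proof (rule Bochner_Integration.integrable_bound)
    show "integrable lebesgue (\<lambda>x. B *\<^sub>R (indicator {-r..r} x *\<^sub>R f x))"
      using assms(2) unfolding locally_integrable_def set_integrable_def by (intro integrable_scaleR_right) auto
    show "(\<lambda>x. \<phi> x *\<^sub>R f x) \<in> borel_measurable lebesgue"
      using test_measurable[OF assms(1)] assms(3) by simp
    show "AE x in lebesgue. norm (\<phi> x *\<^sub>R f x) \<le> norm (B *\<^sub>R (indicator {-r..r} x *\<^sub>R f x))"
    proof (rule AE_I2)
      fix x
      have "\<bar>\<phi> x\<bar> \<le> \<bar>B * indicator {-r..r} x\<bar>" using B[of x] by simp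
      from mult_right_mono[OF this norm_ge_zero[of "f x"]]
      show "norm (\<phi> x *\<^sub>R f x) \<le> norm (B *\<^sub>R (indicator {-r..r} x *\<^sub>R f x))" by (simp add: abs_mult mult.assoc)
    qed
  qed
qed

lemma locally_integrable_measurable:
  fixes f :: "real \<Rightarrow> 'a::euclidean_space"
  assumes "locally_integrable f"
  shows "f \<in> borel_measurable lebesgue"
proof (rule borel_measurable_LIMSEQ_metric)
  show "(\<lambda>x. indicator {- real n..real n} x *\<^sub>R f x) \<in> borel_measurable lebesgue" for n
    using assms borel_measurable_integrable unfolding locally_integrable_def set_integrable_def by blast
  show "(\<lambda>n. indicator {- real n..real n} x *\<^sub>R f x) \<longlonglongrightarrow> f x" for x
  proof (rule tendsto_eventually)
    have "indicator {- real n..real n} x *\<^sub>R f x = f x" if "n \<ge> nat \<lceil>\<bar>x\<bar>\<rceil>" for n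
    proof -
      have "\<bar>x\<bar> \<le> real n" using that by linarith
      then show ?thesis by (simp add: abs_le_iff indicator_def)
    qed
    then show "\<forall>\<^sub>F n in sequentially. indicator {- real n..real n} x *\<^sub>R f x = f x"
      using eventually_sequentially by blast
  qed
qed

text \<open>
  For \<open>q = n (x - a) (b - x)\<close> the bumps increase to the indicator function of the
  interval.
\<close>

lemma interval_bump:
  assumes "a < b"
  shows "\<exists>\<phi>. (\<forall>n. test_function (\<phi> n)) \<and> (\<forall>n x. \<bar>\<phi> n x\<bar> \<le> indicator {a..b} x) \<and>
      (\<forall>x. x \<noteq> a \<longrightarrow> x \<noteq> b \<longrightarrow> (\<lambda>n. \<phi> n x) \<longlonglongrightarrow> indicator {a..b} x)"
proof -
  define q where "q n = smult (real (Suc n)) ([:-a, 1:] * [:b, -1:])" for n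
  have q: "poly (q n) x = real (Suc n) * ((x - a) * (b - x))" for n x by (simp add: q_def algebra_simps)
  have pos: "0 < poly (q n) x \<longleftrightarrow> a < x \<and> x < b" for n x
    unfolding q using assms by (auto simp: zero_less_mult_iff)
  have "test_function (bump 0 1 (q n))" for n
    by (rule test_bump[of _ "max \<bar>a\<bar> \<bar>b\<bar>"]) (auto simp: pos)
  moreover have "\<bar>bump 0 1 (q n) x\<bar> \<le> indicator {a..b} x" for n x
  proof (cases "0 < poly (q n) x")
    case True then show ?thesis using pos[of n x] by (auto simp: bump_def)
  qed (simp add: bump_def)
  moreover have "(\<lambda>n. bump 0 1 (q n) x) \<longlonglongrightarrow> indicator {a..b} x" if "x \<noteq> a" "x \<noteq> b" for x
  proof (cases "a < x \<and> x < b")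
    case True
    have "(\<lambda>n. exp (- (inverse (real (Suc n)) * (1 / ((x - a) * (b - x)))))) \<longlonglongrightarrow> exp (- (0 * (1 / ((x - a) * (b - x)))))"
      by (intro tendsto_intros LIMSEQ_inverse_real_of_nat)
    moreover have "bump 0 1 (q n) x = exp (- (inverse (real (Suc n)) * (1 / ((x - a) * (b - x)))))" for n
      using True pos[of n x] by (simp add: bump_def q field_simps)
    ultimately show ?thesis using True by simp
  next
    case False
    then have "bump 0 1 (q n) x = 0" for n using pos[of n x] by (auto simp: bump_def)
    then show ?thesis using False that by (auto simp: indicator_def)
  qed
  ultimately show ?thesis by (intro exI[of _ "\<lambda>n. bump 0 1 (q n)"]) blast
qed

text \<open>
  Testing with the bumps that approximate an interval shows that all interval integrals
  vanish; Lebesgue differentiation does the rest.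
\<close>

lemma fundamental_lemma:
  fixes f :: "real \<Rightarrow> 'a::euclidean_space"
  assumes f: "locally_integrable f" and test: "\<And>\<phi>. test_function \<phi> \<Longrightarrow> (LINT x|lebesgue. \<phi> x *\<^sub>R f x) = 0"
  shows "AE x in lebesgue. f x = 0"
proof (rule AE_zero_of_interval_integrals[OF f])
  fix a b :: real assume ab: "a < b"
  obtain \<phi> where \<phi>: "\<And>n. test_function (\<phi> n)" "\<And>n x. \<bar>\<phi> n x\<bar> \<le> indicator {a..b} x"
    "\<And>x. x \<noteq> a \<Longrightarrow> x \<noteq> b \<Longrightarrow> (\<lambda>n. \<phi> n x) \<longlonglongrightarrow> indicator {a..b} x"
    using interval_bump[OF ab] by metis
  have "(\<lambda>n. LINT x|lebesgue. \<phi> n x *\<^sub>R f x) \<longlonglongrightarrow> (LINT x|lebesgue. indicator {a..b} x *\<^sub>R f x)"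
  proof (rule integral_dominated_convergence[where w="\<lambda>x. norm (indicator {a..b} x *\<^sub>R f x)"])
    have i: "integrable lebesgue (\<lambda>x. indicator {a..b} x *\<^sub>R f x)"
      using f by (simp add: locally_integrable_def set_integrable_def)
    then show "integrable lebesgue (\<lambda>x. norm (indicator {a..b} x *\<^sub>R f x))" by (rule integrable_norm)
    show "(\<lambda>x. indicator {a..b} x *\<^sub>R f x) \<in> borel_measurable lebesgue"
      using i by (rule borel_measurable_integrable)
    show "(\<lambda>x. \<phi> n x *\<^sub>R f x) \<in> borel_measurable lebesgue" for n
      by (intro borel_measurable_scaleR test_measurable \<phi> locally_integrable_measurable f)
    have "AE x in lebesgue. x \<noteq> a \<and> x \<noteq> b"
      unfolding eventually_ae_filter_negligible
      by (rule exI[of _ "{a, b}"]) auto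
    then show "AE x in lebesgue. (\<lambda>n. \<phi> n x *\<^sub>R f x) \<longlonglongrightarrow> indicator {a..b} x *\<^sub>R f x"
      by eventually_elim (auto intro!: tendsto_intros \<phi>)
    show "AE x in lebesgue. norm (\<phi> n x *\<^sub>R f x) \<le> norm (indicator {a..b} x *\<^sub>R f x)" for n
      using \<phi>(2)[of n] by (auto intro!: AE_I2 mult_right_mono)
  qed
  then have "(\<lambda>n. 0::'a) \<longlonglongrightarrow> (LINT x|lebesgue. indicator {a..b} x *\<^sub>R f x)" by (simp add: test \<phi>)
  then show "(LINT x:{a..b}|lebesgue. f x) = 0"
    unfolding set_lebesgue_integral_def using LIMSEQ_unique tendsto_const by blast
qed

section \<open>Weak and strong derivatives in \<open>L\<^sup>2\<close>\<close>

interpretation shift: isometry_group "shift :: real \<Rightarrow> 'a::euclidean_space l2 \<Rightarrow> 'a l2"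
  by (rule isometry_group.intro)
     (simp_all add: shift_shift shift_tendsto_0 bounded_linear.linear bounded_linear_shift)

abbreviation has_D :: "'a::euclidean_space l2 \<Rightarrow> 'a l2 \<Rightarrow> bool" where "has_D \<equiv> gen shift"

text \<open>
  The relation between \<open>x\<close> and \<open>g\<close> is equivalent to \<open>U t x -
  x\<close> being the antiderivative of \<open>U t g\<close>, which survives limits.
\<close>

lemma gen_closed:
  fixes U :: "real \<Rightarrow> 'x::banach \<Rightarrow> 'x"
  assumes U: "isometry_group U" and g: "\<And>n. gen U (x n) (g n)" and lim: "x \<longlonglongrightarrow> y" "g \<longlonglongrightarrow> k"
  shows "gen U y k"
proof -
  interpret isometry_group U by fact
  have "continuous_on UNIV (\<lambda>r. U r k)" by (intro U_continuous_on continuous_intros)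
  then obtain A where A: "A 0 = 0" "\<And>t. (A has_vector_derivative U t k) (at t)"
    using antiderivative_exists by blast
  have bound: "norm (U t (x n) - x n - A t) \<le> norm (g n - k) * \<bar>t\<bar>" for n t
  proof -
    have "norm (U t (x n) - x n - A t) \<le> norm (g n - k) * \<bar>t\<bar> ^ Suc 0 / real (Suc 0)"
    proof (rule antiderivative_power_bound[where g="\<lambda>s. U s (g n) - U s k"])
      show "((\<lambda>t. U t (x n) - x n - A t) has_vector_derivative U s (g n) - U s k) (at s)" for s
        using gen_at[OF g, of n s] A(2)[of s] by (auto intro!: derivative_eq_intros)
    qed (simp_all add: A(1) flip: U_diff)
    then show ?thesis by simp
  qed
  have "U t y - y - A t = 0" for t
  proof -
    have 1: "(\<lambda>n. norm (U t (x n) - x n - A t)) \<longlonglongrightarrow> norm (U t y - y - A t)"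
      by (intro tendsto_intros U_tendsto lim)
    have "(\<lambda>n. norm (g n - k) * \<bar>t\<bar>) \<longlonglongrightarrow> norm (k - k) * \<bar>t\<bar>"
      by (intro tendsto_intros lim)
    from LIMSEQ_le[OF 1 this] bound show ?thesis by auto
  qed
  then have "U t y = y + A t" for t by (simp add: diff_diff_eq)
  moreover have "((\<lambda>t. y + A t) has_vector_derivative k) (at 0)"
    using A(2)[of 0] by (auto intro!: derivative_eq_intros)
  ultimately show ?thesis by (simp add: gen_def)
qed

text \<open>
  Differentiate the constant function \<open>inner (U t x) (U t y)\<close>. For translations
  this is integration by parts.
\<close>

lemma gen_skew:
  fixes U :: "real \<Rightarrow> 'x::real_inner \<Rightarrow> 'x"
  assumes "isometry_group U" "gen U x g" "gen U y k"
  shows "inner g y + inner x k = 0"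
proof -
  interpret isometry_group U by fact
  have "((\<lambda>t. inner (U t x) (U t y)) has_vector_derivative inner (U 0 x) k + inner g (U 0 y)) (at 0)"
    using assms(2,3) unfolding gen_def by (rule bounded_bilinear.has_vector_derivative[OF bounded_bilinear_inner])
  moreover have "inner (U t x) (U t y) = inner x y" for t
    by (rule isometry_inner[OF linear_U norm_U])
  ultimately have "((\<lambda>t. inner x y) has_vector_derivative inner x k + inner g y) (at 0)" by simp
  then have "inner x k + inner g y = 0"
    using has_vector_derivative_const vector_derivative_unique_at by blast
  then show ?thesis by simp
qed

lemma l2_zero_test:
  fixes F :: "'a::euclidean_space l2"
  assumes "\<And>\<phi> e. test_function \<phi> \<Longrightarrow> inner (cls (\<lambda>x. \<phi> x *\<^sub>R e)) F = 0"
  shows "F = 0"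
proof -
  have li: "locally_integrable (ev F)" by (rule L2_locally_integrable[OF ev_L2])
  have "AE x in lebesgue. ev F x = 0"
  proof (rule fundamental_lemma[OF li])
    fix \<phi> assume \<phi>: "test_function \<phi>"
    have "(LINT x|lebesgue. \<phi> x *\<^sub>R ev F x) \<bullet> e = 0" for e
    proof -
      have "(LINT x|lebesgue. \<phi> x *\<^sub>R ev F x) \<bullet> e = (LINT x|lebesgue. (\<phi> x *\<^sub>R ev F x) \<bullet> e)"
        by (rule integral_inner_left[symmetric]) (intro test_integrable \<phi> li, simp)
      also have "\<dots> = inner (cls (\<lambda>x. \<phi> x *\<^sub>R e)) (cls (ev F))"
        by (subst inner_cls[OF test_L2[OF \<phi>] ev_L2]) (simp add: inner_commute)
      finally show ?thesis using assms[OF \<phi>] by simp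
    qed
    then show "(LINT x|lebesgue. \<phi> x *\<^sub>R ev F x) = 0" using inner_eq_zero_iff by blast
  qed
  then show ?thesis using ev_zero[where 'a='a] by (intro l2_eqI, eventually_elim) simp
qed

text \<open>
  Difference quotients of a test function are bounded, live in a fixed compact set and
  converge pointwise, so dominated convergence makes them converge in
  \<open>L\<^sup>2\<close>.
\<close>

lemma has_D_test:
  fixes e :: "'a::euclidean_space"
  assumes \<phi>: "test_function \<phi>"
  shows "has_D (cls (\<lambda>x. \<phi> x *\<^sub>R e)) (cls (\<lambda>x. deriv \<phi> x *\<^sub>R e))"
proof -
  obtain B where B: "0 \<le> B" "\<And>x. \<bar>deriv \<phi> x\<bar> \<le> B"
  proof -
    obtain B r where B: "0 \<le> B" "\<And>x. \<bar>deriv \<phi> x\<bar> \<le> B * indicator {-r..r} x" using test_bounded[OF test_deriv[OF \<phi>]] by metis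
    have "B * indicator {-r..r} x \<le> B" for x using B(1) by (simp add: indicator_def)
    then show thesis using that B order_trans by metis
  qed
  obtain r where r: "r > 0" "smooth \<phi>" "\<And>x. r < \<bar>x\<bar> \<Longrightarrow> \<phi> x = 0" by (rule test_functionE[OF \<phi>]) (rule that)
  have lip: "\<bar>\<phi> (x + h) - \<phi> x\<bar> \<le> B * \<bar>h\<bar>" for x h
  proof -
    have "norm (\<phi> (x + h) - \<phi> x) \<le> B * norm (x + h - x)"
      by (rule field_differentiable_bound[of UNIV \<phi> "deriv \<phi>"])
         (use smooth_DERIV[OF r(2)] B(2) in \<open>auto intro: has_field_derivative_at_within\<close>)
    then show ?thesis by simp
  qed
  have "((\<lambda>h. (1 / (h - 0)) *\<^sub>R (shift h (cls (\<lambda>x. \<phi> x *\<^sub>R e)) - shift 0 (cls (\<lambda>x. \<phi> x *\<^sub>R e)))) \<longlongrightarrow> cls (\<lambda>x. deriv \<phi> x *\<^sub>R e)) (at 0 within {-1<..<1})"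
    unfolding tendsto_at_iff_sequentially
  proof (intro allI impI)
    fix X :: "nat \<Rightarrow> real" assume X: "\<forall>i. X i \<in> {-1<..<1} - {0}" "X \<longlonglongrightarrow> 0"
    let ?s = "\<lambda>n x. ((\<phi> (x + X n) - \<phi> x) / X n) *\<^sub>R e"
    have eq: "(1 / (X n - 0)) *\<^sub>R (shift (X n) (cls (\<lambda>x. \<phi> x *\<^sub>R e)) - shift 0 (cls (\<lambda>x. \<phi> x *\<^sub>R e))) = cls (?s n)" for n
    proof -
      note L = test_L2[OF \<phi>, of e] test_L2[OF test_shift[OF \<phi>], of "X n" e]
      show ?thesis
        using L2_space_diff[OF L(2) L(1)]
        by (simp add: shift_cls[OF L(1)] L flip: cls_diff cls_scaleR scaleR_diff_left)
    qed
    have "(\<lambda>n. cls (?s n)) \<longlonglongrightarrow> cls (\<lambda>x. deriv \<phi> x *\<^sub>R e)"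
    proof (rule L2_dominated_convergence(3)[OF _ _ L2_space_indicator])
      show "?s n \<in> borel_measurable lebesgue" for n
        using test_measurable[OF \<phi>] test_measurable[OF test_shift[OF \<phi>, of "X n"]] by simp
      show "(\<lambda>x. deriv \<phi> x *\<^sub>R e) \<in> borel_measurable lebesgue"
        using test_measurable[OF test_deriv[OF \<phi>]] by simp
      have "norm (?s n x) \<le> (B * norm e) * indicator {-(r + 1)..r + 1} x" for n x
      proof (cases "x \<in> {-(r + 1)..r + 1}")
        case True
        have X0: "X n \<noteq> 0" using X(1) by auto
        have "\<bar>(\<phi> (x + X n) - \<phi> x) / X n\<bar> \<le> B" using lip[of x "X n"] X0 by (simp add: divide_le_eq)
        from mult_right_mono[OF this norm_ge_zero[of e]] show ?thesis using True by simp
      next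
        case False
        have "-1 < X n" "X n < 1" using X(1) by auto
        with False have "r < \<bar>x\<bar>" "r < \<bar>x + X n\<bar>" by auto
        then show ?thesis using r(3) B(1) by simp
      qed
      then show "AE x in lebesgue. norm (?s n x) \<le> (B * norm e) * indicator {-(r + 1)..r + 1} x" for n by simp
      have "(\<lambda>n. ?s n x) \<longlonglongrightarrow> deriv \<phi> x *\<^sub>R e" for x
      proof -
        have "((\<lambda>h. (\<phi> (x + h) - \<phi> x) / h) \<longlongrightarrow> deriv \<phi> x) (at 0)"
          using smooth_DERIV[OF r(2), of x] unfolding DERIV_def .
        moreover have "filterlim X (at 0) sequentially"
          using X by (auto simp: filterlim_at)
        ultimately have "(\<lambda>n. (\<phi> (x + X n) - \<phi> x) / X n) \<longlonglongrightarrow> deriv \<phi> x"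
          by (rule filterlim_compose)
        then show ?thesis by (intro tendsto_intros)
      qed
      then show "AE x in lebesgue. (\<lambda>n. ?s n x) \<longlonglongrightarrow> deriv \<phi> x *\<^sub>R e" by simp
    qed
    then show "((\<lambda>h. (1 / (h - 0)) *\<^sub>R (shift h (cls (\<lambda>x. \<phi> x *\<^sub>R e)) - shift 0 (cls (\<lambda>x. \<phi> x *\<^sub>R e)))) \<circ> X) \<longlonglongrightarrow> cls (\<lambda>x. deriv \<phi> x *\<^sub>R e)"
      unfolding o_def eq .
  qed
  then show ?thesis unfolding gen_def has_vector_derivative_iff_tendsto
    by (subst (asm) tendsto_within_open) auto
qed

lemma inner_test:
  fixes f :: "real \<Rightarrow> 'a::euclidean_space"
  assumes "test_function \<phi>" "f \<in> L2_space"
  shows "inner (cls (\<lambda>x. \<phi> x *\<^sub>R e)) (cls f) = (LINT x|lebesgue. \<phi> x *\<^sub>R f x) \<bullet> e"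
proof -
  have "(LINT x|lebesgue. \<phi> x *\<^sub>R f x) \<bullet> e = (LINT x|lebesgue. (\<phi> x *\<^sub>R f x) \<bullet> e)"
    by (rule integral_inner_left[symmetric])
       (intro test_integrable assms L2_locally_integrable L2_spaceD(1)[OF assms(2)])
  then show ?thesis by (subst inner_cls[OF test_L2[OF assms(1)] assms(2)]) (simp add: inner_commute)
qed

lemma weak_deriv1_iff:
  "has_weak_deriv 1 f g \<longleftrightarrow> locally_integrable f \<and> locally_integrable g \<and>
    (\<forall>\<phi>. test_function \<phi> \<longrightarrow> (LINT x|lebesgue. deriv \<phi> x *\<^sub>R f x) = - (LINT x|lebesgue. \<phi> x *\<^sub>R g x))"
  by (simp add: has_weak_deriv_def)

text \<open>
  The weak derivative in \<open>L\<^sup>2\<close> is the generator of the translations. If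
  difference quotients converge in \<open>L\<^sup>2\<close>, integration by parts against test
  functions is the skew-symmetry of the generator. Conversely, tested with any test function,
  \<open>shift h f - f\<close> and the antiderivative \<open>A h\<close> of \<open>shift h
  g\<close> have the same derivative in \<open>h\<close>, because translates of test functions
  are test functions; hence they coincide, and \<open>A\<close> is differentiable in norm.
\<close>

lemma weak_deriv_iff_has_D:
  fixes f g :: "real \<Rightarrow> 'a::euclidean_space"
  assumes f: "f \<in> L2_space" and g: "g \<in> L2_space"
  shows "has_weak_deriv 1 f g \<longleftrightarrow> has_D (cls f) (cls g)"
proof
  assume D: "has_D (cls f) (cls g)"
  have "(LINT x|lebesgue. deriv \<phi> x *\<^sub>R f x) = - (LINT x|lebesgue. \<phi> x *\<^sub>R g x)" if \<phi>: "test_function \<phi>" for \<phi>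
  proof (rule euclidean_eqI)
    fix e :: 'a
    have "inner (cls (\<lambda>x. deriv \<phi> x *\<^sub>R e)) (cls f) + inner (cls (\<lambda>x. \<phi> x *\<^sub>R e)) (cls g) = 0"
      by (rule gen_skew[OF shift.isometry_group_axioms has_D_test[OF \<phi>] D])
    then show "(LINT x|lebesgue. deriv \<phi> x *\<^sub>R f x) \<bullet> e = (- (LINT x|lebesgue. \<phi> x *\<^sub>R g x)) \<bullet> e"
      by (simp add: inner_test[OF \<phi> g] inner_test[OF test_deriv[OF \<phi>] f])
  qed
  then show "has_weak_deriv 1 f g" unfolding weak_deriv1_iff using f g L2_locally_integrable by blast
next
  assume W: "has_weak_deriv 1 f g"
  let ?F = "cls f" and ?G = "cls g"
  obtain A where A: "A 0 = 0" "\<And>t. (A has_vector_derivative shift t ?G) (at t)"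
    using antiderivative_exists[OF shift.U_continuous_on[OF continuous_on_id continuous_on_const]] by (metis id_apply)
  have "shift h ?F - A h - ?F = 0" for h
  proof (rule l2_zero_test)
    fix \<phi> and e :: 'a assume \<phi>: "test_function \<phi>"
    let ?P = "cls (\<lambda>x. \<phi> x *\<^sub>R e)"
    have "((\<lambda>h. inner ?P (shift h ?F - A h)) has_vector_derivative 0) (at h within UNIV)" for h
    proof -
      have "((\<lambda>h. shift (0 + (-1) * h) ?P) has_vector_derivative (-1) *\<^sub>R shift (- h) (cls (\<lambda>x. deriv \<phi> x *\<^sub>R e))) (at h)"
        using shift.gen_at[OF has_D_test[OF \<phi>]] by (intro has_vector_derivative_affine) simp
      from bounded_linear.has_vector_derivative[OF bounded_linear_inner_left this, of ?F]
      have 1: "((\<lambda>h. inner ?P (shift h ?F)) has_vector_derivative - inner (shift (- h) (cls (\<lambda>x. deriv \<phi> x *\<^sub>R e))) ?F) (at h)"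
        by (simp add: inner_shift)
      have 2: "((\<lambda>h. inner ?P (A h)) has_vector_derivative inner ?P (shift h ?G)) (at h)"
        by (rule bounded_linear.has_vector_derivative[OF bounded_linear_inner_right A(2)])
      have s: "test_function (\<lambda>x. \<phi> (x - h))" "deriv (\<lambda>x. \<phi> (x - h)) = (\<lambda>x. deriv \<phi> (x - h))"
        using test_shift[OF \<phi>, of "-h"] smooth_shift(2)[of \<phi> "-h"] \<phi> by (auto simp: test_function_iff)
      have "- inner (shift (- h) (cls (\<lambda>x. deriv \<phi> x *\<^sub>R e))) ?F = - ((LINT x|lebesgue. deriv (\<lambda>x. \<phi> (x - h)) x *\<^sub>R f x) \<bullet> e)"
        using inner_test[OF test_deriv[OF s(1)] f, of e] by (simp add: shift_cls[OF test_L2[OF test_deriv[OF \<phi>]]] s(2))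
      also have "\<dots> = (LINT x|lebesgue. \<phi> (x - h) *\<^sub>R g x) \<bullet> e"
        using W s(1) unfolding weak_deriv1_iff by simp
      also have "\<dots> = inner ?P (shift h ?G)"
        using inner_test[OF s(1) g, of e] inner_shift[of "-h" ?P ?G] by (simp add: shift_cls[OF test_L2[OF \<phi>]])
      finally show ?thesis using has_vector_derivative_diff[OF 1 2] by (simp add: inner_diff_right)
    qed
    then obtain c where "\<And>h. inner ?P (shift h ?F - A h) = c"
      using has_vector_derivative_zero_constant[of UNIV "\<lambda>h. inner ?P (shift h ?F - A h)"] by auto
    from this[of h] this[of 0] show "inner ?P (shift h ?F - A h - ?F) = 0" by (simp add: A(1) inner_diff_right)
  qed
  then have "shift h ?F = A h + ?F" for h by (simp add: diff_diff_eq)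
  moreover have "((\<lambda>h. A h + ?F) has_vector_derivative ?G) (at 0)"
    using A(2)[of 0] by (auto intro!: derivative_eq_intros)
  ultimately show "has_D ?F ?G" by (simp add: gen_def)
qed

lemma locally_integrable_diff:
  assumes "locally_integrable f" "locally_integrable g"
  shows "locally_integrable (\<lambda>x. f x - g x)"
  using assms unfolding locally_integrable_def by (auto intro!: set_integral_diff(1))

lemma weak_deriv_unique:
  assumes "has_weak_deriv k f g" "has_weak_deriv k f g'"
  shows "AE x in lebesgue. g x = g' x"
proof -
  have li: "locally_integrable g" "locally_integrable g'" using assms by (simp_all add: has_weak_deriv_def)
  have "AE x in lebesgue. g x - g' x = 0"
  proof (rule fundamental_lemma[OF locally_integrable_diff[OF li]])
    fix \<phi> assume \<phi>: "test_function \<phi>"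
    have "(-1) ^ k *\<^sub>R (LINT x|lebesgue. \<phi> x *\<^sub>R g x) = (-1) ^ k *\<^sub>R (LINT x|lebesgue. \<phi> x *\<^sub>R g' x)"
      using assms[unfolded has_weak_deriv_def, THEN conjunct2, THEN conjunct2, rule_format, OF \<phi>] by simp
    then have "(LINT x|lebesgue. \<phi> x *\<^sub>R g x) = (LINT x|lebesgue. \<phi> x *\<^sub>R g' x)" by simp
    then show "(LINT x|lebesgue. \<phi> x *\<^sub>R (g x - g' x)) = 0"
      by (simp add: scaleR_diff_right test_integrable[OF \<phi>] li locally_integrable_measurable)
  qed
  then show ?thesis by simp
qed

text \<open>
  The derivative of a test function is again a test function, so a weak derivative of order
  \<open>j + 1\<close> is a weak derivative of the one of order \<open>j\<close>.
\<close>

lemma weak_deriv_Suc: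
  assumes "has_weak_deriv j f g" "has_weak_deriv (Suc j) f k"
  shows "has_weak_deriv 1 g k"
  unfolding weak_deriv1_iff
proof (intro conjI allI impI)
  fix \<phi> assume \<phi>: "test_function \<phi>"
  have "(-1) ^ j *\<^sub>R (LINT x|lebesgue. deriv \<phi> x *\<^sub>R g x) = (LINT x|lebesgue. (deriv ^^ j) (deriv \<phi>) x *\<^sub>R f x)"
    using assms(1) test_deriv[OF \<phi>] by (simp add: has_weak_deriv_def)
  also have "\<dots> = (-1) ^ Suc j *\<^sub>R (LINT x|lebesgue. \<phi> x *\<^sub>R k x)"
    using assms(2) \<phi> unfolding has_weak_deriv_def by (simp add: funpow_Suc_right del: funpow.simps)
  also have "\<dots> = (-1) ^ j *\<^sub>R (- (LINT x|lebesgue. \<phi> x *\<^sub>R k x))" by simp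
  finally show "(LINT x|lebesgue. deriv \<phi> x *\<^sub>R g x) = - (LINT x|lebesgue. \<phi> x *\<^sub>R k x)"
    unfolding scaleR_cancel_left by simp
qed (use assms in \<open>simp_all add: has_weak_deriv_def\<close>)

lemma has_weak_deriv_0: "locally_integrable f \<Longrightarrow> has_weak_deriv 0 f f"
  by (simp add: has_weak_deriv_def)

lemma has_weak_deriv_0_AE: "has_weak_deriv 0 f g \<Longrightarrow> AE x in lebesgue. f x = g x"
  by (rule weak_deriv_unique[OF has_weak_deriv_0]) (simp_all add: has_weak_deriv_def)

lemma weak_deriv_AE:
  assumes "has_weak_deriv k f g"
  shows "AE x in lebesgue. weak_deriv k f x = g x"
proof -
  have "has_weak_deriv k f (weak_deriv k f)" unfolding weak_deriv_def using assms by (rule someI[of "has_weak_deriv k f"])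
  then show ?thesis by (rule weak_deriv_unique[OF _ assms])
qed

section \<open>The Sobolev space \<open>H\<^sup>1\<close> as a Hilbert space\<close>

lemma has_D_zero: "has_D 0 0"
  using shift.gen_scale[of _ _ 0] has_D_test[OF test_bump[of "-1" 0]] by fastforce

text \<open>
  \<open>H\<^sup>1\<close> is realised as the graph of the derivative, a closed subspace of
  \<open>L\<^sup>2 \<times> L\<^sup>2\<close>. Its norm is then the Sobolev norm, completeness
  is closedness of the generator, and calculus for curves with values in
  \<open>H\<^sup>1\<close> is available through the type classes.
\<close>

typedef (overloaded) ('a::euclidean_space) h1 = "{p :: 'a l2 \<times> 'a l2. has_D (fst p) (snd p)}"
  using has_D_zero by (intro exI[of _ "(0, 0)"]) simp

definition val :: "'a::euclidean_space h1 \<Rightarrow> 'a l2" where "val u = fst (Rep_h1 u)"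
definition der :: "'a::euclidean_space h1 \<Rightarrow> 'a l2" where "der u = snd (Rep_h1 u)"
definition mk :: "'a::euclidean_space l2 \<Rightarrow> 'a l2 \<Rightarrow> 'a h1" where "mk F G = Abs_h1 (F, G)"

lemma has_D_val: "has_D (val u) (der u)"
  using Rep_h1[of u] by (simp add: val_def der_def)

lemma val_mk [simp]: "has_D F G \<Longrightarrow> val (mk F G) = F"
  and der_mk [simp]: "has_D F G \<Longrightarrow> der (mk F G) = G"
  by (simp_all add: val_def der_def mk_def Abs_h1_inverse)

lemma h1_eqI:
  assumes "val u = val v"
  shows "u = v"
proof -
  have "der u = der v" using shift.gen_unique[of "val u" "der u" "der v"] has_D_val[of u] has_D_val[of v] assms by simp
  with assms have "Rep_h1 u = Rep_h1 v" by (simp add: val_def der_def prod_eq_iff)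
  then show ?thesis by (simp add: Rep_h1_inject)
qed

lemma has_D_diff: "has_D F G \<Longrightarrow> has_D F' G' \<Longrightarrow> has_D (F - F') (G - G')"
  using shift.gen_add[of F G "- F'" "- G'"] shift.gen_scale[of F' G' "-1"] by simp

instantiation h1 :: (euclidean_space) real_vector
begin
definition "0 = mk 0 0"
definition "u + v = mk (val u + val v) (der u + der v)"
definition "u - v = mk (val u - val v) (der u - der v)"
definition "- u = mk (- val u) (- der u)"
definition "c *\<^sub>R u = mk (c *\<^sub>R val u) (c *\<^sub>R der u)"

lemma val_zero [simp]: "val (0::'a h1) = 0" and der_zero [simp]: "der (0::'a h1) = 0"
  by (simp_all add: zero_h1_def has_D_zero)
lemma val_add [simp]: "val (u + v :: 'a h1) = val u + val v" and der_add [simp]: "der (u + v :: 'a h1) = der u + der v"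
  by (simp_all add: plus_h1_def shift.gen_add has_D_val)
lemma val_diff [simp]: "val (u - v :: 'a h1) = val u - val v" and der_diff [simp]: "der (u - v :: 'a h1) = der u - der v"
  by (simp_all add: minus_h1_def has_D_diff has_D_val)
lemma val_scaleR [simp]: "val (c *\<^sub>R u :: 'a h1) = c *\<^sub>R val u" and der_scaleR [simp]: "der (c *\<^sub>R u :: 'a h1) = c *\<^sub>R der u"
  by (simp_all add: scaleR_h1_def shift.gen_scale has_D_val)
lemma val_minus [simp]: "val (- u :: 'a h1) = - val u" and der_minus [simp]: "der (- u :: 'a h1) = - der u"
  using has_D_diff[OF has_D_zero has_D_val[of u]] by (simp_all add: uminus_h1_def)

instance
  by standard (rule h1_eqI; simp add: algebra_simps)+
end

instantiation h1 :: (euclidean_space) real_inner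
begin
definition "inner (u::'a h1) v = inner (val u) (val v) + inner (der u) (der v)"
definition "norm (u::'a h1) = sqrt (inner u u)"
definition "sgn (u::'a h1) = u /\<^sub>R norm u"
definition "dist (u::'a h1) v = norm (u - v)"
definition [code del]: "uniformity = (INF e\<in>{0 <..}. principal {(x::'a h1, y). dist x y < e})"
definition [code del]: "open (U::'a h1 set) = (\<forall>x\<in>U. eventually (\<lambda>(x', y). x' = x \<longrightarrow> y \<in> U) uniformity)"
instance
proof
  fix u v w :: "'a h1" and r :: real
  show "inner u v = inner v u" by (simp add: inner_h1_def inner_commute)
  show "inner (u + v) w = inner u w + inner v w" by (simp add: inner_h1_def inner_add_left)
  show "inner (r *\<^sub>R u) v = r * inner u v" by (simp add: inner_h1_def distrib_left)
  show "0 \<le> inner u u" by (simp add: inner_h1_def)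
  show "inner u u = 0 \<longleftrightarrow> u = 0"
  proof
    assume "inner u u = 0"
    then have "val u = 0" unfolding inner_h1_def
      by (metis add_nonneg_eq_0_iff inner_ge_zero inner_eq_zero_iff)
    then show "u = 0" by (intro h1_eqI) simp
  qed (simp add: inner_h1_def)
qed (simp_all add: norm_h1_def sgn_h1_def dist_h1_def uniformity_h1_def open_h1_def)
end

lemma norm_h1: "norm u = sqrt ((norm (val u))\<^sup>2 + (norm (der u))\<^sup>2)"
  by (simp add: norm_h1_def inner_h1_def power2_norm_eq_inner)

lemma norm_val_le: "norm (val u) \<le> norm u" and norm_der_le: "norm (der u) \<le> norm u"
  by (simp_all add: norm_h1)

lemma norm_h1_le: "norm u \<le> norm (val u) + norm (der u)"
  unfolding norm_h1 by (rule sqrt_sum_squares_le_sum) simp_all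

lemma bounded_linear_val [simp]: "bounded_linear val" and bounded_linear_der [simp]: "bounded_linear der"
  by (intro bounded_linear_intro[where K=1]; simp add: norm_val_le norm_der_le)+

lemma h1_tendstoI:
  assumes "((\<lambda>t. val (u t)) \<longlongrightarrow> val v) net" "((\<lambda>t. der (u t)) \<longlongrightarrow> der v) net"
  shows "(u \<longlongrightarrow> v) net"
proof -
  have "((\<lambda>t. norm (val (u t) - val v) + norm (der (u t) - der v)) \<longlongrightarrow> 0) net"
    using tendsto_add[OF tendsto_norm_zero[OF LIM_zero[OF assms(1)]] tendsto_norm_zero[OF LIM_zero[OF assms(2)]]] by simp
  then have "((\<lambda>t. u t - v) \<longlongrightarrow> 0) net"
    by (rule Lim_null_comparison[rotated]) (use norm_h1_le[of "u _ - v"] in simp)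
  then show ?thesis by (rule LIM_zero_cancel)
qed

instance h1 :: (euclidean_space) banach
proof
  fix X :: "nat \<Rightarrow> 'a h1"
  assume X: "Cauchy X"
  have "Cauchy (\<lambda>n. val (X n))" "Cauchy (\<lambda>n. der (X n))"
    using X by (auto intro: bounded_linear.Cauchy)
  then obtain F G where FG: "(\<lambda>n. val (X n)) \<longlonglongrightarrow> F" "(\<lambda>n. der (X n)) \<longlonglongrightarrow> G"
    by (auto dest!: Cauchy_convergent simp: convergent_def)
  have D: "has_D F G"
    by (rule gen_closed[OF shift.isometry_group_axioms has_D_val FG])
  have "X \<longlonglongrightarrow> mk F G" by (rule h1_tendstoI) (simp_all add: D FG)
  then show "convergent X" by (auto simp: convergent_def)
qed

section \<open>Multiplication by bounded functions\<close>

definition ess_bounded :: "(real \<Rightarrow> real) \<Rightarrow> real \<Rightarrow> bool" where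
  "ess_bounded m c \<longleftrightarrow> m \<in> borel_measurable lebesgue \<and> 0 \<le> c \<and> (AE x in lebesgue. \<bar>m x\<bar> \<le> c)"

lemma ess_bounded_indicator: "ess_bounded (indicator {..a}) 1"
proof -
  have "(indicator {..a} :: real \<Rightarrow> real) \<in> borel_measurable lebesgue"
    by (intro borel_measurable_indicator) auto
  then show ?thesis by (auto simp: ess_bounded_def indicator_def)
qed

definition mulop :: "(real \<Rightarrow> real) \<Rightarrow> 'a::euclidean_space l2 \<Rightarrow> 'a l2" where
  "mulop m F = cls (\<lambda>x. m x *\<^sub>R ev F x)"

lemma L2_mult_bounded:
  fixes f :: "real \<Rightarrow> 'a::euclidean_space"
  assumes "ess_bounded m c" "f \<in> L2_space"
  shows "(\<lambda>x. m x *\<^sub>R f x) \<in> L2_space"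
proof (rule L2_space_dominated[OF _ assms(2), of _ c])
  show "(\<lambda>x. m x *\<^sub>R f x) \<in> borel_measurable lebesgue"
    using assms(1) L2_spaceD(1)[OF assms(2)] by (intro borel_measurable_scaleR) (simp_all add: ess_bounded_def)
  show "AE x in lebesgue. norm (m x *\<^sub>R f x) \<le> c * norm (f x)"
    using assms(1) by (auto simp: ess_bounded_def elim!: eventually_mono intro: mult_right_mono)
qed

lemma ev_mulop: "ess_bounded m c \<Longrightarrow> AE x in lebesgue. ev (mulop m F) x = m x *\<^sub>R ev F x"
  unfolding mulop_def by (rule ev_cls[OF L2_mult_bounded[OF _ ev_L2]])

lemma norm_mulop:
  assumes "ess_bounded m c"
  shows "norm (mulop m F) \<le> c * norm F"
proof (rule norm_l2_le)
  show "0 \<le> c" using assms by (simp add: ess_bounded_def)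
  have "AE x in lebesgue. \<bar>m x\<bar> \<le> c" using assms by (simp add: ess_bounded_def)
  with ev_mulop[OF assms, of F] show "AE x in lebesgue. norm (ev (mulop m F) x) \<le> c * norm (ev F x)"
    by eventually_elim (simp add: mult_right_mono)
qed

lemma bounded_linear_mulop:
  assumes m: "ess_bounded m c"
  shows "bounded_linear (mulop m :: 'a::euclidean_space l2 \<Rightarrow> 'a l2)"
proof (rule bounded_linear_intro[where K=c])
  fix F G :: "'a l2" and r :: real
  show "mulop m (F + G) = mulop m F + mulop m G"
    using ev_mulop[OF m, of "F + G"] ev_mulop[OF m, of F] ev_mulop[OF m, of G] ev_add[of F G] ev_add[of "mulop m F" "mulop m G"]
    by (intro l2_eqI, eventually_elim) (simp add: scaleR_add_right)
  show "mulop m (r *\<^sub>R F) = r *\<^sub>R mulop m F"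
    using ev_mulop[OF m, of "r *\<^sub>R F"] ev_mulop[OF m, of F] ev_scaleR[of r F] ev_scaleR[of r "mulop m F"]
    by (intro l2_eqI, eventually_elim) simp
  show "norm (mulop m F) \<le> norm F * c" using norm_mulop[OF m, of F] by (simp add: mult.commute)
qed

section \<open>Boundedness of \<open>H\<^sup>1\<close> functions\<close>

text \<open>
  The energy of \<open>f\<close> on the half line up to \<open>b\<close>, written as the norm
  of a translate cut off at 0, so that its dependence on \<open>b\<close> can be
  differentiated in the Hilbert space.
\<close>

lemma half_line_energy:
  fixes F :: "'a::euclidean_space l2" and b :: real
  shows "(norm (mulop (indicator {..0}) (shift b F)))\<^sup>2 = (LINT x|lebesgue. indicator {..b} x * (norm (ev F x))\<^sup>2)"
proof -
  note m = ess_bounded_indicator[of 0]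
  have "(norm (mulop (indicator {..0}) (shift b F)))\<^sup>2 = (LINT x|lebesgue. (norm (ev (mulop (indicator {..0}) (shift b F)) x))\<^sup>2)"
    by (simp add: norm_l2_L2 L2_norm_def)
  also have "\<dots> = (LINT x|lebesgue. indicator {..b} (x + b) * (norm (ev F (x + b)))\<^sup>2)"
  proof (rule integral_cong_AE)
    have "(\<lambda>x. indicator {..b} x * (norm (ev F x))\<^sup>2) \<in> borel_measurable lebesgue"
      by (intro borel_measurable_times borel_measurable_indicator) auto
    from lebesgue_measurable_shift[OF this, of b]
    show "(\<lambda>x. indicator {..b} (x + b) * (norm (ev F (x + b)))\<^sup>2) \<in> borel_measurable lebesgue" .
    show "AE x in lebesgue. (norm (ev (mulop (indicator {..0}) (shift b F)) x))\<^sup>2 = indicator {..b} (x + b) * (norm (ev F (x + b)))\<^sup>2"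
      using ev_mulop[OF m, of "shift b F"] ev_shift[of b F]
      by eventually_elim (auto simp: indicator_def)
  qed simp
  also have "\<dots> = (LINT x|lebesgue. indicator {..b} x * (norm (ev F x))\<^sup>2)"
    by (rule lebesgue_integral_shift)
  finally show ?thesis .
qed

text \<open>
  Sobolev embedding. The energy \<open>E b\<close> on the half line up to \<open>b\<close> has
  derivative \<open>2 \<integral> f \<bullet> f'\<close> over that half line, at most \<open>2
  \<parallel>f\<parallel> \<parallel>f'\<parallel> \<le> \<parallel>f\<parallel>\<^sup>2 +
  \<parallel>f'\<parallel>\<^sup>2\<close>. Hence \<open>\<bar>f\<bar>\<^sup>2\<close> has
  integral at most the squared \<open>H\<^sup>1\<close> norm times the length over every
  interval, and the bound holds almost everywhere by Lebesgue differentiation.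
\<close>

lemma h1_ess_bounded:
  fixes u :: "'a::euclidean_space h1"
  shows "AE x in lebesgue. norm (ev (val u) x) \<le> norm u"
proof -
  let ?F = "val u" and ?G = "der u"
  let ?m = "indicator {..0::real} :: real \<Rightarrow> real"
  note m = ess_bounded_indicator[of 0]
  let ?k = "\<lambda>x. (norm (ev ?F x))\<^sup>2"
  define E where "E b = (norm (mulop ?m (shift b ?F)))\<^sup>2" for b
  have Ei: "integrable lebesgue (\<lambda>x. indicator {..b} x * ?k x)" for b :: real
    using integrable_mult_indicator[of "{..b}" lebesgue ?k] by simp
  have E: "E b = (LINT x|lebesgue. indicator {..b} x * ?k x)" for b
    unfolding E_def by (rule half_line_energy)
  have E': "(E has_vector_derivative 2 * inner (mulop ?m (shift b ?F)) (mulop ?m (shift b ?G))) (at b)" for b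
  proof -
    have *: "((\<lambda>b. mulop ?m (shift b ?F)) has_vector_derivative mulop ?m (shift b ?G)) (at b)"
      by (rule bounded_linear.has_vector_derivative[OF bounded_linear_mulop[OF m] shift.gen_at[OF has_D_val]])
    from bounded_bilinear.has_vector_derivative[OF bounded_bilinear_inner this this]
    show ?thesis by (simp add: E_def[abs_def] power2_norm_eq_inner inner_commute)
  qed
  have bound: "norm (2 * inner (mulop ?m (shift b ?F)) (mulop ?m (shift b ?G))) \<le> (norm u)\<^sup>2" for b
  proof -
    have "\<bar>inner (mulop ?m (shift b ?F)) (mulop ?m (shift b ?G))\<bar> \<le> norm (mulop ?m (shift b ?F)) * norm (mulop ?m (shift b ?G))"
      by (rule Cauchy_Schwarz_ineq2)
    also have "\<dots> \<le> norm ?F * norm ?G"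
      using norm_mulop[OF m, of "shift b ?F"] norm_mulop[OF m, of "shift b ?G"] by (intro mult_mono) auto
    finally show ?thesis
      using sum_squares_bound[of "norm ?F" "norm ?G"] by (simp add: norm_h1)
  qed
  have int: "(LINT x:{a..b}|lebesgue. ?k x) \<le> (norm u)\<^sup>2 * (b - a)" if "a < b" for a b
  proof -
    have "(LINT x:{a..b}|lebesgue. ?k x) = (LINT x|lebesgue. indicator {..b} x * ?k x - indicator {..a} x * ?k x)"
      unfolding set_lebesgue_integral_def
    proof (rule integral_cong_AE)
      have "AE x in lebesgue. x \<noteq> a"
        unfolding eventually_ae_filter_negligible by (rule exI[of _ "{a}"]) auto
      then show "AE x in lebesgue. indicator {a..b} x *\<^sub>R ?k x = indicator {..b} x * ?k x - indicator {..a} x * ?k x"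
        by eventually_elim (use that in \<open>auto simp: indicator_def\<close>)
    qed (intro borel_measurable_diff borel_measurable_times borel_measurable_scaleR borel_measurable_indicator; simp)+
    also have "\<dots> = E b - E a" by (simp add: E Ei)
    also have "\<dots> \<le> norm (E b - E a)" by simp
    also have "\<dots> \<le> (\<lambda>s. (norm u)\<^sup>2 * s) b - (\<lambda>s. (norm u)\<^sup>2 * s) a"
    proof (rule differentiable_bound_general[OF that _ _ E' _ bound])
      show "continuous_on {a..b} E"
        by (intro continuous_at_imp_continuous_on ballI) (rule has_vector_derivative_continuous[OF E'])
    qed (auto intro!: derivative_eq_intros continuous_intros)
    finally show ?thesis by (simp add: right_diff_distrib)
  qed
  have "locally_integrable ?k"
    unfolding locally_integrable_def set_integrable_def by (intro allI integrable_mult_indicator) auto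
  from AE_le_of_interval_integrals[OF this int]
  show ?thesis by (auto elim!: eventually_mono simp: power2_le_iff_abs_le)
qed

section \<open>Products of \<open>H\<^sup>1\<close> functions\<close>

text \<open>
  Pointwise products of classes. The product lies in \<open>L\<^sup>2\<close> as soon as one
  factor is in \<open>H\<^sup>1\<close>, hence bounded; for other arguments the value is
  arbitrary.
\<close>

definition prodop :: "('a::euclidean_space \<Rightarrow> 'b::euclidean_space \<Rightarrow> 'c::euclidean_space) \<Rightarrow> 'a l2 \<Rightarrow> 'b l2 \<Rightarrow> 'c l2" where
  "prodop \<beta> F G = cls (\<lambda>x. \<beta> (ev F x) (ev G x))"

lemma bilinear_measurable:
  fixes \<beta> :: "'a::euclidean_space \<Rightarrow> 'b::euclidean_space \<Rightarrow> 'c::euclidean_space"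
  assumes "bounded_bilinear \<beta>" "f \<in> borel_measurable M" "g \<in> borel_measurable M"
  shows "(\<lambda>x. \<beta> (f x) (g x)) \<in> borel_measurable M"
proof -
  have "continuous_on UNIV (\<lambda>p. \<beta> (fst p) (snd p))"
    by (intro bounded_bilinear.continuous_on[OF assms(1)] continuous_intros)
  from borel_measurable_continuous_on[OF this borel_measurable_Pair[OF assms(2,3)]] show ?thesis by simp
qed

locale bilinear_product = bounded_bilinear \<beta>
  for \<beta> :: "'a::euclidean_space \<Rightarrow> 'b::euclidean_space \<Rightarrow> 'c::euclidean_space"
begin

definition B :: real where "B = (SOME K. 0 < K \<and> (\<forall>a b. norm (\<beta> a b) \<le> norm a * norm b * K))"

lemma B: "0 < B" "norm (\<beta> a b) \<le> norm a * norm b * B"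
  using someI_ex[OF pos_bounded] unfolding B_def by auto

lemma L2_right:
  assumes "F \<in> L2_space" "G \<in> borel_measurable lebesgue" "AE x in lebesgue. norm (G x) \<le> c"
  shows "(\<lambda>x. \<beta> (F x) (G x)) \<in> L2_space"
proof (rule L2_space_dominated[OF _ assms(1)])
  show "(\<lambda>x. \<beta> (F x) (G x)) \<in> borel_measurable lebesgue"
    by (rule bilinear_measurable[OF bounded_bilinear_axioms L2_spaceD(1)[OF assms(1)] assms(2)])
  show "AE x in lebesgue. norm (\<beta> (F x) (G x)) \<le> (c * B) * norm (F x)"
    using assms(3)
  proof eventually_elim
    case (elim x)
    have "norm (\<beta> (F x) (G x)) \<le> norm (F x) * norm (G x) * B" by (rule B)
    also have "\<dots> \<le> norm (F x) * c * B" using elim B(1) by (intro mult_right_mono mult_left_mono) auto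
    finally show ?case by (simp add: mult_ac)
  qed
qed

lemma ev_prodop_right: "AE x in lebesgue. ev (prodop \<beta> F (val u)) x = \<beta> (ev F x) (ev (val u) x)"
  unfolding prodop_def by (rule ev_cls[OF L2_right[OF ev_L2 ev_measurable h1_ess_bounded]])

lemma bounded_bilinear_right: "bounded_bilinear (\<lambda>F u. prodop \<beta> F (val u))"
proof
  fix F G :: "'a l2" and u v :: "'b h1" and r :: real
  show "prodop \<beta> (F + G) (val u) = prodop \<beta> F (val u) + prodop \<beta> G (val u)"
    using ev_prodop_right[of "F + G" u] ev_prodop_right[of F u] ev_prodop_right[of G u] ev_add[of F G]
      ev_add[of "prodop \<beta> F (val u)" "prodop \<beta> G (val u)"]
    by (intro l2_eqI, eventually_elim) (simp add: add_left)
  show "prodop \<beta> F (val (u + v)) = prodop \<beta> F (val u) + prodop \<beta> F (val v)"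
    using ev_prodop_right[of F "u + v"] ev_prodop_right[of F u] ev_prodop_right[of F v] ev_add[of "val u" "val v"]
      ev_add[of "prodop \<beta> F (val u)" "prodop \<beta> F (val v)"]
    by (intro l2_eqI, eventually_elim) (simp add: add_right)
  show "prodop \<beta> (r *\<^sub>R F) (val u) = r *\<^sub>R prodop \<beta> F (val u)"
    using ev_prodop_right[of "r *\<^sub>R F" u] ev_prodop_right[of F u] ev_scaleR[of r F]
      ev_scaleR[of r "prodop \<beta> F (val u)"]
    by (intro l2_eqI, eventually_elim) (simp add: scaleR_left)
  show "prodop \<beta> F (val (r *\<^sub>R u)) = r *\<^sub>R prodop \<beta> F (val u)"
    using ev_prodop_right[of F "r *\<^sub>R u"] ev_prodop_right[of F u] ev_scaleR[of r "val u"]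
      ev_scaleR[of r "prodop \<beta> F (val u)"]
    by (intro l2_eqI, eventually_elim) (simp add: scaleR_right)
next
  have "norm (prodop \<beta> F (val u)) \<le> norm F * norm u * B" for F u
  proof -
    have "norm (prodop \<beta> F (val u)) \<le> (norm u * B) * norm F"
    proof (rule norm_l2_le)
      show "0 \<le> norm u * B" using B(1) by simp
      show "AE x in lebesgue. norm (ev (prodop \<beta> F (val u)) x) \<le> norm u * B * norm (ev F x)"
        using ev_prodop_right[of F u] h1_ess_bounded[of u]
      proof eventually_elim
        case (elim x)
        have "norm (\<beta> (ev F x) (ev (val u) x)) \<le> norm (ev F x) * norm (ev (val u) x) * B" by (rule B)
        also have "\<dots> \<le> norm (ev F x) * norm u * B" using elim B(1) by (intro mult_right_mono mult_left_mono) auto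
        finally show ?case using elim by (simp add: mult_ac)
      qed
    qed
    then show ?thesis by (simp add: mult_ac)
  qed
  then show "\<exists>K. \<forall>F u. norm (prodop \<beta> F (val u)) \<le> norm F * norm u * K" by blast
qed

end

lemma bilinear_product_flip: "bilinear_product \<beta> \<Longrightarrow> bilinear_product (\<lambda>x y. \<beta> y x)"
  unfolding bilinear_product_def by (rule bounded_bilinear.flip)

lemma prodop_flip: "prodop \<beta> F G = prodop (\<lambda>x y. \<beta> y x) G F"
  by (simp add: prodop_def)

text \<open>
  The action on \<open>H\<^sup>1\<close> of a bounded operator that commutes with
  translations, hence with the derivative.
\<close>

definition map_h1 :: "('a::euclidean_space l2 \<Rightarrow> 'b::euclidean_space l2) \<Rightarrow> 'a h1 \<Rightarrow> 'b h1" where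
  "map_h1 A u = mk (A (val u)) (A (der u))"

lemma has_D_map:
  assumes "bounded_linear A" "\<And>h F. A (shift h F) = shift h (A F)"
  shows "has_D (A (val u)) (A (der u))"
  using bounded_linear.has_vector_derivative[OF assms(1) has_D_val[of u, unfolded gen_def]]
  by (simp add: gen_def assms(2))

lemma val_der_map_h1:
  assumes "bounded_linear A" "\<And>h F. A (shift h F) = shift h (A F)"
  shows "val (map_h1 A u) = A (val u)" "der (map_h1 A u) = A (der u)"
  unfolding map_h1_def using has_D_map[OF assms] by auto

lemma bounded_linear_map_h1:
  assumes A: "bounded_linear A" "\<And>h F. A (shift h F) = shift h (A F)"
  shows "bounded_linear (map_h1 A)"
proof -
  interpret A: bounded_linear A by fact
  obtain K where K: "0 \<le> K" "\<And>F. norm (A F) \<le> norm F * K" using A.nonneg_bounded by blast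
  show ?thesis
  proof (rule bounded_linear_intro[where K="2 * K"])
    show "map_h1 A (u + v) = map_h1 A u + map_h1 A v" for u v
      by (rule h1_eqI) (simp add: val_der_map_h1[OF A] A.add)
    show "map_h1 A (r *\<^sub>R u) = r *\<^sub>R map_h1 A u" for r u
      by (rule h1_eqI) (simp add: val_der_map_h1[OF A] A.scaleR)
    show "norm (map_h1 A u) \<le> norm u * (2 * K)" for u
    proof -
      have "norm (map_h1 A u) \<le> norm (A (val u)) + norm (A (der u))"
        using norm_h1_le[of "map_h1 A u"] by (simp add: val_der_map_h1[OF A])
      also have "\<dots> \<le> norm u * K + norm u * K"
        using K norm_val_le[of u] norm_der_le[of u]
        by (intro add_mono order_trans[OF K(2)] mult_right_mono) auto
      finally show ?thesis by (simp add: mult_ac)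
    qed
  qed
qed

lemma shift_h1_tendsto: "((\<lambda>h. map_h1 (shift h) u) \<longlongrightarrow> u) (at 0)"
  by (rule h1_tendstoI)
     (simp_all add: val_der_map_h1 bounded_linear_shift shift_shift add.commute shift_tendsto_0)

definition mulh :: "('a::euclidean_space \<Rightarrow> 'b::euclidean_space \<Rightarrow> 'c::euclidean_space) \<Rightarrow> 'a h1 \<Rightarrow> 'b h1 \<Rightarrow> 'c h1" where
  "mulh \<beta> u v = mk (prodop \<beta> (val u) (val v)) (prodop \<beta> (der u) (val v) + prodop \<beta> (val u) (der v))"

context bilinear_product
begin

lemma bounded_bilinear_left: "bounded_bilinear (\<lambda>u G. prodop \<beta> (val u) G)"
proof -
  interpret flip: bilinear_product "\<lambda>x y. \<beta> y x"
    by (rule bilinear_product_flip[OF bilinear_product_axioms])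
  show ?thesis using bounded_bilinear.flip[OF flip.bounded_bilinear_right] by (simp add: prodop_flip[of \<beta>])
qed

lemma ev_prodop_left: "AE x in lebesgue. ev (prodop \<beta> (val u) G) x = \<beta> (ev (val u) x) (ev G x)"
  using bilinear_product.ev_prodop_right[OF bilinear_product_flip[OF bilinear_product_axioms], of G u]
  by (simp add: prodop_flip[of \<beta>])

text \<open>
  Leibniz' rule from difference quotients, one factor of which converges in
  \<open>L\<^sup>2\<close> while the other one converges in \<open>H\<^sup>1\<close>; the
  product is continuous for this pair of norms.
\<close>

lemma has_D_product:
  "has_D (prodop \<beta> (val u) (val v)) (prodop \<beta> (der u) (val v) + prodop \<beta> (val u) (der v))"
proof -
  have sh: "shift h (prodop \<beta> (val u) (val v)) = prodop \<beta> (shift h (val u)) (shift h (val v))" for h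
  proof -
    let ?w = "map_h1 (shift h) v"
    have w: "val ?w = shift h (val v)" by (simp add: val_der_map_h1 bounded_linear_shift shift_shift add.commute)
    show ?thesis
      using ev_shift[of h "prodop \<beta> (val u) (val v)"] AE_lebesgue_shift[OF ev_prodop_right[of "val u" v], of h]
        ev_prodop_right[of "shift h (val u)" ?w] ev_shift[of h "val u"] ev_shift[of h "val v"]
      by (intro l2_eqI, eventually_elim) (simp add: w)
  qed
  have w: "val (map_h1 (shift h) v) = shift h (val v)" for h
    by (simp add: val_der_map_h1 bounded_linear_shift shift_shift add.commute)
  have Du: "((\<lambda>h. (1 / (h - 0)) *\<^sub>R (shift h (val u) - shift 0 (val u))) \<longlongrightarrow> der u) (at 0)"
    and Dv: "((\<lambda>h. (1 / (h - 0)) *\<^sub>R (shift h (val v) - shift 0 (val v))) \<longlongrightarrow> der v) (at 0)"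
    using has_D_val[of u] has_D_val[of v] unfolding gen_def has_vector_derivative_iff_tendsto by auto
  interpret r: bounded_bilinear "\<lambda>F u. prodop \<beta> F (val u)" by (rule bounded_bilinear_right)
  interpret l: bounded_bilinear "\<lambda>u G. prodop \<beta> (val u) G" by (rule bounded_bilinear_left)
  have "((\<lambda>h. prodop \<beta> ((1 / (h - 0)) *\<^sub>R (shift h (val u) - shift 0 (val u))) (val (map_h1 (shift h) v))
      + prodop \<beta> (val u) ((1 / (h - 0)) *\<^sub>R (shift h (val v) - shift 0 (val v))))
      \<longlongrightarrow> prodop \<beta> (der u) (val v) + prodop \<beta> (val u) (der v)) (at 0)"
    by (intro tendsto_add r.tendsto l.tendsto Du Dv shift_h1_tendsto tendsto_const)
  moreover have "prodop \<beta> ((1 / (h - 0)) *\<^sub>R (shift h (val u) - shift 0 (val u))) (val (map_h1 (shift h) v))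
      + prodop \<beta> (val u) ((1 / (h - 0)) *\<^sub>R (shift h (val v) - shift 0 (val v)))
      = (1 / (h - 0)) *\<^sub>R (shift h (prodop \<beta> (val u) (val v)) - shift 0 (prodop \<beta> (val u) (val v)))" for h
    unfolding r.scaleR_left r.diff_left l.scaleR_right l.diff_right
    by (simp add: sh w flip: scaleR_add_right)
  ultimately show ?thesis unfolding gen_def has_vector_derivative_iff_tendsto by simp
qed

lemma val_mulh [simp]: "val (mulh \<beta> u v) = prodop \<beta> (val u) (val v)"
  and der_mulh [simp]: "der (mulh \<beta> u v) = prodop \<beta> (der u) (val v) + prodop \<beta> (val u) (der v)"
  using has_D_product by (simp_all add: mulh_def)

lemma ev_mulh: "AE x in lebesgue. ev (val (mulh \<beta> u v)) x = \<beta> (ev (val u) x) (ev (val v) x)"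
  unfolding val_mulh by (rule ev_prodop_right)

lemma bounded_bilinear_mulh: "bounded_bilinear (mulh \<beta>)"
proof -
  interpret r: bounded_bilinear "\<lambda>F u. prodop \<beta> F (val u)" by (rule bounded_bilinear_right)
  interpret l: bounded_bilinear "\<lambda>u G. prodop \<beta> (val u) G" by (rule bounded_bilinear_left)
  obtain Kr where Kr: "0 \<le> Kr" "\<And>F u. norm (prodop \<beta> F (val u)) \<le> norm F * norm u * Kr" using r.nonneg_bounded by blast
  obtain Kl where Kl: "0 \<le> Kl" "\<And>u G. norm (prodop \<beta> (val u) G) \<le> norm u * norm G * Kl" using l.nonneg_bounded by blast
  show ?thesis
  proof
    show "\<exists>K. \<forall>u v. norm (mulh \<beta> u v) \<le> norm u * norm v * K"
    proof (intro exI allI)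
      fix u v
      have 1: "norm (prodop \<beta> (val u) (val v)) \<le> norm u * norm v * Kr"
        using Kr(1) norm_val_le[of u] by (intro order_trans[OF Kr(2)] mult_right_mono) auto
      have 2: "norm (prodop \<beta> (der u) (val v)) \<le> norm u * norm v * Kr"
        using Kr(1) norm_der_le[of u] by (intro order_trans[OF Kr(2)] mult_right_mono) auto
      have 3: "norm (prodop \<beta> (val u) (der v)) \<le> norm u * norm v * Kl"
        using Kl(1) norm_der_le[of v] by (intro order_trans[OF Kl(2)] mult_right_mono mult_left_mono) auto
      have "norm (mulh \<beta> u v) \<le> norm (prodop \<beta> (val u) (val v)) + (norm (prodop \<beta> (der u) (val v)) + norm (prodop \<beta> (val u) (der v)))"
        using norm_h1_le[of "mulh \<beta> u v"] norm_triangle_ineq[of "prodop \<beta> (der u) (val v)" "prodop \<beta> (val u) (der v)"] by simp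
      also have "\<dots> \<le> norm u * norm v * Kr + (norm u * norm v * Kr + norm u * norm v * Kl)"
        by (intro add_mono 1 2 3)
      finally show "norm (mulh \<beta> u v) \<le> norm u * norm v * (Kr + (Kr + Kl))" by (simp add: algebra_simps)
    qed
  next
    fix u u' v v' and r :: real
    show "mulh \<beta> (u + u') v = mulh \<beta> u v + mulh \<beta> u' v" by (rule h1_eqI) (simp add: r.add_left)
    show "mulh \<beta> u (v + v') = mulh \<beta> u v + mulh \<beta> u v'" by (rule h1_eqI) (simp add: l.add_right)
    show "mulh \<beta> (r *\<^sub>R u) v = r *\<^sub>R mulh \<beta> u v" by (rule h1_eqI) (simp add: r.scaleR_left)
    show "mulh \<beta> u (r *\<^sub>R v) = r *\<^sub>R mulh \<beta> u v" by (rule h1_eqI) (simp add: l.scaleR_right)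
  qed
qed

end

section \<open>Multiplication by \<open>W\<^sup>1\<^sup>,\<^sup>\<infinity>\<close> functions\<close>

lemma bilinear_scaleR: "bilinear_product (scaleR :: real \<Rightarrow> 'a::euclidean_space \<Rightarrow> 'a)"
  unfolding bilinear_product_def by (rule bounded_bilinear_scaleR)

text \<open>
  The bumps of \<open>q = N - x\<^sup>2 / N\<close> with \<open>N = n + 1\<close>. The value 4
  bounds \<open>\<bar>q'\<bar> exp (-1 / q) / q\<^sup>2\<close>, as \<open>\<bar>q'\<bar>
  \<le> 2\<close> on the support and \<open>exp (-1 / u) / u\<^sup>2 \<le> 2!\<close>.
\<close>

lemma cutoffs:
  "\<exists>\<eta>. (\<forall>n. test_function (\<eta> n)) \<and> (\<forall>n x. \<bar>\<eta> n x\<bar> \<le> 1) \<and> (\<forall>n x. \<bar>deriv (\<eta> n) x\<bar> \<le> 4) \<and>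
    (\<forall>x. (\<lambda>n. \<eta> n x) \<longlonglongrightarrow> 1) \<and> (\<forall>x. (\<lambda>n. deriv (\<eta> n) x) \<longlonglongrightarrow> 0)"
proof -
  define q where "q n = [:real (Suc n), 0, - 1 / real (Suc n):]" for n
  have q: "poly (q n) x = real (Suc n) - x\<^sup>2 / real (Suc n)" for n x
    by (simp add: q_def power2_eq_square)
  have q': "poly (pderiv (q n)) x = - (2 * x / real (Suc n))" for n x
    by (simp add: q_def pderiv_pCons)
  have pos: "\<bar>x\<bar> \<le> real (Suc n)" if "0 < poly (q n) x" for n x
  proof -
    have "x\<^sup>2 < (real (Suc n))\<^sup>2" using that unfolding q by (simp add: field_simps power2_eq_square)
    then have "\<bar>x\<bar> \<le> \<bar>real (Suc n)\<bar>" unfolding abs_le_square_iff by (rule less_imp_le)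
    then show ?thesis by simp
  qed
  have t: "test_function (bump 0 1 (q n))" for n using test_bump pos by blast
  have d: "deriv (bump 0 1 (q n)) x = bump 2 (pderiv (q n)) (q n) x" for n x
    using DERIV_imp_deriv[OF bump_DERIV[of 0 1 "q n" x]] by (simp add: numeral_2_eq_2)
  have b: "\<bar>bump 2 (pderiv (q n)) (q n) x\<bar> \<le> 2 * \<bar>2 * x / real (Suc n)\<bar>" for n x
  proof (cases "0 < poly (q n) x")
    case True
    have "\<bar>bump 2 (pderiv (q n)) (q n) x\<bar> = \<bar>2 * x / real (Suc n)\<bar> * (exp (- (1 / poly (q n) x)) / poly (q n) x ^ 2)"
      using True by (simp add: bump_def q' abs_mult)
    also have "\<dots> \<le> \<bar>2 * x / real (Suc n)\<bar> * fact 2"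
      by (intro mult_left_mono exp_recip_bound True) auto
    finally show ?thesis by simp
  qed (simp add: bump_def)
  have b4: "\<bar>deriv (bump 0 1 (q n)) x\<bar> \<le> 4" for n x
  proof (cases "0 < poly (q n) x")
    case True
    have "\<bar>2 * x / real (Suc n)\<bar> \<le> 2" using pos[OF True] by (simp add: abs_mult divide_le_eq)
    then show ?thesis using b[of n x] unfolding d by linarith
  qed (simp add: d bump_def)
  have lim1: "(\<lambda>n. bump 0 1 (q n) x) \<longlonglongrightarrow> 1" for x
  proof -
    have ge: "real n - x\<^sup>2 \<le> poly (q n) x" for n
    proof -
      have "x\<^sup>2 / real (Suc n) \<le> x\<^sup>2 / 1" by (intro divide_left_mono) auto
      then show ?thesis unfolding q by simp
    qed
    have "filterlim (\<lambda>n. real n - x\<^sup>2) at_top sequentially"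
      using filterlim_tendsto_add_at_top[OF tendsto_const[of "- x\<^sup>2"] filterlim_real_sequentially] by simp
    then have top: "filterlim (\<lambda>n. poly (q n) x) at_top sequentially"
      by (rule filterlim_at_top_mono) (simp add: ge)
    have "(\<lambda>n. inverse (poly (q n) x)) \<longlonglongrightarrow> 0"
      by (rule filterlim_compose[OF tendsto_inverse_0 filterlim_mono[OF top at_top_le_at_infinity order_refl]])
    then have "(\<lambda>n. exp (- inverse (poly (q n) x))) \<longlonglongrightarrow> exp (- 0)" by (intro tendsto_intros)
    moreover have "\<forall>\<^sub>F n in sequentially. exp (- inverse (poly (q n) x)) = bump 0 1 (q n) x"
      using filterlim_at_top_dense[THEN iffD1, OF top, rule_format, of 0]
      by eventually_elim (simp add: bump_def inverse_eq_divide)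
    ultimately show ?thesis by (simp add: tendsto_cong)
  qed
  have lim0: "(\<lambda>n. deriv (bump 0 1 (q n)) x) \<longlonglongrightarrow> 0" for x
  proof (rule Lim_null_comparison)
    show "\<forall>\<^sub>F n in sequentially. norm (deriv (bump 0 1 (q n)) x) \<le> \<bar>4 * x\<bar> * inverse (real (Suc n))"
      using b by (intro always_eventually allI) (simp add: d abs_mult field_simps)
    show "(\<lambda>n. \<bar>4 * x\<bar> * inverse (real (Suc n))) \<longlonglongrightarrow> 0"
      using tendsto_mult_right_zero[OF LIMSEQ_inverse_real_of_nat] by blast
  qed
  have "\<bar>bump 0 1 (q n) x\<bar> \<le> 1" for n x by (simp add: bump_def)
  then show ?thesis using t b4 lim1 lim0 by (intro exI[of _ "\<lambda>n. bump 0 1 (q n)"]) blast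
qed

definition W1inf :: "(real \<Rightarrow> real) \<Rightarrow> (real \<Rightarrow> real) \<Rightarrow> real \<Rightarrow> bool" where
  "W1inf a a' c \<longleftrightarrow> has_weak_deriv 1 a a' \<and> ess_bounded a c \<and> ess_bounded a' c"

lemma test_times_bounded_L2:
  assumes "test_function \<phi>" "ess_bounded a c"
  shows "(\<lambda>x. \<phi> x * a x) \<in> L2_space"
  using L2_mult_bounded[OF assms(2) test_L2[OF assms(1), of "1::real"]] by (simp add: mult.commute)

lemma has_D_cutoff:
  assumes \<eta>: "test_function \<eta>" and a: "W1inf a a' c"
  shows "has_D (cls (\<lambda>x. \<eta> x * a x)) (cls (\<lambda>x. deriv \<eta> x * a x + \<eta> x * a' x))"
proof -
  have W: "has_weak_deriv 1 a a'" "ess_bounded a c" "ess_bounded a' c" using a by (auto simp: W1inf_def)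
  have li: "locally_integrable a" "locally_integrable a'" using W(1) unfolding weak_deriv1_iff by blast+
  have L: "(\<lambda>x. \<eta> x * a x) \<in> L2_space" "(\<lambda>x. deriv \<eta> x * a x + \<eta> x * a' x) \<in> L2_space"
    by (intro L2_space_add test_times_bounded_L2 test_deriv \<eta>; rule W)+
  have "has_weak_deriv 1 (\<lambda>x. \<eta> x * a x) (\<lambda>x. deriv \<eta> x * a x + \<eta> x * a' x)"
    unfolding weak_deriv1_iff
  proof (intro conjI L2_locally_integrable L allI impI)
    fix \<phi> assume \<phi>: "test_function \<phi>"
    have sm: "smooth \<phi>" "smooth \<eta>" using \<phi> \<eta> by (auto simp: test_function_iff)
    have t: "test_function (\<lambda>x. \<phi> x * \<eta> x)" by (rule test_mult[OF \<phi> sm(2)])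
    have d: "deriv (\<lambda>x. \<phi> x * \<eta> x) = (\<lambda>x. deriv \<phi> x * \<eta> x + \<phi> x * deriv \<eta> x)"
      using smooth_mult_deriv[OF sm] DERIV_imp_deriv by blast
    note I = test_integrable[OF _ li(1) locally_integrable_measurable[OF li(1)]]
    note I' = test_integrable[OF _ li(2) locally_integrable_measurable[OF li(2)]]
    have i1: "integrable lebesgue (\<lambda>x. deriv \<phi> x * \<eta> x * a x)"
      using I[OF test_mult[OF test_deriv[OF \<phi>] sm(2)]] by simp
    have i2: "integrable lebesgue (\<lambda>x. \<phi> x * deriv \<eta> x * a x)"
      using I[OF test_mult[OF \<phi> smooth_deriv[OF sm(2)]]] by simp
    have i3: "integrable lebesgue (\<lambda>x. \<phi> x * \<eta> x * a' x)"
      using I'[OF t] by simp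
    have "(LINT x|lebesgue. deriv (\<lambda>x. \<phi> x * \<eta> x) x *\<^sub>R a x) = - (LINT x|lebesgue. (\<phi> x * \<eta> x) *\<^sub>R a' x)"
      using W(1) t unfolding weak_deriv1_iff by blast
    then have "(LINT x|lebesgue. (deriv \<phi> x * \<eta> x + \<phi> x * deriv \<eta> x) * a x) = - (LINT x|lebesgue. \<phi> x * \<eta> x * a' x)"
      by (simp add: d)
    then show "(LINT x|lebesgue. deriv \<phi> x *\<^sub>R (\<eta> x * a x)) = - (LINT x|lebesgue. \<phi> x *\<^sub>R (deriv \<eta> x * a x + \<eta> x * a' x))"
      using i1 i2 i3 by (simp add: distrib_left distrib_right mult.assoc)
  qed
  then show ?thesis using weak_deriv_iff_has_D[OF L] by blast
qed

text \<open>
  A bounded function \<open>a\<close> with bounded derivative need not be square integrable,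
  but \<open>\<eta> a\<close> belongs to \<open>H\<^sup>1\<close> for a cutoff
  \<open>\<eta>\<close>, so Leibniz' rule holds for \<open>\<eta> a u\<close>. It passes to
  the limit \<open>\<eta> \<rightarrow> 1\<close> because the derivative is closed.
\<close>

lemma has_D_multiplier:
  fixes u :: "'a::euclidean_space h1"
  assumes a: "W1inf a a' c"
  shows "has_D (mulop a (val u)) (mulop a' (val u) + mulop a (der u))"
proof -
  have W: "ess_bounded a c" "ess_bounded a' c" using a by (auto simp: W1inf_def)
  have am: "a \<in> borel_measurable lebesgue" "a' \<in> borel_measurable lebesgue" "0 \<le> c"
    and ab: "AE x in lebesgue. \<bar>a x\<bar> \<le> c" "AE x in lebesgue. \<bar>a' x\<bar> \<le> c" using W by (auto simp: ess_bounded_def)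
  obtain \<eta> :: "nat \<Rightarrow> real \<Rightarrow> real" where \<eta>: "\<And>n. test_function (\<eta> n)" "\<And>n x. \<bar>\<eta> n x\<bar> \<le> 1"
    "\<And>n x. \<bar>deriv (\<eta> n) x\<bar> \<le> 4" "\<And>x. (\<lambda>n. \<eta> n x) \<longlonglongrightarrow> 1" "\<And>x. (\<lambda>n. deriv (\<eta> n) x) \<longlonglongrightarrow> 0"
    using cutoffs by metis
  note \<eta>m = test_measurable[OF \<eta>(1)] test_measurable[OF test_deriv[OF \<eta>(1)]]
  define w where "w n = mk (cls (\<lambda>x. \<eta> n x * a x)) (cls (\<lambda>x. deriv (\<eta> n) x * a x + \<eta> n x * a' x))" for n
  have w: "val (w n) = cls (\<lambda>x. \<eta> n x * a x)" "der (w n) = cls (\<lambda>x. deriv (\<eta> n) x * a x + \<eta> n x * a' x)" for n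
    using has_D_cutoff[OF \<eta>(1) a] by (simp_all add: w_def)
  have ew: "AE x in lebesgue. ev (val (w n)) x = \<eta> n x * a x"
    "AE x in lebesgue. ev (der (w n)) x = deriv (\<eta> n) x * a x + \<eta> n x * a' x" for n
    unfolding w by (intro ev_cls L2_space_add test_times_bounded_L2 test_deriv \<eta>(1); rule W)+
  interpret p: bilinear_product "scaleR :: real \<Rightarrow> 'a \<Rightarrow> 'a" by (rule bilinear_scaleR)
  note em = borel_measurable_scaleR borel_measurable_times borel_measurable_add ev_measurable \<eta>m am
  have nL: "(\<lambda>x. norm (ev F x)) \<in> L2_space" for F :: "'a l2"
    by (rule L2_space_dominated[of _ "ev F" 1]) auto
  have dom: "(\<lambda>x. (5 * c) * norm (ev F x)) \<in> L2_space" for F :: "'a l2"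
    using L2_space_scaleR[OF nL[of F], of "5 * c"] by simp
  have v: "val (mulh (*\<^sub>R) (w n) u) = cls (\<lambda>x. (\<eta> n x * a x) *\<^sub>R ev (val u) x)" for n
  proof -
    have "cls (ev (val (mulh (*\<^sub>R) (w n) u))) = cls (\<lambda>x. (\<eta> n x * a x) *\<^sub>R ev (val u) x)"
      using p.ev_mulh[of "w n" u] ew(1)[of n] by (intro cls_cong ev_L2, eventually_elim) simp
    then show ?thesis by simp
  qed
  have d: "der (mulh (*\<^sub>R) (w n) u) = cls (\<lambda>x. (deriv (\<eta> n) x * a x + \<eta> n x * a' x) *\<^sub>R ev (val u) x)
      + cls (\<lambda>x. (\<eta> n x * a x) *\<^sub>R ev (der u) x)" for n
  proof -
    have "cls (ev (prodop (*\<^sub>R) (der (w n)) (val u))) = cls (\<lambda>x. (deriv (\<eta> n) x * a x + \<eta> n x * a' x) *\<^sub>R ev (val u) x)"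
      using p.ev_prodop_right[of "der (w n)" u] ew(2)[of n] by (intro cls_cong ev_L2, eventually_elim) simp
    moreover have "cls (ev (prodop (*\<^sub>R) (val (w n)) (der u))) = cls (\<lambda>x. (\<eta> n x * a x) *\<^sub>R ev (der u) x)"
      using p.ev_prodop_left[of "w n" "der u"] ew(1)[of n] by (intro cls_cong ev_L2, eventually_elim) simp
    ultimately show ?thesis by (simp add: p.der_mulh)
  qed
  have bd: "\<bar>\<eta> n x * b\<bar> \<le> c" if "\<bar>b\<bar> \<le> c" for n x b
    using mult_mono[OF \<eta>(2)[of n x] that] by (simp add: abs_mult)
  have l1: "(\<lambda>n. cls (\<lambda>x. (\<eta> n x * a x) *\<^sub>R ev F x)) \<longlonglongrightarrow> mulop a F" for F :: "'a l2"
    unfolding mulop_def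
  proof (rule L2_dominated_convergence(3)[OF _ _ dom[of F]])
    show "AE x in lebesgue. norm ((\<eta> n x * a x) *\<^sub>R ev F x) \<le> 5 * c * norm (ev F x)" for n
      using ab(1)
    proof eventually_elim
      case (elim x)
      have "\<bar>\<eta> n x * a x\<bar> \<le> 5 * c" using bd[OF elim, of n x] am(3) by simp
      from mult_right_mono[OF this norm_ge_zero[of "ev F x"]] show ?case by simp
    qed
    have "(\<lambda>n. (\<eta> n x * a x) *\<^sub>R ev F x) \<longlonglongrightarrow> (1 * a x) *\<^sub>R ev F x" for x
      by (intro tendsto_intros \<eta>)
    then show "AE x in lebesgue. (\<lambda>n. (\<eta> n x * a x) *\<^sub>R ev F x) \<longlonglongrightarrow> a x *\<^sub>R ev F x" by simp
  qed (intro em)+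
  have l2: "(\<lambda>n. cls (\<lambda>x. (deriv (\<eta> n) x * a x + \<eta> n x * a' x) *\<^sub>R ev F x)) \<longlonglongrightarrow> mulop a' F" for F :: "'a l2"
    unfolding mulop_def
  proof (rule L2_dominated_convergence(3)[OF _ _ dom[of F]])
    show "AE x in lebesgue. norm ((deriv (\<eta> n) x * a x + \<eta> n x * a' x) *\<^sub>R ev F x) \<le> 5 * c * norm (ev F x)" for n
      using ab
    proof eventually_elim
      case (elim x)
      have "\<bar>deriv (\<eta> n) x * a x\<bar> \<le> 4 * c"
        using mult_mono[OF \<eta>(3)[of n x] elim(1)] by (simp add: abs_mult)
      then have "\<bar>deriv (\<eta> n) x * a x + \<eta> n x * a' x\<bar> \<le> 5 * c" using bd[OF elim(2), of n x] by linarith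
      from mult_right_mono[OF this norm_ge_zero[of "ev F x"]] show ?case by simp
    qed
    have "(\<lambda>n. (deriv (\<eta> n) x * a x + \<eta> n x * a' x) *\<^sub>R ev F x) \<longlonglongrightarrow> (0 * a x + 1 * a' x) *\<^sub>R ev F x" for x
      by (intro tendsto_intros \<eta>)
    then show "AE x in lebesgue. (\<lambda>n. (deriv (\<eta> n) x * a x + \<eta> n x * a' x) *\<^sub>R ev F x) \<longlonglongrightarrow> a' x *\<^sub>R ev F x" by simp
  qed (intro em)+
  show ?thesis
    by (rule gen_closed[OF shift.isometry_group_axioms has_D_val[of "mulh (*\<^sub>R) (w _) u"]])
       (auto simp only: v d intro!: tendsto_add l1 l2)
qed

definition mulW :: "(real \<Rightarrow> real) \<Rightarrow> (real \<Rightarrow> real) \<Rightarrow> 'a::euclidean_space h1 \<Rightarrow> 'a h1" where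
  "mulW a a' u = mk (mulop a (val u)) (mulop a' (val u) + mulop a (der u))"

lemma
  assumes "W1inf a a' c"
  shows val_mulW: "val (mulW a a' u) = mulop a (val u)"
    and der_mulW: "der (mulW a a' u) = mulop a' (val u) + mulop a (der u)"
  by (simp_all add: mulW_def has_D_multiplier[OF assms])

lemma bounded_linear_mulW:
  assumes a: "W1inf a a' c"
  shows "bounded_linear (mulW a a' :: 'a::euclidean_space h1 \<Rightarrow> 'a h1)"
proof (rule bounded_linear_intro[where K="3 * c"])
  have W: "ess_bounded a c" "ess_bounded a' c" "0 \<le> c" using a by (auto simp: W1inf_def ess_bounded_def)
  interpret l: bounded_linear "mulop a :: 'a l2 \<Rightarrow> 'a l2" by (rule bounded_linear_mulop[OF W(1)])
  fix u v :: "'a h1" and r :: real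
  show "mulW a a' (u + v) = mulW a a' u + mulW a a' v" by (rule h1_eqI) (simp add: val_mulW[OF a] l.add)
  show "mulW a a' (r *\<^sub>R u) = r *\<^sub>R mulW a a' u" by (rule h1_eqI) (simp add: val_mulW[OF a] l.scaleR)
  have "norm (mulW a a' u) \<le> norm (mulop a (val u)) + (norm (mulop a' (val u)) + norm (mulop a (der u)))"
    using norm_h1_le[of "mulW a a' u"] norm_triangle_ineq[of "mulop a' (val u)" "mulop a (der u)"]
    by (simp add: val_mulW[OF a] der_mulW[OF a])
  also have "\<dots> \<le> c * norm u + (c * norm u + c * norm u)"
    using norm_val_le[of u] norm_der_le[of u] W(3)
    by (intro add_mono order_trans[OF norm_mulop[OF W(1)]] order_trans[OF norm_mulop[OF W(2)]] mult_left_mono) auto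
  finally show "norm (mulW a a' u) \<le> norm u * (3 * c)" by (simp add: algebra_simps)
qed

lemma W_inf_derivatives:
  assumes "V \<in> sobolev_W_inf 3"
  obtains V1 V2 V3 c where "W1inf V V1 c" "W1inf V1 V2 c" "W1inf V2 V3 c"
proof -
  have "\<exists>g. has_weak_deriv j V g \<and> (\<exists>M. AE x in lebesgue. norm (g x) \<le> M)" if "j \<in> {0,1,2,3}" for j
  proof -
    have "j \<le> 3" using that by auto
    then show ?thesis using assms unfolding sobolev_W_inf_def by blast
  qed
  then obtain g M where g: "\<And>j. j \<in> {0,1,2,3} \<Longrightarrow> has_weak_deriv j V (g j)"
    "\<And>j. j \<in> {0,1,2,3} \<Longrightarrow> AE x in lebesgue. norm (g j x) \<le> M j"
    by metis
  define c where "c = Max ((\<lambda>j. \<bar>M j\<bar>) ` {0,1,2,3::nat})"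
  have c: "\<bar>M j\<bar> \<le> c" if "j \<in> {0,1,2,3}" for j
    unfolding c_def by (rule Max_ge) (use that in auto)
  have li: "locally_integrable (g j)" if "j \<in> {0,1,2,3}" for j using g(1)[OF that] by (simp add: has_weak_deriv_def)
  have "AE x in lebesgue. V x = g 0 x" by (rule has_weak_deriv_0_AE[OF g(1)]) simp
  have liV: "locally_integrable V" using g(1)[of 0] by (simp add: has_weak_deriv_def)
  have e: "ess_bounded (g j) c" if j: "j \<in> {0,1,2,3}" for j
    unfolding ess_bounded_def
  proof (intro conjI locally_integrable_measurable li j)
    show "0 \<le> c" using c[OF j] by simp
    show "AE x in lebesgue. \<bar>g j x\<bar> \<le> c" using g(2)[OF j] by eventually_elim (use c[OF j] in auto)
  qed
  have eV: "ess_bounded V c"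
    using e[of 0] \<open>AE x in lebesgue. V x = g 0 x\<close> locally_integrable_measurable[OF liV]
    by (auto simp: ess_bounded_def elim: eventually_elim2)
  show thesis
  proof (rule that)
    show "W1inf V (g 1) c" unfolding W1inf_def using eV e[of 1] g(1)[of 1] by simp
    show "W1inf (g 1) (g 2) c" unfolding W1inf_def
      using e[of 1] e[of 2] weak_deriv_Suc[OF g(1)[of 1], of "g 2"] g(1)[of 2] by (simp add: numeral_2_eq_2)
    show "W1inf (g 2) (g 3) c" unfolding W1inf_def
      using e[of 2] e[of 3] weak_deriv_Suc[OF g(1)[of 2], of "g 3"] g(1)[of 3] by (simp add: eval_nat_numeral)
  qed
qed

section \<open>Sobolev functions as elements of \<open>H\<^sup>1\<close>\<close>

text \<open>
  The norm of \<open>sobolev_norm\<close> is built from chosen representatives of weak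
  derivatives; almost everywhere uniqueness identifies it with the norm of the type.
\<close>

lemma cls_val_sobolev:
  fixes f :: "real \<Rightarrow> 'a::euclidean_space"
  assumes f: "f \<in> L2_space" and u: "cls f = val u"
  shows "f \<in> sobolev_H 1" "sobolev_norm 1 f = norm u" "AE x in lebesgue. weak_deriv 1 f x = ev (der u) x"
proof -
  have W0: "has_weak_deriv 0 f f" by (rule has_weak_deriv_0[OF L2_locally_integrable[OF f]])
  have W1: "has_weak_deriv 1 f (ev (der u))"
    unfolding weak_deriv_iff_has_D[OF f ev_L2] by (simp add: u has_D_val)
  show "f \<in> sobolev_H 1"
    using W0 W1 f ev_L2[of "der u"] by (auto simp: sobolev_H_def le_Suc_eq)
  show "AE x in lebesgue. weak_deriv 1 f x = ev (der u) x" by (rule weak_deriv_AE[OF W1])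
  have n: "L2_norm (weak_deriv k f) = norm (cls g)" if W: "has_weak_deriv k f g" and g: "g \<in> L2_space" for k g
  proof -
    have ae: "AE x in lebesgue. g x = weak_deriv k f x" using weak_deriv_AE[OF W] by eventually_elim simp
    have "weak_deriv k f \<in> L2_space" by (rule L2_space_cong_AE[OF g ae])
    then show ?thesis using cls_cong[OF g ae] by (simp add: norm_cls)
  qed
  show "sobolev_norm 1 f = norm u"
    using n[OF W0 f] n[OF W1 ev_L2] by (simp add: sobolev_norm_def norm_h1 u)
qed

lemma sobolev_H1_lift:
  fixes f :: "real \<Rightarrow> 'a::euclidean_space"
  assumes "f \<in> sobolev_H 1"
  obtains u where "f \<in> L2_space" "cls f = val u"
proof -
  have "\<exists>g\<in>L2_space. has_weak_deriv 0 f g" "\<exists>g\<in>L2_space. has_weak_deriv 1 f g"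
    using assms unfolding sobolev_H_def by blast+
  then obtain g0 g1 where g: "g0 \<in> L2_space" "has_weak_deriv 0 f g0" "g1 \<in> L2_space" "has_weak_deriv 1 f g1" by blast
  have f: "f \<in> L2_space"
    by (rule L2_space_cong_AE[OF g(1)]) (use has_weak_deriv_0_AE[OF g(2)] in \<open>auto elim: eventually_mono\<close>)
  have "has_D (cls f) (cls g1)" using g(4) weak_deriv_iff_has_D[OF f g(3)] by blast
  then have "val (mk (cls f) (cls g1)) = cls f" by simp
  then show thesis using that f by metis
qed

text \<open>
  The derivative as a relation inside \<open>H\<^sup>1\<close>, to be chained for higher
  regularity.
\<close>

definition h1D :: "'a::euclidean_space h1 \<Rightarrow> 'a h1 \<Rightarrow> bool" where "h1D u v \<longleftrightarrow> der u = val v"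

lemma sobolev_H3_lift:
  fixes f :: "real \<Rightarrow> 'a::euclidean_space"
  assumes "f \<in> sobolev_H 3" "sobolev_norm 3 f \<le> M"
  obtains u u1 u2 where "f \<in> L2_space" "cls f = val u" "h1D u u1" "h1D u1 u2" "norm u \<le> M" "norm u1 \<le> M" "norm u2 \<le> M"
proof -
  have "\<exists>g. g \<in> L2_space \<and> has_weak_deriv j f g" if "j \<in> {0,1,2,3}" for j
  proof -
    have "j \<le> 3" using that by auto
    then show ?thesis using assms(1) unfolding sobolev_H_def by blast
  qed
  then obtain g where g: "\<And>j. j \<in> {0,1,2,3} \<Longrightarrow> g j \<in> L2_space" "\<And>j. j \<in> {0,1,2,3} \<Longrightarrow> has_weak_deriv j f (g j)"
    by metis
  have ae0: "AE x in lebesgue. g 0 x = f x"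
    using has_weak_deriv_0_AE[OF g(2)[of 0]] by (auto elim: eventually_mono)
  have f: "f \<in> L2_space" by (rule L2_space_cong_AE[OF g(1) ae0]) simp
  have c0: "cls f = cls (g 0)" by (rule cls_cong[OF g(1) ae0, symmetric]) simp
  have D: "has_D (cls (g j)) (cls (g (Suc j)))" if "j \<in> {0,1,2}" for j
  proof -
    have j: "j \<in> {0,1,2,3}" "Suc j \<in> {0,1,2,3}" using that by auto
    show ?thesis
      using weak_deriv_iff_has_D[OF g(1)[OF j(1)] g(1)[OF j(2)]] weak_deriv_Suc[OF g(2)[OF j(1)] g(2)[OF j(2)]] by blast
  qed
  define u where "u j = mk (cls (g j)) (cls (g (Suc j)))" for j
  have u: "val (u j) = cls (g j)" "der (u j) = cls (g (Suc j))" if "j \<in> {0,1,2}" for j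
    using D[OF that] by (simp_all add: u_def)
  have n: "L2_norm (weak_deriv j f) = norm (cls (g j))" if j: "j \<in> {0,1,2,3}" for j
  proof -
    have ae: "AE x in lebesgue. g j x = weak_deriv j f x" using weak_deriv_AE[OF g(2)[OF j]] by eventually_elim simp
    have "weak_deriv j f \<in> L2_space" by (rule L2_space_cong_AE[OF g(1)[OF j] ae])
    then show ?thesis using cls_cong[OF g(1)[OF j] ae] by (simp add: norm_cls)
  qed
  have "sobolev_norm 3 f = sqrt ((norm (cls (g 0)))\<^sup>2 + (norm (cls (g 1)))\<^sup>2 + (norm (cls (g 2)))\<^sup>2 + (norm (cls (g 3)))\<^sup>2)"
    using n by (simp add: sobolev_norm_def eval_nat_numeral)
  then have "norm (u j) \<le> M" if "j \<in> {0,1,2}" for j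
    unfolding norm_h1 u[OF that]
    by (intro order_trans[OF _ assms(2)]) (use that in \<open>auto simp: eval_nat_numeral\<close>)
  then show thesis
    using that[of "u 0" "u 1" "u 2"] f c0 u by (simp add: h1D_def eval_nat_numeral)
qed

section \<open>The Dirac group\<close>

text \<open>
  The real-linear maps \<open>\<sigma>\<^sub>1\<close>, \<open>i \<sigma>\<^sub>3\<close> and
  multiplication by a complex scalar. With \<open>i \<sigma>\<^sub>3\<close> as a unit, the
  generator \<open>- i Q\<close> becomes \<open>- \<epsilon> \<sigma>\<^sub>1
  \<partial>\<^sub>x - i \<sigma>\<^sub>3\<close>, free of explicit complex factors.
\<close>

definition s1 :: "spinor \<Rightarrow> spinor" where "s1 v = sigma1 *v v"
definition kk :: "spinor \<Rightarrow> spinor" where "kk v = \<i> *s (sigma3 *v v)"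
definition cs :: "complex \<Rightarrow> spinor \<Rightarrow> spinor" where "cs a v = a *s v"

lemma spinor_eq_iff: "u = v \<longleftrightarrow> u $ 1 = v $ 1 \<and> u $ 2 = (v $ 2 :: complex)" for u v :: spinor
  by (simp add: vec_eq_iff forall_2)

lemma s1_nth [simp]: "s1 v $ 1 = v $ 2" "s1 v $ 2 = v $ 1"
  by (simp_all add: s1_def sigma1_def matrix_vector_mult_def sum_2 vector_2)
lemma sigma3_nth [simp]: "(sigma3 *v v) $ 1 = v $ 1" "(sigma3 *v v) $ 2 = - v $ 2"
  by (simp_all add: sigma3_def matrix_vector_mult_def sum_2 vector_2)
lemma kk_nth [simp]: "kk v $ 1 = \<i> * v $ 1" "kk v $ 2 = - \<i> * v $ 2"
  by (simp_all add: kk_def)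
lemma cs_nth [simp]: "cs a v $ i = a * v $ i"
  by (simp add: cs_def)

lemma inner_spinor: "u \<bullet> v = u $ 1 \<bullet> v $ 1 + u $ 2 \<bullet> v $ 2" for u v :: spinor
  by (simp add: inner_vec_def sum_2)

lemma norm_spinor: "norm v = sqrt ((norm (v $ 1))\<^sup>2 + (norm (v $ 2))\<^sup>2)" for v :: spinor
  by (simp add: norm_vec_def L2_set_def sum_2)

lemma norm_s1 [simp]: "norm (s1 v) = norm v" by (simp add: norm_spinor add.commute)
lemma norm_kk [simp]: "norm (kk v) = norm v" by (simp add: norm_spinor norm_mult)
lemma norm_cs [simp]: "norm (cs a v) = norm a * norm v"
  by (simp add: norm_spinor norm_mult power_mult_distrib real_sqrt_mult flip: distrib_left)

lemma bounded_linear_s1 [simp]: "bounded_linear s1"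
  by (rule bounded_linear_intro[where K=1]) (simp_all add: spinor_eq_iff)
lemma bounded_linear_kk [simp]: "bounded_linear kk"
  by (rule bounded_linear_intro[where K=1]) (simp_all add: spinor_eq_iff algebra_simps)
lemma bounded_linear_cs [simp]: "bounded_linear (cs a)"
  by (rule bounded_linear_intro[where K="norm a"]) (simp_all add: spinor_eq_iff algebra_simps)

lemma s1_s1 [simp]: "s1 (s1 v) = v" by (simp add: spinor_eq_iff)
lemma kk_kk [simp]: "kk (kk v) = - v" by (simp add: spinor_eq_iff algebra_simps)
lemma kk_s1: "kk (s1 v) = - s1 (kk v)" by (simp add: spinor_eq_iff)
lemma s1_symmetric: "s1 u \<bullet> v = u \<bullet> s1 v" by (simp add: inner_spinor)
lemma kk_skew: "kk u \<bullet> v = - (u \<bullet> kk v)" by (simp add: inner_spinor inner_complex_def algebra_simps)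

lemma lin_s1_s1 [simp]: "lin s1 (lin s1 F) = F"
  by (simp add: lin_compose) (simp add: lin_def)

lemma lin_minus: "bounded_linear A \<Longrightarrow> lin (\<lambda>v. - A v) F = - lin A F"
  using ev_lin[OF bounded_linear_minus, of A F] ev_lin[of A F] ev_minus[of "lin A F"]
  by (intro l2_eqI) (auto elim: eventually_elim2)

lemma lin_kk_kk [simp]: "lin kk (lin kk F) = - F"
proof -
  have "lin kk (lin kk F) = lin (\<lambda>v. - (\<lambda>v. v) v) F" by (simp add: lin_compose)
  also have "\<dots> = - lin (\<lambda>v. v) F" by (rule lin_minus) (rule bounded_linear_ident)
  finally show ?thesis by (simp add: lin_def)
qed

lemma lin_kk_s1: "lin kk (lin s1 F) = - lin s1 (lin kk F)"
  by (simp add: lin_compose kk_s1 lin_minus[OF bounded_linear_compose] )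

lemma norm_lin_s1 [simp]: "norm (lin s1 F) = norm F" by (rule norm_lin_isometry) simp_all
lemma norm_lin_kk [simp]: "norm (lin kk F) = norm F" by (rule norm_lin_isometry) simp_all

lemma inner_lin_s1: "inner (lin s1 F) G = inner F (lin s1 G)"
  by (rule inner_lin) (simp_all add: s1_symmetric)

lemma inner_lin_kk: "inner (lin kk F) F = 0"
proof -
  have "inner (lin kk F) F = inner F (lin (\<lambda>v. - kk v) F)"
    by (rule inner_lin) (simp_all add: bounded_linear_minus kk_skew)
  also have "\<dots> = - inner (lin kk F) F" by (simp add: lin_minus inner_commute)
  finally show ?thesis by simp
qed

text \<open>
  For \<open>c = 1\<close> and \<open>c = -1\<close> these are the orthogonal projections onto
  the eigenspaces of \<open>\<sigma>\<^sub>1\<close>.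
\<close>

definition half_sum :: "real \<Rightarrow> spinor l2 \<Rightarrow> spinor l2" where
  "half_sum c F = (1 / 2) *\<^sub>R (F + c *\<^sub>R lin s1 F)"

lemma bounded_linear_half_sum: "bounded_linear (half_sum c)"
  unfolding half_sum_def[abs_def]
  by (intro bounded_linear_const_scaleR bounded_linear_add bounded_linear_ident bounded_linear_lin bounded_linear_s1)

lemma lin_s1_linear: "lin s1 (F + G) = lin s1 F + lin s1 G" "lin s1 (c *\<^sub>R F) = c *\<^sub>R lin s1 F"
  "lin s1 (F - G) = lin s1 F - lin s1 G" "lin s1 (- F) = - lin s1 F"
proof -
  interpret l: bounded_linear "lin s1" by simp
  show "lin s1 (F + G) = lin s1 F + lin s1 G" "lin s1 (c *\<^sub>R F) = c *\<^sub>R lin s1 F"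
    "lin s1 (F - G) = lin s1 F - lin s1 G" "lin s1 (- F) = - lin s1 F"
    by (simp_all add: l.add l.scaleR l.diff l.neg)
qed

lemma half_sum_alg:
  "half_sum 1 (half_sum 1 F) = half_sum 1 F" "half_sum (-1) (half_sum (-1) F) = half_sum (-1) F"
  "half_sum 1 (half_sum (-1) F) = 0" "half_sum (-1) (half_sum 1 F) = 0"
  "half_sum 1 F + half_sum (-1) F = F" "half_sum 1 F - half_sum (-1) F = lin s1 F"
  by (simp_all add: half_sum_def lin_s1_linear algebra_simps flip: scaleR_add_left)

lemma half_sum_orth: "inner (half_sum 1 F) (half_sum (-1) G) = 0"
  by (simp add: half_sum_def inner_add_left inner_add_right inner_lin_s1 inner_diff_right)

lemma half_sum_pythagoras: "(norm (half_sum 1 F + half_sum (-1) G))\<^sup>2 = (norm (half_sum 1 F))\<^sup>2 + (norm (half_sum (-1) G))\<^sup>2"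
  using half_sum_orth[of F G] by (simp add: power2_norm_eq_inner inner_add_left inner_add_right inner_commute)

lemma shift_half_sum: "shift h (half_sum c F) = half_sum c (shift h F)"
  by (simp add: half_sum_def shift.U_scale shift.U_plus shift_lin)

text \<open>
  The group generated by \<open>- \<epsilon> \<sigma>\<^sub>1 \<partial>\<^sub>x\<close>: the
  two eigencomponents of \<open>\<sigma>\<^sub>1\<close> travel with speeds
  \<open>\<epsilon>\<close> and \<open>- \<epsilon>\<close>.
\<close>

definition transport :: "real \<Rightarrow> real \<Rightarrow> spinor l2 \<Rightarrow> spinor l2" where
  "transport \<epsilon> t F = half_sum 1 (shift (- (\<epsilon> * t)) F) + half_sum (-1) (shift (\<epsilon> * t) F)"

lemma half_sum_transport:
  "half_sum 1 (transport \<epsilon> t F) = half_sum 1 (shift (- (\<epsilon> * t)) F)"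
  "half_sum (-1) (transport \<epsilon> t F) = half_sum (-1) (shift (\<epsilon> * t) F)"
proof -
  interpret p: bounded_linear "half_sum 1" by (rule bounded_linear_half_sum)
  interpret m: bounded_linear "half_sum (-1)" by (rule bounded_linear_half_sum)
  show "half_sum 1 (transport \<epsilon> t F) = half_sum 1 (shift (- (\<epsilon> * t)) F)"
    "half_sum (-1) (transport \<epsilon> t F) = half_sum (-1) (shift (\<epsilon> * t) F)"
    by (simp_all add: transport_def p.add m.add half_sum_alg)
qed

lemma isometry_group_transport: "isometry_group (transport \<epsilon>)"
proof (rule isometry_group.intro)
  interpret p: bounded_linear "half_sum 1" by (rule bounded_linear_half_sum)
  interpret m: bounded_linear "half_sum (-1)" by (rule bounded_linear_half_sum)
  fix s t F
  show "linear (transport \<epsilon> t)"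
    unfolding transport_def
    by (rule linearI) (simp_all add: shift.U_plus shift.U_scale p.add m.add p.scaleR m.scaleR scaleR_add_right)
  have n: "norm (half_sum c (shift h F)) = norm (half_sum c F)" for c h
    by (simp flip: shift_half_sum)
  have "(norm (transport \<epsilon> t F))\<^sup>2 = (norm F)\<^sup>2"
    using half_sum_pythagoras[of F F] by (simp add: transport_def half_sum_pythagoras n half_sum_alg)
  then show "norm (transport \<epsilon> t F) = norm F" by simp
  show "transport \<epsilon> 0 F = F" by (simp add: transport_def half_sum_alg)
  show "transport \<epsilon> s (transport \<epsilon> t F) = transport \<epsilon> (s + t) F"
  proof -
    have "transport \<epsilon> s (transport \<epsilon> t F)
        = shift (- (\<epsilon> * s)) (half_sum 1 (transport \<epsilon> t F)) + shift (\<epsilon> * s) (half_sum (-1) (transport \<epsilon> t F))"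
      by (simp add: transport_def[of \<epsilon> s] shift_half_sum)
    also have "\<dots> = transport \<epsilon> (s + t) F"
      unfolding half_sum_transport by (simp add: transport_def shift_half_sum shift_shift algebra_simps)
    finally show ?thesis .
  qed
  have "((\<lambda>t. transport \<epsilon> t F) \<longlongrightarrow> half_sum 1 (shift (- (\<epsilon> * 0)) F) + half_sum (-1) (shift (\<epsilon> * 0) F)) (at 0)"
    unfolding transport_def
    by (intro tendsto_add p.tendsto m.tendsto shift.U_tendsto tendsto_intros)
  then show "((\<lambda>t. transport \<epsilon> t F) \<longlongrightarrow> F) (at 0)" by (simp add: half_sum_alg)
qed

text \<open>
  Conversely to the obvious inclusion, differentiability of the transported function makes
  both of its eigencomponents differentiable along translations, so it is in
  \<open>H\<^sup>1\<close>.
\<close>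

lemma gen_transport:
  assumes "\<epsilon> \<noteq> 0"
  shows "gen (transport \<epsilon>) F G \<longleftrightarrow> (\<exists>u. F = val u \<and> G = - \<epsilon> *\<^sub>R lin s1 (der u))"
proof
  interpret p: bounded_linear "half_sum 1" by (rule bounded_linear_half_sum)
  interpret m: bounded_linear "half_sum (-1)" by (rule bounded_linear_half_sum)
  have sh: "((\<lambda>t. shift (c * t) F') has_vector_derivative c *\<^sub>R G') (at 0)" if "has_D F' G'" for c and F' G' :: "spinor l2"
    using has_vector_derivative_affine[of "\<lambda>t. shift t F'" G' 0 c 0] that by (simp add: gen_def)
  {
    assume "\<exists>u. F = val u \<and> G = - \<epsilon> *\<^sub>R lin s1 (der u)"
    then obtain u where u: "F = val u" "G = - \<epsilon> *\<^sub>R lin s1 (der u)" by blast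
    have "((\<lambda>t. half_sum 1 (shift ((- \<epsilon>) * t) F) + half_sum (-1) (shift (\<epsilon> * t) F)) has_vector_derivative
        half_sum 1 ((- \<epsilon>) *\<^sub>R der u) + half_sum (-1) (\<epsilon> *\<^sub>R der u)) (at 0)"
      unfolding u(1)
      by (intro has_vector_derivative_add p.has_vector_derivative m.has_vector_derivative sh has_D_val)
    moreover have "half_sum 1 ((- \<epsilon>) *\<^sub>R der u) + half_sum (-1) (\<epsilon> *\<^sub>R der u) = G"
      unfolding u(2) half_sum_alg(6)[of "der u", symmetric] p.scaleR m.scaleR by (simp add: algebra_simps)
    ultimately show "gen (transport \<epsilon>) F G" by (simp add: gen_def transport_def)
  }
  assume "gen (transport \<epsilon>) F G"
  then have W: "((\<lambda>t. transport \<epsilon> t F) has_vector_derivative G) (at 0)" by (simp add: gen_def)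
  have P: "((\<lambda>t. shift (- (\<epsilon> * t)) (half_sum 1 F)) has_vector_derivative half_sum 1 G) (at 0)"
    using p.has_vector_derivative[OF W] by (simp add: half_sum_transport shift_half_sum)
  have M: "((\<lambda>t. shift (\<epsilon> * t) (half_sum (-1) F)) has_vector_derivative half_sum (-1) G) (at 0)"
    using m.has_vector_derivative[OF W] by (simp add: half_sum_transport shift_half_sum)
  have P': "has_D (half_sum 1 F) ((- 1 / \<epsilon>) *\<^sub>R half_sum 1 G)"
    using has_vector_derivative_affine[of "\<lambda>t. shift (- (\<epsilon> * t)) (half_sum 1 F)" "half_sum 1 G" 0 "- 1 / \<epsilon>" 0] P assms
    by (simp add: gen_def)
  have M': "has_D (half_sum (-1) F) ((1 / \<epsilon>) *\<^sub>R half_sum (-1) G)"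
    using has_vector_derivative_affine[of "\<lambda>t. shift (\<epsilon> * t) (half_sum (-1) F)" "half_sum (-1) G" 0 "1 / \<epsilon>" 0] M assms
    by (simp add: gen_def)
  let ?H = "(- 1 / \<epsilon>) *\<^sub>R half_sum 1 G + (1 / \<epsilon>) *\<^sub>R half_sum (-1) G"
  have D: "has_D F ?H" using shift.gen_add[OF P' M'] by (simp add: half_sum_alg)
  have "?H = (- 1 / \<epsilon>) *\<^sub>R (half_sum 1 G - half_sum (-1) G)" by (simp add: algebra_simps)
  also have "\<dots> = (- 1 / \<epsilon>) *\<^sub>R lin s1 G" by (simp add: half_sum_alg)
  finally have "- \<epsilon> *\<^sub>R lin s1 ?H = G" using assms by (simp add: lin_s1_linear)
  then show "\<exists>u. F = val u \<and> G = - \<epsilon> *\<^sub>R lin s1 (der u)"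
    using D by (intro exI[of _ "mk F ?H"]) simp
qed

text \<open>
  The graph of \<open>- i Q\<^sup>\<epsilon>\<close> on classes, with domain
  \<open>H\<^sup>1\<close>.
\<close>

definition dirac_gen :: "real \<Rightarrow> spinor l2 \<Rightarrow> spinor l2 \<Rightarrow> bool" where
  "dirac_gen \<epsilon> F G \<longleftrightarrow> (\<exists>u. F = val u \<and> G = - \<epsilon> *\<^sub>R lin s1 (der u) - lin kk F)"

lemma dirac_isometry_group_exists:
  assumes "\<epsilon> \<noteq> 0"
  shows "\<exists>V. isometry_group V \<and> (\<forall>F G. gen V F G \<longleftrightarrow> dirac_gen \<epsilon> F G)"
proof -
  have "bounded_linear (\<lambda>F. - lin kk F)" by (intro bounded_linear_minus bounded_linear_lin) simp
  moreover have "inner (- lin kk F) F = 0" for F by (simp add: inner_lin_kk)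
  ultimately obtain V where V: "isometry_group V" "\<And>F G. gen V F G \<longleftrightarrow> gen (transport \<epsilon>) F (G - - lin kk F)"
    using skew_perturbation[OF isometry_group_transport[of \<epsilon>], of "\<lambda>F. - lin kk F"] by blast
  have "gen V F G \<longleftrightarrow> dirac_gen \<epsilon> F G" for F G
    unfolding V(2) gen_transport[OF assms] dirac_gen_def by (auto simp: algebra_simps)
  with V(1) show ?thesis by blast
qed

text \<open>
  The conjugate group \<open>A' U A\<close> has the same generator.
\<close>

lemma isometry_group_commute:
  fixes U :: "real \<Rightarrow> 'x::banach \<Rightarrow> 'x"
  assumes U: "isometry_group U" and A: "bounded_linear A" "bounded_linear A'" "\<And>x. norm (A x) = norm x"
    "\<And>x. A (A' x) = x" "\<And>x. A' (A x) = x"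
    and g: "\<And>x g. gen U x g \<Longrightarrow> gen U (A x) (A g)"
  shows "A (U t x) = U t (A x)"
proof -
  interpret U: isometry_group U by fact
  interpret A: bounded_linear A by fact
  interpret A': bounded_linear A' by fact
  have n: "norm (A' x) = norm x" for x using A(3)[of "A' x"] A(4) by simp
  define V where "V t x = A' (U t (A x))" for t x
  have V: "isometry_group V"
  proof (rule isometry_group.intro)
    show "linear (V t)" for t unfolding V_def
      by (rule linearI) (simp_all add: A.add A'.add A.scaleR A'.scaleR U.U_plus U.U_scale)
    show "((\<lambda>t. V t x) \<longlongrightarrow> x) (at 0)" for x
      using A'.tendsto[OF U.U_tendsto_0[of "A x"]] by (simp add: V_def A)
  qed (simp_all add: V_def n A U.U_add)
  have "gen V x g" if "gen U x g" for x g
    using A'.has_vector_derivative[OF g[OF that, unfolded gen_def]] by (simp add: gen_def V_def A)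
  from isometry_group_eqI[OF U V this] have "A (U t x) = A (V t x)" by simp
  then show ?thesis by (simp add: V_def A)
qed

lemma dirac_gen_map:
  assumes A: "bounded_linear A" "\<And>h F. A (shift h F) = shift h (A F)"
    and c: "\<And>F. A (lin s1 F) = lin s1 (A F)" "\<And>F. A (lin kk F) = lin kk (A F)"
    and g: "dirac_gen \<epsilon> F G"
  shows "dirac_gen \<epsilon> (A F) (A G)"
proof -
  interpret A: bounded_linear A by (rule A)
  obtain u where u: "F = val u" "G = - \<epsilon> *\<^sub>R lin s1 (der u) - lin kk F" using g by (auto simp: dirac_gen_def)
  have "A F = val (map_h1 A u)" "A G = - \<epsilon> *\<^sub>R lin s1 (der (map_h1 A u)) - lin kk (A F)"
    unfolding u by (simp_all add: val_der_map_h1[OF A] A.diff A.scaleR A.neg c)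
  then show ?thesis unfolding dirac_gen_def by blast
qed

lemma has_L2_deriv_iff:
  assumes "\<And>s. s \<in> I \<Longrightarrow> u s \<in> L2_space" "u t \<in> L2_space" "p \<in> L2_space"
  shows "has_L2_deriv u p t I \<longleftrightarrow> ((\<lambda>s. cls (u s)) has_vector_derivative cls p) (at t within I)"
proof -
  have "has_L2_deriv u p t I \<longleftrightarrow> ((\<lambda>s. L2_norm (\<lambda>x. (1 / (s - t)) *\<^sub>R (u s x - u t x) - p x)) \<longlongrightarrow> 0) (at t within I)"
    unfolding has_L2_deriv_def using assms(3) by blast
  also have "\<dots> \<longleftrightarrow> ((\<lambda>s. norm ((1 / (s - t)) *\<^sub>R (cls (u s) - cls (u t)) - cls p)) \<longlongrightarrow> 0) (at t within I)"
  proof (rule tendsto_cong, unfold eventually_at_filter, intro always_eventually allI impI)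
    fix s assume "s \<noteq> t" "s \<in> I"
    then have L: "u s \<in> L2_space" by (simp add: assms)
    have 1: "(\<lambda>x. u s x - u t x) \<in> L2_space" by (rule L2_space_diff[OF L assms(2)])
    have 2: "(\<lambda>x. (1 / (s - t)) *\<^sub>R (u s x - u t x)) \<in> L2_space" by (rule L2_space_scaleR[OF 1])
    have 3: "(\<lambda>x. (1 / (s - t)) *\<^sub>R (u s x - u t x) - p x) \<in> L2_space" by (rule L2_space_diff[OF 2 assms(3)])
    show "L2_norm (\<lambda>x. (1 / (s - t)) *\<^sub>R (u s x - u t x) - p x) = norm ((1 / (s - t)) *\<^sub>R (cls (u s) - cls (u t)) - cls p)"
      using norm_cls[OF 3] cls_diff[OF 2 assms(3)] cls_scaleR[OF 1, of "1 / (s - t)"] cls_diff[OF L assms(2)]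
      by simp
  qed
  also have "\<dots> \<longleftrightarrow> ((\<lambda>s. (1 / (s - t)) *\<^sub>R (cls (u s) - cls (u t)) - cls p) \<longlongrightarrow> 0) (at t within I)"
    by (rule tendsto_norm_zero_iff)
  also have "\<dots> \<longleftrightarrow> ((\<lambda>s. cls (u s)) has_vector_derivative cls p) (at t within I)"
    unfolding has_vector_derivative_iff_tendsto by (rule LIM_zero_iff)
  finally show ?thesis .
qed

lemma dirac_op_AE:
  assumes f: "f \<in> L2_space" and u: "cls f = val u"
  shows "AE x in lebesgue. dirac_op \<epsilon> f x = cs \<i> (\<epsilon> *\<^sub>R (- s1 (ev (der u) x)) - kk (f x))"
  using cls_val_sobolev(3)[OF assms]
proof eventually_elim
  case (elim x)
  then show ?case
    by (simp add: dirac_op_def spinor_eq_iff flip: s1_def) (simp add: scaleR_conv_of_real algebra_simps)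
qed

lemma dirac_gen_cls:
  assumes f: "f \<in> L2_space" and g: "g \<in> L2_space"
  shows "dirac_gen \<epsilon> (cls f) (cls g) \<longleftrightarrow> f \<in> sobolev_H 1 \<and> (AE x in lebesgue. g x = (- \<i>) *s dirac_op \<epsilon> f x)"
proof -
  have key: "cls g = - \<epsilon> *\<^sub>R lin s1 (der u) - lin kk (cls f) \<longleftrightarrow> (AE x in lebesgue. g x = (- \<i>) *s dirac_op \<epsilon> f x)"
    if u: "cls f = val u" for u
  proof -
    let ?G = "- \<epsilon> *\<^sub>R lin s1 (der u) - lin kk (cls f)"
    have "AE x in lebesgue. ev ?G x = (- \<i>) *s dirac_op \<epsilon> f x"
      using dirac_op_AE[OF f u, of \<epsilon>] ev_diff[of "- \<epsilon> *\<^sub>R lin s1 (der u)" "lin kk (cls f)"]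
        ev_scaleR[of "- \<epsilon>" "lin s1 (der u)"] ev_lin[OF bounded_linear_s1, of "der u"] ev_lin[OF bounded_linear_kk, of "cls f"]
        ev_cls[OF f]
    proof eventually_elim
      case (elim x)
      have mi: "- (\<i> *s cs \<i> v) = v" for v by (simp add: spinor_eq_iff)
      show ?case using elim by (simp add: mi)
    qed
    moreover have "cls g = ?G \<longleftrightarrow> (AE x in lebesgue. g x = ev ?G x)"
      using cls_eq_iff[OF g ev_L2, of ?G] by simp
    ultimately show ?thesis by (auto elim: eventually_elim2)
  qed
  show ?thesis
  proof
    assume "dirac_gen \<epsilon> (cls f) (cls g)"
    then obtain u where u: "cls f = val u" "cls g = - \<epsilon> *\<^sub>R lin s1 (der u) - lin kk (cls f)"
      by (auto simp: dirac_gen_def)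
    then show "f \<in> sobolev_H 1 \<and> (AE x in lebesgue. g x = (- \<i>) *s dirac_op \<epsilon> f x)"
      using key[OF u(1)] cls_val_sobolev(1)[OF f u(1)] by blast
  next
    assume R: "f \<in> sobolev_H 1 \<and> (AE x in lebesgue. g x = (- \<i>) *s dirac_op \<epsilon> f x)"
    obtain u where u: "cls f = val u" using sobolev_H1_lift[of f] R by blast
    then show "dirac_gen \<epsilon> (cls f) (cls g)" unfolding dirac_gen_def using key[OF u] R by blast
  qed
qed

lemma lin_cs: "lin (cs a) F = Re a *\<^sub>R F + Im a *\<^sub>R lin (cs \<i>) F"
  using ev_lin[OF bounded_linear_cs, of a F] ev_lin[OF bounded_linear_cs, of \<i> F]
    ev_scaleR[of "Re a" F] ev_scaleR[of "Im a" "lin (cs \<i>) F"] ev_add[of "Re a *\<^sub>R F" "Im a *\<^sub>R lin (cs \<i>) F"]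
  by (intro l2_eqI, eventually_elim) (simp add: spinor_eq_iff complex_eq_iff)

lemma lin_cs_commute: "lin (cs a) (lin s1 F) = lin s1 (lin (cs a) F)" "lin (cs a) (lin kk F) = lin kk (lin (cs a) F)"
proof -
  have "(\<lambda>v. cs a (s1 v)) = (\<lambda>v. s1 (cs a v))" "(\<lambda>v. cs a (kk v)) = (\<lambda>v. kk (cs a v))"
    by (auto simp: spinor_eq_iff)
  then show "lin (cs a) (lin s1 F) = lin s1 (lin (cs a) F)" "lin (cs a) (lin kk F) = lin kk (lin (cs a) F)"
    by (simp_all add: lin_compose)
qed

text \<open>
  Transport plus the skew bounded mass term. Complex linearity holds because multiplication by
  \<open>i\<close> preserves the generator.
\<close>

lemma generated_unitary_group_exists:
  assumes "\<epsilon> \<noteq> 0"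
  shows "\<exists>U. generated_unitary_group (sobolev_H 1) (dirac_op \<epsilon>) U"
proof -
  obtain V where V: "isometry_group V" and gV: "\<And>F G. gen V F G \<longleftrightarrow> dirac_gen \<epsilon> F G"
    using dirac_isometry_group_exists[OF assms] by blast
  interpret V: isometry_group V by fact
  have J: "lin (cs \<i>) (V t F) = V t (lin (cs \<i>) F)" for t F
  proof (rule isometry_group_commute[OF V, where A'="\<lambda>F. - lin (cs \<i>) F"])
    have "lin (cs \<i>) (lin (cs \<i>) F) = - F" for F
    proof -
      have "(\<lambda>v. cs \<i> (cs \<i> v)) = (\<lambda>v. - (\<lambda>v. v) v)" by (auto simp: spinor_eq_iff algebra_simps)
      then have "lin (cs \<i>) (lin (cs \<i>) F) = - lin (\<lambda>v. v) F"
        using lin_minus[OF bounded_linear_ident, of F] by (simp add: lin_compose)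
      then show ?thesis by (simp add: lin_def)
    qed
    then show "lin (cs \<i>) (- lin (cs \<i>) F) = F" "- lin (cs \<i>) (lin (cs \<i>) F) = F" for F
      by (simp_all add: linear_neg bounded_linear.linear)
    show "norm (lin (cs \<i>) F) = norm F" for F by (rule norm_lin_isometry) simp_all
    show "gen V (lin (cs \<i>) F) (lin (cs \<i>) G)" if "gen V F G" for F G
      using that unfolding gV by (rule dirac_gen_map[rotated 4]) (simp_all add: shift_lin lin_cs_commute)
  qed (simp_all add: bounded_linear_minus)
  have C: "lin (cs a) (V t F) = V t (lin (cs a) F)" for a t F
    unfolding lin_cs[of a] by (simp add: J V.U_plus V.U_scale)
  define U where "U t f = ev (V t (cls f))" for t f
  have UL [simp]: "U t f \<in> L2_space" for t f by (simp add: U_def)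
  have clsU [simp]: "cls (U t f) = V t (cls f)" for t f by (simp add: U_def)
  have "generated_unitary_group (sobolev_H 1) (dirac_op \<epsilon>) U"
    unfolding generated_unitary_group_def
  proof (intro conjI allI ballI)
    fix f :: "real \<Rightarrow> spinor" and s t assume f: "f \<in> L2_space"
    show "U t f \<in> L2_space" by simp
    show "L2_norm (U t f) = L2_norm f" using norm_cls[OF UL, of t f] norm_cls[OF f] by simp
    show "AE x in lebesgue. U 0 f x = f x" using ev_cls[OF f] by (simp add: U_def)
    show "AE x in lebesgue. U (s + t) f x = U s (U t f) x" by (simp add: U_def V.U_add)
    show "((\<lambda>t. L2_norm (\<lambda>x. U t f x - f x)) \<longlongrightarrow> 0) (at 0)"
    proof -
      have "L2_norm (\<lambda>x. U t f x - f x) = norm (V t (cls f) - cls f)" for t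
        using norm_cls[OF L2_space_diff[OF UL f]] cls_diff[OF UL f] by simp
      then show ?thesis using tendsto_norm_zero[OF LIM_zero[OF V.U_tendsto_0]] by simp
    qed
    fix g :: "real \<Rightarrow> spinor" assume g: "g \<in> L2_space"
    show "has_L2_deriv (\<lambda>t. U t f) g 0 UNIV \<longleftrightarrow> f \<in> sobolev_H 1 \<and> (AE x in lebesgue. g x = (- \<i>) *s dirac_op \<epsilon> f x)"
      unfolding dirac_gen_cls[OF f g, symmetric] gV[symmetric] gen_def
      by (subst has_L2_deriv_iff) (simp_all add: g)
    fix a b :: complex
    have L: "(\<lambda>x. cs a (f x)) \<in> L2_space" "(\<lambda>x. cs b (g x)) \<in> L2_space"
      by (rule L2_space_linear[OF f bounded_linear_cs] L2_space_linear[OF g bounded_linear_cs])+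
    have "cls (\<lambda>x. a *s f x + b *s g x) = lin (cs a) (cls f) + lin (cs b) (cls g)"
      using cls_add[OF L] by (simp add: lin_cls f g) (simp add: cs_def)
    then have U_comb: "U t (\<lambda>x. a *s f x + b *s g x) = ev (lin (cs a) (V t (cls f)) + lin (cs b) (V t (cls g)))"
      by (simp add: U_def V.U_plus C)
    show "AE x in lebesgue. U t (\<lambda>x. a *s f x + b *s g x) x = a *s U t f x + b *s U t g x"
      using ev_add[of "lin (cs a) (V t (cls f))" "lin (cs b) (V t (cls g))"]
        ev_lin[OF bounded_linear_cs, of a "V t (cls f)"] ev_lin[OF bounded_linear_cs, of b "V t (cls g)"]
      unfolding U_comb
      by eventually_elim (simp add: U_def cs_def)
  qed
  then show ?thesis by blast
qed

text \<open>
  The group is specified by a choice among function-level groups that may differ on null sets.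
  On classes the choice is immaterial: each map respects almost everywhere equality by
  linearity and isometry, and the generator determines the group.
\<close>

definition dgroup :: "real \<Rightarrow> real \<Rightarrow> spinor l2 \<Rightarrow> spinor l2" where
  "dgroup \<epsilon> t F = cls (dirac_group \<epsilon> t (ev F))"

lemma dgroup:
  assumes "\<epsilon> \<noteq> 0"
  shows isometry_group_dgroup: "isometry_group (dgroup \<epsilon>)"
    and gen_dgroup: "gen (dgroup \<epsilon>) F G \<longleftrightarrow> dirac_gen \<epsilon> F G"
    and dirac_group_L2: "f \<in> L2_space \<Longrightarrow> dirac_group \<epsilon> t f \<in> L2_space"
    and cls_dirac_group: "f \<in> L2_space \<Longrightarrow> cls (dirac_group \<epsilon> t f) = dgroup \<epsilon> t (cls f)"
proof -
  define U where "U = dirac_group \<epsilon>"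
  have "generated_unitary_group (sobolev_H 1) (dirac_op \<epsilon>) U"
    unfolding U_def dirac_group_def by (rule someI_ex[OF generated_unitary_group_exists[OF assms]])
  then have U: "\<And>t f. f \<in> L2_space \<Longrightarrow> U t f \<in> L2_space" "\<And>t f. f \<in> L2_space \<Longrightarrow> L2_norm (U t f) = L2_norm f"
    "\<And>t a b f g. f \<in> L2_space \<Longrightarrow> g \<in> L2_space \<Longrightarrow> AE x in lebesgue. U t (\<lambda>x. a *s f x + b *s g x) x = a *s U t f x + b *s U t g x"
    "\<And>f. f \<in> L2_space \<Longrightarrow> AE x in lebesgue. U 0 f x = f x"
    "\<And>s t f. f \<in> L2_space \<Longrightarrow> AE x in lebesgue. U (s + t) f x = U s (U t f) x"
    "\<And>f. f \<in> L2_space \<Longrightarrow> ((\<lambda>t. L2_norm (\<lambda>x. U t f x - f x)) \<longlongrightarrow> 0) (at 0)"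
    "\<And>f g. f \<in> L2_space \<Longrightarrow> g \<in> L2_space \<Longrightarrow> has_L2_deriv (\<lambda>t. U t f) g 0 UNIV \<longleftrightarrow>
        f \<in> sobolev_H 1 \<and> (AE x in lebesgue. g x = (- \<i>) *s dirac_op \<epsilon> f x)"
    unfolding generated_unitary_group_def by blast+
  have lc: "cls (U t (\<lambda>x. a *s f x + b *s g x)) = lin (cs a) (cls (U t f)) + lin (cs b) (cls (U t g))"
    if f: "f \<in> L2_space" "g \<in> L2_space" for t a b f g
  proof -
    have L: "(\<lambda>x. cs a (U t f x)) \<in> L2_space" "(\<lambda>x. cs b (U t g x)) \<in> L2_space"
      by (rule L2_space_linear[OF U(1)[OF f(1)] bounded_linear_cs] L2_space_linear[OF U(1)[OF f(2)] bounded_linear_cs])+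
    have "(\<lambda>x. a *s f x + b *s g x) \<in> L2_space"
      using L2_space_add[OF L2_space_linear[OF f(1) bounded_linear_cs[of a]] L2_space_linear[OF f(2) bounded_linear_cs[of b]]]
      by (simp add: cs_def)
    from cls_cong[OF U(1)[OF this] U(3)[OF f]]
    show ?thesis using cls_add[OF L] by (simp add: lin_cls U f) (simp add: cs_def)
  qed
  have one: "lin (cs 1) F = F" "lin (cs (- 1)) F = - F" "lin (cs 0) F = 0" "lin (cs (of_real r)) F = r *\<^sub>R F" for F r
    using lin_cs[of 1 F] lin_cs[of "-1" F] lin_cs[of 0 F] lin_cs[of "of_real r" F] by simp_all
  have cong: "cls (U t f) = cls (U t g)" if f: "f \<in> L2_space" "g \<in> L2_space" and fg: "AE x in lebesgue. f x = g x" for t f g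
  proof -
    let ?d = "\<lambda>x. 1 *s f x + (- 1) *s g x"
    have d: "?d = (\<lambda>x. f x - g x)" by (auto simp: spinor_eq_iff)
    have dL: "?d \<in> L2_space" unfolding d by (rule L2_space_diff[OF f])
    have "cls f = cls g" by (rule cls_cong[OF f(1) fg])
    then have "norm (cls ?d) = 0" unfolding d using cls_diff[OF f] by simp
    then have "norm (cls (U t ?d)) = 0" using U(2)[OF dL, of t] norm_cls[OF dL] norm_cls[OF U(1)[OF dL], of t] by simp
    then show ?thesis using lc[OF f, of t 1 "-1"] by (simp add: one)
  qed
  have S: "cls (U t f) = dgroup \<epsilon> t (cls f)" if f: "f \<in> L2_space" for t f
    unfolding dgroup_def U_def[symmetric]
    by (rule cong[OF f ev_L2]) (use ev_cls[OF f] in \<open>auto elim: eventually_mono\<close>)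
  show "f \<in> L2_space \<Longrightarrow> dirac_group \<epsilon> t f \<in> L2_space" using U(1) by (simp add: U_def)
  show "f \<in> L2_space \<Longrightarrow> cls (dirac_group \<epsilon> t f) = dgroup \<epsilon> t (cls f)" using S by (simp add: U_def)
  have Se: "dgroup \<epsilon> t F = cls (U t (ev F))" for t F by (simp add: dgroup_def U_def)
  show "isometry_group (dgroup \<epsilon>)"
  proof (rule isometry_group.intro)
    fix s t F
    have comb: "dgroup \<epsilon> t (cls (\<lambda>x. a *s ev F x + b *s ev G x)) = lin (cs a) (dgroup \<epsilon> t F) + lin (cs b) (dgroup \<epsilon> t G)" for F G a b
    proof -
      have "(\<lambda>x. a *s ev F x + b *s ev G x) \<in> L2_space"
        using L2_space_add[OF L2_space_linear[OF ev_L2 bounded_linear_cs[of a]] L2_space_linear[OF ev_L2 bounded_linear_cs[of b]], of F G]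
        by (simp add: cs_def)
      from S[OF this, of t] show ?thesis using lc[OF ev_L2[of F] ev_L2[of G], of t a b] by (simp add: Se)
    qed
    have c1: "cls (\<lambda>x. 1 *s ev F x + 1 *s ev G x) = F + G" for F G :: "spinor l2"
      using cls_add[OF ev_L2[of F] ev_L2[of G]] by simp
    have c2: "cls (\<lambda>x. complex_of_real r *s ev F x + 0 *s ev F x) = r *\<^sub>R F" for F :: "spinor l2" and r
    proof -
      have "(\<lambda>x. complex_of_real r *s ev F x + 0 *s ev F x) = (\<lambda>x. r *\<^sub>R ev F x)"
        by (rule ext) (simp add: spinor_eq_iff, simp add: scaleR_conv_of_real)
      then show ?thesis using cls_scaleR[OF ev_L2[of F], of r] by simp
    qed
    show "linear (dgroup \<epsilon> t)"
    proof (rule linearI)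
      show "dgroup \<epsilon> t (F + G) = dgroup \<epsilon> t F + dgroup \<epsilon> t G" for F G
        using comb[of 1 F 1 G] by (simp only: c1 one)
      show "dgroup \<epsilon> t (r *\<^sub>R F) = r *\<^sub>R dgroup \<epsilon> t F" for r F
        using comb[of "of_real r" F 0 F] by (simp only: c2 one) simp
    qed
    show "norm (dgroup \<epsilon> t F) = norm F"
      using norm_cls[OF U(1)[OF ev_L2[of F], of t]] U(2)[OF ev_L2[of F], of t] by (simp add: Se norm_l2_L2[of F])
    show "dgroup \<epsilon> 0 F = F" unfolding Se using cls_cong[OF U(1)[OF ev_L2] U(4)[OF ev_L2, of F]] by simp
    show "dgroup \<epsilon> s (dgroup \<epsilon> t F) = dgroup \<epsilon> (s + t) F"
      using S[OF U(1)[OF ev_L2[of F], of t], of s] cls_cong[OF U(1)[OF ev_L2] U(5)[OF ev_L2, of s t F]] by (simp add: Se)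
    have "L2_norm (\<lambda>x. U t (ev F) x - ev F x) = norm (dgroup \<epsilon> t F - F)" for t
      using norm_cls[OF L2_space_diff[OF U(1)[OF ev_L2] ev_L2]] cls_diff[OF U(1)[OF ev_L2] ev_L2] by (simp add: Se)
    then have "((\<lambda>t. norm (dgroup \<epsilon> t F - F)) \<longlongrightarrow> 0) (at 0)" using U(6)[OF ev_L2, of F] by simp
    then show "((\<lambda>t. dgroup \<epsilon> t F) \<longlongrightarrow> F) (at 0)" by (rule LIM_zero_cancel[OF tendsto_norm_zero_cancel])
  qed
  show "gen (dgroup \<epsilon>) F G \<longleftrightarrow> dirac_gen \<epsilon> F G"
  proof -
    have "gen (dgroup \<epsilon>) F G \<longleftrightarrow> has_L2_deriv (\<lambda>t. U t (ev F)) (ev G) 0 UNIV"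
      by (subst has_L2_deriv_iff) (simp_all add: U gen_def Se)
    also have "\<dots> \<longleftrightarrow> dirac_gen \<epsilon> (cls (ev F)) (cls (ev G))"
      unfolding U(7)[OF ev_L2 ev_L2] dirac_gen_cls[OF ev_L2 ev_L2] ..
    finally show ?thesis by simp
  qed
qed

text \<open>
  Constant coefficients: translations preserve the generator. Therefore the group acts on
  \<open>H\<^sup>1\<close> and commutes with the derivative.
\<close>

lemma dgroup_shift:
  assumes "\<epsilon> \<noteq> 0"
  shows "dgroup \<epsilon> t (shift h F) = shift h (dgroup \<epsilon> t F)"
proof (rule isometry_group_commute[OF isometry_group_dgroup[OF assms], where A="shift h" and A'="shift (-h)", symmetric])
  show "gen (dgroup \<epsilon>) (shift h F) (shift h G)" if "gen (dgroup \<epsilon>) F G" for F G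
    using that unfolding gen_dgroup[OF assms]
    by (rule dirac_gen_map[rotated 4]) (simp_all add: bounded_linear_shift shift_shift shift_lin add.commute)
qed (simp_all add: bounded_linear_shift)

section \<open>Comparison of the Dirac group with its mass part\<close>

text \<open>
  \<open>exp (- i r \<sigma>\<^sub>3)\<close>, the group of the mass term alone.
\<close>

definition ro :: "real \<Rightarrow> spinor \<Rightarrow> spinor" where "ro r v = cos r *\<^sub>R v - sin r *\<^sub>R kk v"

lemma ro_nth: "ro r v $ 1 = cis (- r) * v $ 1" "ro r v $ 2 = cis r * v $ 2"
  by (simp_all add: ro_def complex_eq_iff)

lemma norm_ro [simp]: "norm (ro r v) = norm v"
  by (simp add: norm_spinor ro_nth norm_mult)

lemma bounded_linear_ro [simp]: "bounded_linear (ro r)"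
  unfolding ro_def[abs_def]
  by (intro bounded_linear_sub bounded_linear_const_scaleR bounded_linear_ident bounded_linear_kk)

lemma ro_ro: "ro r (ro s v) = ro (r + s) v"
  by (simp add: spinor_eq_iff ro_nth flip: mult.assoc) (simp add: cis_mult add.commute)

lemma ro_0 [simp]: "ro 0 v = v" by (simp add: ro_def)

definition rot :: "real \<Rightarrow> spinor l2 \<Rightarrow> spinor l2" where "rot r = lin (ro r)"

lemma bounded_linear_rot [simp]: "bounded_linear (rot r)" by (simp add: rot_def)
lemma norm_rot [simp]: "norm (rot r F) = norm F" unfolding rot_def by (rule norm_lin_isometry) simp_all
lemma rot_shift: "rot r (shift h F) = shift h (rot r F)" by (simp add: rot_def shift_lin)
lemma rot_rot: "rot r (rot s F) = rot (r + s) F" by (simp add: rot_def lin_compose ro_ro)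
lemma rot_0 [simp]: "rot 0 F = F" by (simp add: rot_def lin_def)

lemma rot_eq: "rot r F = cos r *\<^sub>R F - sin r *\<^sub>R lin kk F"
  unfolding rot_def
  using ev_lin[OF bounded_linear_ro, of r F] ev_lin[OF bounded_linear_kk, of F] ev_scaleR[of "cos r" F]
    ev_scaleR[of "sin r" "lin kk F"] ev_diff[of "cos r *\<^sub>R F" "sin r *\<^sub>R lin kk F"]
  by (intro l2_eqI, eventually_elim) (simp add: ro_def)

lemma lin_kk_linear: "lin kk (F + G) = lin kk F + lin kk G" "lin kk (c *\<^sub>R F) = c *\<^sub>R lin kk F"
  "lin kk (F - G) = lin kk F - lin kk G" "lin kk (- F) = - lin kk F"
proof -
  interpret l: bounded_linear "lin kk" by simp
  show "lin kk (F + G) = lin kk F + lin kk G" "lin kk (c *\<^sub>R F) = c *\<^sub>R lin kk F"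
    "lin kk (F - G) = lin kk F - lin kk G" "lin kk (- F) = - lin kk F"
    by (simp_all add: l.add l.scaleR l.diff l.neg)
qed

text \<open>
  \<open>\<sigma>\<^sub>1\<close> and \<open>\<sigma>\<^sub>3\<close> anticommute, so moving
  \<open>\<sigma>\<^sub>1\<close> through the rotation reverses it. This is the source of all
  oscillations.
\<close>

lemma lin_s1_rot: "lin s1 (rot r F) = rot (- r) (lin s1 F)"
  by (simp add: rot_eq lin_s1_linear lin_kk_s1 lin_kk_linear)

lemma rot_derivative: "((\<lambda>r. rot (c * r) F) has_vector_derivative (- c) *\<^sub>R lin kk (rot (c * r) F)) (at r)"
proof -
  have "((\<lambda>r. cos (c * r)) has_real_derivative - sin (c * r) * c) (at r)"
    "((\<lambda>r. sin (c * r)) has_real_derivative cos (c * r) * c) (at r)"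
    by (auto intro!: derivative_eq_intros)
  then have "((\<lambda>r. cos (c * r) *\<^sub>R F - sin (c * r) *\<^sub>R lin kk F) has_vector_derivative
      (- sin (c * r) * c) *\<^sub>R F - (cos (c * r) * c) *\<^sub>R lin kk F) (at r)"
    by (intro has_vector_derivative_diff)
       (auto intro!: derivative_eq_intros simp: has_real_derivative_iff_has_vector_derivative)
  moreover have "(- sin (c * r) * c) *\<^sub>R F - (cos (c * r) * c) *\<^sub>R lin kk F = (- c) *\<^sub>R lin kk (rot (c * r) F)"
    by (simp add: rot_eq lin_kk_linear algebra_simps)
  ultimately show ?thesis by (simp add: rot_eq)
qed

lemma dirac_gen_val: "dirac_gen \<epsilon> (val u) (- \<epsilon> *\<^sub>R lin s1 (der u) - lin kk (val u))"
  unfolding dirac_gen_def by blast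

lemma rot_dirac_gen: "dirac_gen \<epsilon> (rot r (val u)) (- \<epsilon> *\<^sub>R rot (- r) (lin s1 (der u)) - lin kk (rot r (val u)))"
  using dirac_gen_val[of \<epsilon> "map_h1 (rot r) u"] by (simp add: val_der_map_h1 rot_shift lin_s1_rot)

context
  fixes \<epsilon> :: real
  assumes \<epsilon>: "0 < \<epsilon>"
begin

interpretation S: isometry_group "dgroup \<epsilon>"
  using isometry_group_dgroup[of \<epsilon>] \<epsilon> by simp

text \<open>
  The mass terms cancel, and the remaining derivative term carries the doubled rotation.
\<close>

lemma twisted_derivative:
  "((\<lambda>r. dgroup \<epsilon> (- r) (rot r (val v))) has_vector_derivative \<epsilon> *\<^sub>R dgroup \<epsilon> (- r) (rot (- r) (lin s1 (der v)))) (at r)"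
proof -
  have g: "gen (dgroup \<epsilon>) (rot r (val v)) (- \<epsilon> *\<^sub>R rot (- r) (lin s1 (der v)) - lin kk (rot r (val v)))"
    using rot_dirac_gen \<epsilon> by (simp add: gen_dgroup)
  have "((\<lambda>r. rot r (val v)) has_vector_derivative - lin kk (rot r (val v))) (at r)"
    using rot_derivative[of 1] by simp
  from S.curve_derivative[OF this g, of "-1"] show ?thesis by (simp add: S.U_scale)
qed

text \<open>
  Here the mass terms add up instead of cancelling. Up to a term of size
  \<open>\<epsilon>\<close> the derivative is a multiple of the oscillating derivative in the
  preceding lemma, so this curve is an approximate antiderivative of it.
\<close>

lemma counter_twisted_derivative:
  assumes "h1D v v1"
  shows "((\<lambda>r. dgroup \<epsilon> (- r) (rot (- r) (lin kk (lin s1 (der v))))) has_vector_derivative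
    \<epsilon> *\<^sub>R dgroup \<epsilon> (- r) (rot r (lin s1 (lin kk (lin s1 (der v1))))) - 2 *\<^sub>R dgroup \<epsilon> (- r) (rot (- r) (lin s1 (der v)))) (at r)"
proof -
  define w where "w = map_h1 (\<lambda>F. lin kk (lin s1 F)) v1"
  have A: "bounded_linear (\<lambda>F. lin kk (lin s1 F))" by (intro bounded_linear_compose[of "lin kk" "lin s1"]) simp_all
  have w: "val w = lin kk (lin s1 (der v))" "der w = lin kk (lin s1 (der v1))"
    using assms unfolding w_def h1D_def by (simp_all add: val_der_map_h1[OF A] shift_lin)
  have g: "gen (dgroup \<epsilon>) (rot (- r) (val w)) (- \<epsilon> *\<^sub>R rot r (lin s1 (der w)) - lin kk (rot (- r) (val w)))"
    using rot_dirac_gen[of \<epsilon> "- r" w] \<epsilon> by (simp add: gen_dgroup)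
  have "((\<lambda>r. rot (- r) (val w)) has_vector_derivative lin kk (rot (- r) (val w))) (at r)"
    using rot_derivative[of "-1"] by simp
  from S.curve_derivative[OF this g, of "-1"]
  have "((\<lambda>r. dgroup \<epsilon> (- r) (rot (- r) (val w))) has_vector_derivative
      dgroup \<epsilon> (- r) (2 *\<^sub>R lin kk (rot (- r) (val w)) + \<epsilon> *\<^sub>R rot r (lin s1 (der w)))) (at r)"
    by (simp add: scaleR_2 algebra_simps)
  moreover have "lin kk (rot (- r) (val w)) = - rot (- r) (lin s1 (der v))"
    by (simp add: w rot_eq lin_kk_linear)
  ultimately show ?thesis by (simp add: w S.U_plus S.U_diff S.U_scale linear_neg[OF S.linear_U])
qed

text \<open>
  First-order comparison: the derivative of the twisted curve has norm at most
  \<open>\<epsilon>\<close> times that of the derivative of \<open>v\<close>.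
\<close>

lemma mass_comparison_1:
  "norm (dgroup \<epsilon> (- r) (rot r (val v)) - val v) \<le> \<epsilon> * \<bar>r\<bar> * norm (der v)"
proof -
  have "norm ((\<lambda>r. dgroup \<epsilon> (- r) (rot r (val v)) - val v) r) \<le> (\<epsilon> * norm (der v)) * \<bar>r\<bar> ^ Suc 0 / real (Suc 0)"
  proof (rule antiderivative_power_bound)
    show "((\<lambda>r. dgroup \<epsilon> (- r) (rot r (val v)) - val v) has_vector_derivative
      \<epsilon> *\<^sub>R dgroup \<epsilon> (- s) (rot (- s) (lin s1 (der v)))) (at s)" for s
      using has_vector_derivative_diff_const[THEN iffD2, OF twisted_derivative] by simp
  qed (use \<epsilon> in auto)
  then show ?thesis by (simp add: mult_ac)
qed

text \<open>
  Integration by parts in \<open>r\<close>. Adding \<open>\<epsilon> / 2\<close> times the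
  counter-twisted curve \<open>m\<close> removes the oscillating derivative of order
  \<open>\<epsilon>\<close>; what remains has order \<open>\<epsilon>\<^sup>2\<close> and
  costs one more space derivative. The corrector itself is of size \<open>\<epsilon>\<close>,
  uniformly in \<open>r\<close>.
\<close>

lemma mass_comparison_2:
  assumes "h1D v v1"
  shows "norm (dgroup \<epsilon> (- r) (rot r (val v)) - val v) \<le> \<epsilon> * norm (der v) + \<epsilon>\<^sup>2 * \<bar>r\<bar> * norm (der v1)"
proof -
  \<comment> \<open>the corrector\<close>
  define m where "m r = dgroup \<epsilon> (- r) (rot (- r) (lin kk (lin s1 (der v))))" for r
  have m: "norm (m r) = norm (der v)" for r by (simp add: m_def)
  define Y where "Y r = dgroup \<epsilon> (- r) (rot r (val v)) + (\<epsilon> / 2) *\<^sub>R m r" for r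
  have Y': "(Y has_vector_derivative (\<epsilon>\<^sup>2 / 2) *\<^sub>R dgroup \<epsilon> (- s) (rot s (lin s1 (lin kk (lin s1 (der v1)))))) (at s)" for s
  proof -
    have "((\<lambda>r. (\<epsilon> / 2) *\<^sub>R m r) has_vector_derivative
      (\<epsilon> / 2) *\<^sub>R (\<epsilon> *\<^sub>R dgroup \<epsilon> (- s) (rot s (lin s1 (lin kk (lin s1 (der v1))))) - 2 *\<^sub>R dgroup \<epsilon> (- s) (rot (- s) (lin s1 (der v))))) (at s)"
      unfolding m_def
      by (rule bounded_linear.has_vector_derivative[OF bounded_linear_scaleR_right counter_twisted_derivative[OF assms]])
    from has_vector_derivative_add[OF twisted_derivative[of v s] this]
    show ?thesis unfolding Y_def[abs_def]
      by (simp add: scaleR_diff_right power2_eq_square)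
  qed
  have "norm ((\<lambda>r. Y r - Y 0) r) \<le> (\<epsilon>\<^sup>2 / 2 * norm (der v1)) * \<bar>r\<bar> ^ Suc 0 / real (Suc 0)"
  proof (rule antiderivative_power_bound)
    show "((\<lambda>r. Y r - Y 0) has_vector_derivative
      (\<epsilon>\<^sup>2 / 2) *\<^sub>R dgroup \<epsilon> (- s) (rot s (lin s1 (lin kk (lin s1 (der v1)))))) (at s)" for s
      using has_vector_derivative_diff_const[THEN iffD2, OF Y'] by simp
  qed auto
  then have Yb: "norm (Y r - Y 0) \<le> \<epsilon>\<^sup>2 * \<bar>r\<bar> * norm (der v1)"
  proof (rule order_trans)
    have "0 \<le> \<epsilon>\<^sup>2 * \<bar>r\<bar> * norm (der v1)" by simp
    moreover have "\<epsilon>\<^sup>2 / 2 * norm (der v1) * \<bar>r\<bar> ^ Suc 0 / real (Suc 0) = (\<epsilon>\<^sup>2 * \<bar>r\<bar> * norm (der v1)) / 2" by simp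
    ultimately show "\<epsilon>\<^sup>2 / 2 * norm (der v1) * \<bar>r\<bar> ^ Suc 0 / real (Suc 0) \<le> \<epsilon>\<^sup>2 * \<bar>r\<bar> * norm (der v1)" by linarith
  qed
  have eq: "dgroup \<epsilon> (- r) (rot r (val v)) - val v = (Y r - Y 0) - (\<epsilon> / 2) *\<^sub>R (m r - m 0)"
    by (simp add: Y_def algebra_simps)
  have "norm ((\<epsilon> / 2) *\<^sub>R (m r - m 0)) \<le> \<epsilon> / 2 * (norm (der v) + norm (der v))"
    using norm_triangle_ineq4[of "m r" "m 0"] \<epsilon> by (simp add: m)
  then show ?thesis
    unfolding eq using norm_triangle_ineq4[of "Y r - Y 0" "(\<epsilon> / 2) *\<^sub>R (m r - m 0)"] Yb by simp
qed

end

section \<open>The comparison in \<open>H\<^sup>1\<close>\<close>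

definition hgroup :: "real \<Rightarrow> real \<Rightarrow> spinor h1 \<Rightarrow> spinor h1" where "hgroup \<epsilon> t = map_h1 (dgroup \<epsilon> t)"
definition hrot :: "real \<Rightarrow> spinor h1 \<Rightarrow> spinor h1" where "hrot r = map_h1 (rot r)"

lemma val_der_hrot [simp]: "val (hrot r u) = rot r (val u)" "der (hrot r u) = rot r (der u)"
  by (simp_all add: hrot_def val_der_map_h1 rot_shift)

lemma norm_hrot [simp]: "norm (hrot r u) = norm u"
  by (simp add: norm_h1)

lemma hrot_hrot: "hrot r (hrot s u) = hrot (r + s) u" and hrot_0 [simp]: "hrot 0 u = u"
  by (auto intro!: h1_eqI simp: rot_rot)

lemma h1D_hrot: "h1D u v \<Longrightarrow> h1D (hrot r u) (hrot r v)"
  by (simp add: h1D_def)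

lemma val_der_hgroup:
  assumes "\<epsilon> \<noteq> 0"
  shows "val (hgroup \<epsilon> t u) = dgroup \<epsilon> t (val u)" "der (hgroup \<epsilon> t u) = dgroup \<epsilon> t (der u)"
proof -
  interpret isometry_group "dgroup \<epsilon>" by (rule isometry_group_dgroup[OF assms])
  show "val (hgroup \<epsilon> t u) = dgroup \<epsilon> t (val u)" "der (hgroup \<epsilon> t u) = dgroup \<epsilon> t (der u)"
    unfolding hgroup_def by (rule val_der_map_h1[OF bounded_linear_U dgroup_shift[OF assms]])+
qed

lemma isometry_group_hgroup:
  assumes "\<epsilon> \<noteq> 0"
  shows "isometry_group (hgroup \<epsilon>)"
proof -
  interpret isometry_group "dgroup \<epsilon>" by (rule isometry_group_dgroup[OF assms])
  note vd = val_der_hgroup[OF assms]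
  show ?thesis
  proof (rule isometry_group.intro)
    show "linear (hgroup \<epsilon> t)" for t
      by (rule linearI; rule h1_eqI) (simp_all add: vd U_plus U_scale)
    show "((\<lambda>t. hgroup \<epsilon> t u) \<longlongrightarrow> u) (at 0)" for u
      by (rule h1_tendstoI) (simp_all add: vd U_tendsto_0)
  qed (auto intro!: h1_eqI simp: vd U_add norm_h1)
qed

text \<open>
  The comparison in \<open>H\<^sup>1\<close> consumes two derivatives. Regularity is therefore
  recorded as a chain of derivatives inside \<open>H\<^sup>1\<close> with one common bound,
  which is easy to propagate through products.
\<close>

definition H3 :: "real \<Rightarrow> 'a::euclidean_space h1 \<Rightarrow> bool" where
  "H3 C u \<longleftrightarrow> (\<exists>u1 u2. h1D u u1 \<and> h1D u1 u2 \<and> norm u \<le> C \<and> norm u1 \<le> C \<and> norm u2 \<le> C)"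

lemma H3_norm: "H3 C u \<Longrightarrow> norm u \<le> C" by (auto simp: H3_def)

lemma H3_hrot: "H3 C u \<Longrightarrow> H3 C (hrot r u)"
  unfolding H3_def using h1D_hrot norm_hrot by metis

text \<open>
  The two comparisons at \<open>r = s / \<epsilon>\<^sup>2\<close> give \<open>s /
  \<epsilon>\<close> and \<open>\<epsilon> + s\<close>, hence the minimum; they are applied to
  \<open>u\<close> and to its derivative.
\<close>

lemma mass_comparison_h1:
  assumes \<epsilon>: "0 < \<epsilon>" "\<epsilon> \<le> 1" and u: "H3 C u" and s: "0 \<le> s"
  shows "norm (hgroup \<epsilon> (- (s / \<epsilon>\<^sup>2)) (hrot (s / \<epsilon>\<^sup>2) u) - u) \<le> 2 * C * (s + min \<epsilon> (s / \<epsilon>))"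
    and "norm (hgroup \<epsilon> (s / \<epsilon>\<^sup>2) (hrot (- (s / \<epsilon>\<^sup>2)) u) - u) \<le> 2 * C * (s + min \<epsilon> (s / \<epsilon>))"
proof -
  obtain u1 u2 where u12: "h1D u u1" "h1D u1 u2" "norm u \<le> C" "norm u1 \<le> C" "norm u2 \<le> C" using u by (auto simp: H3_def)
  have C0: "0 \<le> C" using u12(3) norm_ge_zero order_trans by blast
  have main: "norm (hgroup \<epsilon> (- r) (hrot r u) - u) \<le> 2 * C * (s + min \<epsilon> (s / \<epsilon>))" if r: "\<bar>r\<bar> = s / \<epsilon>\<^sup>2" for r
  proof -
    have e: "\<epsilon> * \<bar>r\<bar> = s / \<epsilon>" "\<epsilon>\<^sup>2 * \<bar>r\<bar> = s" using \<epsilon> by (simp_all add: r power2_eq_square)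
    let ?d0 = "norm (dgroup \<epsilon> (- r) (rot r (val u)) - val u)"
    let ?d1 = "norm (dgroup \<epsilon> (- r) (rot r (val u1)) - val u1)"
    have n: "norm (der u) \<le> C" "norm (der u1) \<le> C" "norm (der u2) \<le> C"
      using u12 norm_der_le order_trans by blast+
    have a: "?d0 \<le> s / \<epsilon> * C" "?d1 \<le> s / \<epsilon> * C"
    proof -
      have "s / \<epsilon> * norm (der u) \<le> s / \<epsilon> * C" "s / \<epsilon> * norm (der u1) \<le> s / \<epsilon> * C"
        using n \<epsilon> s by (intro mult_left_mono; simp)+
      then show "?d0 \<le> s / \<epsilon> * C" "?d1 \<le> s / \<epsilon> * C"
        using mass_comparison_1[OF \<epsilon>(1), of r u] mass_comparison_1[OF \<epsilon>(1), of r u1] unfolding e by linarith+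
    qed
    have b: "?d0 \<le> (\<epsilon> + s) * C" "?d1 \<le> (\<epsilon> + s) * C"
    proof -
      have "\<epsilon> * norm (der u) \<le> \<epsilon> * C" "\<epsilon> * norm (der u1) \<le> \<epsilon> * C" "s * norm (der u1) \<le> s * C" "s * norm (der u2) \<le> s * C"
        using n \<epsilon> s by (intro mult_left_mono; simp)+
      then show "?d0 \<le> (\<epsilon> + s) * C" "?d1 \<le> (\<epsilon> + s) * C"
        using mass_comparison_2[OF \<epsilon>(1) u12(1), of r] mass_comparison_2[OF \<epsilon>(1) u12(2), of r] unfolding e distrib_right by linarith+
    qed
    have d: "d \<le> C * (s + min \<epsilon> (s / \<epsilon>))" if "d \<le> s / \<epsilon> * C" "d \<le> (\<epsilon> + s) * C" for d
    proof (cases "\<epsilon> \<le> s / \<epsilon>")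
      case True then show ?thesis using that(2) by (simp add: algebra_simps)
    next
      case False
      have "0 \<le> s * C" using s C0 by simp
      then show ?thesis using that(1) False by (simp add: algebra_simps)
    qed
    have ne: "\<epsilon> \<noteq> 0" using \<epsilon> by simp
    have "norm (hgroup \<epsilon> (- r) (hrot r u) - u) \<le> ?d0 + ?d1"
      using norm_h1_le[of "hgroup \<epsilon> (- r) (hrot r u) - u"] u12(1) by (simp add: val_der_hgroup[OF ne] h1D_def)
    also have "\<dots> \<le> C * (s + min \<epsilon> (s / \<epsilon>)) + C * (s + min \<epsilon> (s / \<epsilon>))"
      by (intro add_mono d a b)
    finally show ?thesis by simp
  qed
  show "norm (hgroup \<epsilon> (- (s / \<epsilon>\<^sup>2)) (hrot (s / \<epsilon>\<^sup>2) u) - u) \<le> 2 * C * (s + min \<epsilon> (s / \<epsilon>))"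
    by (rule main) (use s in simp)
  show "norm (hgroup \<epsilon> (s / \<epsilon>\<^sup>2) (hrot (- (s / \<epsilon>\<^sup>2)) u) - u) \<le> 2 * C * (s + min \<epsilon> (s / \<epsilon>))"
    using main[of "- (s / \<epsilon>\<^sup>2)"] s by simp
qed

section \<open>Exponential flows with state-dependent generators\<close>

text \<open>
  The nonlinear substep is \<open>exp (\<tau> M v) v\<close> with a generator \<open>M
  v\<close> frozen at the initial value. Its power series stays inside
  \<open>H\<^sup>1\<close> and yields all estimates from bounds on \<open>M\<close>, without
  calculus for the superposition operator of an exponential.
\<close>

locale flow_estimates =
  fixes M :: "'h::banach \<Rightarrow> 'h \<Rightarrow> 'h" and R K :: real
  assumes linear_M: "linear (M v)"
    and M_bound: "norm v \<le> R \<Longrightarrow> norm (M v w) \<le> K * norm w"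
    and M_lipschitz: "norm v \<le> R \<Longrightarrow> norm v' \<le> R \<Longrightarrow> norm (M v w - M v' w) \<le> K * norm (v - v') * norm w"
    and R: "0 \<le> R" and K: "0 \<le> K"
begin

definition flow_term :: "real \<Rightarrow> 'h \<Rightarrow> nat \<Rightarrow> 'h" where
  "flow_term \<tau> v k = (\<tau> ^ k / fact k) *\<^sub>R (M v ^^ k) v"

lemma power_bound:
  assumes "norm v \<le> R"
  shows "norm ((M v ^^ k) v) \<le> K ^ k * R"
proof (induction k)
  case (Suc k)
  have "norm (M v ((M v ^^ k) v)) \<le> K * norm ((M v ^^ k) v)" by (rule M_bound[OF assms])
  also have "\<dots> \<le> K * (K ^ k * R)" by (intro mult_left_mono Suc K)
  finally show ?case by (simp add: mult.assoc)
qed (use assms in simp)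

text \<open>
  Telescoping: each of the \<open>k\<close> factors contributes one difference of generators,
  applied to a vector of norm at most \<open>K\<^sup>j R\<close>.
\<close>

lemma power_lipschitz:
  assumes v: "norm v \<le> R" "norm v' \<le> R"
  shows "norm ((M v ^^ k) v - (M v' ^^ k) v') \<le> K ^ k * (1 + real k * R) * norm (v - v')"
proof (induction k)
  case (Suc k)
  let ?a = "(M v ^^ k) v" and ?b = "(M v' ^^ k) v'"
  have eq: "M v ?a - M v' ?b = M v (?a - ?b) + (M v ?b - M v' ?b)" by (simp add: linear_diff[OF linear_M])
  have "norm (M v (?a - ?b)) \<le> K * (K ^ k * (1 + real k * R) * norm (v - v'))"
    by (rule order_trans[OF M_bound[OF v(1)]]) (intro mult_left_mono Suc K)
  moreover have "norm (M v ?b - M v' ?b) \<le> K * norm (v - v') * (K ^ k * R)"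
    by (rule order_trans[OF M_lipschitz[OF v]]) (intro mult_left_mono power_bound v mult_nonneg_nonneg K norm_ge_zero)
  ultimately have "norm (M v ?a - M v' ?b) \<le> K * (K ^ k * (1 + real k * R) * norm (v - v')) + K * norm (v - v') * (K ^ k * R)"
    unfolding eq by (rule norm_triangle_le[OF add_mono])
  then show ?case by (simp add: algebra_simps)
qed simp

lemma summable_exp_K: "summable (\<lambda>k. c * (K ^ k / fact k))"
  using summable_exp_generic[of K] by (intro summable_mult) (simp add: field_simps)

lemma suminf_exp_K: "(\<Sum>k. c * (K ^ k / fact k)) = c * exp K"
  using suminf_mult[OF summable_exp_K[of 1], of c] by (simp add: exp_def field_simps)

lemma summable_flow_term:
  assumes "norm v \<le> R" "0 \<le> \<tau>" "\<tau> \<le> 1"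
  shows "summable (flow_term \<tau> v)"
proof (rule summable_comparison_test'[OF summable_exp_K[of R]])
  fix k
  have "\<tau> ^ k \<le> 1" using assms by (intro power_le_one)
  then have "\<tau> ^ k / fact k * norm ((M v ^^ k) v) \<le> 1 / fact k * (K ^ k * R)"
    using assms by (intro mult_mono divide_right_mono power_bound) auto
  then show "norm (flow_term \<tau> v k) \<le> R * (K ^ k / fact k)"
    using assms by (simp add: flow_term_def field_simps)
qed

definition flow :: "real \<Rightarrow> 'h \<Rightarrow> 'h" where "flow \<tau> v = (\<Sum>k. flow_term \<tau> v k)"

lemma flow_sums: "norm v \<le> R \<Longrightarrow> 0 \<le> \<tau> \<Longrightarrow> \<tau> \<le> 1 \<Longrightarrow> flow_term \<tau> v sums flow \<tau> v"
  unfolding flow_def by (rule summable_sums[OF summable_flow_term])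

text \<open>
  The term of order zero contributes exactly \<open>1\<close>, so that the Lipschitz constant
  is \<open>1 + O(\<tau>)\<close> and its powers over \<open>T / \<tau>\<close> steps stay
  bounded.
\<close>

lemma flow_lipschitz:
  assumes v: "norm v \<le> R" "norm v' \<le> R" and \<tau>: "0 \<le> \<tau>" "\<tau> \<le> 1"
  shows "norm (flow \<tau> v - flow \<tau> v') \<le> (1 + \<tau> * ((1 + R) * K * exp K)) * norm (v - v')"
proof -
  let ?d = "\<lambda>k. flow_term \<tau> v k - flow_term \<tau> v' k"
  have s: "summable ?d" by (intro summable_diff summable_flow_term v \<tau>)
  have b: "norm (?d (Suc k)) \<le> (\<tau> * (1 + R) * K * norm (v - v')) * (K ^ k / fact k)" for k
  proof -
    have t: "\<tau> ^ Suc k \<le> \<tau>" using \<tau> power_le_one[of \<tau> k] mult_left_mono[of "\<tau> ^ k" 1 \<tau>] by simp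
    \<comment> \<open>absorbs the constant so that \<open>k + 1\<close> cancels against the factorial\<close>
    have k: "1 + real (Suc k) * R \<le> real (Suc k) * (1 + R)" using R by (simp add: algebra_simps)
    have "norm (?d (Suc k)) = \<tau> ^ Suc k / fact (Suc k) * norm ((M v ^^ Suc k) v - (M v' ^^ Suc k) v')"
      using \<tau> by (simp add: flow_term_def flip: scaleR_diff_right)
    also have "\<dots> \<le> \<tau> / fact (Suc k) * (K ^ Suc k * (real (Suc k) * (1 + R)) * norm (v - v'))"
      using \<tau> R K
      by (intro mult_mono divide_right_mono t order_trans[OF power_lipschitz[OF v]] mult_right_mono mult_left_mono k) auto
    also have "\<dots> = (\<tau> * (1 + R) * K * norm (v - v')) * (K ^ k / fact k)"
      by (simp add: field_simps del: of_nat_Suc)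
    finally show ?thesis .
  qed
  have s': "summable (\<lambda>k. norm (?d (Suc k)))"
    by (rule summable_comparison_test'[OF summable_exp_K]) (use b in simp)
  have "flow \<tau> v - flow \<tau> v' = (\<Sum>k. ?d k)"
    unfolding flow_def by (rule suminf_diff[OF summable_flow_term summable_flow_term]) (use v \<tau> in auto)
  also have "\<dots> = ?d 0 + (\<Sum>k. ?d (Suc k))" using suminf_split_head[OF s] by (simp add: algebra_simps)
  finally have "norm (flow \<tau> v - flow \<tau> v') \<le> norm (?d 0) + norm (\<Sum>k. ?d (Suc k))" by (metis norm_triangle_ineq)
  also have "norm (\<Sum>k. ?d (Suc k)) \<le> (\<Sum>k. norm (?d (Suc k)))" by (rule summable_norm[OF s'])
  also have "\<dots> \<le> (\<Sum>k. (\<tau> * (1 + R) * K * norm (v - v')) * (K ^ k / fact k))"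
    by (rule suminf_le[OF b s' summable_exp_K])
  also have "\<dots> = (\<tau> * (1 + R) * K * norm (v - v')) * exp K" by (rule suminf_exp_K)
  finally show ?thesis by (simp add: flow_term_def algebra_simps)
qed

lemma flow_expansion:
  assumes v: "norm v \<le> R" and \<tau>: "0 \<le> \<tau>" "\<tau> \<le> 1"
  shows "norm (flow \<tau> v - v - \<tau> *\<^sub>R M v v) \<le> \<tau>\<^sup>2 * (R * K\<^sup>2 * exp K)"
proof -
  let ?d = "flow_term \<tau> v"
  have s: "summable ?d" by (rule summable_flow_term[OF v \<tau>])
  have b: "norm (?d (Suc (Suc k))) \<le> (\<tau>\<^sup>2 * R * K\<^sup>2) * (K ^ k / fact k)" for k
  proof -
    have t: "\<tau> ^ Suc (Suc k) \<le> \<tau>\<^sup>2" using \<tau> power_le_one[of \<tau> k] mult_left_mono[of "\<tau> ^ k" 1 "\<tau>\<^sup>2"] by (simp add: power2_eq_square mult_ac)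
    have f: "(fact k :: real) \<le> fact (Suc (Suc k))" by (rule fact_mono) simp
    have "norm (?d (Suc (Suc k))) = \<tau> ^ Suc (Suc k) / fact (Suc (Suc k)) * norm ((M v ^^ Suc (Suc k)) v)"
      using \<tau> by (simp add: flow_term_def)
    also have "\<dots> \<le> \<tau>\<^sup>2 / fact k * (K ^ Suc (Suc k) * R)"
      using \<tau> f by (intro mult_mono frac_le t power_bound v) auto
    also have "\<dots> = (\<tau>\<^sup>2 * R * K\<^sup>2) * (K ^ k / fact k)" by (simp add: field_simps power2_eq_square)
    finally show ?thesis .
  qed
  have s': "summable (\<lambda>k. norm (?d (Suc (Suc k))))"
    by (rule summable_comparison_test'[OF summable_exp_K]) (use b in simp)
  have "flow \<tau> v = ?d 0 + (?d 1 + (\<Sum>k. ?d (Suc (Suc k))))"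
    using suminf_split_head[OF s] suminf_split_head[of "\<lambda>k. ?d (Suc k)"] s
    by (simp add: flow_def summable_Suc_iff algebra_simps)
  then have "norm (flow \<tau> v - v - \<tau> *\<^sub>R M v v) = norm (\<Sum>k. ?d (Suc (Suc k)))" by (simp add: flow_term_def)
  also have "\<dots> \<le> (\<Sum>k. norm (?d (Suc (Suc k))))" by (rule summable_norm[OF s'])
  also have "\<dots> \<le> (\<Sum>k. (\<tau>\<^sup>2 * R * K\<^sup>2) * (K ^ k / fact k))" by (rule suminf_le[OF b s' summable_exp_K])
  also have "\<dots> = (\<tau>\<^sup>2 * R * K\<^sup>2) * exp K" by (rule suminf_exp_K)
  finally show ?thesis by (simp add: mult_ac)
qed

lemma nonlinearity_bound: "norm v \<le> R \<Longrightarrow> norm (M v v) \<le> K * R"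
  using M_bound[of v v] mult_left_mono[OF _ K] order_trans by blast

lemma nonlinearity_lipschitz:
  assumes "norm v \<le> R" "norm w \<le> R"
  shows "norm (M v v - M w w) \<le> K * (1 + R) * norm (v - w)"
proof -
  have "M v v - M w w = M v (v - w) + (M v w - M w w)" by (simp add: linear_diff[OF linear_M])
  then have "norm (M v v - M w w) \<le> K * norm (v - w) + K * norm (v - w) * norm w"
    using M_bound[OF assms(1), of "v - w"] M_lipschitz[OF assms, of w] by (metis norm_triangle_le add_mono)
  also have "\<dots> \<le> K * norm (v - w) + K * norm (v - w) * R"
    using assms K by (intro add_mono mult_left_mono) auto
  finally show ?thesis by (simp add: algebra_simps)
qed

end

section \<open>The cubic nonlinearity on \<open>H\<^sup>1\<close>\<close>

definition sg :: "spinor \<Rightarrow> spinor \<Rightarrow> real" where "sg u v = u \<bullet> (sigma3 *v v)"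

lemma sigma3_kk: "sigma3 *v v = - cs \<i> (kk v)" by (simp add: spinor_eq_iff)

lemma bounded_linear_sigma3: "bounded_linear (\<lambda>v::spinor. sigma3 *v v)"
  unfolding sigma3_kk by (intro bounded_linear_minus bounded_linear_compose[OF bounded_linear_cs bounded_linear_kk])

lemma bilinear_sg: "bilinear_product sg"
  unfolding bilinear_product_def sg_def[abs_def]
  by (rule bounded_bilinear.comp[OF bounded_bilinear_inner bounded_linear_ident bounded_linear_sigma3])

lemma bilinear_inner: "bilinear_product (inner :: spinor \<Rightarrow> spinor \<Rightarrow> real)"
  unfolding bilinear_product_def by (rule bounded_bilinear_inner)

interpretation sg: bilinear_product sg by (rule bilinear_sg)
interpretation inn: bilinear_product "inner :: spinor \<Rightarrow> spinor \<Rightarrow> real" by (rule bilinear_inner)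
interpretation sc: bilinear_product "scaleR :: real \<Rightarrow> spinor \<Rightarrow> spinor" by (rule bilinear_scaleR)

definition iK :: "spinor h1 \<Rightarrow> spinor h1" where "iK = map_h1 (lin kk)"
definition iJ :: "spinor h1 \<Rightarrow> spinor h1" where "iJ = map_h1 (lin (cs \<i>))"

lemma val_der_iK [simp]: "val (iK u) = lin kk (val u)" "der (iK u) = lin kk (der u)"
  and val_der_iJ [simp]: "val (iJ u) = lin (cs \<i>) (val u)" "der (iJ u) = lin (cs \<i>) (der u)"
  by (simp_all add: iK_def iJ_def val_der_map_h1 shift_lin)

lemma norm_iK [simp]: "norm (iK u) = norm u" and norm_iJ [simp]: "norm (iJ u) = norm u"
  using norm_lin_isometry[of "cs \<i>"] by (simp_all add: norm_h1)

lemma bounded_linear_iK: "bounded_linear iK" and bounded_linear_iJ: "bounded_linear iJ"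
  unfolding iK_def iJ_def by (simp_all add: bounded_linear_map_h1 shift_lin)

text \<open>
  The operator \<open>- i (V + F v)\<close> on \<open>H\<^sup>1\<close>, with \<open>F v = l1
  (v\<^sup>* \<sigma>\<^sub>3 v) \<sigma>\<^sub>3 + l2 \<bar>v\<bar>\<^sup>2\<close>. It is
  linear in its last argument and quadratic plus constant in \<open>v\<close>.
\<close>

definition genM :: "real \<Rightarrow> real \<Rightarrow> (real \<Rightarrow> real) \<Rightarrow> (real \<Rightarrow> real) \<Rightarrow> spinor h1 \<Rightarrow> spinor h1 \<Rightarrow> spinor h1" where
  "genM l1 l2 V V1 v w = - iJ (mulW V V1 w)
     - l1 *\<^sub>R mulh scaleR (mulh sg v v) (iK w) - l2 *\<^sub>R mulh scaleR (mulh inner v v) (iJ w)"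

text \<open>
  The same operator as a matrix at a point where the potential has the value \<open>p\<close>.
\<close>

definition nlM :: "real \<Rightarrow> real \<Rightarrow> real \<Rightarrow> spinor \<Rightarrow> complex^2^2" where
  "nlM l1 l2 p v = mat (- \<i>) ** (mat (of_real p) + nl_matrix l1 l2 v)"

lemma nl_matrix_nth:
  "(nl_matrix l1 l2 v *v w) $ 1 = of_real (l1 * sg v v + l2 * (v \<bullet> v)) * w $ 1"
  "(nl_matrix l1 l2 v *v w) $ 2 = of_real (- l1 * sg v v + l2 * (v \<bullet> v)) * w $ 2"
proof -
  have h: "herm_prod v (sigma3 *v v) = of_real (sg v v)" "herm_prod v v = of_real (v \<bullet> v)"
    by (simp_all add: herm_prod_def sg_def inner_spinor sum_2 complex_eq_iff inner_complex_def)
  have m: "(mat c *v u) $ i = c * u $ i" for c :: complex and u :: spinor and i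
    by (simp add: matrix_vector_mult_def mat_def if_distrib[of "\<lambda>x. x * _"] cong: if_cong)
  show "(nl_matrix l1 l2 v *v w) $ 1 = of_real (l1 * sg v v + l2 * (v \<bullet> v)) * w $ 1"
    "(nl_matrix l1 l2 v *v w) $ 2 = of_real (- l1 * sg v v + l2 * (v \<bullet> v)) * w $ 2"
    by (simp_all add: nl_matrix_def h matrix_vector_mult_add_rdistrib m algebra_simps flip: matrix_vector_mul_assoc)
qed

lemma mat_vec_nth: "(mat c *v u) $ i = c * u $ i" for c :: complex and u :: spinor
  by (simp add: matrix_vector_mult_def mat_def if_distrib[of "\<lambda>x. x * _"] cong: if_cong)

lemma nlM_nth:
  "(nlM l1 l2 p v *v w) $ 1 = - \<i> * of_real (p + l1 * sg v v + l2 * (v \<bullet> v)) * w $ 1"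
  "(nlM l1 l2 p v *v w) $ 2 = - \<i> * of_real (p - l1 * sg v v + l2 * (v \<bullet> v)) * w $ 2"
  by (simp_all add: nlM_def matrix_vector_mult_add_rdistrib mat_vec_nth nl_matrix_nth algebra_simps flip: matrix_vector_mul_assoc)

context
  fixes l1 l2 c :: real and V V1 V2 V3 :: "real \<Rightarrow> real"
  assumes V: "W1inf V V1 c"
begin

lemma ev_genM:
  "AE x in lebesgue. ev (val (genM l1 l2 V V1 v w)) x = nlM l1 l2 (V x) (ev (val v) x) *v ev (val w) x"
proof -
  have eb: "ess_bounded V c" using V by (simp add: W1inf_def)
  let ?A = "iJ (mulW V V1 w)" and ?B = "mulh scaleR (mulh sg v v) (iK w)" and ?C = "mulh scaleR (mulh inner v v) (iJ w)"
  have A: "AE x in lebesgue. ev (val ?A) x = cs \<i> (V x *\<^sub>R ev (val w) x)"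
    using ev_lin[OF bounded_linear_cs, of \<i> "mulop V (val w)"] ev_mulop[OF eb, of "val w"]
    unfolding val_der_iJ val_mulW[OF V] by eventually_elim simp
  have B: "AE x in lebesgue. ev (val ?B) x = sg (ev (val v) x) (ev (val v) x) *\<^sub>R kk (ev (val w) x)"
    using sc.ev_mulh[of "mulh sg v v" "iK w"] sg.ev_mulh[of v v] ev_lin[OF bounded_linear_kk, of "val w"]
    by eventually_elim simp
  have C: "AE x in lebesgue. ev (val ?C) x = (ev (val v) x \<bullet> ev (val v) x) *\<^sub>R cs \<i> (ev (val w) x)"
    using sc.ev_mulh[of "mulh inner v v" "iJ w"] inn.ev_mulh[of v v] ev_lin[OF bounded_linear_cs, of \<i> "val w"]
    by eventually_elim simp
  have "AE x in lebesgue. ev (val (genM l1 l2 V V1 v w)) x = - ev (val ?A) x - l1 *\<^sub>R ev (val ?B) x - l2 *\<^sub>R ev (val ?C) x"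
    using ev_diff[of "- val ?A - l1 *\<^sub>R val ?B" "l2 *\<^sub>R val ?C"] ev_diff[of "- val ?A" "l1 *\<^sub>R val ?B"]
      ev_minus[of "val ?A"] ev_scaleR[of l1 "val ?B"] ev_scaleR[of l2 "val ?C"]
    unfolding genM_def val_diff val_minus val_scaleR by eventually_elim simp
  with A B C show ?thesis
    by eventually_elim (simp add: spinor_eq_iff nlM_nth scaleR_conv_of_real[where 'a=complex] algebra_simps)
qed

text \<open>
  Gauge invariance, the structural reason for the error bounds: the matrix \<open>V + F
  v\<close> is diagonal and depends only on the moduli of the components of \<open>v\<close>,
  and the mass rotation changes only their phases.
\<close>

lemma genM_hrot: "genM l1 l2 V V1 (hrot r v) (hrot r w) = hrot r (genM l1 l2 V V1 v w)"
proof (rule h1_eqI, rule l2_eqI)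
  have inv: "sg (ro r v) (ro r v) = sg v v" "ro r v \<bullet> ro r v = v \<bullet> v" for v
  proof -
    have n: "(cis a * z) \<bullet> (cis a * z) = z \<bullet> z" for a z
      by (simp add: norm_mult flip: power2_norm_eq_inner)
    show "sg (ro r v) (ro r v) = sg v v" "ro r v \<bullet> ro r v = v \<bullet> v"
      by (simp_all add: sg_def inner_spinor ro_nth n)
  qed
  show "AE x in lebesgue. ev (val (genM l1 l2 V V1 (hrot r v) (hrot r w))) x = ev (val (hrot r (genM l1 l2 V V1 v w))) x"
    using ev_genM[of "hrot r v" "hrot r w"] ev_genM[of v w]
      ev_lin[OF bounded_linear_ro, of r "val v"] ev_lin[OF bounded_linear_ro, of r "val w"]
      ev_lin[OF bounded_linear_ro, of r "val (genM l1 l2 V V1 v w)"]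
    by eventually_elim (simp add: rot_def inv spinor_eq_iff nlM_nth ro_nth)
qed

text \<open>
  Apart from the potential term the operator is trilinear and bounded on
  \<open>H\<^sup>1\<close>; differences are expanded by polarisation.
\<close>

lemma genM_bounds:
  obtains K where "0 \<le> K" "\<And>v. linear (genM l1 l2 V V1 v)"
    "\<And>v w. norm (genM l1 l2 V V1 v w) \<le> K * (1 + (norm v)\<^sup>2) * norm w"
    "\<And>v v' w. norm (genM l1 l2 V V1 v w - genM l1 l2 V V1 v' w) \<le> K * (norm v + norm v') * norm (v - v') * norm w"
proof -
  interpret bsg: bounded_bilinear "mulh sg" by (rule sg.bounded_bilinear_mulh)
  interpret binn: bounded_bilinear "mulh (inner :: spinor \<Rightarrow> spinor \<Rightarrow> real)" by (rule inn.bounded_bilinear_mulh)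
  interpret bsc: bounded_bilinear "mulh (scaleR :: real \<Rightarrow> spinor \<Rightarrow> spinor)" by (rule sc.bounded_bilinear_mulh)
  interpret W: bounded_linear "mulW V V1 :: spinor h1 \<Rightarrow> spinor h1" by (rule bounded_linear_mulW[OF V])
  interpret iK: bounded_linear iK by (rule bounded_linear_iK)
  interpret iJ: bounded_linear iJ by (rule bounded_linear_iJ)
  obtain k1 where k1: "0 \<le> k1" "\<And>u v. norm (mulh sg u v) \<le> norm u * norm v * k1" using bsg.nonneg_bounded by blast
  obtain k2 where k2: "0 \<le> k2" "\<And>u v :: spinor h1. norm (mulh inner u v) \<le> norm u * norm v * k2" using binn.nonneg_bounded by blast
  obtain k3 where k3: "0 \<le> k3" "\<And>u (v::spinor h1). norm (mulh scaleR u v) \<le> norm u * norm v * k3" using bsc.nonneg_bounded by blast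
  obtain k4 where k4: "0 \<le> k4" "\<And>u :: spinor h1. norm (mulW V V1 u) \<le> norm u * k4" using W.nonneg_bounded by blast
  define T1 where "T1 p q w = mulh scaleR (mulh sg p q) (iK w)" for p q w
  define T2 where "T2 p q w = mulh scaleR (mulh inner p q) (iJ w)" for p q w :: "spinor h1"
  have T1: "norm (T1 p q w) \<le> (k1 * k3) * (norm p * norm q) * norm w" for p q w
  proof -
    have "norm (T1 p q w) \<le> norm (mulh sg p q) * norm (iK w) * k3" unfolding T1_def by (rule k3)
    also have "\<dots> \<le> (norm p * norm q * k1) * norm (iK w) * k3" using k3(1) by (intro mult_right_mono k1) auto
    finally show ?thesis by (simp add: mult_ac)
  qed
  have T2: "norm (T2 p q w) \<le> (k2 * k3) * (norm p * norm q) * norm w" for p q w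
  proof -
    have "norm (T2 p q w) \<le> norm (mulh inner p q) * norm (iJ w) * k3" unfolding T2_def by (rule k3)
    also have "\<dots> \<le> (norm p * norm q * k2) * norm (iJ w) * k3" using k3(1) by (intro mult_right_mono k2) auto
    finally show ?thesis by (simp add: mult_ac)
  qed
  define k where "k = \<bar>l1\<bar> * (k1 * k3) + \<bar>l2\<bar> * (k2 * k3)"
  have k: "0 \<le> k" using k1 k2 k3 by (simp add: k_def)
  have T: "norm (l1 *\<^sub>R T1 p q w + l2 *\<^sub>R T2 p q w) \<le> k * (norm p * norm q) * norm w" for p q w
  proof -
    have "norm (l1 *\<^sub>R T1 p q w + l2 *\<^sub>R T2 p q w) \<le> \<bar>l1\<bar> * norm (T1 p q w) + \<bar>l2\<bar> * norm (T2 p q w)"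
      by (rule order_trans[OF norm_triangle_ineq]) simp
    also have "\<dots> \<le> \<bar>l1\<bar> * ((k1 * k3) * (norm p * norm q) * norm w) + \<bar>l2\<bar> * ((k2 * k3) * (norm p * norm q) * norm w)"
      by (intro add_mono mult_left_mono T1 T2) auto
    finally show ?thesis by (simp add: k_def algebra_simps)
  qed
  have genM: "genM l1 l2 V V1 v w = - iJ (mulW V V1 w) - (l1 *\<^sub>R T1 v v w + l2 *\<^sub>R T2 v v w)" for v w
    by (simp add: genM_def T1_def T2_def)
  show thesis
  proof (rule that[of "k + k4"])
    show "0 \<le> k + k4" using k k4 by simp
    show "linear (genM l1 l2 V V1 v)" for v
      unfolding genM_def
      by (rule linearI) (simp_all add: W.add W.scaleR iJ.add iJ.scaleR iK.add iK.scaleR bsc.add_right bsc.scaleR_right algebra_simps)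
    show "norm (genM l1 l2 V V1 v w) \<le> (k + k4) * (1 + (norm v)\<^sup>2) * norm w" for v w
    proof -
      have "norm (genM l1 l2 V V1 v w) \<le> norm (iJ (mulW V V1 w)) + norm (l1 *\<^sub>R T1 v v w + l2 *\<^sub>R T2 v v w)"
        unfolding genM using norm_triangle_ineq4[of "- iJ (mulW V V1 w)" "l1 *\<^sub>R T1 v v w + l2 *\<^sub>R T2 v v w"] by simp
      also have "\<dots> \<le> norm w * k4 + k * (norm v * norm v) * norm w" using k4 T by (intro add_mono) simp_all
      also have "\<dots> \<le> (k + k4) * (1 + (norm v)\<^sup>2) * norm w"
      proof -
        have "0 \<le> norm w * k" "0 \<le> k4 * (norm v)\<^sup>2 * norm w" using k k4 by simp_all
        then show ?thesis by (simp add: algebra_simps power2_eq_square)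
      qed
      finally show ?thesis .
    qed
    show "norm (genM l1 l2 V V1 v w - genM l1 l2 V V1 v' w) \<le> (k + k4) * (norm v + norm v') * norm (v - v') * norm w" for v v' w
    proof -
      have 1: "T1 v v w - T1 v' v' w = T1 v (v - v') w + T1 (v - v') v' w"
        unfolding T1_def by (simp add: bsg.diff_left bsg.diff_right bsc.diff_left bsc.add_left)
      have 2: "T2 v v w - T2 v' v' w = T2 v (v - v') w + T2 (v - v') v' w"
        unfolding T2_def by (simp add: binn.diff_left binn.diff_right bsc.diff_left bsc.add_left)
      have "genM l1 l2 V V1 v w - genM l1 l2 V V1 v' w = - (l1 *\<^sub>R (T1 v v w - T1 v' v' w) + l2 *\<^sub>R (T2 v v w - T2 v' v' w))"
        unfolding genM by (simp add: algebra_simps)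
      also have "\<dots> = - ((l1 *\<^sub>R T1 v (v - v') w + l2 *\<^sub>R T2 v (v - v') w) + (l1 *\<^sub>R T1 (v - v') v' w + l2 *\<^sub>R T2 (v - v') v' w))"
        unfolding 1 2 by (simp add: algebra_simps)
      finally have eq: "genM l1 l2 V V1 v w - genM l1 l2 V V1 v' w = \<dots>" .
      have "norm (genM l1 l2 V V1 v w - genM l1 l2 V V1 v' w)
        \<le> norm (l1 *\<^sub>R T1 v (v - v') w + l2 *\<^sub>R T2 v (v - v') w) + norm (l1 *\<^sub>R T1 (v - v') v' w + l2 *\<^sub>R T2 (v - v') v' w)"
        unfolding eq norm_minus_cancel by (rule norm_triangle_ineq)
      also have "\<dots> \<le> k * (norm v * norm (v - v')) * norm w + k * (norm (v - v') * norm v') * norm w"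
        by (intro add_mono T)
      also have "\<dots> = k * (norm v + norm v') * norm (v - v') * norm w" by (simp add: algebra_simps)
      also have "\<dots> \<le> (k + k4) * (norm v + norm v') * norm (v - v') * norm w"
        using k4 by (intro mult_right_mono) auto
      finally show ?thesis .
    qed
  qed
qed

end

section \<open>Regularity of the nonlinearity\<close>

lemma h1D_add: "h1D u u1 \<Longrightarrow> h1D v v1 \<Longrightarrow> h1D (u + v) (u1 + v1)"
  and h1D_diff: "h1D u u1 \<Longrightarrow> h1D v v1 \<Longrightarrow> h1D (u - v) (u1 - v1)"
  and h1D_scaleR: "h1D u u1 \<Longrightarrow> h1D (r *\<^sub>R u) (r *\<^sub>R u1)"
  by (simp_all add: h1D_def)

lemma H3_diff: assumes "H3 C u" "H3 C' v" shows "H3 (C + C') (u - v)"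
proof -
  obtain u1 u2 v1 v2 where *: "h1D u u1" "h1D u1 u2" "norm u \<le> C" "norm u1 \<le> C" "norm u2 \<le> C"
    "h1D v v1" "h1D v1 v2" "norm v \<le> C'" "norm v1 \<le> C'" "norm v2 \<le> C'"
    using assms unfolding H3_def by blast
  show ?thesis unfolding H3_def
    by (intro exI[of _ "u1 - v1"] exI[of _ "u2 - v2"] conjI h1D_diff order_trans[OF norm_triangle_ineq4] add_mono *)
qed

lemma H3_scaleR: assumes "H3 C u" shows "H3 (\<bar>r\<bar> * C) (r *\<^sub>R u)"
proof -
  obtain u1 u2 where *: "h1D u u1" "h1D u1 u2" "norm u \<le> C" "norm u1 \<le> C" "norm u2 \<le> C"
    using assms unfolding H3_def by blast
  show ?thesis unfolding H3_def
    by (intro exI[of _ "r *\<^sub>R u1"] exI[of _ "r *\<^sub>R u2"] conjI h1D_scaleR *) (auto intro!: mult_left_mono *)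
qed

lemma H3_minus: "H3 C u \<Longrightarrow> H3 C (- u)"
  using H3_scaleR[of C u "-1"] by simp

lemma H3_iK: assumes "H3 C u" shows "H3 C (iK u)"
proof -
  obtain u1 u2 where *: "h1D u u1" "h1D u1 u2" "norm u \<le> C" "norm u1 \<le> C" "norm u2 \<le> C"
    using assms unfolding H3_def by blast
  show ?thesis unfolding H3_def
    by (rule exI[of _ "iK u1"], rule exI[of _ "iK u2"]) (use * in \<open>simp add: h1D_def\<close>)
qed

lemma H3_iJ: assumes "H3 C u" shows "H3 C (iJ u)"
proof -
  obtain u1 u2 where *: "h1D u u1" "h1D u1 u2" "norm u \<le> C" "norm u1 \<le> C" "norm u2 \<le> C"
    using assms unfolding H3_def by blast
  show ?thesis unfolding H3_def
    by (rule exI[of _ "iJ u1"], rule exI[of _ "iJ u2"]) (use * in \<open>simp add: h1D_def\<close>)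
qed

lemma (in bilinear_product) h1D_mulh:
  assumes "h1D u u1" "h1D v v1"
  shows "h1D (mulh \<beta> u v) (mulh \<beta> u1 v + mulh \<beta> u v1)"
  using assms by (simp add: h1D_def)

lemma (in bilinear_product) H3_mulh:
  "\<exists>K. 0 \<le> K \<and> (\<forall>C C' u v. H3 C u \<longrightarrow> H3 C' v \<longrightarrow> H3 (K * C * C') (mulh \<beta> u v))"
proof -
  interpret b: bounded_bilinear "mulh \<beta>" by (rule bounded_bilinear_mulh)
  obtain K where K: "0 \<le> K" "\<And>u v. norm (mulh \<beta> u v) \<le> norm u * norm v * K" using b.nonneg_bounded by blast
  have "H3 ((4 * K) * C * C') (mulh \<beta> u v)" if uv: "H3 C u" "H3 C' v" for C C' u v
  proof -
    obtain u1 u2 v1 v2 where *: "h1D u u1" "h1D u1 u2" "norm u \<le> C" "norm u1 \<le> C" "norm u2 \<le> C"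
      "h1D v v1" "h1D v1 v2" "norm v \<le> C'" "norm v1 \<le> C'" "norm v2 \<le> C'"
      using uv unfolding H3_def by blast
    have C: "0 \<le> C" "0 \<le> C'" using *(3,8) norm_ge_zero order_trans by blast+
    have n: "norm (mulh \<beta> p q) \<le> K * C * C'" if "norm p \<le> C" "norm q \<le> C'" for p q
    proof -
      have "norm p * norm q * K \<le> C * C' * K" using that C K(1) by (intro mult_right_mono mult_mono) auto
      then show ?thesis using K(2)[of p q] by (simp add: mult_ac)
    qed
    have P: "0 \<le> K * C * C'" using C K(1) by simp
    let ?w1 = "mulh \<beta> u1 v + mulh \<beta> u v1"
    let ?w2 = "(mulh \<beta> u2 v + mulh \<beta> u1 v1) + (mulh \<beta> u1 v1 + mulh \<beta> u v2)"
    have "norm (mulh \<beta> u v) \<le> 4 * K * C * C'" using n[OF *(3) *(8)] P by simp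
    moreover have "norm ?w1 \<le> 4 * K * C * C'"
      using norm_triangle_le[OF add_mono[OF n[OF *(4) *(8)] n[OF *(3) *(9)]]] P by (simp add: mult_ac)
    moreover have "norm ?w2 \<le> 4 * K * C * C'"
      using norm_triangle_le[OF add_mono[OF norm_triangle_le[OF add_mono[OF n[OF *(5) *(8)] n[OF *(4) *(9)]]]
          norm_triangle_le[OF add_mono[OF n[OF *(4) *(9)] n[OF *(3) *(10)]]]]] by (simp add: mult_ac)
    ultimately show ?thesis
      unfolding H3_def by (intro exI[of _ ?w1] exI[of _ ?w2] conjI h1D_mulh h1D_add *)
  qed
  then show ?thesis using K(1) by (intro exI[of _ "4 * K"]) simp
qed

lemma h1D_mulW:
  assumes "W1inf a a1 c" "W1inf a1 a2 c" "h1D u u1"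
  shows "h1D (mulW a a1 u) (mulW a1 a2 u + mulW a a1 u1)"
  using assms(3) by (simp add: h1D_def val_mulW[OF assms(1)] der_mulW[OF assms(1)] val_mulW[OF assms(2)])

lemma H3_mulW:
  assumes W: "W1inf V V1 c" "W1inf V1 V2 c" "W1inf V2 V3 c"
  shows "\<exists>K. 0 \<le> K \<and> (\<forall>C (u :: 'a::euclidean_space h1). H3 C u \<longrightarrow> H3 (K * C) (mulW V V1 u))"
proof -
  obtain K0 where K0: "0 \<le> K0" "\<And>u :: 'a h1. norm (mulW V V1 u) \<le> norm u * K0"
    using bounded_linear.nonneg_bounded[OF bounded_linear_mulW[OF W(1)]] by blast
  obtain K1 where K1: "0 \<le> K1" "\<And>u :: 'a h1. norm (mulW V1 V2 u) \<le> norm u * K1"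
    using bounded_linear.nonneg_bounded[OF bounded_linear_mulW[OF W(2)]] by blast
  obtain K2 where K2: "0 \<le> K2" "\<And>u :: 'a h1. norm (mulW V2 V3 u) \<le> norm u * K2"
    using bounded_linear.nonneg_bounded[OF bounded_linear_mulW[OF W(3)]] by blast
  define K where "K = K0 + K1 + K2"
  have K: "0 \<le> K" using K0 K1 K2 by (simp add: K_def)
  have "H3 ((4 * K) * C) (mulW V V1 u)" if u: "H3 C u" for C and u :: "'a h1"
  proof -
    obtain u1 u2 where *: "h1D u u1" "h1D u1 u2" "norm u \<le> C" "norm u1 \<le> C" "norm u2 \<le> C"
      using u unfolding H3_def by blast
    have C: "0 \<le> C" using *(3) norm_ge_zero order_trans by blast
    have n: "norm (mulW V V1 p) \<le> K * C" "norm (mulW V1 V2 p) \<le> K * C" "norm (mulW V2 V3 p) \<le> K * C"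
      if "norm p \<le> C" for p :: "'a h1"
    proof -
      have "norm p * K0 \<le> C * K" "norm p * K1 \<le> C * K" "norm p * K2 \<le> C * K"
        using that C K0 K1 K2 unfolding K_def by (intro mult_mono; simp)+
      then show "norm (mulW V V1 p) \<le> K * C" "norm (mulW V1 V2 p) \<le> K * C" "norm (mulW V2 V3 p) \<le> K * C"
        using K0(2)[of p] K1(2)[of p] K2(2)[of p] by (simp_all add: mult.commute)
    qed
    have P: "0 \<le> K * C" using C K by simp
    let ?w1 = "mulW V1 V2 u + mulW V V1 u1"
    let ?w2 = "(mulW V2 V3 u + mulW V1 V2 u1) + (mulW V1 V2 u1 + mulW V V1 u2)"
    have "norm (mulW V V1 u) \<le> 4 * K * C" using n(1)[OF *(3)] P by simp
    moreover have "norm ?w1 \<le> 4 * K * C"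
      using norm_triangle_le[OF add_mono[OF n(2)[OF *(3)] n(1)[OF *(4)]]] P by (simp add: mult_ac)
    moreover have "norm ?w2 \<le> 4 * K * C"
      using norm_triangle_le[OF add_mono[OF norm_triangle_le[OF add_mono[OF n(3)[OF *(3)] n(2)[OF *(4)]]]
          norm_triangle_le[OF add_mono[OF n(2)[OF *(4)] n(1)[OF *(5)]]]]] by (simp add: mult_ac)
    ultimately show ?thesis
      unfolding H3_def by (intro exI[of _ ?w1] exI[of _ ?w2] conjI h1D_mulW[OF W(1) W(2)] h1D_mulW[OF W(2) W(3)] h1D_add *)
  qed
  then show ?thesis using K by (intro exI[of _ "4 * K"]) simp
qed

text \<open>
  Leibniz' rule in each product. Three derivatives of the potential are used: two for the
  chain of derivatives and one for membership of its last element in \<open>H\<^sup>1\<close>.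
\<close>

lemma H3_genM:
  assumes W: "W1inf V V1 c" "W1inf V1 V2 c" "W1inf V2 V3 c"
  shows "\<exists>C'. \<forall>v. H3 C v \<longrightarrow> H3 C' (genM l1 l2 V V1 v v)"
proof -
  obtain k0 where k0: "\<And>C (u :: spinor h1). H3 C u \<Longrightarrow> H3 (k0 * C) (mulW V V1 u)" using H3_mulW[OF W, where 'a=spinor] by blast
  obtain k1 where k1: "\<And>C C' u v. H3 C u \<Longrightarrow> H3 C' v \<Longrightarrow> H3 (k1 * C * C') (mulh sg u v)" using sg.H3_mulh by blast
  obtain k2 where k2: "\<And>C C' (u :: spinor h1) v. H3 C u \<Longrightarrow> H3 C' v \<Longrightarrow> H3 (k2 * C * C') (mulh inner u v)" using inn.H3_mulh by blast
  obtain k3 where k3: "\<And>C C' u (v :: spinor h1). H3 C u \<Longrightarrow> H3 C' v \<Longrightarrow> H3 (k3 * C * C') (mulh scaleR u v)" using sc.H3_mulh by blast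
  have "H3 (k0 * C + \<bar>l1\<bar> * (k3 * (k1 * C * C) * C) + \<bar>l2\<bar> * (k3 * (k2 * C * C) * C)) (genM l1 l2 V V1 v v)" if v: "H3 C v" for v
    unfolding genM_def
    by (intro H3_diff H3_minus H3_iJ H3_scaleR k0 k3 k1 k2 H3_iK v)
  then show ?thesis by blast
qed

section \<open>The nonlinear substep as a pointwise matrix exponential\<close>

lemma bounded_linear_matrix_vector: "bounded_linear (\<lambda>A :: complex^2^2. A *v v)"
proof -
  have "linear (\<lambda>A :: complex^2^2. A *v v)"
    by (rule linearI)
       (simp_all add: vec_eq_iff matrix_vector_mult_def scaleR_sum_right distrib_right sum.distrib)
  then show ?thesis by (rule linear_conv_bounded_linear[THEN iffD1])
qed

lemma summable_mat_exp:
  fixes A :: "complex^2^2"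
  shows "summable (\<lambda>n. (1 / fact n) *\<^sub>R (((**) A) ^^ n) (mat 1 :: complex^2^2))"
proof -
  have "linear ((**) A :: complex^2^2 \<Rightarrow> complex^2^2)"
    by (rule linearI)
       (simp_all add: vec_eq_iff matrix_matrix_mult_def scaleR_sum_right distrib_left sum.distrib)
  then have "bounded_linear ((**) A :: complex^2^2 \<Rightarrow> complex^2^2)" by (rule linear_conv_bounded_linear[THEN iffD1])
  then obtain K where K: "0 \<le> K" "\<And>B :: complex^2^2. norm (A ** B) \<le> norm B * K"
    using bounded_linear.nonneg_bounded by blast
  have b: "norm ((((**) A) ^^ n) (mat 1 :: complex^2^2)) \<le> K ^ n * norm (mat 1 :: complex^2^2)" for n
  proof (induction n)
    case (Suc n)
    have "norm (A ** (((**) A) ^^ n) (mat 1)) \<le> norm ((((**) A) ^^ n) (mat 1 :: complex^2^2)) * K" by (rule K)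
    also have "\<dots> \<le> (K ^ n * norm (mat 1 :: complex^2^2)) * K" by (intro mult_right_mono Suc K)
    finally show ?case by (simp add: mult_ac)
  qed simp
  have s: "summable (\<lambda>n. norm (mat 1 :: complex^2^2) * (K ^ n / fact n))"
    using summable_exp_generic[of K] by (intro summable_mult) (simp add: field_simps)
  show ?thesis
  proof (rule summable_comparison_test'[OF s])
    show "norm ((1 / fact n) *\<^sub>R (((**) A) ^^ n) (mat 1 :: complex^2^2)) \<le> norm (mat 1 :: complex^2^2) * (K ^ n / fact n)" for n
      using divide_right_mono[OF b[of n], of "fact n"] by (simp add: field_simps)
  qed
qed

lemma mat_exp_vector_sums: "(\<lambda>n. (1 / fact n) *\<^sub>R ((\<lambda>w. A *v w) ^^ n) v) sums (mat_exp A *v v)"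
proof -
  have p: "((((**) A) ^^ n) (mat 1)) *v v = ((\<lambda>w. A *v w) ^^ n) v" for n
    by (induction n) (simp_all flip: matrix_vector_mul_assoc)
  have "(\<lambda>n. ((1 / fact n) *\<^sub>R (((**) A) ^^ n) (mat 1)) *v v) sums (mat_exp A *v v)"
    unfolding mat_exp_def
    by (rule bounded_linear.sums[OF bounded_linear_matrix_vector summable_sums[OF summable_mat_exp]])
  moreover have "((1 / fact n) *\<^sub>R (((**) A) ^^ n) (mat 1)) *v v = (1 / fact n) *\<^sub>R ((\<lambda>w. A *v w) ^^ n) v" for n
    using linear_scale[OF bounded_linear.linear[OF bounded_linear_matrix_vector[of v]], of "1 / fact n" "(((**) A) ^^ n) (mat 1)"]
    unfolding p .
  ultimately show ?thesis by simp
qed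

lemma splitting_matrix:
  "((\<lambda>w. (mat (- \<i> * of_real \<tau>) ** (mat (of_real p) + nl_matrix l1 l2 v)) *v w) ^^ n) w
    = \<tau> ^ n *\<^sub>R ((\<lambda>w. nlM l1 l2 p v *v w) ^^ n) w"
proof (induction n)
  case (Suc n)
  let ?B = "nlM l1 l2 p v"
  have lin: "?B *v (r *\<^sub>R z) = r *\<^sub>R (?B *v z)" for r z
    by (simp add: vec_eq_iff matrix_vector_mult_def scaleR_sum_right)
  have eq: "(mat (- \<i> * of_real \<tau>) ** (mat (of_real p) + nl_matrix l1 l2 v)) *v z = \<tau> *\<^sub>R (?B *v z)" for z
    by (simp add: vec_eq_iff nlM_def mat_vec_nth flip: matrix_vector_mul_assoc) (simp add: scaleR_conv_of_real[where 'a=complex])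
  show ?case by (unfold funpow.simps o_apply, unfold Suc, unfold eq lin) simp
qed simp

text \<open>
  The \<open>H\<^sup>1\<close> norm dominates the essential supremum, so convergence in
  \<open>H\<^sup>1\<close> implies pointwise convergence almost everywhere.
\<close>

lemma h1_sums_AE:
  fixes g :: "nat \<Rightarrow> 'a::euclidean_space h1"
  assumes "g sums u"
  shows "AE x in lebesgue. (\<lambda>k. ev (val (g k)) x) sums ev (val u) x"
proof -
  have S: "AE x in lebesgue. ev (val (\<Sum>k<n. g k)) x = (\<Sum>k<n. ev (val (g k)) x)" for n
  proof (induction n)
    case 0 then show ?case using ev_zero by simp
  next
    case (Suc n)
    then show ?case using ev_add[of "val (\<Sum>k<n. g k)" "val (g n)"] by (auto elim: eventually_elim2)
  qed
  have B: "AE x in lebesgue. norm ((\<Sum>k<n. ev (val (g k)) x) - ev (val u) x) \<le> norm ((\<Sum>k<n. g k) - u)" for n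
    using S[of n] ev_diff[of "val (\<Sum>k<n. g k)" "val u"] h1_ess_bounded[of "(\<Sum>k<n. g k) - u"]
    by eventually_elim simp
  have lim: "(\<lambda>n. norm ((\<Sum>k<n. g k) - u)) \<longlonglongrightarrow> 0"
    using assms unfolding sums_def by (intro tendsto_norm_zero) (rule LIM_zero)
  have "AE x in lebesgue. \<forall>n. norm ((\<Sum>k<n. ev (val (g k)) x) - ev (val u) x) \<le> norm ((\<Sum>k<n. g k) - u)"
    unfolding AE_all_countable using B by blast
  then show ?thesis
  proof eventually_elim
    case (elim x)
    have "(\<lambda>n. (\<Sum>k<n. ev (val (g k)) x) - ev (val u) x) \<longlonglongrightarrow> 0"
      by (rule Lim_null_comparison[OF _ lim]) (use elim in simp)
    then show ?case unfolding sums_def by (rule LIM_zero_cancel)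
  qed
qed

text \<open>
  The abstract exponential flow is the pointwise matrix exponential of the scheme: both are
  sums of the same series.
\<close>

lemma flow_pointwise:
  assumes V: "W1inf V V1 c" and fe: "flow_estimates (genM l1 l2 V V1) R K"
    and u: "norm u \<le> R" and \<tau>: "0 \<le> \<tau>" "\<tau> \<le> 1" and f: "f \<in> L2_space" "cls f = val u"
  shows "AE x in lebesgue. ev (val (flow_estimates.flow (genM l1 l2 V V1) \<tau> u)) x =
    mat_exp (mat (- \<i> * of_real \<tau>) ** (mat (of_real (V x)) + nl_matrix l1 l2 (f x))) *v f x"
proof -
  interpret flow_estimates "genM l1 l2 V V1" R K by fact
  have fu: "AE x in lebesgue. ev (val u) x = f x" using ev_cls[OF f(1)] by (simp add: f(2))
  have P: "AE x in lebesgue. ev (val ((genM l1 l2 V V1 u ^^ k) u)) x = ((\<lambda>w. nlM l1 l2 (V x) (f x) *v w) ^^ k) (f x)" for k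
  proof (induction k)
    case 0 then show ?case using fu by simp
  next
    case (Suc k)
    show ?case using Suc ev_genM[OF V, of l1 l2 u "(genM l1 l2 V V1 u ^^ k) u"] fu
      by eventually_elim simp
  qed
  have T: "AE x in lebesgue. ev (val (flow_term \<tau> u k)) x = (\<tau> ^ k / fact k) *\<^sub>R ((\<lambda>w. nlM l1 l2 (V x) (f x) *v w) ^^ k) (f x)" for k
    using P[of k] ev_scaleR[of "\<tau> ^ k / fact k" "val ((genM l1 l2 V V1 u ^^ k) u)"]
    unfolding flow_term_def val_scaleR by eventually_elim simp
  have "AE x in lebesgue. \<forall>k. ev (val (flow_term \<tau> u k)) x = (\<tau> ^ k / fact k) *\<^sub>R ((\<lambda>w. nlM l1 l2 (V x) (f x) *v w) ^^ k) (f x)"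
    unfolding AE_all_countable using T by blast
  with h1_sums_AE[OF flow_sums[OF u \<tau>]] show ?thesis
  proof eventually_elim
    case (elim x)
    let ?A = "mat (- \<i> * of_real \<tau>) ** (mat (of_real (V x)) + nl_matrix l1 l2 (f x))"
    have "(\<lambda>k. (1 / fact k) *\<^sub>R ((\<lambda>w. ?A *v w) ^^ k) (f x)) sums ev (val (flow \<tau> u)) x"
      unfolding splitting_matrix using elim by simp
    with mat_exp_vector_sums[of ?A "f x"] show ?case by (rule sums_unique2[symmetric])
  qed
qed

section \<open>Error analysis\<close>

text \<open>
  In the moving frame \<open>Y s = exp (i s Q / \<epsilon>\<^sup>2) u (t + s)\<close> the
  equation reads \<open>Y' = c\<close>, where \<open>c\<close> is the nonlinearity \<open>N (u
  (t + s))\<close> in that frame, while a splitting step advances with the constant velocity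
  \<open>N (u t)\<close> up to \<open>O(\<tau>\<^sup>2)\<close>. So the local error is
  \<open>\<tau>\<close> times a bound of \<open>c s - N (u t)\<close>. For a regular value
  \<open>u (t + s)\<close>, replace the Dirac group by the mass rotation on both sides of
  \<open>N\<close>, at the price of the comparison error; the rotation then commutes with
  \<open>N\<close> and cancels. Regular times are dense, and continuity in
  \<open>H\<^sup>1\<close> extends the bound to all times.
\<close>

lemma flow_local_error:
  fixes u :: "real \<Rightarrow> spinor h1"
  assumes \<epsilon>: "0 < \<epsilon>" "\<epsilon> \<le> 1"
    and fe: "flow_estimates M R K"
    and equivariant: "\<And>r v w. M (hrot r v) (hrot r w) = hrot r (M v w)"
    and regular: "\<And>v. H3 B v \<Longrightarrow> H3 C (M v v)" and C: "0 \<le> C" and B: "0 \<le> B" "B \<le> R"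
    and u_cont: "continuous_on {0..T} u" and u_bound: "\<And>t. t \<in> {0..T} \<Longrightarrow> norm (u t) \<le> B"
    and u_deriv: "\<And>t. t \<in> {0..T} \<Longrightarrow> \<exists>G. gen (dgroup \<epsilon>) (val (u t)) G \<and>
      ((\<lambda>s. val (u s)) has_vector_derivative (1 / \<epsilon>\<^sup>2) *\<^sub>R G + val (M (u t) (u t))) (at t within {0..T})"
    and u_H3: "\<And>a b. 0 \<le> a \<Longrightarrow> a < b \<Longrightarrow> b \<le> T \<Longrightarrow> \<exists>t\<in>{a..b}. H3 B (u t)"
    and t: "0 \<le> t" and \<tau>: "0 < \<tau>" "\<tau> \<le> 1" and tT: "t + \<tau> \<le> T"
  shows "norm (u (t + \<tau>) - hgroup \<epsilon> (\<tau> / \<epsilon>\<^sup>2) (flow_estimates.flow M \<tau> (u t)))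
    \<le> \<tau> * ((2 * C + 2 * B * (K * (1 + R)) + K * R * (K * (1 + R)) + R * K\<^sup>2 * exp K) * (\<tau> + min \<epsilon> (\<tau> / \<epsilon>)))"
proof -
  interpret flow_estimates M R K by fact
  have e0: "\<epsilon> \<noteq> 0" using \<epsilon> by simp
  interpret S: isometry_group "dgroup \<epsilon>" by (rule isometry_group_dgroup[OF e0])
  interpret H: isometry_group "hgroup \<epsilon>" by (rule isometry_group_hgroup[OF e0])
  define N where "N v = M v v" for v
  define Y where "Y s = hgroup \<epsilon> (- (s / \<epsilon>\<^sup>2)) (u (t + s))" for s
  define c where "c s = hgroup \<epsilon> (- (s / \<epsilon>\<^sup>2)) (N (u (t + s)))" for s
  define \<delta> where "\<delta> = min \<epsilon> (\<tau> / \<epsilon>)"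
  have \<delta>0: "0 \<le> \<delta>" using \<epsilon> \<tau> by (simp add: \<delta>_def)
  have K1: "0 \<le> K * (1 + R)" "0 \<le> K * R" using K R by simp_all
  have ub: "norm (u (t + s)) \<le> R" "norm (u (t + s)) \<le> B" if "s \<in> {0..\<tau>}" for s
  proof -
    show "norm (u (t + s)) \<le> B" using u_bound[of "t + s"] that t tT by simp
    then show "norm (u (t + s)) \<le> R" using B by simp
  qed
  have Nb: "norm (N (u (t + s))) \<le> K * R" if "s \<in> {0..\<tau>}" for s
    unfolding N_def by (rule nonlinearity_bound[OF ub(1)[OF that]])
  have uc: "continuous_on {0..\<tau>} (\<lambda>s. u (t + s))"
    by (rule continuous_on_compose2[OF u_cont]) (use t tT in \<open>auto intro!: continuous_intros\<close>)
  have Nc: "continuous_on {0..\<tau>} (\<lambda>s. N (u (t + s)))"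
    unfolding continuous_on_def
  proof
    fix s assume s: "s \<in> {0..\<tau>}"
    have lim: "((\<lambda>s. u (t + s)) \<longlongrightarrow> u (t + s)) (at s within {0..\<tau>})" using uc s unfolding continuous_on_def by blast
    have z: "((\<lambda>r. K * (1 + R) * norm (u (t + r) - u (t + s))) \<longlongrightarrow> 0) (at s within {0..\<tau>})"
      by (intro tendsto_mult_right_zero tendsto_norm_zero) (rule LIM_zero[OF lim])
    have "((\<lambda>r. N (u (t + r)) - N (u (t + s))) \<longlongrightarrow> 0) (at s within {0..\<tau>})"
    proof (rule Lim_null_comparison[OF _ z])
      show "\<forall>\<^sub>F r in at s within {0..\<tau>}. norm (N (u (t + r)) - N (u (t + s))) \<le> K * (1 + R) * norm (u (t + r) - u (t + s))"
        unfolding eventually_at_filter N_def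
        by (intro always_eventually allI impI nonlinearity_lipschitz ub s)
    qed
    then show "((\<lambda>s. N (u (t + s))) \<longlongrightarrow> N (u (t + s))) (at s within {0..\<tau>})" by (rule LIM_zero_cancel)
  qed
  have cc: "continuous_on {0..\<tau>} c"
    unfolding c_def by (intro H.U_continuous_on Nc continuous_intros) (use \<epsilon> in simp_all)
  have Y': "((\<lambda>s. val (Y s)) has_vector_derivative val (c s)) (at s within {0..\<tau>})" if s: "s \<in> {0..\<tau>}" for s
  proof -
    have ts: "t + s \<in> {0..T}" using s t tT by simp
    obtain G where G: "gen (dgroup \<epsilon>) (val (u (t + s))) G"
      "((\<lambda>s. val (u s)) has_vector_derivative (1 / \<epsilon>\<^sup>2) *\<^sub>R G + val (N (u (t + s)))) (at (t + s) within {0..T})"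
      using u_deriv[OF ts] unfolding N_def by blast
    have "((\<lambda>s. t + s) has_vector_derivative 1) (at s within {0..\<tau>})" by (auto intro!: derivative_eq_intros)
    moreover have "((\<lambda>s. val (u s)) has_vector_derivative (1 / \<epsilon>\<^sup>2) *\<^sub>R G + val (N (u (t + s)))) (at (t + s) within (\<lambda>s. t + s) ` {0..\<tau>})"
      by (rule has_vector_derivative_within_subset[OF G(2)]) (use t tT in auto)
    ultimately have "((\<lambda>s. val (u (t + s))) has_vector_derivative (1 / \<epsilon>\<^sup>2) *\<^sub>R G + val (N (u (t + s)))) (at s within {0..\<tau>})"
      using vector_diff_chain_within[of "\<lambda>s. t + s" 1 s "{0..\<tau>}" "\<lambda>s. val (u s)"] by (simp add: o_def)
    from S.curve_derivative[OF this G(1), of "- 1 / \<epsilon>\<^sup>2"]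
    show ?thesis by (simp add: Y_def c_def val_der_hgroup[OF e0])
  qed
  have I: "(c has_integral Y s - Y 0) {0..s}" if s: "s \<in> {0..\<tau>}" for s
  proof -
    have "c integrable_on {0..s}"
      by (rule integrable_continuous_real[OF continuous_on_subset[OF cc]]) (use s in auto)
    then obtain i where i: "(c has_integral i) {0..s}" by blast
    have "((\<lambda>s. val (c s)) has_integral val (Y s) - val (Y 0)) {0..s}"
    proof (rule fundamental_theorem_of_calculus)
      show "((\<lambda>s. val (Y s)) has_vector_derivative val (c r)) (at r within {0..s})" if "r \<in> {0..s}" for r
        by (rule has_vector_derivative_within_subset[OF Y']) (use that s in auto)
    qed (use s in simp)
    moreover have "((\<lambda>s. val (c s)) has_integral val i) {0..s}"
      using has_integral_linear[OF i bounded_linear_val] by (simp add: o_def)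
    ultimately have "val i = val (Y s) - val (Y 0)" by (rule has_integral_unique[symmetric])
    \<comment> \<open>the identity holds in \<open>L\<^sup>2\<close>, and the integral already lies in \<open>H\<^sup>1\<close>\<close>
    then have "i = Y s - Y 0" by (intro h1_eqI) simp
    then show ?thesis using i by simp
  qed
  have Y0: "Y 0 = u t" by (simp add: Y_def)
  have rough: "norm (Y s - u t) \<le> K * R * s" if s: "s \<in> {0..\<tau>}" for s
  proof -
    have "norm (Y s - Y 0) \<le> K * R * measure lborel {0..s}"
      by (rule has_integral_bound_real[OF K1(2) finite.emptyI I[OF s]]) (use Nb s in \<open>simp add: c_def\<close>)
    then show ?thesis using s by (simp add: Y0)
  qed
  let ?D = "(2 * C + 2 * B * (K * (1 + R)) + K * R * (K * (1 + R))) * (\<tau> + \<delta>)"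
  have good: "norm (c s - N (u t)) \<le> ?D" if s: "s \<in> {0..\<tau>}" and H3: "H3 B (u (t + s))" for s
  proof -
    let ?r = "s / \<epsilon>\<^sup>2"
    define w where "w = hrot (- ?r) (u (t + s))"
    have w: "H3 B w" "norm w \<le> R" using H3_hrot[OF H3] H3_norm B unfolding w_def by (blast, fastforce)
    have sd: "s + min \<epsilon> (s / \<epsilon>) \<le> \<tau> + \<delta>"
    proof -
      have "s / \<epsilon> \<le> \<tau> / \<epsilon>" using s \<epsilon> by (simp add: divide_right_mono)
      then show ?thesis using s by (auto simp: \<delta>_def min_def)
    qed
    have "u (t + s) = hrot ?r w" by (simp add: w_def hrot_hrot)
    then have "N (u (t + s)) = hrot ?r (N w)" by (simp add: N_def equivariant)
    then have c: "c s = hgroup \<epsilon> (- ?r) (hrot ?r (N w))" by (simp add: c_def)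
    \<comment> \<open>comparison for the value \<open>N w\<close>, after pulling the rotation out of \<open>N\<close>\<close>
    have 1: "norm (c s - N w) \<le> 2 * C * (\<tau> + \<delta>)"
    proof -
      have "norm (c s - N w) \<le> 2 * C * (s + min \<epsilon> (s / \<epsilon>))"
        unfolding c N_def by (rule mass_comparison_h1(1)[OF \<epsilon> regular[OF w(1)]]) (use s in simp)
      also have "\<dots> \<le> 2 * C * (\<tau> + \<delta>)" using sd C by (intro mult_left_mono) auto
      finally show ?thesis .
    qed
    \<comment> \<open>comparison for the argument of \<open>N\<close>\<close>
    have 2: "norm (N w - N (Y s)) \<le> 2 * B * (K * (1 + R)) * (\<tau> + \<delta>)"
    proof -
      have Ys: "norm (Y s) \<le> R" using ub[OF s] by (simp add: Y_def)
      have "norm (w - Y s) = norm (hgroup \<epsilon> ?r (w - Y s))" by simp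
      also have "hgroup \<epsilon> ?r (w - Y s) = hgroup \<epsilon> ?r w - u (t + s)" by (simp add: H.U_diff Y_def)
      also have "norm \<dots> \<le> 2 * B * (s + min \<epsilon> (s / \<epsilon>))"
        unfolding w_def by (rule mass_comparison_h1(2)[OF \<epsilon> H3]) (use s in simp)
      also have "\<dots> \<le> 2 * B * (\<tau> + \<delta>)" using sd B by (intro mult_left_mono) auto
      finally have le: "K * (1 + R) * norm (w - Y s) \<le> K * (1 + R) * (2 * B * (\<tau> + \<delta>))" using K1 by (intro mult_left_mono)
      show ?thesis using order_trans[OF nonlinearity_lipschitz[OF w(2) Ys] le] unfolding N_def by (simp only: mult_ac)
    qed
    \<comment> \<open>the moving-frame curve has bounded velocity\<close>
    have 3: "norm (N (Y s) - N (u t)) \<le> K * R * (K * (1 + R)) * (\<tau> + \<delta>)"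
    proof -
      have Ys: "norm (Y s) \<le> R" using ub[OF s] by (simp add: Y_def)
      have ut: "norm (u t) \<le> R" using ub(1)[of 0] \<tau> by simp
      have "norm (N (Y s) - N (u t)) \<le> K * (1 + R) * norm (Y s - u t)"
        unfolding N_def by (rule nonlinearity_lipschitz[OF Ys ut])
      also have "\<dots> \<le> K * (1 + R) * (K * R * s)" using rough[OF s] K1 by (intro mult_left_mono)
      also have "\<dots> \<le> K * (1 + R) * (K * R * (\<tau> + \<delta>))"
        using s K1 \<delta>0 by (intro mult_left_mono) auto
      finally show ?thesis by (simp add: mult_ac)
    qed
    have "norm (c s - N (u t)) = norm ((c s - N w) + (N w - N (Y s)) + (N (Y s) - N (u t)))" by simp
    also have "\<dots> \<le> 2 * C * (\<tau> + \<delta>) + 2 * B * (K * (1 + R)) * (\<tau> + \<delta>) + K * R * (K * (1 + R)) * (\<tau> + \<delta>)"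
      by (intro norm_triangle_le add_mono 1 2 3)
    finally show ?thesis by (simp add: distrib_right)
  qed
  have all: "norm (c s - N (u t)) \<le> ?D" if s: "s \<in> {0..\<tau>}" for s
  proof -
    let ?G = "{s \<in> {0..\<tau>}. H3 B (u (t + s))}"
    have cl: "closure ?G \<subseteq> {0..\<tau>}" by (rule closure_minimal) auto
    have "s \<in> closure ?G"
      unfolding closure_approachable
    proof (intro allI impI)
      fix e :: real assume e: "0 < e"
      define a b where "a = max 0 (s - e / 2)" and "b = min \<tau> (s + e / 2)"
      have ab: "0 \<le> a" "a < b" "b \<le> \<tau>" "s - e / 2 \<le> a" "b \<le> s + e / 2"
        using s e \<tau> by (auto simp: a_def b_def)
      obtain q where q: "q \<in> {t + a..t + b}" "H3 B (u q)" using u_H3[of "t + a" "t + b"] ab t tT by auto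
      then show "\<exists>y\<in>?G. dist y s < e"
        using ab e by (intro bexI[of _ "q - t"]) (auto simp: dist_real_def abs_less_iff)
    qed
    moreover have "continuous_on (closure ?G) (\<lambda>s. c s - N (u t))"
      by (intro continuous_on_diff continuous_on_const continuous_on_subset[OF cc cl])
    ultimately show ?thesis
      using continuous_on_closure_norm_le[of ?G "\<lambda>s. c s - N (u t)" ?D s] good by blast
  qed
  have hi: "((\<lambda>s. c s - N (u t)) has_integral (Y \<tau> - Y 0 - \<tau> *\<^sub>R N (u t))) {0..\<tau>}"
    using has_integral_diff[OF I[of \<tau>] has_integral_const_real[of "N (u t)" 0 \<tau>]] \<tau> by simp
  have "0 \<le> ?D" by (rule order_trans[OF norm_ge_zero all[of 0]]) (use \<tau> in simp)
  from has_integral_bound_real[OF this finite.emptyI hi] all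
  have "norm (Y \<tau> - Y 0 - \<tau> *\<^sub>R N (u t)) \<le> ?D * measure lborel {0..\<tau>}" by simp
  then have a: "norm (Y \<tau> - u t - \<tau> *\<^sub>R N (u t)) \<le> ?D * \<tau>" using \<tau> by (simp add: Y0)
  have "norm (flow \<tau> (u t) - u t - \<tau> *\<^sub>R N (u t)) \<le> \<tau>\<^sup>2 * (R * K\<^sup>2 * exp K)"
    unfolding N_def by (rule flow_expansion) (use ub(1)[of 0] \<tau> in auto)
  also have "\<dots> = R * K\<^sup>2 * exp K * \<tau> * \<tau>" by (simp add: power2_eq_square)
  also have "\<dots> \<le> R * K\<^sup>2 * exp K * (\<tau> + \<delta>) * \<tau>"
    using \<tau> \<delta>0 R by (intro mult_right_mono mult_left_mono) auto
  finally have b: "norm (flow \<tau> (u t) - u t - \<tau> *\<^sub>R N (u t)) \<le> R * K\<^sup>2 * exp K * (\<tau> + \<delta>) * \<tau>" .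
  have "norm (u (t + \<tau>) - hgroup \<epsilon> (\<tau> / \<epsilon>\<^sup>2) (flow \<tau> (u t))) = norm (hgroup \<epsilon> (\<tau> / \<epsilon>\<^sup>2) (Y \<tau> - flow \<tau> (u t)))"
    by (simp add: H.U_diff Y_def del: H.norm_U)
  also have "\<dots> = norm ((Y \<tau> - u t - \<tau> *\<^sub>R N (u t)) - (flow \<tau> (u t) - u t - \<tau> *\<^sub>R N (u t)))" by simp
  also have "\<dots> \<le> ?D * \<tau> + R * K\<^sup>2 * exp K * (\<tau> + \<delta>) * \<tau>"
    by (rule order_trans[OF norm_triangle_ineq4 add_mono[OF a b]])
  finally show ?thesis unfolding \<delta>_def by (simp add: algebra_simps)
qed

text \<open>
  The one-step inequality is only available while the error is at most 1, because Lipschitz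
  constants are local. The resulting bound is itself at most 1, so the induction never leaves
  this regime.
\<close>

lemma discrete_gronwall_bootstrap:
  fixes e :: "nat \<Rightarrow> real"
  assumes L: "0 \<le> L" and \<tau>: "0 < \<tau>" and \<eta>: "0 \<le> \<eta>" and e0: "e 0 = 0"
    and step: "\<And>n. real (Suc n) * \<tau> \<le> T \<Longrightarrow> e n \<le> 1 \<Longrightarrow> e (Suc n) \<le> \<tau> * \<eta> + (1 + L * \<tau>) * e n"
    and small: "T * exp (L * T) * \<eta> \<le> 1"
  shows "real n * \<tau> \<le> T \<Longrightarrow> e n \<le> T * exp (L * T) * \<eta>"
proof -
  have fin: "real n * \<tau> * \<eta> * (1 + L * \<tau>) ^ n \<le> T * exp (L * T) * \<eta>" if n: "real n * \<tau> \<le> T" for n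
  proof -
    have "(1 + L * \<tau>) ^ n \<le> exp (L * \<tau>) ^ n"
      using L \<tau> by (intro power_mono exp_ge_add_one_self) simp
    also have "\<dots> = exp (L * (real n * \<tau>))" by (simp add: exp_of_nat_mult[symmetric] mult_ac)
    also have "\<dots> \<le> exp (L * T)" using n L by (simp add: mult_left_mono)
    finally have a: "(1 + L * \<tau>) ^ n \<le> exp (L * T)" .
    have "0 \<le> real n * \<tau>" using \<tau> by simp
    then have T: "0 \<le> T" using n by linarith
    have "real n * \<tau> * \<eta> * (1 + L * \<tau>) ^ n \<le> (T * \<eta>) * exp (L * T)"
      using a n \<eta> L \<tau> T by (intro mult_mono mult_right_mono) auto
    then show ?thesis by (simp add: mult_ac)
  qed
  have "e n \<le> real n * \<tau> * \<eta> * (1 + L * \<tau>) ^ n" if "real n * \<tau> \<le> T" for n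
    using that
  proof (induction n)
    case 0 then show ?case by (simp add: e0)
  next
    case (Suc n)
    have n: "real n * \<tau> \<le> T" using Suc.prems \<tau> by (simp add: algebra_simps)
    note IH = Suc.IH[OF n]
    have "e n \<le> 1" using IH fin[OF n] small by linarith
    then have "e (Suc n) \<le> \<tau> * \<eta> + (1 + L * \<tau>) * e n" by (rule step[OF Suc.prems])
    also have "\<dots> \<le> \<tau> * \<eta> * (1 + L * \<tau>) ^ Suc n + (1 + L * \<tau>) * (real n * \<tau> * \<eta> * (1 + L * \<tau>) ^ n)"
    proof (intro add_mono mult_left_mono IH)
      have "1 \<le> (1 + L * \<tau>) ^ Suc n" using L \<tau> by (intro one_le_power) simp
      then have "\<tau> * \<eta> * 1 \<le> \<tau> * \<eta> * (1 + L * \<tau>) ^ Suc n" using \<tau> \<eta> by (intro mult_left_mono) auto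
      then show "\<tau> * \<eta> \<le> \<tau> * \<eta> * (1 + L * \<tau>) ^ Suc n" by simp
    qed (use L \<tau> in simp)
    also have "\<dots> = real (Suc n) * \<tau> * \<eta> * (1 + L * \<tau>) ^ Suc n" by (simp add: algebra_simps)
    finally show ?case .
  qed
  then show "e n \<le> T * exp (L * T) * \<eta>" if "real n * \<tau> \<le> T" using fin[OF that] that order_trans by blast
qed

primrec h1_splitting :: "(spinor h1 \<Rightarrow> spinor h1) \<Rightarrow> (spinor h1 \<Rightarrow> spinor h1) \<Rightarrow> spinor h1 \<Rightarrow> nat \<Rightarrow> spinor h1" where
  "h1_splitting S E u 0 = u"
| "h1_splitting S E u (Suc n) = S (E (h1_splitting S E u n))"

lemma lie_trotter_class:
  assumes V: "W1inf V V1 c" and fe: "flow_estimates (genM l1 l2 V V1) R K"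
    and \<epsilon>: "\<epsilon> \<noteq> 0" and \<tau>: "0 \<le> \<tau>" "\<tau> \<le> 1" and \<Phi>0: "\<Phi>0 \<in> L2_space" "cls \<Phi>0 = val u0"
    and bound: "\<And>k. k < n \<Longrightarrow>
      norm (h1_splitting (hgroup \<epsilon> (\<tau> / \<epsilon>\<^sup>2)) (flow_estimates.flow (genM l1 l2 V V1) \<tau>) u0 k) \<le> R"
  shows "lie_trotter \<epsilon> l1 l2 V \<Phi>0 \<tau> n \<in> L2_space \<and>
    cls (lie_trotter \<epsilon> l1 l2 V \<Phi>0 \<tau> n) = val (h1_splitting (hgroup \<epsilon> (\<tau> / \<epsilon>\<^sup>2)) (flow_estimates.flow (genM l1 l2 V V1) \<tau>) u0 n)"
  using bound
proof (induction n)
  case 0 then show ?case using \<Phi>0 by simp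
next
  case (Suc n)
  let ?f = "lie_trotter \<epsilon> l1 l2 V \<Phi>0 \<tau> n"
  let ?E = "flow_estimates.flow (genM l1 l2 V V1) \<tau>"
  let ?u = "h1_splitting (hgroup \<epsilon> (\<tau> / \<epsilon>\<^sup>2)) ?E u0 n"
  let ?g = "\<lambda>x. mat_exp (mat (- \<i> * of_real \<tau>) ** (mat (of_real (V x)) + nl_matrix l1 l2 (?f x))) *v ?f x"
  have f: "?f \<in> L2_space" "cls ?f = val ?u" using Suc.IH Suc.prems by simp_all
  have ae: "AE x in lebesgue. ev (val (?E ?u)) x = ?g x"
    by (rule flow_pointwise[OF V fe _ \<tau> f]) (use Suc.prems in simp)
  have g: "?g \<in> L2_space" by (rule L2_space_cong_AE[OF ev_L2 ae])
  have "cls ?g = val (?E ?u)" using cls_cong[OF ev_L2 ae] by simp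
  then show ?case
    using dirac_group_L2[OF \<epsilon> g] cls_dirac_group[OF \<epsilon> g] by (simp add: val_der_hgroup[OF \<epsilon>])
qed

text \<open>
  A solution is a continuous curve in \<open>H\<^sup>1\<close> that is differentiable in
  \<open>L\<^sup>2\<close>, with velocity \<open>\<epsilon>\<^sup>-\<^sup>2 (- i Q u) + N
  u\<close>.
\<close>

lemma solution_curve:
  assumes V: "W1inf V V1 c" and \<epsilon>: "0 < \<epsilon>" and sol: "nlde_solution \<epsilon> l1 l2 V \<Phi>0 I \<Phi>" and T: "{0..T} \<subseteq> I"
  obtains u where "\<And>t. t \<in> {0..T} \<Longrightarrow> \<Phi> t \<in> L2_space \<and> cls (\<Phi> t) = val (u t)"
    "continuous_on {0..T} u"
    "\<And>t. t \<in> {0..T} \<Longrightarrow> \<exists>G. gen (dgroup \<epsilon>) (val (u t)) G \<and>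
      ((\<lambda>s. val (u s)) has_vector_derivative (1 / \<epsilon>\<^sup>2) *\<^sub>R G + val (genM l1 l2 V V1 (u t) (u t))) (at t within {0..T})"
proof -
  have "\<exists>v. \<Phi> t \<in> L2_space \<and> cls (\<Phi> t) = val v" if t: "t \<in> I" for t
  proof -
    have "\<Phi> t \<in> sobolev_H 1" using sol t by (simp add: nlde_solution_def)
    from sobolev_H1_lift[OF this] show ?thesis by blast
  qed
  then obtain u where u: "\<And>t. t \<in> I \<Longrightarrow> \<Phi> t \<in> L2_space" "\<And>t. t \<in> I \<Longrightarrow> cls (\<Phi> t) = val (u t)"
    by metis
  have cont: "(u \<longlongrightarrow> u t) (at t within {0..T})" if t: "t \<in> {0..T}" for t
  proof -
    have tI: "t \<in> I" using t T by blast
    have "((\<lambda>s. sobolev_norm 1 (\<lambda>x. \<Phi> s x - \<Phi> t x)) \<longlongrightarrow> 0) (at t within I)"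
      using sol tI unfolding nlde_solution_def by blast
    then have "((\<lambda>s. sobolev_norm 1 (\<lambda>x. \<Phi> s x - \<Phi> t x)) \<longlongrightarrow> 0) (at t within {0..T})"
      by (rule tendsto_within_subset[OF _ T])
    moreover have "\<forall>\<^sub>F s in at t within {0..T}. sobolev_norm 1 (\<lambda>x. \<Phi> s x - \<Phi> t x) = norm (u s - u t)"
      unfolding eventually_at_filter
    proof (intro always_eventually allI impI)
      fix s assume "s \<in> {0..T}"
      then have s: "s \<in> I" using T by blast
      show "sobolev_norm 1 (\<lambda>x. \<Phi> s x - \<Phi> t x) = norm (u s - u t)"
        by (rule cls_val_sobolev(2)) (simp_all add: u s tI L2_space_diff cls_diff)
    qed
    ultimately have "((\<lambda>s. norm (u s - u t)) \<longlongrightarrow> 0) (at t within {0..T})"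
      using tendsto_cong by fastforce
    then show ?thesis by (rule LIM_zero_cancel[OF tendsto_norm_zero_cancel])
  qed
  show thesis
  proof (rule that[of u])
    show "\<And>t. t \<in> {0..T} \<Longrightarrow> \<Phi> t \<in> L2_space \<and> cls (\<Phi> t) = val (u t)" using u T by blast
    show "continuous_on {0..T} u" unfolding continuous_on_def using cont by blast
    fix t assume t: "t \<in> {0..T}"
    then have tI: "t \<in> I" using T by blast
    let ?v = "u t"
    obtain p where p: "has_L2_deriv \<Phi> p t I" and eq: "AE x in lebesgue.
           \<i> *s p x = of_real (1 / \<epsilon>\<^sup>2) *s dirac_op \<epsilon> (\<Phi> t) x
                      + of_real (V x) *s \<Phi> t x
                      + nl_matrix l1 l2 (\<Phi> t x) *v \<Phi> t x"
      using sol tI unfolding nlde_solution_def by blast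
    have pL: "p \<in> L2_space" using p by (simp add: has_L2_deriv_def)
    have "((\<lambda>s. cls (\<Phi> s)) has_vector_derivative cls p) (at t within I)"
      using p has_L2_deriv_iff[of I \<Phi> t p] u(1) tI pL by blast
    then have "((\<lambda>s. cls (\<Phi> s)) has_vector_derivative cls p) (at t within {0..T})"
      by (rule has_vector_derivative_within_subset[OF _ T])
    then have d: "((\<lambda>s. val (u s)) has_vector_derivative cls p) (at t within {0..T})"
      by (rule has_vector_derivative_transform[OF t, rotated]) (use u T in auto)
    let ?G = "- \<epsilon> *\<^sub>R lin s1 (der ?v) - lin kk (val ?v)"
    let ?N = "genM l1 l2 V V1 ?v ?v"
    have "cls p = (1 / \<epsilon>\<^sup>2) *\<^sub>R ?G + val ?N"
    proof (rule l2_eqI)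
      show "AE x in lebesgue. ev (cls p) x = ev ((1 / \<epsilon>\<^sup>2) *\<^sub>R ?G + val ?N) x"
        using eq ev_cls[OF pL] dirac_op_AE[OF u(1)[OF tI] u(2)[OF tI], of \<epsilon>] ev_cls[OF u(1)[OF tI], unfolded u(2)[OF tI]]
          ev_add[of "(1 / \<epsilon>\<^sup>2) *\<^sub>R ?G" "val ?N"] ev_scaleR[of "1 / \<epsilon>\<^sup>2" ?G]
          ev_diff[of "- \<epsilon> *\<^sub>R lin s1 (der ?v)" "lin kk (val ?v)"] ev_scaleR[of "- \<epsilon>" "lin s1 (der ?v)"]
          ev_lin[OF bounded_linear_s1, of "der ?v"] ev_lin[OF bounded_linear_kk, of "val ?v"]
          ev_genM[OF V, of l1 l2 ?v ?v]
      proof eventually_elim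
        case (elim x)
        let ?a = "ev (der ?v) x" and ?b = "\<Phi> t x"
        have "p x = - cs \<i> (\<i> *s p x)" by (simp add: spinor_eq_iff)
        also have "\<dots> = (1 / \<epsilon>\<^sup>2) *\<^sub>R (- \<epsilon> *\<^sub>R s1 ?a - kk ?b) + nlM l1 l2 (V x) ?b *v ?b"
          unfolding elim(1) elim(3)
          by (simp add: spinor_eq_iff nlM_nth nl_matrix_nth scaleR_conv_of_real[where 'a=complex] algebra_simps)
        finally show ?case using elim by simp
      qed
    qed
    moreover have "gen (dgroup \<epsilon>) (val ?v) ?G"
      using gen_dgroup[of \<epsilon>] dirac_gen_val[of \<epsilon> ?v] \<epsilon> by simp
    ultimately show "\<exists>G. gen (dgroup \<epsilon>) (val ?v) G \<and>
      ((\<lambda>s. val (u s)) has_vector_derivative (1 / \<epsilon>\<^sup>2) *\<^sub>R G + val ?N) (at t within {0..T})"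
      using d by metis
  qed
qed

lemma dense_of_AE:
  assumes "AE t in lebesgue_on {0..T}. P t" "0 \<le> a" "a < b" "b \<le> (T::real)"
  shows "\<exists>t\<in>{a..b}. P t"
proof (rule ccontr)
  assume n: "\<not> (\<exists>t\<in>{a..b}. P t)"
  have "AE t in lebesgue. t \<in> {0..T} \<longrightarrow> P t"
    using assms(1) by (subst (asm) AE_restrict_space_iff) auto
  then obtain N where N: "negligible N" "{t. \<not> (t \<in> {0..T} \<longrightarrow> P t)} \<subseteq> N"
    unfolding eventually_ae_filter_negligible by blast
  have "{a..b} \<subseteq> N" using n N(2) assms by auto
  then have "negligible {a..b}" using N(1) negligible_subset by blast
  then show False using assms(3) negligible_interval(1)[of a b] by (simp add: box_real)
qed

lemma flow_estimates_genM:
  assumes V: "W1inf V V1 c" and R: "0 \<le> R"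
  shows "\<exists>K. flow_estimates (genM l1 l2 V V1) R K"
proof -
  obtain K where K: "0 \<le> K" "\<And>v. linear (genM l1 l2 V V1 v)"
    "\<And>v w. norm (genM l1 l2 V V1 v w) \<le> K * (1 + (norm v)\<^sup>2) * norm w"
    "\<And>v v' w. norm (genM l1 l2 V V1 v w - genM l1 l2 V V1 v' w) \<le> K * (norm v + norm v') * norm (v - v') * norm w"
    by (rule genM_bounds[OF V]) (rule that)
  have "flow_estimates (genM l1 l2 V V1) R (K * (1 + R)\<^sup>2)"
  proof (rule flow_estimates.intro)
    have KR: "K * (1 + R\<^sup>2) \<le> K * (1 + R)\<^sup>2" "K * (R + R) \<le> K * (1 + R)\<^sup>2"
      using K(1) R by (intro mult_left_mono; simp add: power2_sum)+
    show "linear (genM l1 l2 V V1 v)" for v by (rule K)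
    show "norm (genM l1 l2 V V1 v w) \<le> K * (1 + R)\<^sup>2 * norm w" if "norm v \<le> R" for v w
    proof -
      have "K * (1 + (norm v)\<^sup>2) \<le> K * (1 + R\<^sup>2)" using K(1) that by (intro mult_left_mono add_left_mono power_mono) auto
      then have "K * (1 + (norm v)\<^sup>2) \<le> K * (1 + R)\<^sup>2" using KR by linarith
      from mult_right_mono[OF this norm_ge_zero[of w]] show ?thesis using K(3)[of v w] by linarith
    qed
    show "norm (genM l1 l2 V V1 v w - genM l1 l2 V V1 v' w) \<le> K * (1 + R)\<^sup>2 * norm (v - v') * norm w"
      if "norm v \<le> R" "norm v' \<le> R" for v v' w
    proof -
      have "K * (norm v + norm v') \<le> K * (R + R)" using K(1) that by (intro mult_left_mono add_mono) auto
      then have "K * (norm v + norm v') \<le> K * (1 + R)\<^sup>2" using KR by linarith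
      then have "K * (norm v + norm v') * norm (v - v') * norm w \<le> K * (1 + R)\<^sup>2 * norm (v - v') * norm w"
        by (intro mult_right_mono) auto
      then show ?thesis using K(4)[of v w v'] by linarith
    qed
    show "0 \<le> K * (1 + R)\<^sup>2" using K(1) by simp
  qed (rule R)
  then show ?thesis by blast
qed

lemma min_le_sqrt:
  assumes "0 < \<epsilon>" "0 < \<tau>"
  shows "min \<epsilon> (\<tau> / \<epsilon>) \<le> sqrt \<tau>"
proof (cases "\<epsilon> \<le> sqrt \<tau>")
  case False
  have "\<tau> / \<epsilon> \<le> \<tau> / sqrt \<tau>" using False assms by (intro divide_left_mono) auto
  also have "\<dots> = sqrt \<tau>" by (rule real_div_sqrt) (use assms in simp)
  finally show ?thesis by simp
qed simp

text \<open>
  Both error bounds in one. The estimate \<open>min \<epsilon> (\<tau> / \<epsilon>) \<le>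
  sqrt \<tau>\<close> makes the right-hand side small uniformly in \<open>\<epsilon>\<close>,
  which is what allows the bootstrap: the numerical solution stays in the ball of radius
  \<open>R\<close>, one unit larger than the bound of the exact solution.
\<close>

theorem splitting_error_bound:
  fixes l1 l2 T :: real and V :: "real \<Rightarrow> real" and \<Phi>0 :: "real \<Rightarrow> complex^2" and \<Phi> :: "real \<Rightarrow> real \<Rightarrow> real \<Rightarrow> complex^2"
  assumes V: "V \<in> sobolev_W_inf 3" and T: "0 < T" and TI: "{0..T} \<subseteq> I"
    and sol: "\<And>\<epsilon>. \<epsilon> \<in> {0<..1} \<Longrightarrow> nlde_solution \<epsilon> l1 l2 V \<Phi>0 I (\<Phi> \<epsilon>)"
    and bound: "\<And>\<epsilon>. \<epsilon> \<in> {0<..1} \<Longrightarrow> AE t in lebesgue_on {0..T}. \<Phi> \<epsilon> t \<in> sobolev_H 3 \<and> sobolev_norm 3 (\<Phi> \<epsilon> t) \<le> M"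
  obtains C \<tau>0 where "0 < C" "0 < \<tau>0" "\<tau>0 \<le> 1"
    "\<And>\<epsilon> \<tau> n. \<epsilon> \<in> {0<..1} \<Longrightarrow> 0 < \<tau> \<Longrightarrow> \<tau> < \<tau>0 \<Longrightarrow> real n \<le> T / \<tau> \<Longrightarrow>
      splitting_error \<epsilon> l1 l2 V \<Phi>0 (\<Phi> \<epsilon>) \<tau> n \<in> sobolev_H 1 \<and>
      sobolev_norm 1 (splitting_error \<epsilon> l1 l2 V \<Phi>0 (\<Phi> \<epsilon>) \<tau> n) \<le> C * (\<tau> + min \<epsilon> (\<tau> / \<epsilon>))"
proof -
  obtain V1 V2 V3 c where W: "W1inf V V1 c" "W1inf V1 V2 c" "W1inf V2 V3 c"
    by (rule W_inf_derivatives[OF V]) (rule that)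
  define B where "B = max M 0"
  define R where "R = B + 1"
  have B: "0 \<le> B" "B \<le> R" and R: "0 \<le> R" by (auto simp: B_def R_def)
  let ?M = "genM l1 l2 V V1"
  obtain K where fe: "flow_estimates ?M R K" using flow_estimates_genM[OF W(1) R] by blast
  interpret flow_estimates ?M R K by fact
  obtain C' where C': "\<And>v. H3 B v \<Longrightarrow> H3 C' (?M v v)" using H3_genM[OF W] by blast
  define C where "C = max C' 0"
  have C: "H3 C (?M v v)" if "H3 B v" for v
    using C'[OF that] unfolding H3_def C_def by (meson max.coboundedI1)
  have C0: "0 \<le> C" by (simp add: C_def)
  define A where "A = 2 * C + 2 * B * (K * (1 + R)) + K * R * (K * (1 + R)) + R * K\<^sup>2 * exp K"
  define L where "L = (1 + R) * K * exp K"
  have A: "0 \<le> A" and L: "0 \<le> L" using C0 B K R by (simp_all add: A_def L_def)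
  \<comment> \<open>the summand 1 only makes the constant positive\<close>
  define D where "D = T * exp (L * T) * A + 1"
  have D: "0 < D" using T A by (simp add: D_def add_nonneg_pos)
  \<comment> \<open>chosen so that \<open>D (\<tau> + min \<epsilon> (\<tau> / \<epsilon>)) \<le> 2 D sqrt \<tau> \<le> 1\<close>\<close>
  define \<tau>0 where "\<tau>0 = min 1 ((1 / (2 * D))\<^sup>2)"
  have \<tau>0: "0 < \<tau>0" "\<tau>0 \<le> 1" using D by (simp_all add: \<tau>0_def)
  show thesis
  proof (rule that[OF D \<tau>0])
    fix \<epsilon> \<tau> :: real and n :: nat
    assume \<epsilon>1: "\<epsilon> \<in> {0<..1}" and \<tau>: "0 < \<tau>" "\<tau> < \<tau>0" and n: "real n \<le> T / \<tau>"
    have \<epsilon>: "0 < \<epsilon>" "\<epsilon> \<le> 1" "\<epsilon> \<noteq> 0" using \<epsilon>1 by auto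
    have \<tau>1: "\<tau> \<le> 1" "0 \<le> \<tau>" using \<tau> \<tau>0 by auto
    have nT: "real n * \<tau> \<le> T" using n \<tau>(1) by (simp add: pos_le_divide_eq)
    let ?\<delta> = "min \<epsilon> (\<tau> / \<epsilon>)"
    have \<delta>0: "0 \<le> ?\<delta>" using \<epsilon> \<tau> by simp
    have sq: "\<tau> + ?\<delta> \<le> 2 * sqrt \<tau>"
    proof -
      have "\<tau> \<le> sqrt \<tau>" using \<tau>1 real_le_rsqrt[of \<tau> \<tau>] by (simp add: power2_eq_square mult_left_le)
      then show ?thesis using min_le_sqrt[OF \<epsilon>(1) \<tau>(1)] by linarith
    qed
    have small: "D * (\<tau> + ?\<delta>) \<le> 1"
    proof -
      have "sqrt \<tau> \<le> sqrt ((1 / (2 * D))\<^sup>2)" using \<tau>(2) unfolding \<tau>0_def by (intro real_sqrt_le_mono) linarith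
      also have "\<dots> = 1 / (2 * D)" using D by simp
      finally have "D * (2 * sqrt \<tau>) \<le> D * (2 * (1 / (2 * D)))" using D by (intro mult_left_mono) auto
      also have "\<dots> = 1" using D by simp
      finally show ?thesis using mult_left_mono[OF sq less_imp_le[OF D]] by linarith
    qed
    obtain u where u: "\<And>t. t \<in> {0..T} \<Longrightarrow> \<Phi> \<epsilon> t \<in> L2_space \<and> cls (\<Phi> \<epsilon> t) = val (u t)"
      and uc: "continuous_on {0..T} u"
      and ud: "\<And>t. t \<in> {0..T} \<Longrightarrow> \<exists>G. gen (dgroup \<epsilon>) (val (u t)) G \<and>
        ((\<lambda>s. val (u s)) has_vector_derivative (1 / \<epsilon>\<^sup>2) *\<^sub>R G + val (?M (u t) (u t))) (at t within {0..T})"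
      by (rule solution_curve[OF W(1) \<epsilon>(1) sol[OF \<epsilon>1] TI, of thesis]) (rule that)
    have uH3: "\<exists>t\<in>{a..b}. H3 B (u t)" if ab: "0 \<le> a" "a < b" "b \<le> T" for a b
    proof -
      obtain t where t: "t \<in> {a..b}" "\<Phi> \<epsilon> t \<in> sobolev_H 3" "sobolev_norm 3 (\<Phi> \<epsilon> t) \<le> M"
        using dense_of_AE[OF bound[OF \<epsilon>1] ab] by blast
      obtain v v1 v2 where v: "cls (\<Phi> \<epsilon> t) = val v" "h1D v v1" "h1D v1 v2" "norm v \<le> M" "norm v1 \<le> M" "norm v2 \<le> M"
        by (rule sobolev_H3_lift[OF t(2,3)]) (rule that)
      have "v = u t" using u[of t] t(1) ab v(1) by (intro h1_eqI) auto
      moreover have "H3 B v" unfolding H3_def B_def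
        by (intro exI[of _ v1] exI[of _ v2] conjI v max.coboundedI1)
      ultimately show ?thesis using t(1) by blast
    qed
    have ub: "norm (u t) \<le> B" if t: "t \<in> {0..T}" for t
    proof -
      let ?S = "{s \<in> {0..T}. H3 B (u s)}"
      have "t \<in> closure ?S"
        unfolding closure_approachable
      proof (intro allI impI)
        fix e :: real assume e: "0 < e"
        define a b where "a = max 0 (t - e / 2)" and "b = min T (t + e / 2)"
        have ab: "0 \<le> a" "a < b" "b \<le> T" "t - e / 2 \<le> a" "b \<le> t + e / 2"
          using t e T by (auto simp: a_def b_def)
        obtain s where s: "s \<in> {a..b}" "H3 B (u s)" using uH3[OF ab(1-3)] by blast
        then show "\<exists>y\<in>?S. dist y t < e"
          using ab e by (intro bexI[of _ s]) (auto simp: dist_real_def abs_less_iff)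
      qed
      moreover have "closure ?S \<subseteq> {0..T}" by (rule closure_minimal) auto
      then have "continuous_on (closure ?S) u" by (rule continuous_on_subset[OF uc])
      ultimately show ?thesis
        by (intro continuous_on_closure_norm_le[of ?S u]) (auto intro: H3_norm)
    qed
    define hs where "hs = h1_splitting (hgroup \<epsilon> (\<tau> / \<epsilon>\<^sup>2)) (flow \<tau>) (u 0)"
    define e where "e k = norm (u (real k * \<tau>) - hs k)" for k
    interpret H: isometry_group "hgroup \<epsilon>" by (rule isometry_group_hgroup[OF \<epsilon>(3)])
    have kT: "real k * \<tau> \<in> {0..T}" if "real k * \<tau> \<le> T" for k using that \<tau> by simp
    have hsb: "norm (hs k) \<le> R" if k: "real k * \<tau> \<le> T" "e k \<le> 1" for k
    proof -
      have "norm (hs k) \<le> norm (u (real k * \<tau>)) + norm (u (real k * \<tau>) - hs k)"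
        by (metis norm_minus_commute norm_triangle_sub)
      then show ?thesis using ub[OF kT[OF k(1)]] k(2) by (simp add: e_def R_def)
    qed
    have step: "e (Suc k) \<le> \<tau> * (A * (\<tau> + ?\<delta>)) + (1 + L * \<tau>) * e k" if k: "real (Suc k) * \<tau> \<le> T" "e k \<le> 1" for k
    proof -
      let ?t = "real k * \<tau>"
      have t: "?t \<le> T" "?t + \<tau> \<le> T" "0 \<le> ?t" using k(1) \<tau> by (auto simp: algebra_simps)
      have loc: "norm (u (?t + \<tau>) - hgroup \<epsilon> (\<tau> / \<epsilon>\<^sup>2) (flow \<tau> (u ?t))) \<le> \<tau> * (A * (\<tau> + ?\<delta>))"
        unfolding A_def
        by (rule flow_local_error[OF \<epsilon>(1,2) fe genM_hrot[OF W(1)] C C0 B uc ub ud uH3 t(3) \<tau>(1) \<tau>1(1) t(2)])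
      have stab: "norm (flow \<tau> (u ?t) - flow \<tau> (hs k)) \<le> (1 + L * \<tau>) * e k"
        using flow_lipschitz[OF order_trans[OF ub[OF kT[OF t(1)]] B(2)] hsb[OF t(1) k(2)] \<tau>1(2,1)]
        by (simp add: L_def e_def mult_ac)
      have "u (real (Suc k) * \<tau>) - hs (Suc k) = (u (?t + \<tau>) - hgroup \<epsilon> (\<tau> / \<epsilon>\<^sup>2) (flow \<tau> (u ?t)))
          + hgroup \<epsilon> (\<tau> / \<epsilon>\<^sup>2) (flow \<tau> (u ?t) - flow \<tau> (hs k))"
        by (simp add: hs_def H.U_diff algebra_simps)
      then have "e (Suc k) \<le> norm (u (?t + \<tau>) - hgroup \<epsilon> (\<tau> / \<epsilon>\<^sup>2) (flow \<tau> (u ?t))) + norm (flow \<tau> (u ?t) - flow \<tau> (hs k))"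
        unfolding e_def by (metis H.norm_U norm_triangle_ineq)
      then show ?thesis using loc stab by linarith
    qed
    have T0: "T * exp (L * T) * (A * (\<tau> + ?\<delta>)) \<le> D * (\<tau> + ?\<delta>)"
      using \<delta>0 \<tau>1 by (simp add: D_def algebra_simps)
    have e_bound: "e k \<le> D * (\<tau> + ?\<delta>)" if "real k * \<tau> \<le> T" for k
    proof -
      have "e k \<le> T * exp (L * T) * (A * (\<tau> + ?\<delta>))"
      proof (rule discrete_gronwall_bootstrap[where e=e, OF L \<tau>(1) _ _ step])
        show "T * exp (L * T) * (A * (\<tau> + ?\<delta>)) \<le> 1" using T0 small by linarith
      qed (use A \<delta>0 \<tau>1 that in \<open>simp_all add: e_def hs_def\<close>)
      then show ?thesis using T0 by linarith
    qed
    have bk: "norm (hs k) \<le> R" if "k < n" for k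
    proof -
      have "real k * \<tau> \<le> real n * \<tau>" using that \<tau> by (intro mult_right_mono) auto
      then have k: "real k * \<tau> \<le> T" using nT by linarith
      then show ?thesis using hsb[OF k] e_bound[OF k] small by linarith
    qed
    have \<Phi>0: "\<Phi>0 \<in> L2_space" "cls \<Phi>0 = val (u 0)"
    proof -
      have ae: "AE x in lebesgue. \<Phi> \<epsilon> 0 x = \<Phi>0 x" using sol[OF \<epsilon>1] by (simp add: nlde_solution_def)
      have u0: "\<Phi> \<epsilon> 0 \<in> L2_space" "cls (\<Phi> \<epsilon> 0) = val (u 0)" using u[of 0] T by auto
      show "\<Phi>0 \<in> L2_space" by (rule L2_space_cong_AE[OF u0(1) ae])
      show "cls \<Phi>0 = val (u 0)" using cls_cong[OF u0(1) ae] u0(2) by simp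
    qed
    have lt: "lie_trotter \<epsilon> l1 l2 V \<Phi>0 \<tau> n \<in> L2_space" "cls (lie_trotter \<epsilon> l1 l2 V \<Phi>0 \<tau> n) = val (hs n)"
      using lie_trotter_class[OF W(1) fe \<epsilon>(3) \<tau>1(2,1) \<Phi>0, of n] bk unfolding hs_def by blast+
    have un: "\<Phi> \<epsilon> (real n * \<tau>) \<in> L2_space" "cls (\<Phi> \<epsilon> (real n * \<tau>)) = val (u (real n * \<tau>))"
      using u[OF kT[OF nT]] by auto
    let ?e = "splitting_error \<epsilon> l1 l2 V \<Phi>0 (\<Phi> \<epsilon>) \<tau> n"
    have eL: "?e \<in> L2_space" "cls ?e = val (u (real n * \<tau>) - hs n)"
      unfolding splitting_error_def by (simp_all add: L2_space_diff cls_diff un lt)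
    show "?e \<in> sobolev_H 1 \<and> sobolev_norm 1 ?e \<le> D * (\<tau> + ?\<delta>)"
      using cls_val_sobolev(1,2)[OF eL] e_bound[OF nT] by (simp add: e_def)
  qed
qed

theorem theorem2p1:
  fixes l1 l2 T :: real
    and V :: "real \<Rightarrow> real"
    and \<Phi>0 :: "real \<Rightarrow> complex^2"
    and \<Phi> :: "real \<Rightarrow> real \<Rightarrow> real \<Rightarrow> complex^2"
  assumes V: "V \<in> sobolev_W_inf 3"
    and T: "0 < T" "ereal T < nlde_common_max_time l1 l2 V \<Phi>0"
    and sol: "\<forall>\<epsilon>\<in>{0<..1}. nlde_solution \<epsilon> l1 l2 V \<Phi>0
                (time_interval (nlde_common_max_time l1 l2 V \<Phi>0)) (\<Phi> \<epsilon>)"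
    and bound: "\<exists>M. \<forall>\<epsilon>\<in>{0<..1}. AE t in lebesgue_on {0..T}.
                  \<Phi> \<epsilon> t \<in> sobolev_H 3 \<and> sobolev_norm 3 (\<Phi> \<epsilon> t) \<le> M"
  shows "\<exists>\<tau>0. 0 < \<tau>0 \<and> \<tau>0 \<le> 1 \<and>
    (\<exists>C>0. \<forall>\<epsilon>\<in>{0<..1}. \<forall>\<tau>. 0 < \<tau> \<and> \<tau> < \<tau>0 \<longrightarrow> (\<forall>n::nat. real n \<le> T / \<tau> \<longrightarrow>
       (let e = splitting_error \<epsilon> l1 l2 V \<Phi>0 (\<Phi> \<epsilon>) \<tau> n in
          e \<in> sobolev_H 1 \<and>
          sobolev_norm 1 e \<le> C * (\<tau> + \<epsilon>) \<and>
          sobolev_norm 1 e \<le> C * (\<tau> + \<tau> / \<epsilon>)))) \<and>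
    (\<exists>C>0. \<forall>\<epsilon>\<in>{0<..1}. \<forall>\<tau>. 0 < \<tau> \<and> \<tau> < \<tau>0 \<longrightarrow> (\<forall>n::nat. real n \<le> T / \<tau> \<longrightarrow>
       (let e = splitting_error \<epsilon> l1 l2 V \<Phi>0 (\<Phi> \<epsilon>) \<tau> n in
          e \<in> sobolev_H 1 \<and>
          sobolev_norm 1 e \<le> C * (\<tau> + (SUP \<epsilon>'\<in>{0<..1}. min \<epsilon>' (\<tau> / \<epsilon>'))) \<and>
          sobolev_norm 1 e \<le> C * sqrt \<tau>)))"
proof -
  obtain M where M: "\<And>\<epsilon>. \<epsilon> \<in> {0<..1} \<Longrightarrow> AE t in lebesgue_on {0..T}. \<Phi> \<epsilon> t \<in> sobolev_H 3 \<and> sobolev_norm 3 (\<Phi> \<epsilon> t) \<le> M"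
    using bound by blast
  have TI: "{0..T} \<subseteq> time_interval (nlde_common_max_time l1 l2 V \<Phi>0)"
    using T(2) by (auto simp: time_interval_def intro: le_less_trans[of _ "ereal T"])
  obtain C \<tau>0 where C: "0 < C" "0 < \<tau>0" "\<tau>0 \<le> 1"
    and main: "\<And>\<epsilon> \<tau> n. \<epsilon> \<in> {0<..1} \<Longrightarrow> 0 < \<tau> \<Longrightarrow> \<tau> < \<tau>0 \<Longrightarrow> real n \<le> T / \<tau> \<Longrightarrow>
      splitting_error \<epsilon> l1 l2 V \<Phi>0 (\<Phi> \<epsilon>) \<tau> n \<in> sobolev_H 1 \<and>
      sobolev_norm 1 (splitting_error \<epsilon> l1 l2 V \<Phi>0 (\<Phi> \<epsilon>) \<tau> n) \<le> C * (\<tau> + min \<epsilon> (\<tau> / \<epsilon>))"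
    using splitting_error_bound[OF V T(1) TI sol[rule_format] M] by metis
  have two: "C * (\<tau> + min \<epsilon> (\<tau> / \<epsilon>)) \<le> C * (\<tau> + \<epsilon>)" "C * (\<tau> + min \<epsilon> (\<tau> / \<epsilon>)) \<le> C * (\<tau> + \<tau> / \<epsilon>)" for \<epsilon> \<tau>
    using C by (intro mult_left_mono; simp)+
  have sup: "C * (\<tau> + min \<epsilon> (\<tau> / \<epsilon>)) \<le> 2 * C * (\<tau> + (SUP \<epsilon>'\<in>{0<..1}. min \<epsilon>' (\<tau> / \<epsilon>')))"
    if "\<epsilon> \<in> {0<..1}" "0 < \<tau>" for \<epsilon> \<tau>
  proof -
    have "bdd_above ((\<lambda>\<epsilon>'. min \<epsilon>' (\<tau> / \<epsilon>')) ` {0<..1})"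
      by (rule bdd_aboveI2[of _ _ 1]) auto
    from cSUP_upper[OF that(1) this] have s: "min \<epsilon> (\<tau> / \<epsilon>) \<le> (SUP \<epsilon>'\<in>{0<..1}. min \<epsilon>' (\<tau> / \<epsilon>'))" .
    have p: "0 < min \<epsilon> (\<tau> / \<epsilon>)" using that by simp
    have "C * (\<tau> + min \<epsilon> (\<tau> / \<epsilon>)) \<le> 2 * C * (\<tau> + min \<epsilon> (\<tau> / \<epsilon>))"
      using C p that(2) by (intro mult_right_mono) auto
    also have "\<dots> \<le> 2 * C * (\<tau> + (SUP \<epsilon>'\<in>{0<..1}. min \<epsilon>' (\<tau> / \<epsilon>')))"
      using s C by (intro mult_left_mono) auto
    finally show ?thesis .
  qed
  have root: "C * (\<tau> + min \<epsilon> (\<tau> / \<epsilon>)) \<le> 2 * C * sqrt \<tau>" if "\<epsilon> \<in> {0<..1}" "0 < \<tau>" "\<tau> < \<tau>0" for \<epsilon> \<tau>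
  proof -
    have "\<tau> \<le> sqrt \<tau>" using that C(3) real_le_rsqrt[of \<tau> \<tau>] by (simp add: power2_eq_square mult_left_le)
    moreover have "min \<epsilon> (\<tau> / \<epsilon>) \<le> sqrt \<tau>" using that by (intro min_le_sqrt) auto
    ultimately have "C * (\<tau> + min \<epsilon> (\<tau> / \<epsilon>)) \<le> C * (2 * sqrt \<tau>)" using C by (intro mult_left_mono) auto
    then show ?thesis by simp
  qed
  show ?thesis
    unfolding Let_def
  proof (rule exI[of _ \<tau>0], intro conjI C)
    show "\<exists>C>0. \<forall>\<epsilon>\<in>{0<..1}. \<forall>\<tau>. 0 < \<tau> \<and> \<tau> < \<tau>0 \<longrightarrow> (\<forall>n::nat. real n \<le> T / \<tau> \<longrightarrow>
          splitting_error \<epsilon> l1 l2 V \<Phi>0 (\<Phi> \<epsilon>) \<tau> n \<in> sobolev_H 1 \<and>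
          sobolev_norm 1 (splitting_error \<epsilon> l1 l2 V \<Phi>0 (\<Phi> \<epsilon>) \<tau> n) \<le> C * (\<tau> + \<epsilon>) \<and>
          sobolev_norm 1 (splitting_error \<epsilon> l1 l2 V \<Phi>0 (\<Phi> \<epsilon>) \<tau> n) \<le> C * (\<tau> + \<tau> / \<epsilon>))"
      using C(1) main two by (intro exI[of _ C]) (meson order_trans)
    show "\<exists>C>0. \<forall>\<epsilon>\<in>{0<..1}. \<forall>\<tau>. 0 < \<tau> \<and> \<tau> < \<tau>0 \<longrightarrow> (\<forall>n::nat. real n \<le> T / \<tau> \<longrightarrow>
          splitting_error \<epsilon> l1 l2 V \<Phi>0 (\<Phi> \<epsilon>) \<tau> n \<in> sobolev_H 1 \<and>
          sobolev_norm 1 (splitting_error \<epsilon> l1 l2 V \<Phi>0 (\<Phi> \<epsilon>) \<tau> n) \<le> C * (\<tau> + (SUP \<epsilon>'\<in>{0<..1}. min \<epsilon>' (\<tau> / \<epsilon>'))) \<and>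
          sobolev_norm 1 (splitting_error \<epsilon> l1 l2 V \<Phi>0 (\<Phi> \<epsilon>) \<tau> n) \<le> C * sqrt \<tau>)"
      using C(1) main sup root by (intro exI[of _ "2 * C"]) (meson order_trans mult_pos_pos zero_less_numeral)
  qed
qed

end
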